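(* Let $\Omega\subset\mathbb{R}^d$ be a sufficiently smooth bounded open set, $T>0$, $Q=\Omega\times(0,T)$, $p\geq2$, $p'=p/(p-1)$, let $J$, $\boldsymbol a=\nabla_\lambda J$ and $c$ be as in the context, and let the hysteresis family $\mathcal W[\cdot;x]$ satisfy (A4) and (A5) of the context. Suppose moreover that for every $x\in\Omega$ the following holds: for all $v_1,v_2\in W^{1,1}(0,T)$, with $w_i=\mathcal W[v_i;x]$, $v=v_2-v_1$, $w=w_2-w_1$, one has $\frac{d}{dt}w_+(t)\leq w'(t)H(v(t))$ for a.e. $t\in(0,T)$, where $w_+=\max\{w,0\}$ and $H$ is the Heaviside function. Let $u_{0,1},u_{0,2}\in W^{1,p}_0(\Omega)$ and $f_1,f_2\in L^2(Q)$. Then, for any weak solution $(u_1,w_1)$ with data $(f_1,u_{0,1})$ and any weak solution $(u_2,w_2)$ with data $(f_2,u_{0,2})$, for a.e. $t\in(0,T)$, $$\int_\Omega c|u_2-u_1|(x,t)\,dx+\int_\Omega|w_2-w_1|(x,t)\,dx\leq\int_\Omega c|u_{0,2}-u_{0,1}|(x)\,dx+\int_\Omega|w_2-w_1|(x,0)\,dx+\int_0^t\!\!\int_\Omega|f_2-f_1|(x,\tau)\,dx\,d\tau.$$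
   Context: $J:\Omega\times\mathbb{R}^d\to[0,\infty)$ with $J(\cdot,\lambda)$ measurable, $J(x,\cdot)$ differentiable and strictly convex, $\alpha_1|\lambda|^p\leq J(x,\lambda)\leq\alpha_2(1+|\lambda|^p)$ ($\alpha_1,\alpha_2>0$); $\boldsymbol a(x,\lambda)=\nabla_\lambda J(x,\lambda)$. $c\in L^\infty(\Omega)$, $c\geq\alpha>0$. (A4): for every $x$, $\mathcal W[\cdot;x]$ is a hysteresis operator continuous on $\mathcal C([0,T])$, piecewise increasing (output monotone in the same sense as the input on every interval where the input is monotone), affine bounded ($\|\mathcal W[v;x]\|_{\mathcal C([0,T])}\leq L\|v\|_{\mathcal C([0,T])}+\upsilon(x)$, $L>0$, $\upsilon\in L^2(\Omega)$), and its generating functional $\mathcal W_f(s;x)$ (final output value for the piecewise linear input through the string $s=(v_0,\dots,v_k)$) is measurable in $(s,x)$ with $|\mathcal W_f(s;x)|\leq\kappa_0(x)+\gamma_0\max_i|v_i|$, $\kappa_0\in L^2(\Omega)$, $\gamma_0>0$. (A5): for every $x$, $\mathcal W[\cdot;x]$ maps $W^{1,1}(0,T)$ into itself and $|(\mathcal W[v;x])'(t)|\leq\kappa_1(x)+\gamma_1|v'(t)|$ for a.e. $t$, every $v\in W^{1,1}(0,T)$, with $\gamma_1>0$, $\kappa_1\in L^2(\Omega)$. Weak solution with data $(f,u_0)$: $u\in L^\infty(0,T;W^{1,p}_0(\Omega))$, $u'\in L^2(0,T;L^2(\Omega))$, $u(\cdot,0)=u_0$, $w(x,t)=\mathcal W[u(x,\cdot);x](t)$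 in $L^2(Q)\cap L^2(\Omega;\mathcal C([0,T]))$ with $w'\in L^{p'}(0,T;W^{-1,p'}(\Omega))$, and $\int_Qcu'\varphi+\int_0^T\langle w',\varphi\rangle dt+\int_Q\boldsymbol a(x,\nabla u)\cdot\nabla\varphi=\int_Qf\varphi$ for all $\varphi\in L^p(0,T;W^{1,p}_0(\Omega))$. *)

theory Defs
  imports "HOL-Analysis.Analysis"
begin

text \<open>C-infinity on an (open) set U: all iterated partial derivatives exist, are continuous,
  and are Frechet differentiable.  F ds is the iterated partial derivative along the
  basis directions listed in ds.\<close>
definition Cinf_on :: "'a::euclidean_space set \<Rightarrow> ('a \<Rightarrow> 'b::real_normed_vector) \<Rightarrow> bool" where
  "Cinf_on U f \<longleftrightarrow>
     (\<exists>F :: 'a list \<Rightarrow> 'a \<Rightarrow> 'b.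
        (\<forall>x\<in>U. F [] x = f x) \<and>
        (\<forall>ds. continuous_on U (F ds) \<and>
              (\<forall>x\<in>U. (F ds has_derivative (\<lambda>h. \<Sum>b\<in>Basis. (h \<bullet> b) *\<^sub>R F (b # ds) x)) (at x))))"

definition fsupp :: "('a::topological_space \<Rightarrow> real) \<Rightarrow> 'a set" where
  "fsupp \<phi> = closure {x. \<phi> x \<noteq> 0}"

definition test_fun :: "'a::euclidean_space set \<Rightarrow> ('a \<Rightarrow> real) \<Rightarrow> bool" where
  "test_fun U \<phi> \<longleftrightarrow> Cinf_on UNIV \<phi> \<and> compact (fsupp \<phi>) \<and> fsupp \<phi> \<subseteq> U"

definition grad :: "('a::euclidean_space \<Rightarrow> real) \<Rightarrow> 'a \<Rightarrow> 'a" where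
  "grad \<phi> x = (\<Sum>b\<in>Basis. frechet_derivative \<phi> (at x) b *\<^sub>R b)"

definition grad_x :: "('a::euclidean_space \<times> real \<Rightarrow> real) \<Rightarrow> 'a \<times> real \<Rightarrow> 'a" where
  "grad_x \<psi> z = (\<Sum>b\<in>Basis. frechet_derivative \<psi> (at z) (b, 0) *\<^sub>R b)"

definition d_t :: "('a::euclidean_space \<times> real \<Rightarrow> real) \<Rightarrow> 'a \<times> real \<Rightarrow> real" where
  "d_t \<psi> z = frechet_derivative \<psi> (at z) (0, 1)"

definition smooth_domain :: "'a::euclidean_space set \<Rightarrow> bool" where
  "smooth_domain \<Omega> \<longleftrightarrow> open \<Omega> \<and> bounded \<Omega> \<and>
     (\<forall>x0\<in>frontier \<Omega>. \<exists>U V (\<Phi>::'a\<Rightarrow>'a) \<Psi> e.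
        open U \<and> open V \<and> x0 \<in> U \<and> e \<in> Basis \<and>
        Cinf_on U \<Phi> \<and> Cinf_on V \<Psi> \<and> \<Phi> ` U = V \<and>
        (\<forall>x\<in>U. \<Psi> (\<Phi> x) = x) \<and> (\<forall>y\<in>V. \<Phi> (\<Psi> y) = y) \<and>
        \<Phi> ` (U \<inter> \<Omega>) = V \<inter> {y. y \<bullet> e < 0})"

definition Lp :: "real \<Rightarrow> 'a measure \<Rightarrow> ('a \<Rightarrow> 'b::{banach,second_countable_topology}) \<Rightarrow> bool" where
  "Lp p M f \<longleftrightarrow> f \<in> borel_measurable M \<and> integrable M (\<lambda>x. norm (f x) powr p)"

definition weak_grad :: "'a::euclidean_space set \<Rightarrow> ('a \<Rightarrow> real) \<Rightarrow> ('a \<Rightarrow> 'a) \<Rightarrow> bool" where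
  "weak_grad U v g \<longleftrightarrow>
     (\<forall>K. compact K \<and> K \<subseteq> U \<longrightarrow> set_integrable lebesgue K v \<and> set_integrable lebesgue K g) \<and>
     (\<forall>\<phi>. test_fun U \<phi> \<longrightarrow> (\<forall>b\<in>Basis.
        (LINT x:U|lebesgue. v x * frechet_derivative \<phi> (at x) b)
          = - (LINT x:U|lebesgue. (g x \<bullet> b) * \<phi> x)))"

definition W1p0 :: "real \<Rightarrow> 'a::euclidean_space set \<Rightarrow> ('a \<Rightarrow> real) \<Rightarrow> ('a \<Rightarrow> 'a) \<Rightarrow> bool" where
  "W1p0 p U v g \<longleftrightarrow> Lp p (lebesgue_on U) v \<and> Lp p (lebesgue_on U) g \<and> weak_grad U v g \<and>
     (\<exists>\<phi>s :: nat \<Rightarrow> 'a \<Rightarrow> real. (\<forall>k. test_fun U (\<phi>s k)) \<and>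
        (\<lambda>k. LINT x:U|lebesgue. \<bar>\<phi>s k x - v x\<bar> powr p) \<longlonglongrightarrow> 0 \<and>
        (\<lambda>k. LINT x:U|lebesgue. norm (grad (\<phi>s k) x - g x) powr p) \<longlonglongrightarrow> 0)"

definition Lp_W1p0 :: "real \<Rightarrow> 'a::euclidean_space set \<Rightarrow> real \<Rightarrow> ('a \<times> real \<Rightarrow> real) \<Rightarrow> ('a \<times> real \<Rightarrow> 'a) \<Rightarrow> bool" where
  "Lp_W1p0 p \<Omega> T \<phi> D\<phi> \<longleftrightarrow>
     Lp p (lebesgue_on (\<Omega> \<times> {0<..<T})) \<phi> \<and> Lp p (lebesgue_on (\<Omega> \<times> {0<..<T})) D\<phi> \<and>
     (AE t in lborel. t \<in> {0<..<T} \<longrightarrow> W1p0 p \<Omega> (\<lambda>x. \<phi> (x, t)) (\<lambda>x. D\<phi> (x, t)))"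

definition Linf_W1p0 :: "real \<Rightarrow> 'a::euclidean_space set \<Rightarrow> real \<Rightarrow> ('a \<times> real \<Rightarrow> real) \<Rightarrow> ('a \<times> real \<Rightarrow> 'a) \<Rightarrow> bool" where
  "Linf_W1p0 p \<Omega> T u Du \<longleftrightarrow>
     u \<in> borel_measurable (lebesgue_on (\<Omega> \<times> {0<..<T})) \<and>
     Du \<in> borel_measurable (lebesgue_on (\<Omega> \<times> {0<..<T})) \<and>
     (AE t in lborel. t \<in> {0<..<T} \<longrightarrow> W1p0 p \<Omega> (\<lambda>x. u (x, t)) (\<lambda>x. Du (x, t))) \<and>
     (\<exists>M. AE t in lborel. t \<in> {0<..<T} \<longrightarrow>
        (LINT x:\<Omega>|lebesgue. \<bar>u (x, t)\<bar> powr p + norm (Du (x, t)) powr p) \<le> M)"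

definition abs_cont_on :: "real set \<Rightarrow> (real \<Rightarrow> real) \<Rightarrow> bool" where
  "abs_cont_on S f \<longleftrightarrow>
     (\<forall>\<epsilon>>0. \<exists>\<delta>>0. \<forall>(n::nat) (I :: nat \<Rightarrow> real \<times> real).
        (\<forall>i<n. fst (I i) \<le> snd (I i) \<and> {fst (I i)..snd (I i)} \<subseteq> S) \<and>
        (\<forall>i<n. \<forall>j<n. i \<noteq> j \<longrightarrow> {fst (I i)<..<snd (I i)} \<inter> {fst (I j)<..<snd (I j)} = {}) \<and>
        (\<Sum>i<n. snd (I i) - fst (I i)) < \<delta>
        \<longrightarrow> (\<Sum>i<n. \<bar>f (snd (I i)) - f (fst (I i))\<bar>) < \<epsilon>)"

definition strictly_convex :: "('a::real_vector \<Rightarrow> real) \<Rightarrow> bool" where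
  "strictly_convex f \<longleftrightarrow>
     (\<forall>x y (s::real). x \<noteq> y \<and> 0 < s \<and> s < 1 \<longrightarrow>
        f ((1 - s) *\<^sub>R x + s *\<^sub>R y) < (1 - s) * f x + s * f y)"

definition heaviside :: "real \<Rightarrow> real" where
  "heaviside r = (if r > 0 then 1 else 0)"

definition hysteresis_operator :: "real \<Rightarrow> ((real \<Rightarrow> real) \<Rightarrow> real \<Rightarrow> real) \<Rightarrow> bool" where
  "hysteresis_operator T F \<longleftrightarrow>
     (\<forall>v. continuous_on {0..T} v \<longrightarrow> continuous_on {0..T} (F v)) \<and>
     \<comment> \<open>causality\<close>
     (\<forall>v1 v2 t. continuous_on {0..T} v1 \<and> continuous_on {0..T} v2 \<and> t \<in> {0..T} \<and>
        (\<forall>s\<in>{0..t}. v1 s = v2 s) \<longrightarrow> F v1 t = F v2 t) \<and>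
     \<comment> \<open>rate independence\<close>
     (\<forall>v \<phi>. continuous_on {0..T} v \<and> continuous_on {0..T} \<phi> \<and> mono_on {0..T} \<phi> \<and>
        \<phi> 0 = 0 \<and> \<phi> T = T \<longrightarrow> (\<forall>t\<in>{0..T}. F (v \<circ> \<phi>) t = F v (\<phi> t)))"

definition continuous_on_C :: "real \<Rightarrow> ((real \<Rightarrow> real) \<Rightarrow> real \<Rightarrow> real) \<Rightarrow> bool" where
  "continuous_on_C T F \<longleftrightarrow>
     (\<forall>v vs. continuous_on {0..T} v \<and> (\<forall>n. continuous_on {0..T} (vs n)) \<and>
        uniform_limit {0..T} vs v sequentially \<longrightarrow>
        uniform_limit {0..T} (\<lambda>n. F (vs n)) (F v) sequentially)"

definition piecewise_increasing :: "real \<Rightarrow> ((real \<Rightarrow> real) \<Rightarrow> real \<Rightarrow> real) \<Rightarrow> bool" where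
  "piecewise_increasing T F \<longleftrightarrow>
     (\<forall>v t1 t2. continuous_on {0..T} v \<and> 0 \<le> t1 \<and> t1 \<le> t2 \<and> t2 \<le> T \<longrightarrow>
        (mono_on {t1..t2} v \<longrightarrow> mono_on {t1..t2} (F v)) \<and>
        (antimono_on {t1..t2} v \<longrightarrow> antimono_on {t1..t2} (F v)))"

text \<open>Piecewise linear input on [0,T] through the string s = (v_0,...,v_k), nodes i*T/k.\<close>
definition string_input :: "real \<Rightarrow> real list \<Rightarrow> real \<Rightarrow> real" where
  "string_input T s t =
     (if length s \<le> 1 then hd s
      else (let k = length s - 1;
                i = min (nat \<lfloor>t * real k / T\<rfloor>) (k - 1);
                r = t * real k / T - real i
            in (1 - r) * s ! i + r * s ! (i + 1)))"

definition gen_functional :: "real \<Rightarrow> ((real \<Rightarrow> real) \<Rightarrow> real \<Rightarrow> real) \<Rightarrow> real list \<Rightarrow> real" where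
  "gen_functional T F s = F (string_input T s) T"

text \<open>(u,w) is a weak solution with data (f,u0).  Functions on Q are functions of (x,t).
  ut is the time derivative u' (u(x,.) absolutely continuous for a.e. x), Du the space
  gradient; the W^{-1,p'}-valued derivative w' is represented as g0 + div-type term G:
  <w'(t),phi> = int_Omega g0 phi + G . grad phi.\<close>
definition weak_solution ::
  "'a::euclidean_space set \<Rightarrow> real \<Rightarrow> real \<Rightarrow> ('a \<Rightarrow> 'a \<Rightarrow> 'a) \<Rightarrow> ('a \<Rightarrow> real) \<Rightarrow>
   ('a \<Rightarrow> (real \<Rightarrow> real) \<Rightarrow> real \<Rightarrow> real) \<Rightarrow> ('a \<times> real \<Rightarrow> real) \<Rightarrow> ('a \<Rightarrow> real) \<Rightarrow>
   ('a \<times> real \<Rightarrow> real) \<Rightarrow> ('a \<times> real \<Rightarrow> real) \<Rightarrow> bool" where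
  "weak_solution \<Omega> T p a c W f u0 u w \<longleftrightarrow>
     (let Q = \<Omega> \<times> {0<..<T}; p' = p / (p - 1) in
     (\<exists>Du ut g0 G.
        Linf_W1p0 p \<Omega> T u Du \<and>
        \<comment> \<open>u' in L^2(Q) and initial condition\<close>
        Lp 2 (lebesgue_on Q) ut \<and>
        (AE x in lebesgue_on \<Omega>. abs_cont_on {0..T} (\<lambda>t. u (x, t)) \<and>
            (AE t in lborel. t \<in> {0<..<T} \<longrightarrow> ((\<lambda>s. u (x, s)) has_real_derivative ut (x, t)) (at t)) \<and>
            u (x, 0) = u0 x) \<and>
        \<comment> \<open>w = W[u]\<close>
        (AE x in lebesgue_on \<Omega>. \<forall>t\<in>{0..T}. w (x, t) = W x (\<lambda>s. u (x, s)) t) \<and>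
        \<comment> \<open>w in L^2(Q) and L^2(Omega; C([0,T]))\<close>
        Lp 2 (lebesgue_on Q) w \<and>
        w \<in> borel_measurable (lebesgue_on (\<Omega> \<times> {0..T})) \<and>
        (AE x in lebesgue_on \<Omega>. continuous_on {0..T} (\<lambda>t. w (x, t))) \<and>
        Lp 2 (lebesgue_on \<Omega>) (\<lambda>x. SUP t\<in>{0..T}. \<bar>w (x, t)\<bar>) \<and>
        \<comment> \<open>w' in L^p'(0,T;W^{-1,p'}(Omega))\<close>
        Lp p' (lebesgue_on Q) g0 \<and> Lp p' (lebesgue_on Q) G \<and>
        (\<forall>\<psi>. test_fun Q \<psi> \<longrightarrow>
           - (LINT z:Q|lebesgue. w z * d_t \<psi> z) = (LINT z:Q|lebesgue. g0 z * \<psi> z + G z \<bullet> grad_x \<psi> z)) \<and>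
        \<comment> \<open>the weak equation\<close>
        (\<forall>\<phi> D\<phi>. Lp_W1p0 p \<Omega> T \<phi> D\<phi> \<longrightarrow>
           (LINT z:Q|lebesgue. c (fst z) * ut z * \<phi> z)
           + (LINT z:Q|lebesgue. g0 z * \<phi> z + G z \<bullet> D\<phi> z)
           + (LINT z:Q|lebesgue. a (fst z) (Du z) \<bullet> D\<phi> z)
           = (LINT z:Q|lebesgue. f z * \<phi> z))))"

end

theory Submission imports Defs begin

text \<open>The difference of the two equations is tested with tanh(n(u2 - u1)) on (0,t); the elliptic term
  is nonnegative because the gradient of a convex function is monotone, and n tends to infinity,
  which leaves the test function sgn(u2 - u1). The dual pairing with w' becomes an honest integral:
  by (A5) w' is dominated by the derivative of u and hence lies in L2, and it represents the
  distributional derivative. For a.e. x the Hilpert inequality, used for (u1, u2) and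
  for (u2, u1), gives (w2 - w1)' sgn(u2 - u1) as an upper bound for the derivative of |w2 - w1|;
  integrating over (0,t) and over the domain yields the estimate. Points with u1 = u2 cause no
  loss: there both one-sided inequalities show that |w2 - w1| is not increasing.\<close>

section \<open>Absolutely continuous functions\<close>

text \<open>Three obstacles shape the development. Absolute continuity is given in its epsilon-delta
  form, so the fundamental theorem of calculus has to be derived from it: Jordan decomposition,
  Radon-Nikodym for Stieltjes measures, Lebesgue differentiation. The functional w' is prescribed
  only on smooth test functions of Q, while the required test function lies merely in
  L^p(0,T;W^{1,p}_0); it is reached slice by slice in time, through products of a bump in t and a
  test function in x. Finally, a Lebesgue measurable function on a product may have nonmeasurable
  slices, so every use of Fubini passes to a Borel representative. The choice of \<open>tanh\<close>
  rests on its derivative 1 - tanh^2. This is a polynomial in \<open>tanh\<close>, so compositions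
  with smooth functions are smooth by pure algebra, and it takes values in [0,1], so
  \<open>tanh\<close> is increasing and Lipschitz. The limit sgn has the value 0 at 0, which is also
  the value of H(v) - H(-v) there; thus the tested equation and the two Hilpert inequalities carry
  exactly the same factor.\<close>

definition nonoverlapping :: "real set \<Rightarrow> (real \<times> real) set \<Rightarrow> bool" where
  "nonoverlapping S D \<longleftrightarrow> finite D \<and> (\<forall>p\<in>D. fst p < snd p \<and> {fst p..snd p} \<subseteq> S) \<and>
     pairwise (\<lambda>p q. {fst p<..<snd p} \<inter> {fst q<..<snd q} = {}) D"

definition var_sum :: "(real \<Rightarrow> real) \<Rightarrow> (real \<times> real) set \<Rightarrow> real" where
  "var_sum f D = (\<Sum>p\<in>D. \<bar>f (snd p) - f (fst p)\<bar>)"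

definition length_sum :: "(real \<times> real) set \<Rightarrow> real" where
  "length_sum D = (\<Sum>p\<in>D. snd p - fst p)"

definition variation :: "(real \<Rightarrow> real) \<Rightarrow> real \<Rightarrow> real \<Rightarrow> real" where
  "variation f a t = Sup (var_sum f ` {D. nonoverlapping {a..t} D})"

text \<open>Indexed families are traded for finite sets of intervals, which can be cut, refined and
  united without renumbering; \<open>h\<close> enumerates the set. Degenerate intervals, which
  contribute nothing, are excluded from \<open>nonoverlapping\<close> so that distinct members have
  distinct endpoints.\<close>

lemma abs_cont_on_nonoverlapping:
  assumes "abs_cont_on S f" "0 < \<epsilon>"
  shows "\<exists>\<delta>>0. \<forall>D. nonoverlapping S D \<and> length_sum D < \<delta> \<longrightarrow> var_sum f D < \<epsilon>"
proof -
  from assms(1)[unfolded abs_cont_on_def, THEN spec, THEN mp, OF assms(2)]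
  obtain \<delta> where "\<delta> > 0" and \<delta>: "\<forall>(n::nat) (I :: nat \<Rightarrow> real \<times> real).
        (\<forall>i<n. fst (I i) \<le> snd (I i) \<and> {fst (I i)..snd (I i)} \<subseteq> S) \<and>
        (\<forall>i<n. \<forall>j<n. i \<noteq> j \<longrightarrow> {fst (I i)<..<snd (I i)} \<inter> {fst (I j)<..<snd (I j)} = {}) \<and>
        (\<Sum>i<n. snd (I i) - fst (I i)) < \<delta>
        \<longrightarrow> (\<Sum>i<n. \<bar>f (snd (I i)) - f (fst (I i))\<bar>) < \<epsilon>"
    by (elim exE conjE)
  have "var_sum f D < \<epsilon>" if D: "nonoverlapping S D" "length_sum D < \<delta>" for D
  proof -
    have "finite D" using D unfolding nonoverlapping_def by auto
    then obtain h where h: "bij_betw h {0..<card D} D" using ex_bij_betw_nat_finite by blast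
    then have h': "bij_betw h {..<card D} D" by (simp add: atLeast0LessThan)
    have "(\<Sum>i<card D. \<bar>f (snd (h i)) - f (fst (h i))\<bar>) < \<epsilon>"
    proof (intro \<delta>[THEN spec, THEN spec, THEN mp] conjI)
      show "\<forall>i<card D. fst (h i) \<le> snd (h i) \<and> {fst (h i)..snd (h i)} \<subseteq> S"
      proof (intro allI impI)
        fix i assume "i < card D"
        then have "h i \<in> D" using h' unfolding bij_betw_def by auto
        then show "fst (h i) \<le> snd (h i) \<and> {fst (h i)..snd (h i)} \<subseteq> S"
          using D unfolding nonoverlapping_def by (auto intro: less_imp_le)
      qed
      show "\<forall>i<card D. \<forall>j<card D. i \<noteq> j \<longrightarrow> {fst (h i)<..<snd (h i)} \<inter> {fst (h j)<..<snd (h j)} = {}"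
      proof (intro allI impI)
        fix i j assume ij: "i < card D" "j < card D" "i \<noteq> j"
        then have "h i \<noteq> h j" "h i \<in> D" "h j \<in> D"
          using h' unfolding bij_betw_def inj_on_def by auto
        then show "{fst (h i)<..<snd (h i)} \<inter> {fst (h j)<..<snd (h j)} = {}"
          using D unfolding nonoverlapping_def pairwise_def by blast
      qed
      show "(\<Sum>i<card D. snd (h i) - fst (h i)) < \<delta>"
        using D(2) sum.reindex_bij_betw[OF h', of "\<lambda>p. snd p - fst p"] by (simp add: length_sum_def)
    qed
    then show ?thesis
      using sum.reindex_bij_betw[OF h', of "\<lambda>p. \<bar>f (snd p) - f (fst p)\<bar>"] by (simp add: var_sum_def)
  qed
  then show ?thesis using \<open>\<delta> > 0\<close> by blast
qed

text \<open>Intervals with a common left end share the midpoint between it and the nearer right end.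
  The injectivity guarantees that truncating the members of a family at a point merges no two of
  them.\<close>

lemma nonoverlapping_fst_inj: "nonoverlapping S D \<Longrightarrow> inj_on fst D"
proof (rule inj_onI)
  fix p q assume *: "nonoverlapping S D" "p \<in> D" "q \<in> D" "fst p = fst q"
  then have "fst p < snd p" "fst q < snd q" by (auto simp: nonoverlapping_def)
  then have "(fst p + min (snd p) (snd q))/2 \<in> {fst p<..<snd p} \<inter> {fst q<..<snd q}"
    using * by (auto simp: min_def)
  then show "p = q" using * unfolding nonoverlapping_def pairwise_def by blast
qed

lemma nonoverlapping_snd_inj: "nonoverlapping S D \<Longrightarrow> inj_on snd D"
proof (rule inj_onI)
  fix p q assume *: "nonoverlapping S D" "p \<in> D" "q \<in> D" "snd p = snd q"
  then have "fst p < snd p" "fst q < snd q" by (auto simp: nonoverlapping_def)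
  then have "(snd p + max (fst p) (fst q))/2 \<in> {fst p<..<snd p} \<inter> {fst q<..<snd q}"
    using * by (auto simp: max_def)
  then show "p = q" using * unfolding nonoverlapping_def pairwise_def by blast
qed

lemma nonoverlapping_disjointI:
  assumes "nonoverlapping S D" "p \<in> D" "q \<in> D" "x \<in> {fst p<..<snd p}" "x \<in> {fst q<..<snd q}"
  shows "p = q"
  using assms unfolding nonoverlapping_def pairwise_def by blast

text \<open>Every interval is cut at \<open>s\<close>. An interval with \<open>s\<close> in its
  interior leaves a piece on each side, and the triangle inequality through \<open>f s\<close> gives
  the estimate.\<close>

lemma nonoverlapping_split:
  assumes D: "nonoverlapping S D"
  shows "\<exists>D1 D2. nonoverlapping (S \<inter> {..s}) D1 \<and> nonoverlapping (S \<inter> {s..}) D2 \<and>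
           var_sum f D \<le> var_sum f D1 + var_sum f D2"
proof -
  have fin: "finite D" and lt: "\<And>p. p \<in> D \<Longrightarrow> fst p < snd p" and sub: "\<And>p. p \<in> D \<Longrightarrow> {fst p..snd p} \<subseteq> S"
    using D by (auto simp: nonoverlapping_def)
  define D1 where "D1 = (\<lambda>p. (fst p, min (snd p) s)) ` {p\<in>D. fst p < s}"
  define D2 where "D2 = (\<lambda>p. (max (fst p) s, snd p)) ` {p\<in>D. s < snd p}"
  have inj1: "inj_on (\<lambda>p. (fst p, min (snd p) s)) {p\<in>D. fst p < s}"
    using nonoverlapping_fst_inj[OF D] by (auto simp: inj_on_def)
  have inj2: "inj_on (\<lambda>p. (max (fst p) s, snd p)) {p\<in>D. s < snd p}"
    using nonoverlapping_snd_inj[OF D] by (auto simp: inj_on_def)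
  have "nonoverlapping (S \<inter> {..s}) D1"
    unfolding nonoverlapping_def
  proof (intro conjI)
    show "finite D1" using fin by (simp add: D1_def)
    show "\<forall>p\<in>D1. fst p < snd p \<and> {fst p..snd p} \<subseteq> S \<inter> {..s}"
      using lt sub by (fastforce simp: D1_def)
    show "pairwise (\<lambda>p q. {fst p<..<snd p} \<inter> {fst q<..<snd q} = {}) D1"
unfolding pairwise_def
    proof (intro ballI impI)
      fix p' q' assume "p' \<in> D1" "q' \<in> D1" "p' \<noteq> q'"
      then obtain p q where pq: "p \<in> D" "q \<in> D" "p \<noteq> q" "p' = (fst p, min (snd p) s)" "q' = (fst q, min (snd q) s)"
        unfolding D1_def by blast
      then have "{fst p<..<snd p} \<inter> {fst q<..<snd q} = {}" using D unfolding nonoverlapping_def pairwise_def by blast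
      moreover have "{fst p'<..<snd p'} \<subseteq> {fst p<..<snd p}" "{fst q'<..<snd q'} \<subseteq> {fst q<..<snd q}"
        by (auto simp: pq(4,5))
      ultimately show "{fst p'<..<snd p'} \<inter> {fst q'<..<snd q'} = {}" by blast
    qed
  qed
  moreover have "nonoverlapping (S \<inter> {s..}) D2"
    unfolding nonoverlapping_def
  proof (intro conjI)
    show "finite D2" using fin by (simp add: D2_def)
    show "\<forall>p\<in>D2. fst p < snd p \<and> {fst p..snd p} \<subseteq> S \<inter> {s..}"
      using lt sub by (fastforce simp: D2_def)
    show "pairwise (\<lambda>p q. {fst p<..<snd p} \<inter> {fst q<..<snd q} = {}) D2"
unfolding pairwise_def
    proof (intro ballI impI)
      fix p' q' assume "p' \<in> D2" "q' \<in> D2" "p' \<noteq> q'"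
      then obtain p q where pq: "p \<in> D" "q \<in> D" "p \<noteq> q" "p' = (max (fst p) s, snd p)" "q' = (max (fst q) s, snd q)"
        unfolding D2_def by blast
      then have "{fst p<..<snd p} \<inter> {fst q<..<snd q} = {}" using D unfolding nonoverlapping_def pairwise_def by blast
      moreover have "{fst p'<..<snd p'} \<subseteq> {fst p<..<snd p}" "{fst q'<..<snd q'} \<subseteq> {fst q<..<snd q}"
        by (auto simp: pq(4,5))
      ultimately show "{fst p'<..<snd p'} \<inter> {fst q'<..<snd q'} = {}" by blast
    qed
  qed
  moreover have "var_sum f D \<le> var_sum f D1 + var_sum f D2"
  proof -
    have "var_sum f D1 = (\<Sum>p\<in>D. if fst p < s then \<bar>f (min (snd p) s) - f (fst p)\<bar> else 0)"
      unfolding var_sum_def D1_def using fin by (simp add: sum.reindex[OF inj1] sum.inter_filter)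
    moreover have "var_sum f D2 = (\<Sum>p\<in>D. if s < snd p then \<bar>f (snd p) - f (max (fst p) s)\<bar> else 0)"
      unfolding var_sum_def D2_def using fin by (simp add: sum.reindex[OF inj2] sum.inter_filter)
    moreover have "var_sum f D \<le> (\<Sum>p\<in>D. (if fst p < s then \<bar>f (min (snd p) s) - f (fst p)\<bar> else 0)
        + (if s < snd p then \<bar>f (snd p) - f (max (fst p) s)\<bar> else 0))"
      unfolding var_sum_def
    proof (rule sum_mono)
      fix p assume "p \<in> D"
      from lt[OF this] show "\<bar>f (snd p) - f (fst p)\<bar> \<le> (if fst p < s then \<bar>f (min (snd p) s) - f (fst p)\<bar> else 0)
        + (if s < snd p then \<bar>f (snd p) - f (max (fst p) s)\<bar> else 0)"
        by (cases "snd p \<le> s"; cases "s \<le> fst p") (auto simp: min_def max_def)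
    qed
    ultimately show ?thesis by (simp add: sum.distrib)
  qed
  ultimately show ?thesis by blast
qed

lemma nonoverlapping_mono: "nonoverlapping S D \<Longrightarrow> S \<subseteq> S' \<Longrightarrow> nonoverlapping S' D"
  unfolding nonoverlapping_def by blast

lemma nonoverlapping_empty[simp]: "nonoverlapping S {}"
  by (simp add: nonoverlapping_def)

text \<open>The total length is the Lebesgue measure of the union of the disjoint open interiors, so
  monotonicity of the measure applies.\<close>

lemma length_sum_le:
  assumes D: "nonoverlapping {x..y} D" and "x \<le> y"
  shows "length_sum D \<le> y - x"
proof -
  have fin: "finite D" and lt: "\<And>p. p \<in> D \<Longrightarrow> fst p < snd p" and sub: "\<And>p. p \<in> D \<Longrightarrow> {fst p..snd p} \<subseteq> {x..y}"
    using D by (auto simp: nonoverlapping_def)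
  have "length_sum D = (\<Sum>p\<in>D. measure lborel {fst p<..<snd p})"
    unfolding length_sum_def by (rule sum.cong) (auto simp: less_imp_le[OF lt])
  also have "\<dots> = measure lborel (\<Union>p\<in>D. {fst p<..<snd p})"
  proof (rule measure_finite_Union[symmetric, OF fin])
    show "disjoint_family_on (\<lambda>p. {fst p<..<snd p}) D"
      using D unfolding nonoverlapping_def pairwise_def disjoint_family_on_def by blast
    show "emeasure lborel {fst p<..<snd p} \<noteq> \<infinity>" if "p \<in> D" for p
      using lt[OF that] by (simp add: less_imp_le)
  qed auto
  also have "\<dots> \<le> measure lborel {x..y}"
  proof (rule measure_mono_fmeasurable)
    show "(\<Union>p\<in>D. {fst p<..<snd p}) \<subseteq> {x..y}"
    proof (rule UN_least)
      fix p assume "p \<in> D"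
      have "{fst p<..<snd p} \<subseteq> {fst p..snd p}" by auto
      with sub[OF \<open>p \<in> D\<close>] show "{fst p<..<snd p} \<subseteq> {x..y}" by blast
    qed
    show "{x..y} \<in> fmeasurable lborel" by (rule fmeasurableI) (auto simp: emeasure_lborel_Icc_eq)
  qed (use fin in auto)
  finally show ?thesis using assms by simp
qed

text \<open>Refinement of a partition: each member \<open>p\<close> of \<open>D\<close> is
  subdivided by its own family \<open>E p\<close>. The sums add because these families are disjoint
  as sets: a pair common to \<open>E p\<close> and \<open>E q\<close> would have an interior point
  common to \<open>p\<close> and \<open>q\<close>.\<close>

lemma nonoverlapping_Union:
  assumes D: "nonoverlapping S D" and E: "\<And>p. p \<in> D \<Longrightarrow> nonoverlapping {fst p..snd p} (E p)"
  shows "nonoverlapping S (\<Union>p\<in>D. E p)" "var_sum f (\<Union>p\<in>D. E p) = (\<Sum>p\<in>D. var_sum f (E p))"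
    "length_sum (\<Union>p\<in>D. E p) = (\<Sum>p\<in>D. length_sum (E p))"
proof -
  have fin: "finite D" and sub: "\<And>p. p \<in> D \<Longrightarrow> {fst p..snd p} \<subseteq> S"
    using D by (auto simp: nonoverlapping_def)
  have finE: "\<And>p. p \<in> D \<Longrightarrow> finite (E p)" using E by (auto simp: nonoverlapping_def)
  have sub': "fst r < snd r" "{fst r..snd r} \<subseteq> {fst p..snd p}" "{fst r<..<snd r} \<subseteq> {fst p<..<snd p}"
    if "p \<in> D" "r \<in> E p" for p r
    using E[OF that(1)] that(2) unfolding nonoverlapping_def by force+
  have same: "p = q" if "p \<in> D" "q \<in> D" "r \<in> E p" "s \<in> E q" "{fst r<..<snd r} \<inter> {fst s<..<snd s} \<noteq> {}" for p q r s
    using that sub'(3)[of p r] sub'(3)[of q s] nonoverlapping_disjointI[OF D, of p q] by blast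
  have disj: "E p \<inter> E q = {}" if "p \<in> D" "q \<in> D" "p \<noteq> q" for p q
  proof (rule ccontr)
    assume "E p \<inter> E q \<noteq> {}"
    then obtain r where r: "r \<in> E p" "r \<in> E q" by blast
    then have "(fst r + snd r)/2 \<in> {fst r<..<snd r} \<inter> {fst r<..<snd r}" using sub'(1)[of p r] that by auto
    then show False using same[OF that(1,2) r] that(3) by blast
  qed
  show "nonoverlapping S (\<Union>p\<in>D. E p)"
    unfolding nonoverlapping_def
  proof (intro conjI)
    show "finite (\<Union>p\<in>D. E p)" using fin finE by auto
    show "\<forall>p\<in>\<Union>p\<in>D. E p. fst p < snd p \<and> {fst p..snd p} \<subseteq> S"
      using sub' sub by blast
    show "pairwise (\<lambda>p q. {fst p<..<snd p} \<inter> {fst q<..<snd q} = {}) (\<Union>p\<in>D. E p)"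
      unfolding pairwise_def
    proof (intro ballI impI)
      fix r s assume "r \<in> (\<Union>p\<in>D. E p)" "s \<in> (\<Union>p\<in>D. E p)" "r \<noteq> s"
      then obtain p q where pq: "p \<in> D" "q \<in> D" "r \<in> E p" "s \<in> E q" by blast
      then show "{fst r<..<snd r} \<inter> {fst s<..<snd s} = {}"
        using same[OF pq] E[of p] \<open>r \<noteq> s\<close> unfolding nonoverlapping_def pairwise_def by blast
    qed
  qed
  show "var_sum f (\<Union>p\<in>D. E p) = (\<Sum>p\<in>D. var_sum f (E p))"
    unfolding var_sum_def using fin finE disj by (intro sum.UNION_disjoint) auto
  show "length_sum (\<Union>p\<in>D. E p) = (\<Sum>p\<in>D. length_sum (E p))"
    unfolding length_sum_def using fin finE disj by (intro sum.UNION_disjoint) auto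
qed

lemma nonoverlapping_Un:
  assumes "nonoverlapping {a..s} D1" "nonoverlapping {s..t} D2" "a \<le> s" "s \<le> t"
  shows "nonoverlapping {a..t} (D1 \<union> D2)" "var_sum f (D1 \<union> D2) = var_sum f D1 + var_sum f D2"
proof -
  have 1: "\<And>p. p \<in> D1 \<Longrightarrow> fst p < snd p \<and> a \<le> fst p \<and> snd p \<le> s"
    and 2: "\<And>p. p \<in> D2 \<Longrightarrow> fst p < snd p \<and> s \<le> fst p \<and> snd p \<le> t"
    using assms by (auto simp: nonoverlapping_def)
  have "pairwise (\<lambda>p q. {fst p<..<snd p} \<inter> {fst q<..<snd q} = {}) (D1 \<union> D2)"
    unfolding pairwise_def
  proof (intro ballI impI)
    fix p q assume "p \<in> D1 \<union> D2" "q \<in> D1 \<union> D2" "p \<noteq> q"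
    then show "{fst p<..<snd p} \<inter> {fst q<..<snd q} = {}"
    proof (elim UnE)
      assume "p \<in> D1" "q \<in> D1" then show ?thesis using assms(1) \<open>p \<noteq> q\<close> unfolding nonoverlapping_def pairwise_def by blast
    next
      assume "p \<in> D2" "q \<in> D2" then show ?thesis using assms(2) \<open>p \<noteq> q\<close> unfolding nonoverlapping_def pairwise_def by blast
    next
      assume "p \<in> D1" "q \<in> D2" then show ?thesis using 1[of p] 2[of q] by auto
    next
      assume "p \<in> D2" "q \<in> D1" then show ?thesis using 2[of p] 1[of q] by auto
    qed
  qed
  then show "nonoverlapping {a..t} (D1 \<union> D2)"
    using assms 1 2 unfolding nonoverlapping_def by fastforce
  have "D1 \<inter> D2 = {}" using 1 2 by fastforce
  then show "var_sum f (D1 \<union> D2) = var_sum f D1 + var_sum f D2"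
    unfolding var_sum_def using assms(1,2) by (intro sum.union_disjoint) (auto simp: nonoverlapping_def)
qed

section \<open>The variation of an absolutely continuous function\<close>

text \<open>Windows of width \<delta>/2 are attached one after another, starting at
  \<open>a\<close>. As \<delta> belongs to the tolerance 1, each new window adds at most 1 to the
  bound, and finitely many windows exhaust the interval.\<close>

lemma abs_cont_on_bounded_variation:
  assumes f: "abs_cont_on {a..b} f"
  shows "\<exists>M. \<forall>D. nonoverlapping {a..b} D \<longrightarrow> var_sum f D \<le> M"
proof -
  obtain \<delta> where "\<delta> > 0" and \<delta>: "\<And>D. nonoverlapping {a..b} D \<Longrightarrow> length_sum D < \<delta> \<Longrightarrow> var_sum f D < 1"
    using abs_cont_on_nonoverlapping[OF f, of 1] by auto
  have *: "\<exists>M. \<forall>D. nonoverlapping ({a..b} \<inter> {..a + real n * (\<delta>/2)}) D \<longrightarrow> var_sum f D \<le> M" for n :: nat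
  proof (induction n)
    case 0
    have "var_sum f D \<le> 0" if "nonoverlapping ({a..b} \<inter> {..a + real 0 * (\<delta>/2)}) D" for D
    proof -
      have "D = {}"
      proof (rule ccontr)
        assume "D \<noteq> {}"
        then obtain p where "p \<in> D" by blast
        then have "fst p < snd p" "{fst p..snd p} \<subseteq> {a..b} \<inter> {..a}" using that unfolding nonoverlapping_def by auto
        then show False by auto
      qed
      then show ?thesis by (simp add: var_sum_def)
    qed
    then show ?case by blast
  next
    case (Suc n)
    then obtain M where M: "\<And>D. nonoverlapping ({a..b} \<inter> {..a + real n * (\<delta>/2)}) D \<Longrightarrow> var_sum f D \<le> M" by blast
    have "var_sum f D \<le> M + 1" if D: "nonoverlapping ({a..b} \<inter> {..a + real (Suc n) * (\<delta>/2)}) D" for D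
    proof -
      let ?s = "a + real n * (\<delta>/2)"
      obtain D1 D2 where D12: "nonoverlapping (({a..b} \<inter> {..a + real (Suc n) * (\<delta>/2)}) \<inter> {..?s}) D1"
        "nonoverlapping (({a..b} \<inter> {..a + real (Suc n) * (\<delta>/2)}) \<inter> {?s..}) D2"
        "var_sum f D \<le> var_sum f D1 + var_sum f D2"
        using nonoverlapping_split[OF D] by blast
      have "var_sum f D1 \<le> M" by (rule M) (rule nonoverlapping_mono[OF D12(1)], auto)
      moreover have "var_sum f D2 < 1"
      proof (rule \<delta>)
        show "nonoverlapping {a..b} D2" by (rule nonoverlapping_mono[OF D12(2)]) auto
        have "length_sum D2 \<le> (a + real (Suc n) * (\<delta>/2)) - ?s"
          by (rule length_sum_le) (rule nonoverlapping_mono[OF D12(2)], use \<open>\<delta> > 0\<close> in \<open>auto simp: algebra_simps\<close>)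
        then show "length_sum D2 < \<delta>" using \<open>\<delta> > 0\<close> by (simp add: algebra_simps)
      qed
      ultimately show ?thesis using D12(3) by linarith
    qed
    then show ?case by blast
  qed
  obtain n :: nat where "(b - a) / (\<delta>/2) < real n" using reals_Archimedean2 by blast
  then have "b - a < real n * (\<delta>/2)" using \<open>\<delta> > 0\<close> by (subst (asm) pos_divide_less_eq) auto
  then have "{a..b} \<inter> {..a + real n * (\<delta>/2)} = {a..b}" by (intro Int_absorb2) auto
  with *[of n] show ?thesis by (simp only:)
qed

text \<open>A competitor for the supremum on \<open>{a..s}\<close> may be enlarged by
  \<open>D\<close> to one on \<open>{a..t}\<close>; bounded variation keeps the suprema
  meaningful.\<close>

lemma variation_superadditive:
  assumes f: "abs_cont_on {a..b} f" and "a \<le> s" "s \<le> t" "t \<le> b" "nonoverlapping {s..t} D"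
  shows "variation f a s + var_sum f D \<le> variation f a t"
proof -
  obtain M where M: "\<And>D. nonoverlapping {a..b} D \<Longrightarrow> var_sum f D \<le> M"
    using abs_cont_on_bounded_variation[OF f] by blast
  have bdd: "bdd_above (var_sum f ` {D. nonoverlapping {a..t} D})"
    using M nonoverlapping_mono[of "{a..t}" _ "{a..b}"] assms by (auto intro!: bdd_aboveI[of _ M])
  have "variation f a s \<le> variation f a t - var_sum f D"
    unfolding variation_def[of f a s]
  proof (rule cSup_least)
    show "var_sum f ` {D. nonoverlapping {a..s} D} \<noteq> {}" using nonoverlapping_empty by blast
    fix x assume "x \<in> var_sum f ` {D. nonoverlapping {a..s} D}"
    then obtain D0 where D0: "nonoverlapping {a..s} D0" "x = var_sum f D0" by auto
    have "var_sum f (D0 \<union> D) \<le> variation f a t"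
      unfolding variation_def by (rule cSup_upper[OF _ bdd]) (use nonoverlapping_Un(1)[OF D0(1) assms(5) assms(2,3)] in auto)
    then show "x \<le> variation f a t - var_sum f D"
      using nonoverlapping_Un(2)[OF D0(1) assms(5) assms(2,3), of f] D0 by simp
  qed
  then show ?thesis by simp
qed

text \<open>A near-optimal family on \<open>{a..t}\<close> is cut at \<open>s\<close>, and its left
  part is charged to \<open>variation f a s\<close>.\<close>

lemma variation_subadditive:
  assumes f: "abs_cont_on {a..b} f" and "a \<le> s" "s \<le> t" "t \<le> b" "e > 0"
  shows "\<exists>D. nonoverlapping {s..t} D \<and> variation f a t - variation f a s < var_sum f D + e"
proof -
  have "variation f a t - e < Sup (var_sum f ` {D. nonoverlapping {a..t} D})"
    using assms by (simp add: variation_def)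
  then have "\<exists>x\<in>var_sum f ` {D. nonoverlapping {a..t} D}. variation f a t - e < x"
    by (intro less_cSupD) (use nonoverlapping_empty in blast)+
  then obtain D where D: "nonoverlapping {a..t} D" "variation f a t - e < var_sum f D"
    by auto
  obtain D1 D2 where D12: "nonoverlapping ({a..t} \<inter> {..s}) D1" "nonoverlapping ({a..t} \<inter> {s..}) D2"
        "var_sum f D \<le> var_sum f D1 + var_sum f D2"
    using nonoverlapping_split[OF D(1)] by blast
  have 1: "nonoverlapping {a..s} D1" by (rule nonoverlapping_mono[OF D12(1)]) auto
  have 2: "nonoverlapping {s..t} D2" by (rule nonoverlapping_mono[OF D12(2)]) auto
  have "variation f a a + var_sum f D1 \<le> variation f a s"
    by (rule variation_superadditive[OF f]) (use assms 1 in auto)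
  \<comment> \<open>On a one-point interval only the empty family is admissible.\<close>
  moreover have "variation f a a \<ge> 0"
  proof -
    have "D = {}" if "nonoverlapping {a..a} D" for D
    proof (rule ccontr)
      assume "D \<noteq> {}"
      then obtain p where "p \<in> D" by blast
      then have "fst p < snd p" "{fst p..snd p} \<subseteq> {a..a}" using that unfolding nonoverlapping_def by blast+
      then show False by (auto simp: atLeastatMost_subset_iff simp del: atLeastAtMost_singleton)
    qed
    then have "{D. nonoverlapping {a..a} D} = {{}}" by auto
    then show ?thesis by (simp add: variation_def var_sum_def)
  qed
  ultimately show ?thesis using D D12(3) 2 by (intro exI[of _ D2]) auto
qed

lemma variation_ge:
  assumes "abs_cont_on {a..b} f" "a \<le> s" "s \<le> t" "t \<le> b"
  shows "\<bar>f t - f s\<bar> \<le> variation f a t - variation f a s"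
proof (cases "s = t")
  case False
  then have "nonoverlapping {s..t} {(s,t)}" using assms by (auto simp: nonoverlapping_def)
  from variation_superadditive[OF assms this] show ?thesis by (simp add: var_sum_def)
qed simp

text \<open>Each interval of \<open>D\<close> is replaced by a near-optimal subdivision of itself.
  The refined family is no longer than \<open>D\<close>, so the \<delta> that \<open>f\<close> has
  for \<epsilon>/2 still applies to it.\<close>

lemma variation_abs_cont:
  assumes f: "abs_cont_on {a..b} f" and "\<epsilon> > 0"
  shows "\<exists>\<delta>>0. \<forall>D. nonoverlapping {a..b} D \<and> length_sum D < \<delta> \<longrightarrow>
           (\<Sum>p\<in>D. variation f a (snd p) - variation f a (fst p)) \<le> \<epsilon>"
proof -
  obtain \<delta> where "\<delta> > 0" and \<delta>: "\<And>D. nonoverlapping {a..b} D \<Longrightarrow> length_sum D < \<delta> \<Longrightarrow> var_sum f D < \<epsilon>/2"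
    using abs_cont_on_nonoverlapping[OF f, of "\<epsilon>/2"] \<open>\<epsilon> > 0\<close> by auto
  have "(\<Sum>p\<in>D. variation f a (snd p) - variation f a (fst p)) \<le> \<epsilon>"
    if D: "nonoverlapping {a..b} D" "length_sum D < \<delta>" for D
  proof -
    have pD: "fst p < snd p \<and> a \<le> fst p \<and> snd p \<le> b" if "p \<in> D" for p
      using D that by (auto simp: nonoverlapping_def)
    \<comment> \<open>Accuracy per interval: the \<open>card D\<close> errors add up to at most
      \<epsilon>/2, and the summand 1 covers an empty \<open>D\<close>.\<close>
    let ?e = "\<epsilon> / (2 * (real (card D) + 1))"
    have "?e > 0" using \<open>\<epsilon> > 0\<close> by simp
    have "\<exists>E. nonoverlapping {fst p..snd p} E \<and> variation f a (snd p) - variation f a (fst p) < var_sum f E + ?e"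
      if "p \<in> D" for p
      using pD[OF that] \<open>?e > 0\<close> by (intro variation_subadditive[OF f]) auto
    then obtain E where E: "\<And>p. p \<in> D \<Longrightarrow> nonoverlapping {fst p..snd p} (E p)"
      "\<And>p. p \<in> D \<Longrightarrow> variation f a (snd p) - variation f a (fst p) < var_sum f (E p) + ?e"
      by metis
    have U: "nonoverlapping {a..b} (\<Union>p\<in>D. E p)" "var_sum f (\<Union>p\<in>D. E p) = (\<Sum>p\<in>D. var_sum f (E p))"
      "length_sum (\<Union>p\<in>D. E p) = (\<Sum>p\<in>D. length_sum (E p))"
      using nonoverlapping_Union[OF D(1), of E] E(1) by blast+
    have "length_sum (\<Union>p\<in>D. E p) \<le> length_sum D"
      unfolding U(3) unfolding length_sum_def[of D]
    proof (rule sum_mono)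
      fix p assume "p \<in> D"
      then show "length_sum (E p) \<le> snd p - fst p"
        using E(1) pD by (intro length_sum_le) (auto intro: less_imp_le)
    qed
    then have "var_sum f (\<Union>p\<in>D. E p) < \<epsilon>/2"
      using U(1) D(2) by (intro \<delta>) linarith+
    have "(\<Sum>p\<in>D. variation f a (snd p) - variation f a (fst p)) \<le> (\<Sum>p\<in>D. var_sum f (E p) + ?e)"
      by (rule sum_mono) (use E in force)
    also have "\<dots> = var_sum f (\<Union>p\<in>D. E p) + card D * ?e"
      by (simp add: U(2) sum.distrib)
    also have "\<dots> \<le> \<epsilon>/2 + \<epsilon>/2"
      using \<open>var_sum f (\<Union>p\<in>D. E p) < \<epsilon>/2\<close> \<open>\<epsilon> > 0\<close> by (intro add_mono) (auto simp: field_simps)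
    finally show ?thesis by simp
  qed
  then show ?thesis using \<open>\<delta> > 0\<close> by blast
qed

section \<open>Densities from Stieltjes measures\<close>

text \<open>The null set is covered by countably many nonoverlapping closed intervals of total
  length below \<delta>. Finite subfamilies have Stieltjes measure at most \<epsilon> by
  \<open>ac\<close>, and continuity from below extends the bound to the whole cover.\<close>

lemma interval_measure_absolutely_continuous:
  assumes mono: "\<And>x y. x \<le> y \<Longrightarrow> F x \<le> F y" and cont: "continuous_on UNIV F" and "a < b"
    and ac: "\<And>\<epsilon>. \<epsilon> > 0 \<Longrightarrow> \<exists>\<delta>>0. \<forall>D. nonoverlapping {a..b} D \<and> length_sum D < \<delta> \<longrightarrow>
           (\<Sum>p\<in>D. F (snd p) - F (fst p)) \<le> \<epsilon>"
    and N: "N \<in> null_sets lborel" "N \<subseteq> {a..b}"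
  shows "emeasure (interval_measure F) N = 0"
proof -
  let ?\<nu> = "interval_measure F"
  have N0: "N \<in> sets borel" "N \<in> lmeasurable" "measure lebesgue N = 0"
    using N by (auto simp: null_sets_def measure_def intro!: fmeasurableI)
  have le: "emeasure ?\<nu> N \<le> ennreal \<epsilon>" if eps: "\<epsilon> > 0" for \<epsilon>
  proof -
    obtain \<delta> where "\<delta> > 0" and \<delta>: "\<And>D. nonoverlapping {a..b} D \<Longrightarrow> length_sum D < \<delta> \<Longrightarrow>
           (\<Sum>p\<in>D. F (snd p) - F (fst p)) \<le> \<epsilon>"
      using ac[OF eps] by blast
    have Ns: "N \<subseteq> cbox a b" and d2: "0 < \<delta>/2" using N(2) \<open>\<delta> > 0\<close> by (simp_all add: cbox_interval)
    obtain \<D> where \<D>: "countable \<D>" "\<And>K. K \<in> \<D> \<Longrightarrow> K \<subseteq> cbox a b \<and> K \<noteq> {} \<and> (\<exists>c d. K = cbox c d)"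
        "pairwise (\<lambda>A B. interior A \<inter> interior B = {}) \<D>"
        "\<And>u v. cbox u v \<in> \<D> \<Longrightarrow> \<exists>n. \<forall>i \<in> Basis. v \<bullet> i - u \<bullet> i = (b \<bullet> i - a \<bullet> i)/2^n"
        "\<And>K. \<lbrakk>K \<in> \<D>; box a b \<noteq> {}\<rbrakk> \<Longrightarrow> interior K \<noteq> {}"
        "N \<subseteq> \<Union>\<D>" "\<Union>\<D> \<in> lmeasurable" "measure lebesgue (\<Union>\<D>) \<le> measure lebesgue N + \<delta>/2"
      by (rule measurable_outer_intervals_bounded[OF N0(2) Ns d2], rule that) (assumption | blast)+
    \<comment> \<open>The endpoints are recovered from the interval itself. Nonempty interior,
      available because \<open>a < b\<close>, excludes degenerate members, as
      \<open>nonoverlapping\<close> demands.\<close>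
    define lo hi where "lo = (\<lambda>K::real set. Inf K)" and "hi = (\<lambda>K::real set. Sup K)"
    have K: "K = {lo K..hi K}" "lo K < hi K" "a \<le> lo K" "hi K \<le> b" if KD: "K \<in> \<D>" for K
    proof -
      obtain c d where cd: "K = {c..d}" using \<D>(2)[OF KD] by (auto simp: cbox_interval)
      moreover have "interior K \<noteq> {}" using \<D>(5)[OF KD] \<open>a < b\<close> by (simp add: box_real)
      ultimately have "c < d" by (auto simp: interior_atLeastAtMost_real)
      moreover have "K \<subseteq> {a..b}" using \<D>(2)[OF KD] by (simp add: cbox_interval)
      ultimately show "K = {lo K..hi K}" "lo K < hi K" "a \<le> lo K" "hi K \<le> b"
        using cd by (auto simp: lo_def hi_def)
    qed
    have Kb: "K \<in> sets borel" if "K \<in> \<D>" for K by (subst K(1)[OF that]) simp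
    have fin: "(\<Sum>K\<in>\<F>. F (hi K) - F (lo K)) \<le> \<epsilon>" if \<F>: "finite \<F>" "\<F> \<subseteq> \<D>" for \<F>
    proof -
      define D where "D = (\<lambda>K. (lo K, hi K)) ` \<F>"
      have inj: "inj_on (\<lambda>K. (lo K, hi K)) \<F>"
      proof (rule inj_onI)
        fix K K' assume *: "K \<in> \<F>" "K' \<in> \<F>" "(lo K, hi K) = (lo K', hi K')"
        have "K = {lo K..hi K}" by (rule K(1)) (use * \<F> in blast)
        also have "\<dots> = {lo K'..hi K'}" using *(3) by simp
        also have "\<dots> = K'" by (rule K(1)[symmetric]) (use * \<F> in blast)
        finally show "K = K'" .
      qed
      have dj: "{lo K<..<hi K} \<inter> {lo K'<..<hi K'} = {}" if "K \<in> \<F>" "K' \<in> \<F>" "K \<noteq> K'" for K K'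
      proof -
        have "K \<in> \<D>" "K' \<in> \<D>" using that \<F> by blast+
        then have "interior K = {lo K<..<hi K}" "interior K' = {lo K'<..<hi K'}"
          using arg_cong[OF K(1), of _ interior] by (simp_all only: interior_atLeastAtMost_real)
        then show ?thesis using \<D>(3) that \<F> unfolding pairwise_def by blast
      qed
      have nov: "nonoverlapping {a..b} D"
        unfolding nonoverlapping_def
      proof (intro conjI)
        show "finite D" using \<F> by (simp add: D_def)
        show "\<forall>p\<in>D. fst p < snd p \<and> {fst p..snd p} \<subseteq> {a..b}"
          unfolding D_def using K(2,3,4) \<F> by auto
        show "pairwise (\<lambda>p q. {fst p<..<snd p} \<inter> {fst q<..<snd q} = {}) D"
          unfolding pairwise_def
        proof (intro ballI impI)
          fix p q assume "p \<in> D" "q \<in> D" "p \<noteq> q"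
          then obtain K1 K2 where "K1 \<in> \<F>" "K2 \<in> \<F>" "K1 \<noteq> K2" "p = (lo K1, hi K1)" "q = (lo K2, hi K2)"
            unfolding D_def by blast
          then show "{fst p<..<snd p} \<inter> {fst q<..<snd q} = {}" using dj by (simp only: fst_conv snd_conv)
        qed
      qed
      have "length_sum D = (\<Sum>K\<in>\<F>. hi K - lo K)"
        unfolding length_sum_def D_def by (simp add: sum.reindex[OF inj])
      also have "\<dots> = (\<Sum>K\<in>\<F>. measure lebesgue {lo K<..<hi K})"
        using K(2) \<F> by (intro sum.cong) (auto simp: less_imp_le subset_iff)
      also have "\<dots> = measure lebesgue (\<Union>K\<in>\<F>. {lo K<..<hi K})"
      proof (rule measure_finite_Union[symmetric, OF \<F>(1)])
        show "disjoint_family_on (\<lambda>K. {lo K<..<hi K}) \<F>"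
          using dj unfolding disjoint_family_on_def by blast
        show "emeasure lebesgue {lo K<..<hi K} \<noteq> \<infinity>" if "K \<in> \<F>" for K
          using K(2)[of K] that \<F> by (auto simp: less_imp_le subset_iff)
      qed auto
      also have "\<dots> \<le> measure lebesgue (\<Union>\<D>)"
      proof (rule measure_mono_fmeasurable)
        show "(\<Union>K\<in>\<F>. {lo K<..<hi K}) \<subseteq> \<Union>\<D>"
        proof (rule UN_least)
          fix K assume "K \<in> \<F>"
          then have "K \<in> \<D>" using \<F> by blast
          have "{lo K<..<hi K} \<subseteq> {lo K..hi K}" by auto
          also have "\<dots> = K" by (rule K(1)[symmetric]) fact
          finally show "{lo K<..<hi K} \<subseteq> \<Union>\<D>" using \<open>K \<in> \<D>\<close> by blast
        qed
        show "(\<Union>K\<in>\<F>. {lo K<..<hi K}) \<in> sets lebesgue" using \<F> by auto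
      qed (rule \<D>(7))
      also have "\<dots> < \<delta>" using \<D>(8) N0(3) \<open>\<delta> > 0\<close> by simp
      finally have "(\<Sum>p\<in>D. F (snd p) - F (fst p)) \<le> \<epsilon>" by (rule \<delta>[OF nov])
      then show ?thesis unfolding D_def by (simp add: sum.reindex[OF inj])
    qed
    have "emeasure ?\<nu> N \<le> emeasure ?\<nu> (\<Union>\<D>)"
      by (rule emeasure_mono) (use \<D> Kb in \<open>auto intro!: sets.countable_Union\<close>)
    also have "\<dots> \<le> ennreal \<epsilon>"
    proof (cases "\<D> = {}")
      case False
      \<comment> \<open>Exhaustion of the cover by finite unions; repetitions in the enumeration do
        no harm.\<close>
      define A where "A n = \<Union>(from_nat_into \<D> ` {..n})" for n :: nat
      have sub: "from_nat_into \<D> ` {..n} \<subseteq> \<D>" for n using False by (auto intro: from_nat_into)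
      have "\<Union>\<D> = (\<Union>n. A n)"
      proof -
        have "\<Union>\<D> = \<Union>(range (from_nat_into \<D>))" by (simp only: range_from_nat_into[OF False \<D>(1)])
        then show ?thesis by (auto simp: A_def)
      qed
      also have "emeasure ?\<nu> (\<Union>n. A n) = (SUP n. emeasure ?\<nu> (A n))"
      proof (rule SUP_emeasure_incseq[symmetric])
        show "range A \<subseteq> sets ?\<nu>" using sub Kb by (auto simp: A_def intro!: sets.finite_UN)
        show "incseq A" by (force simp: A_def incseq_def)
      qed
      also have "\<dots> \<le> ennreal \<epsilon>"
      proof (rule SUP_least)
        fix n
        let ?\<F> = "from_nat_into \<D> ` {..n}"
        have "emeasure ?\<nu> (A n) \<le> (\<Sum>K\<in>?\<F>. emeasure ?\<nu> K)"
          unfolding A_def using emeasure_subadditive_finite[of ?\<F> "\<lambda>K. K" ?\<nu>] sub Kb by auto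
        also have "\<dots> = (\<Sum>K\<in>?\<F>. ennreal (F (hi K) - F (lo K)))"
        proof (rule sum.cong[OF refl])
          fix K assume "K \<in> ?\<F>"
          then have KD: "K \<in> \<D>" using sub by blast
          \<comment> \<open>Since \<open>F\<close> is continuous, endpoints carry no mass, and a
            closed interval has the increment of \<open>F\<close> as its measure.\<close>
          show "emeasure ?\<nu> K = ennreal (F (hi K) - F (lo K))"
            using emeasure_interval_measure_Icc[OF less_imp_le[OF K(2)[OF KD]] mono cont] K(1)[OF KD] by simp
        qed
        also have "\<dots> = ennreal (\<Sum>K\<in>?\<F>. F (hi K) - F (lo K))"
        proof (rule sum_ennreal)
          fix K assume "K \<in> ?\<F>"
          then have KD: "K \<in> \<D>" using sub by blast
          show "0 \<le> F (hi K) - F (lo K)" using mono[OF less_imp_le[OF K(2)[OF KD]]] by simp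
        qed
        also have "\<dots> \<le> ennreal \<epsilon>" using fin[OF _ sub] by (intro ennreal_leI) auto
        finally show "emeasure ?\<nu> (A n) \<le> ennreal \<epsilon>" .
      qed
      finally show ?thesis .
    qed simp
    finally show ?thesis .
  qed
  show ?thesis
  proof (rule antisym)
    show "emeasure ?\<nu> N \<le> 0"
    proof (rule ennreal_le_epsilon)
      fix e :: real assume "0 < e"
      then show "emeasure ?\<nu> N \<le> 0 + ennreal e" using le by simp
    qed
  qed simp
qed

text \<open>Radon-Nikodym for the Stieltjes measure of G, extended by constants outside the interval.\<close>

lemma mono_abs_cont_density:
  fixes G :: "real \<Rightarrow> real"
  assumes mono: "mono_on {a..b} G" and cont: "continuous_on {a..b} G" and "a < b"
    and ac: "\<And>\<epsilon>. \<epsilon> > 0 \<Longrightarrow> \<exists>\<delta>>0. \<forall>D. nonoverlapping {a..b} D \<and> length_sum D < \<delta> \<longrightarrow>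
           (\<Sum>p\<in>D. G (snd p) - G (fst p)) \<le> \<epsilon>"
  shows "\<exists>g. integrable lborel g \<and> (\<forall>s\<in>{a..b}. \<forall>t\<in>{s..b}. G t - G s = (LINT x:{s..t}|lborel. g x))"
proof -
  define F where "F x = G (max a (min b x))" for x
  have FG: "F x = G x" if "x \<in> {a..b}" for x using that by (simp add: F_def)
  have mF: "F x \<le> F y" if "x \<le> y" for x y
    unfolding F_def by (rule mono_onD[OF mono]) (use that \<open>a < b\<close> in auto)
  have cF: "continuous_on UNIV F"
    unfolding F_def by (rule continuous_on_compose2[OF cont]) (use \<open>a < b\<close> in \<open>auto intro!: continuous_intros\<close>)
  let ?\<nu> = "interval_measure F"
  \<comment> \<open>The restriction to \<open>{a..b}\<close> matches the range in which
    \<open>ac\<close> controls null sets.\<close>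
  let ?\<nu>' = "density ?\<nu> (indicator {a..b})"
  have acF: "\<exists>\<delta>>0. \<forall>D. nonoverlapping {a..b} D \<and> length_sum D < \<delta> \<longrightarrow>
           (\<Sum>p\<in>D. F (snd p) - F (fst p)) \<le> \<epsilon>" if eps: "\<epsilon> > 0" for \<epsilon>
  proof -
    obtain \<delta> where d: "\<delta> > 0" "\<And>D. nonoverlapping {a..b} D \<Longrightarrow> length_sum D < \<delta> \<Longrightarrow>
           (\<Sum>p\<in>D. G (snd p) - G (fst p)) \<le> \<epsilon>" using ac[OF eps] by blast
    have "(\<Sum>p\<in>D. F (snd p) - F (fst p)) = (\<Sum>p\<in>D. G (snd p) - G (fst p))" if "nonoverlapping {a..b} D" for D
    proof (rule sum.cong[OF refl])
      fix p assume "p \<in> D"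
      then have "fst p \<in> {a..b}" "snd p \<in> {a..b}" using that unfolding nonoverlapping_def by force+
      then show "F (snd p) - F (fst p) = G (snd p) - G (fst p)" by (simp add: FG)
    qed
    then show ?thesis using d by metis
  qed
  have em: "emeasure ?\<nu>' A = emeasure ?\<nu> (A \<inter> {a..b})" if "A \<in> sets borel" for A
    using that by (subst emeasure_density) (auto simp: nn_integral_indicator[symmetric] indicator_inter_arith mult.commute simp del: nn_integral_indicator)
  have "absolutely_continuous lborel ?\<nu>'"
    unfolding absolutely_continuous_def
  proof
    fix N :: "real set" assume N: "N \<in> null_sets lborel"
    then have Nb: "N \<in> sets borel" by auto
    have "emeasure ?\<nu> (N \<inter> {a..b}) = 0"
      by (rule interval_measure_absolutely_continuous[OF mF cF \<open>a < b\<close> acF])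
         (use N in \<open>auto intro: null_set_Int2\<close>)
    then show "N \<in> null_sets ?\<nu>'" using em[OF Nb] Nb by (auto simp: null_sets_def)
  qed
  then obtain h where h: "h \<in> borel_measurable lborel" "density lborel h = ?\<nu>'"
    using sigma_finite_measure.Radon_Nikodym[OF sigma_finite_lborel, of ?\<nu>'] by auto
  have hA: "(\<integral>\<^sup>+x. h x * indicator A x \<partial>lborel) = emeasure ?\<nu> (A \<inter> {a..b})" if "A \<in> sets borel" for A
    using emeasure_density[OF h(1), of A] h(2) em[OF that] that by simp
  have hst: "(\<integral>\<^sup>+x. h x * indicator {s..t} x \<partial>lborel) = ennreal (G t - G s)" if "s \<in> {a..b}" "t \<in> {s..b}" for s t
  proof -
    have "{s..t} \<inter> {a..b} = {s..t}" using that by auto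
    moreover have "emeasure ?\<nu> {s..t} = ennreal (F t - F s)"
      using that by (intro emeasure_interval_measure_Icc mF cF) auto
    moreover have "F t = G t" "F s = G s" using that by (auto intro!: FG)
    ultimately show ?thesis using hA[of "{s..t}"] by (simp only: sets_lborel borel_closed closed_real_atLeastAtMost)
  qed
  have htot: "(\<integral>\<^sup>+x. h x \<partial>lborel) = ennreal (G b - G a)"
  proof -
    have "emeasure ?\<nu> {a..b} = ennreal (F b - F a)"
      using \<open>a < b\<close> by (intro emeasure_interval_measure_Icc mF cF) auto
    moreover have "F b = G b" "F a = G a" using \<open>a < b\<close> by (auto intro!: FG)
    ultimately show ?thesis using hA[of UNIV] by simp
  qed
  have fin: "AE x in lborel. h x \<noteq> \<infinity>"
    using h(1) htot by (intro nn_integral_noteq_infinite) auto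
  \<comment> \<open>The density has total integral \<open>G b - G a\<close>, hence is finite almost
    everywhere, and passing to real values changes it only on a null set.\<close>
  define g where "g x = enn2real (h x)" for x
  have gm[measurable]: "g \<in> borel_measurable lborel" unfolding g_def using h(1) by measurable
  have gh: "AE x in lborel. ennreal (g x) = h x"
    using fin by eventually_elim (auto simp: g_def less_top)
  have gi: "integrable lborel g"
  proof (rule integrableI_nonneg)
    have "(\<integral>\<^sup>+x. ennreal (g x) \<partial>lborel) = ennreal (G b - G a)"
      using htot nn_integral_cong_AE[OF gh] by simp
    then show "(\<integral>\<^sup>+x. ennreal (g x) \<partial>lborel) < \<infinity>" by simp
  qed (auto simp: g_def)
  have "G t - G s = (LINT x:{s..t}|lborel. g x)" if st: "s \<in> {a..b}" "t \<in> {s..b}" for s t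
  proof -
    have "(LINT x:{s..t}|lborel. g x) = enn2real (\<integral>\<^sup>+x. ennreal (indicator {s..t} x * g x) \<partial>lborel)"
      unfolding set_lebesgue_integral_def by (simp, rule integral_eq_nn_integral) (use gm in measurable, auto simp: g_def)
    also have "(\<integral>\<^sup>+x. ennreal (indicator {s..t} x * g x) \<partial>lborel) = (\<integral>\<^sup>+x. h x * indicator {s..t} x \<partial>lborel)"
      by (rule nn_integral_cong_AE) (use gh in \<open>eventually_elim, auto simp: indicator_def\<close>)
    also have "\<dots> = ennreal (G t - G s)" by (rule hst[OF st])
    finally show ?thesis using mono_onD[OF mono, of s t] st by simp
  qed
  with gi show ?thesis by blast
qed

lemma abs_cont_on_continuous:
  assumes f: "abs_cont_on {a..b} f"
  shows "continuous_on {a..b} f"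
  unfolding continuous_on_iff
proof (intro ballI allI impI)
  fix x e :: real assume x: "x \<in> {a..b}" and "0 < e"
  obtain \<delta> where "\<delta> > 0" and \<delta>: "\<And>D. nonoverlapping {a..b} D \<Longrightarrow> length_sum D < \<delta> \<Longrightarrow> var_sum f D < e"
    using abs_cont_on_nonoverlapping[OF f \<open>0 < e\<close>] by auto
  have *: "\<bar>f v - f u\<bar> < e" if "u \<in> {a..b}" "v \<in> {a..b}" "u < v" "v - u < \<delta>" for u v
    using \<delta>[of "{(u,v)}"] that by (auto simp: nonoverlapping_def length_sum_def var_sum_def)
  have "dist (f x') (f x) < e" if "x' \<in> {a..b}" "dist x' x < \<delta>" for x'
    using *[of x x'] *[of x' x] that x \<open>0 < e\<close> by (cases x x' rule: linorder_cases) (auto simp: dist_real_def)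
  then show "\<exists>d>0. \<forall>x'\<in>{a..b}. dist x' x < d \<longrightarrow> dist (f x') (f x) < e" using \<open>\<delta> > 0\<close> by blast
qed

text \<open>Jordan decomposition \<open>f = V - (V - f)\<close> with the variation \<open>V\<close>.
  Both parts are increasing and their increments are at most twice those of \<open>V\<close>, so the
  density result for increasing functions applies to each; the two densities are subtracted.\<close>

lemma abs_cont_on_integral:
  assumes f: "abs_cont_on {a..b} f" and "a < b"
  shows "\<exists>g. integrable lborel g \<and> (\<forall>s\<in>{a..b}. \<forall>t\<in>{s..b}. f t - f s = (LINT x:{s..t}|lborel. g x))"
proof -
  let ?V = "variation f a"
  have ge: "\<bar>f t - f s\<bar> \<le> ?V t - ?V s" if "s \<in> {a..b}" "t \<in> {s..b}" for s t
    using variation_ge[OF f, of s t] that by auto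
  \<comment> \<open>Formulated for every \<open>G\<close> dominated by the variation, since it
    serves both parts of the decomposition; the factor 2 is absorbed by using \<epsilon>/2.\<close>
  have acV: "\<exists>\<delta>>0. \<forall>D. nonoverlapping {a..b} D \<and> length_sum D < \<delta> \<longrightarrow>
           (\<Sum>p\<in>D. G (snd p) - G (fst p)) \<le> \<epsilon>"
    if "\<epsilon> > 0" and G: "\<And>s t. s \<in> {a..b} \<Longrightarrow> t \<in> {s..b} \<Longrightarrow> G t - G s \<le> 2 * (?V t - ?V s)" for \<epsilon> :: real and G
  proof -
    obtain \<delta> where d: "\<delta> > 0" "\<And>D. nonoverlapping {a..b} D \<Longrightarrow> length_sum D < \<delta> \<Longrightarrow>
           (\<Sum>p\<in>D. ?V (snd p) - ?V (fst p)) \<le> \<epsilon>/2" using variation_abs_cont[OF f, of "\<epsilon>/2"] \<open>\<epsilon> > 0\<close> by auto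
    have "(\<Sum>p\<in>D. G (snd p) - G (fst p)) \<le> \<epsilon>" if D: "nonoverlapping {a..b} D" "length_sum D < \<delta>" for D
    proof -
      have "(\<Sum>p\<in>D. G (snd p) - G (fst p)) \<le> (\<Sum>p\<in>D. 2 * (?V (snd p) - ?V (fst p)))"
      proof (rule sum_mono)
        fix p assume "p \<in> D"
        then have "fst p < snd p" "{fst p..snd p} \<subseteq> {a..b}" using D(1) unfolding nonoverlapping_def by blast+
        then show "G (snd p) - G (fst p) \<le> 2 * (?V (snd p) - ?V (fst p))" by (intro G) auto
      qed
      also have "\<dots> \<le> \<epsilon>" unfolding sum_distrib_left[symmetric] using d(2)[OF D] by simp
      finally show ?thesis .
    qed
    then show ?thesis using d(1) by blast
  qed
  have cV: "continuous_on {a..b} G"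
    if G: "\<And>s t. s \<in> {a..b} \<Longrightarrow> t \<in> {s..b} \<Longrightarrow> 0 \<le> G t - G s \<and> G t - G s \<le> 2 * (?V t - ?V s)" for G
    unfolding continuous_on_iff
  proof (intro ballI allI impI)
    fix x e :: real assume x: "x \<in> {a..b}" and "0 < e"
    obtain \<delta> where d: "\<delta> > 0" "\<And>D. nonoverlapping {a..b} D \<Longrightarrow> length_sum D < \<delta> \<Longrightarrow>
           (\<Sum>p\<in>D. G (snd p) - G (fst p)) \<le> e/2" using acV[of "e/2" G] G \<open>0 < e\<close> by auto
    have *: "\<bar>G v - G u\<bar> \<le> e/2" if "u \<in> {a..b}" "v \<in> {a..b}" "u < v" "v - u < \<delta>" for u v
      using d(2)[of "{(u,v)}"] that G[of u v] by (auto simp: nonoverlapping_def length_sum_def)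
    have "dist (G x') (G x) < e" if "x' \<in> {a..b}" "dist x' x < \<delta>" for x'
      using *[of x x'] *[of x' x] that x \<open>0 < e\<close> by (cases x x' rule: linorder_cases) (auto simp: dist_real_def abs_minus_commute)
    then show "\<exists>d>0. \<forall>x'\<in>{a..b}. dist x' x < d \<longrightarrow> dist (G x') (G x) < e" using d(1) by blast
  qed
  have *: "\<exists>g. integrable lborel g \<and> (\<forall>s\<in>{a..b}. \<forall>t\<in>{s..b}. G t - G s = (LINT x:{s..t}|lborel. g x))"
    if G: "\<And>s t. s \<in> {a..b} \<Longrightarrow> t \<in> {s..b} \<Longrightarrow> 0 \<le> G t - G s \<and> G t - G s \<le> 2 * (?V t - ?V s)" for G
  proof (rule mono_abs_cont_density[OF _ cV[OF G] \<open>a < b\<close> acV])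
    show "mono_on {a..b} G" by (rule mono_onI) (use G in force)
  qed (use G in auto)
  have "0 \<le> ?V t - ?V s \<and> ?V t - ?V s \<le> 2 * (?V t - ?V s)"
    if "s \<in> {a..b}" "t \<in> {s..b}" for s t using order_trans[OF abs_ge_zero ge[OF that]] by simp
  from *[of ?V, OF this]
  obtain g1 where g1: "integrable lborel g1" "\<And>s t. s \<in> {a..b} \<Longrightarrow> t \<in> {s..b} \<Longrightarrow> ?V t - ?V s = (LINT x:{s..t}|lborel. g1 x)"
    by blast
  have "0 \<le> (?V t - f t) - (?V s - f s) \<and> (?V t - f t) - (?V s - f s) \<le> 2 * (?V t - ?V s)"
    if "s \<in> {a..b}" "t \<in> {s..b}" for s t using ge[OF that] by (auto simp: abs_le_iff)
  from *[of "\<lambda>t. ?V t - f t", OF this]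
  obtain g2 where g2: "integrable lborel g2" "\<And>s t. s \<in> {a..b} \<Longrightarrow> t \<in> {s..b} \<Longrightarrow> (?V t - f t) - (?V s - f s) = (LINT x:{s..t}|lborel. g2 x)"
    by blast
  have "f t - f s = (LINT x:{s..t}|lborel. g1 x - g2 x)" if st: "s \<in> {a..b}" "t \<in> {s..b}" for s t
  proof -
    have si: "set_integrable lborel {s..t} g" if "integrable lborel g" for g :: "real \<Rightarrow> real"
      using that unfolding set_integrable_def by (rule integrable_mult_indicator[rotated]) auto
    have "(LINT x:{s..t}|lborel. g1 x - g2 x) = (LINT x:{s..t}|lborel. g1 x) - (LINT x:{s..t}|lborel. g2 x)"
      by (rule set_integral_diff) (intro si g1 g2)+
    then show ?thesis using g1(2)[OF st] g2(2)[OF st] by simp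
  qed
  then show ?thesis using g1(1) g2(1) by (intro exI[of _ "\<lambda>x. g1 x - g2 x"]) auto
qed

section \<open>Differentiation of indefinite integrals and the fundamental theorem\<close>

text \<open>Lebesgue differentiation is invoked in a form with cubes that extend to the right of the
  point. Left difference quotients are right ones of the reflected function, hence the second
  exceptional set and its reflection.\<close>

lemma derivative_of_integral:
  fixes f g :: "real \<Rightarrow> real"
  assumes g: "integrable lborel g"
    and fg: "\<And>s t. s \<in> {a..b} \<Longrightarrow> t \<in> {s..b} \<Longrightarrow> f t - f s = (LINT x:{s..t}|lborel. g x)"
  shows "AE x in lborel. x \<in> {a<..<b} \<longrightarrow> (f has_real_derivative g x) (at x)"
proof -
  have si: "set_integrable lborel {s..t} g" for s t
    unfolding set_integrable_def by (rule integrable_mult_indicator[OF _ g]) auto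
  have fI: "f t - f s = integral {s..t} g" if "s \<in> {a..b}" "t \<in> {s..b}" for s t
    using fg[OF that] set_borel_integral_eq_integral(2)[OF si] by simp
  have g1: "g integrable_on cbox s t" for s t
    using set_borel_integral_eq_integral(1)[OF si] by (simp add: cbox_interval)
  have g2: "(\<lambda>x. g (- x)) integrable_on cbox s t" for s t
    using g1[of "-t" "-s"] Henstock_Kurzweil_Integration.integrable_reflect_real[of g "-s" "-t"] by (simp add: cbox_interval)
  obtain N1 where N1: "negligible N1" "\<And>x e. \<lbrakk>x \<notin> N1; 0 < e\<rbrakk> \<Longrightarrow>
               \<exists>d>0. \<forall>h. 0 < h \<and> h < d \<longrightarrow> norm(integral (cbox x (x + h *\<^sub>R One)) g /\<^sub>R h ^ DIM(real) - g x) < e"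
    using integrable_ccontinuous_explicit[OF g1] by blast
  obtain N2 where N2: "negligible N2" "\<And>x e. \<lbrakk>x \<notin> N2; 0 < e\<rbrakk> \<Longrightarrow>
               \<exists>d>0. \<forall>h. 0 < h \<and> h < d \<longrightarrow> norm(integral (cbox x (x + h *\<^sub>R One)) (\<lambda>x. g (-x)) /\<^sub>R h ^ DIM(real) - g (-x)) < e"
    using integrable_ccontinuous_explicit[OF g2] by blast
  have "negligible (uminus ` N2)"
    by (rule negligible_differentiable_image_negligible[OF _ N2(1)]) (auto simp: differentiable_on_def intro!: derivative_intros)
  then have "negligible (N1 \<union> uminus ` N2)" using N1(1) by (rule negligible_Un[rotated])
  then have "AE x in lebesgue. x \<notin> N1 \<union> uminus ` N2"
    by (intro AE_not_in) (simp only: negligible_iff_null_sets)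
  then have "AE x in lborel. x \<notin> N1 \<union> uminus ` N2" by (simp only: AE_completion_iff)
  then show ?thesis
  proof eventually_elim
    case (elim x)
    show ?case
    proof
      assume x: "x \<in> {a<..<b}"
      have x1: "x \<notin> N1" and x2: "- x \<notin> N2" using elim by (auto simp: image_iff)
      show "(f has_real_derivative g x) (at x)"
        unfolding has_field_derivative_iff LIM_eq
      proof (intro allI impI)
        fix e :: real assume "0 < e"
        obtain d1 where d1: "d1 > 0" "\<forall>h. 0 < h \<and> h < d1 \<longrightarrow> norm (integral (cbox x (x + h *\<^sub>R One)) g /\<^sub>R h ^ DIM(real) - g x) < e"
          using N1(2)[OF x1 \<open>0 < e\<close>] by (elim exE conjE)
        have d1': "\<bar>integral {x..x+h} g / h - g x\<bar> < e" if "0 < h" "h < d1" for h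
          using d1(2)[THEN spec, THEN mp, OF conjI[OF that]] by (simp add: cbox_interval divide_inverse mult.commute)
        obtain d2 where d2: "d2 > 0" "\<forall>h. 0 < h \<and> h < d2 \<longrightarrow> norm (integral (cbox (-x) (-x + h *\<^sub>R One)) (\<lambda>x. g (-x)) /\<^sub>R h ^ DIM(real) - g (- (-x))) < e"
          using N2(2)[OF x2 \<open>0 < e\<close>] by (elim exE conjE)
        have d2': "\<bar>integral {-x..-x+h} (\<lambda>x. g (-x)) / h - g x\<bar> < e" if "0 < h" "h < d2" for h
          using d2(2)[THEN spec, THEN mp, OF conjI[OF that]] by (simp add: cbox_interval divide_inverse mult.commute)
        \<comment> \<open>The second minimum keeps \<open>y\<close> inside \<open>{a..b}\<close>,
          where increments of \<open>f\<close> are integrals of \<open>g\<close>.\<close>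
        let ?d = "min (min d1 d2) (min (x - a) (b - x))"
        have "\<bar>(f y - f x) / (y - x) - g x\<bar> < e" if y: "y \<noteq> x" "\<bar>y - x\<bar> < ?d" for y
        proof (cases "y > x")
          case True
          have "f y - f x = integral {x..y} g" by (rule fI) (use True x y in auto)
          then show ?thesis using d1'[of "y - x"] True y by simp
        next
          case False
          have "f x - f y = integral {y..x} g" by (rule fI) (use False x y in auto)
          also have "\<dots> = integral {-x..-x+(x-y)} (\<lambda>x. g (-x))"
            using Henstock_Kurzweil_Integration.integral_reflect_real[of x y g] by simp
          finally have *: "f x - f y = integral {-x..-x+(x-y)} (\<lambda>x. g (-x))" .
          have "(f y - f x) / (y - x) = (f x - f y) / (x - y)"
            by (metis minus_diff_eq minus_divide_left minus_divide_right minus_minus)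
          then show ?thesis using d2'[of "x - y"] False y * by simp
        qed
        then show "\<exists>s>0. \<forall>xa. xa \<noteq> x \<and> norm (xa - x) < s \<longrightarrow> norm ((f xa - f x) / (xa - x) - g x) < e"
          using d1(1) d2(1) x by (intro exI[of _ ?d]) auto
      qed
    qed
  qed
qed

theorem abs_cont_on_FTC:
  assumes f: "abs_cont_on {a..b} f" and "a < b"
  shows "\<exists>g. integrable lborel g \<and>
    (AE x in lborel. x \<in> {a<..<b} \<longrightarrow> (f has_real_derivative g x) (at x)) \<and>
    (\<forall>s\<in>{a..b}. \<forall>t\<in>{s..b}. f t - f s = (LINT x:{s..t}|lborel. g x))"
proof -
  from abs_cont_on_integral[OF assms]
  obtain g where g: "integrable lborel g" "\<forall>s\<in>{a..b}. \<forall>t\<in>{s..b}. f t - f s = (LINT x:{s..t}|lborel. g x)"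
    by (elim exE conjE)
  show ?thesis
    by (intro exI[of _ g] conjI g derivative_of_integral) (rule g(2)[THEN bspec, THEN bspec])
qed

text \<open>By uniqueness of derivatives \<open>h\<close> equals the density of the fundamental
  theorem almost everywhere, which also makes it integrable. The endpoints \<open>a\<close> and
  \<open>b\<close>, where no derivative is assumed, form a null set.\<close>

corollary abs_cont_on_FTC_derivative:
  assumes f: "abs_cont_on {a..b} f" and "a < b"
    and h: "h \<in> borel_measurable lborel"
    and deriv: "AE x in lborel. x \<in> {a<..<b} \<longrightarrow> (f has_real_derivative h x) (at x)"
    and st: "s \<in> {a..b}" "t \<in> {s..b}"
  shows "set_integrable lborel {s..t} h" "f t - f s = (LINT x:{s..t}|lborel. h x)"
proof -
  from abs_cont_on_FTC[OF f \<open>a < b\<close>]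
  obtain g where g: "integrable lborel g"
    "AE x in lborel. x \<in> {a<..<b} \<longrightarrow> (f has_real_derivative g x) (at x)"
    "\<forall>s\<in>{a..b}. \<forall>t\<in>{s..b}. f t - f s = (LINT x:{s..t}|lborel. g x)"
    by (elim exE conjE)
  have "AE x in lborel. x \<noteq> a" "AE x in lborel. x \<noteq> b" by (rule AE_lborel_singleton)+
  with g(2) deriv have eq: "AE x in lborel. indicator {s..t} x *\<^sub>R g x = indicator {s..t} x *\<^sub>R h x"
  proof eventually_elim
    case (elim x)
    show ?case
    proof (cases "x \<in> {s..t}")
      case True
      then have "x \<in> {a<..<b}" using elim(3,4) st by auto
      then have "g x = h x" using elim(1,2) by (intro DERIV_unique[of f _ x]) auto
      then show ?thesis by simp
    qed simp
  qed
  have gi: "set_integrable lborel {s..t} g"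
    unfolding set_integrable_def by (rule integrable_mult_indicator[OF _ g(1)]) auto
  have m: "(\<lambda>x. indicator {s..t} x *\<^sub>R h x) \<in> borel_measurable lborel"
    using h by measurable
  show "set_integrable lborel {s..t} h"
    using gi unfolding set_integrable_def by (rule integrable_cong_AE_imp[OF _ m eq])
  show "f t - f s = (LINT x:{s..t}|lborel. h x)"
    unfolding g(3)[THEN bspec, THEN bspec, OF st] set_lebesgue_integral_def
    by (rule integral_cong_AE[OF _ m eq]) (use gi in \<open>auto simp: set_integrable_def\<close>)
qed

section \<open>Permanence properties of absolute continuity\<close>

lemma abs_cont_on_dominated:
  assumes f1: "abs_cont_on S f1" and f2: "abs_cont_on S f2"
    and le: "\<And>x y. x \<in> S \<Longrightarrow> y \<in> S \<Longrightarrow> \<bar>h x - h y\<bar> \<le> C * (\<bar>f1 x - f1 y\<bar> + \<bar>f2 x - f2 y\<bar>)"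
  shows "abs_cont_on S h"
  unfolding abs_cont_on_def
proof (intro allI impI)
  fix \<epsilon> :: real assume "0 < \<epsilon>"
  \<comment> \<open>\<open>C\<close> may be zero or negative; a positive constant is needed as a
    divisor.\<close>
  define C' where "C' = \<bar>C\<bar> + 1"
  have C': "C' > 0" "C \<le> C'" by (auto simp: C'_def)
  let ?e = "\<epsilon> / (2 * C')"
  have e: "0 < ?e" using \<open>0 < \<epsilon>\<close> C' by simp
  let ?P = "\<lambda>(n::nat) (I :: nat \<Rightarrow> real \<times> real) \<delta>. (\<forall>i<n. fst (I i) \<le> snd (I i) \<and> {fst (I i)..snd (I i)} \<subseteq> S) \<and>
        (\<forall>i<n. \<forall>j<n. i \<noteq> j \<longrightarrow> {fst (I i)<..<snd (I i)} \<inter> {fst (I j)<..<snd (I j)} = {}) \<and>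
        (\<Sum>i<n. snd (I i) - fst (I i)) < \<delta>"
  from f1[unfolded abs_cont_on_def, THEN spec, THEN mp, OF e]
  obtain d1 where d1: "0 < d1" "\<forall>n I. ?P n I d1 \<longrightarrow> (\<Sum>i<n. \<bar>f1 (snd (I i)) - f1 (fst (I i))\<bar>) < ?e"
    by (elim exE conjE)
  from f2[unfolded abs_cont_on_def, THEN spec, THEN mp, OF e]
  obtain d2 where d2: "0 < d2" "\<forall>n I. ?P n I d2 \<longrightarrow> (\<Sum>i<n. \<bar>f2 (snd (I i)) - f2 (fst (I i))\<bar>) < ?e"
    by (elim exE conjE)
  have "(\<Sum>i<n. \<bar>h (snd (I i)) - h (fst (I i))\<bar>) < \<epsilon>" if P: "?P n I (min d1 d2)" for n I
  proof -
    have 1: "(\<Sum>i<n. \<bar>f1 (snd (I i)) - f1 (fst (I i))\<bar>) < ?e"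
      by (rule d1(2)[THEN spec, THEN spec, THEN mp]) (use P in simp)
    have 2: "(\<Sum>i<n. \<bar>f2 (snd (I i)) - f2 (fst (I i))\<bar>) < ?e"
      by (rule d2(2)[THEN spec, THEN spec, THEN mp]) (use P in simp)
    have "(\<Sum>i<n. \<bar>h (snd (I i)) - h (fst (I i))\<bar>) \<le>
      (\<Sum>i<n. C' * (\<bar>f1 (snd (I i)) - f1 (fst (I i))\<bar> + \<bar>f2 (snd (I i)) - f2 (fst (I i))\<bar>))"
    proof (rule sum_mono)
      fix i assume "i \<in> {..<n}"
      then have "fst (I i) \<le> snd (I i)" "{fst (I i)..snd (I i)} \<subseteq> S" using P by blast+
      then have "snd (I i) \<in> S" "fst (I i) \<in> S" by auto
      from le[OF this] have "\<bar>h (snd (I i)) - h (fst (I i))\<bar> \<le> C * (\<bar>f1 (snd (I i)) - f1 (fst (I i))\<bar> + \<bar>f2 (snd (I i)) - f2 (fst (I i))\<bar>)" .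
      also have "\<dots> \<le> C' * (\<bar>f1 (snd (I i)) - f1 (fst (I i))\<bar> + \<bar>f2 (snd (I i)) - f2 (fst (I i))\<bar>)"
        by (rule mult_right_mono[OF C'(2)]) auto
      finally show "\<bar>h (snd (I i)) - h (fst (I i))\<bar> \<le> C' * (\<bar>f1 (snd (I i)) - f1 (fst (I i))\<bar> + \<bar>f2 (snd (I i)) - f2 (fst (I i))\<bar>)" .
    qed
    also have "\<dots> = C' * ((\<Sum>i<n. \<bar>f1 (snd (I i)) - f1 (fst (I i))\<bar>) + (\<Sum>i<n. \<bar>f2 (snd (I i)) - f2 (fst (I i))\<bar>))"
      by (simp add: sum_distrib_left sum.distrib distrib_left)
    also have "\<dots> < C' * (?e + ?e)"
      by (rule mult_strict_left_mono[OF _ C'(1)]) (use 1 2 in linarith)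
    also have "\<dots> = \<epsilon>" using C'(1) by (simp add: field_simps)
    finally show ?thesis .
  qed
  then show "\<exists>\<delta>>0. \<forall>n I. ?P n I \<delta> \<longrightarrow> (\<Sum>i<n. \<bar>h (snd (I i)) - h (fst (I i))\<bar>) < \<epsilon>"
    using d1(1) d2(1) by (intro exI[of _ "min d1 d2"]) simp
qed

lemma abs_cont_on_ident: "abs_cont_on S (\<lambda>x. x)"
  unfolding abs_cont_on_def
proof (intro allI impI exI[of _ "\<epsilon>::real" for \<epsilon>] conjI)
  fix \<epsilon> :: real and n :: nat and I :: "nat \<Rightarrow> real \<times> real"
  assume *: "(\<forall>i<n. fst (I i) \<le> snd (I i) \<and> {fst (I i)..snd (I i)} \<subseteq> S) \<and>
        (\<forall>i<n. \<forall>j<n. i \<noteq> j \<longrightarrow> {fst (I i)<..<snd (I i)} \<inter> {fst (I j)<..<snd (I j)} = {}) \<and>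
        (\<Sum>i<n. snd (I i) - fst (I i)) < \<epsilon>"
  have "(\<Sum>i<n. \<bar>snd (I i) - fst (I i)\<bar>) = (\<Sum>i<n. snd (I i) - fst (I i))"
    by (rule sum.cong) (use * in auto)
  with * show "(\<Sum>i<n. \<bar>snd (I i) - fst (I i)\<bar>) < \<epsilon>" by linarith
qed

lemma abs_cont_on_diff:
  assumes "abs_cont_on S f" "abs_cont_on S g"
  shows "abs_cont_on S (\<lambda>x. f x - g x)"
proof (rule abs_cont_on_dominated[OF assms, where C = 1])
  fix x y
  show "\<bar>f x - g x - (f y - g y)\<bar> \<le> 1 * (\<bar>f x - f y\<bar> + \<bar>g x - g y\<bar>)"
    using abs_triangle_ineq4[of "f x - f y" "g x - g y"] by (simp add: algebra_simps)
qed

lemma abs_cont_on_abs: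
  assumes "abs_cont_on S f"
  shows "abs_cont_on S (\<lambda>x. \<bar>f x\<bar>)"
proof (rule abs_cont_on_dominated[OF assms assms, where C = 1])
  fix x y
  show "\<bar>\<bar>f x\<bar> - \<bar>f y\<bar>\<bar> \<le> 1 * (\<bar>f x - f y\<bar> + \<bar>f x - f y\<bar>)"
    by (rule order_trans[OF abs_triangle_ineq3]) simp
qed

lemma abs_cont_on_max0:
  assumes "abs_cont_on S f"
  shows "abs_cont_on S (\<lambda>x. max (f x) 0)"
proof (rule abs_cont_on_dominated[OF assms assms, where C = 1])
  fix x y
  show "\<bar>max (f x) 0 - max (f y) 0\<bar> \<le> 1 * (\<bar>f x - f y\<bar> + \<bar>f x - f y\<bar>)"
    by (cases "0 \<le> f x"; cases "0 \<le> f y") (auto simp: max_def)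
qed

text \<open>Compactness of the interval bounds both factors, and the increment of the product is
  split as in the product rule.\<close>

lemma abs_cont_on_mult:
  assumes f: "abs_cont_on {a..b} f" and g: "abs_cont_on {a..b} g"
  shows "abs_cont_on {a..b} (\<lambda>x. f x * g x)"
proof -
  have "bounded (f ` {a..b})" "bounded (g ` {a..b})"
    using abs_cont_on_continuous[OF f] abs_cont_on_continuous[OF g]
    by (auto intro!: compact_imp_bounded compact_continuous_image)
  then obtain A B where A: "\<And>x. x \<in> {a..b} \<Longrightarrow> \<bar>f x\<bar> \<le> A" and B: "\<And>x. x \<in> {a..b} \<Longrightarrow> \<bar>g x\<bar> \<le> B"
    unfolding bounded_iff by fastforce
  show ?thesis
  proof (rule abs_cont_on_dominated[OF f g, of _ "max A B"])
    fix x y assume xy: "x \<in> {a..b}" "y \<in> {a..b}"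
    have "f x * g x - f y * g y = g x * (f x - f y) + f y * (g x - g y)" by (simp add: algebra_simps)
    then have "\<bar>f x * g x - f y * g y\<bar> \<le> \<bar>g x\<bar> * \<bar>f x - f y\<bar> + \<bar>f y\<bar> * \<bar>g x - g y\<bar>"
      by (simp add: abs_mult[symmetric])
    also have "\<dots> \<le> max A B * \<bar>f x - f y\<bar> + max A B * \<bar>g x - g y\<bar>"
      using A[OF xy(2)] B[OF xy(1)] by (intro add_mono mult_right_mono) auto
    finally show "\<bar>f x * g x - f y * g y\<bar> \<le> max A B * (\<bar>f x - f y\<bar> + \<bar>g x - g y\<bar>)"
      by (simp add: distrib_left)
  qed
qed

section \<open>Smooth test functions\<close>

text \<open>Smoothness is proved algebraically: by the sum and product rules, the polynomials in a
  generating set are stable under partial differentiation as soon as the partials of the generators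
  are such polynomials.\<close>

inductive_set function_algebra :: "('a \<Rightarrow> real) set \<Rightarrow> ('a \<Rightarrow> real) set" for G where
  generator: "g \<in> G \<Longrightarrow> g \<in> function_algebra G"
| const: "(\<lambda>x. c) \<in> function_algebra G"
| add: "f \<in> function_algebra G \<Longrightarrow> g \<in> function_algebra G \<Longrightarrow> (\<lambda>x. f x + g x) \<in> function_algebra G"
| mult: "f \<in> function_algebra G \<Longrightarrow> g \<in> function_algebra G \<Longrightarrow> (\<lambda>x. f x * g x) \<in> function_algebra G"

text \<open>\<open>D b\<close> must lie in \<open>A\<close> for every vector \<open>b\<close>, also
  outside \<open>Basis\<close>: \<open>Cinf_on\<close> quantifies over all lists of directions, and
  the iteration must never leave \<open>A\<close>.\<close>

definition partials_in :: "('a::euclidean_space \<Rightarrow> real) set \<Rightarrow> ('a \<Rightarrow> real) \<Rightarrow> bool" where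
  "partials_in A f \<longleftrightarrow> (\<exists>D. (\<forall>b. D b \<in> A) \<and>
     (\<forall>x. (f has_derivative (\<lambda>h. \<Sum>b\<in>Basis. (h \<bullet> b) * D b x)) (at x)))"

lemma partials_in_function_algebra:
  assumes f: "f \<in> function_algebra G" and G: "\<And>g. g \<in> G \<Longrightarrow> partials_in (function_algebra G) g"
  shows "partials_in (function_algebra G) f"
  using f
proof induction
  case (generator g)
  then show ?case by (rule G)
next
  case (const c)
  show ?case unfolding partials_in_def
    by (rule exI[of _ "\<lambda>b x. 0"]) (auto intro: function_algebra.const)
next
  case (add f g)
  obtain Df where Df: "\<forall>b. Df b \<in> function_algebra G" "\<forall>x. (f has_derivative (\<lambda>h. \<Sum>b\<in>Basis. (h \<bullet> b) * Df b x)) (at x)"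
    using add.IH(1) unfolding partials_in_def by blast
  obtain Dg where Dg: "\<forall>b. Dg b \<in> function_algebra G" "\<forall>x. (g has_derivative (\<lambda>h. \<Sum>b\<in>Basis. (h \<bullet> b) * Dg b x)) (at x)"
    using add.IH(2) unfolding partials_in_def by blast
  show ?case unfolding partials_in_def
  proof (rule exI[of _ "\<lambda>b x. Df b x + Dg b x"], intro conjI allI)
    show "(\<lambda>x. Df b x + Dg b x) \<in> function_algebra G" for b
      using Df(1) Dg(1) by (intro function_algebra.add) auto
    show "((\<lambda>x. f x + g x) has_derivative (\<lambda>h. \<Sum>b\<in>Basis. (h \<bullet> b) * (Df b x + Dg b x))) (at x)" for x
      using has_derivative_add[OF Df(2)[rule_format, of x] Dg(2)[rule_format, of x]]
      by (simp add: distrib_left sum.distrib)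
  qed
next
  case (mult f g)
  obtain Df where Df: "\<forall>b. Df b \<in> function_algebra G" "\<forall>x. (f has_derivative (\<lambda>h. \<Sum>b\<in>Basis. (h \<bullet> b) * Df b x)) (at x)"
    using mult.IH(1) unfolding partials_in_def by blast
  obtain Dg where Dg: "\<forall>b. Dg b \<in> function_algebra G" "\<forall>x. (g has_derivative (\<lambda>h. \<Sum>b\<in>Basis. (h \<bullet> b) * Dg b x)) (at x)"
    using mult.IH(2) unfolding partials_in_def by blast
  show ?case unfolding partials_in_def
  proof (rule exI[of _ "\<lambda>b x. f x * Dg b x + Df b x * g x"], intro conjI allI)
    show "(\<lambda>x. f x * Dg b x + Df b x * g x) \<in> function_algebra G" for b
      using Df(1) Dg(1) mult.hyps by (intro function_algebra.add function_algebra.mult) auto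
    have eq: "(\<Sum>b\<in>Basis. (h \<bullet> b) * (f x * Dg b x + Df b x * g x)) =
        f x * (\<Sum>b\<in>Basis. (h \<bullet> b) * Dg b x) + (\<Sum>b\<in>Basis. (h \<bullet> b) * Df b x) * g x" for h x
      by (simp add: sum_distrib_left sum_distrib_right sum.distrib algebra_simps)
    show "((\<lambda>x. f x * g x) has_derivative (\<lambda>h. \<Sum>b\<in>Basis. (h \<bullet> b) * (f x * Dg b x + Df b x * g x))) (at x)" for x
      unfolding eq by (rule has_derivative_mult[OF Df(2)[rule_format, of x] Dg(2)[rule_format, of x]])
  qed
qed

text \<open>A family of functions closed under partial derivatives consists of smooth functions, so
  a smoothness proof reduces to a single differentiation step for each generator.\<close>

lemma Cinf_on_partials_closed:
  assumes f: "f \<in> A" and A: "\<And>g. g \<in> A \<Longrightarrow> partials_in A g"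
  shows "Cinf_on UNIV f"
proof -
  have "\<forall>g. \<exists>D. g \<in> A \<longrightarrow> (\<forall>b. D b \<in> A) \<and> (\<forall>x. (g has_derivative (\<lambda>h. \<Sum>b\<in>Basis. (h \<bullet> b) * D b x)) (at x))"
    using A unfolding partials_in_def by blast
  from choice[OF this] obtain D where D': "\<forall>g. g \<in> A \<longrightarrow> (\<forall>b. D g b \<in> A) \<and>
      (\<forall>x. (g has_derivative (\<lambda>h. \<Sum>b\<in>Basis. (h \<bullet> b) * D g b x)) (at x))"
    by (elim exE)
  have D: "D g b \<in> A" "(g has_derivative (\<lambda>h. \<Sum>b\<in>Basis. (h \<bullet> b) * D g b x)) (at x)" if "g \<in> A" for g b x
    using D'[THEN spec, THEN mp, OF that] by simp_all
  \<comment> \<open>With \<open>foldr\<close>, \<open>F (b # ds)\<close> unfolds to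
    \<open>D (F ds) b\<close>, which is the coherence between successive partials that
    \<open>Cinf_on\<close> demands.\<close>
  define F where "F ds = foldr (\<lambda>b g. D g b) ds f" for ds
  have FA: "F ds \<in> A" for ds
    by (induction ds) (auto simp: F_def f D(1))
  have "continuous_on UNIV (F ds)" for ds
    unfolding continuous_on_eq_continuous_at[OF open_UNIV]
    using D(2)[OF FA[of ds]] has_derivative_continuous by blast
  moreover have "(F ds has_derivative (\<lambda>h. \<Sum>b\<in>Basis. (h \<bullet> b) *\<^sub>R F (b # ds) x)) (at x)" for ds x
    using D(2)[OF FA[of ds], of x] by (simp add: F_def)
  ultimately show ?thesis
    unfolding Cinf_on_def by (intro exI[of _ F]) (auto simp: F_def)
qed

lemma Cinf_on_function_algebra:
  assumes "f \<in> function_algebra G" "\<And>g. g \<in> G \<Longrightarrow> partials_in (function_algebra G) g"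
  shows "Cinf_on UNIV f"
  using Cinf_on_partials_closed[OF assms(1)] partials_in_function_algebra[OF _ assms(2)] by blast

lemma Cinf_on_UNIV_E:
  fixes f :: "'a::euclidean_space \<Rightarrow> real"
  assumes "Cinf_on UNIV f"
  shows "\<exists>F. F [] = f \<and> (\<forall>ds x. (F ds has_derivative (\<lambda>h. \<Sum>b\<in>Basis. (h \<bullet> b) * F (b # ds) x)) (at x)) \<and>
    (\<forall>ds. continuous_on UNIV (F ds))"
proof -
  from assms obtain F where F: "\<forall>x\<in>UNIV. F [] x = f x"
    "\<forall>ds. continuous_on UNIV (F ds) \<and> (\<forall>x\<in>UNIV. (F ds has_derivative (\<lambda>h. \<Sum>b\<in>Basis. (h \<bullet> b) *\<^sub>R F (b # ds) x)) (at x))"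
    unfolding Cinf_on_def by (elim exE conjE)
  show ?thesis
  proof (intro exI[of _ F] conjI allI)
    show "F [] = f" using F(1) by (simp add: fun_eq_iff)
    show "(F ds has_derivative (\<lambda>h. \<Sum>b\<in>Basis. (h \<bullet> b) * F (b # ds) x)) (at x)" for ds x
      using F(2)[THEN spec, THEN conjunct2, THEN bspec, of x ds] by simp
    show "continuous_on UNIV (F ds)" for ds using F(2) by blast
  qed
qed

text \<open>The generators are all iterated partials of both functions; each of them differentiates
  to further generators.\<close>

lemma Cinf_on_diff:
  fixes f g :: "'a::euclidean_space \<Rightarrow> real"
  assumes f: "Cinf_on UNIV f" and g: "Cinf_on UNIV g"
  shows "Cinf_on UNIV (\<lambda>x. f x - g x)"
proof -
  obtain F where F: "F [] = f" "\<And>ds x. (F ds has_derivative (\<lambda>h. \<Sum>b\<in>Basis. (h \<bullet> b) * F (b # ds) x)) (at x)"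
    using Cinf_on_UNIV_E[OF f] by blast
  obtain H where H: "H [] = g" "\<And>ds x. (H ds has_derivative (\<lambda>h. \<Sum>b\<in>Basis. (h \<bullet> b) * H (b # ds) x)) (at x)"
    using Cinf_on_UNIV_E[OF g] by blast
  let ?G = "range F \<union> range H"
  have "(\<lambda>x. f x + (-1) * g x) \<in> function_algebra ?G"
    using F(1) H(1) by (intro function_algebra.intros) auto
  moreover have "partials_in (function_algebra ?G) u" if "u \<in> ?G" for u
    using that
  proof
    assume "u \<in> range F"
    then obtain ds where "u = F ds" by blast
    then show ?thesis unfolding partials_in_def
      using F(2) by (intro exI[of _ "\<lambda>b. F (b # ds)"]) (auto intro: function_algebra.generator)
  next
    assume "u \<in> range H"
    then obtain ds where "u = H ds" by blast
    then show ?thesis unfolding partials_in_def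
      using H(2) by (intro exI[of _ "\<lambda>b. H (b # ds)"]) (auto intro: function_algebra.generator)
  qed
  ultimately show ?thesis using Cinf_on_function_algebra[of "\<lambda>x. f x + (-1) * g x" ?G] by simp
qed

text \<open>Because the derivative of \<open>tanh\<close> is a polynomial in \<open>tanh\<close>, a
  single new generator suffices besides the iterated partials of \<open>f\<close>.\<close>

lemma Cinf_on_tanh:
  fixes f :: "'a::euclidean_space \<Rightarrow> real"
  assumes f: "Cinf_on UNIV f"
  shows "Cinf_on UNIV (\<lambda>x. tanh (n * f x))"
proof -
  obtain F where F: "F [] = f" "\<And>ds x. (F ds has_derivative (\<lambda>h. \<Sum>b\<in>Basis. (h \<bullet> b) * F (b # ds) x)) (at x)"
    using Cinf_on_UNIV_E[OF f] by blast
  let ?t = "\<lambda>x. tanh (n * f x)"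
  let ?G = "insert ?t (range F)"
  have t: "?t \<in> function_algebra ?G" by (rule function_algebra.generator) simp
  have "partials_in (function_algebra ?G) u" if "u \<in> ?G" for u
    using that
  proof
    assume u: "u = ?t"
    show ?thesis unfolding partials_in_def u
    proof (rule exI[of _ "\<lambda>b x. (1 + (-1) * (tanh (n * f x) * tanh (n * f x))) * (n * F [b] x)"], intro conjI allI)
      show "(\<lambda>x. (1 + (-1) * (tanh (n * f x) * tanh (n * f x))) * (n * F [b] x)) \<in> function_algebra ?G" for b
        by (intro function_algebra.mult[of "\<lambda>x. 1 + (-1) * (tanh (n * f x) * tanh (n * f x))"] function_algebra.add
            function_algebra.mult[of "\<lambda>x. n"] function_algebra.mult[of "\<lambda>x. -1"] function_algebra.mult[of ?t ?G ?t]
            function_algebra.const t function_algebra.generator) auto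
      fix x
      have eq: "(\<Sum>b\<in>Basis. (h \<bullet> b) * ((1 + (-1) * (tanh (n * f x) * tanh (n * f x))) * (n * F [b] x))) =
         (1 - (tanh (n * f x))\<^sup>2) * (n * (\<Sum>b\<in>Basis. (h \<bullet> b) * F [b] x))" for h
        by (simp add: sum_distrib_left power2_eq_square algebra_simps)
      have "((\<lambda>x. n * f x) has_derivative (\<lambda>h. n * (\<Sum>b\<in>Basis. (h \<bullet> b) * F [b] x))) (at x)"
        using has_derivative_mult_right[OF F(2)[of "[]" x], of n] by (simp add: F(1))
      moreover have "(tanh has_derivative (*) (1 - (tanh (n * f x))\<^sup>2)) (at (n * f x))"
        unfolding has_field_derivative_def[symmetric] by (auto intro!: derivative_eq_intros)
      ultimately have "(?t has_derivative (\<lambda>h. (1 - (tanh (n * f x))\<^sup>2) * (n * (\<Sum>b\<in>Basis. (h \<bullet> b) * F [b] x)))) (at x)"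
        by (rule has_derivative_compose)
      then show "(?t has_derivative (\<lambda>h. \<Sum>b\<in>Basis. (h \<bullet> b) * ((1 + (-1) * (tanh (n * f x) * tanh (n * f x))) * (n * F [b] x)))) (at x)"
        unfolding eq .
    qed
  next
    assume "u \<in> range F"
    then obtain ds where "u = F ds" by blast
    then show ?thesis unfolding partials_in_def
      using F(2) by (intro exI[of _ "\<lambda>b. F (b # ds)"]) (auto intro: function_algebra.generator)
  qed
  then show ?thesis by (rule Cinf_on_function_algebra[OF t])
qed

lemma sum_Basis_prod:
  fixes f :: "'a::euclidean_space \<times> 'b::euclidean_space \<Rightarrow> real"
  shows "sum f Basis = (\<Sum>i\<in>Basis. f (i, 0)) + (\<Sum>i\<in>Basis. f (0, i))"
proof -
  have "inj_on (\<lambda>u. (u::'a, 0::'b)) Basis" "inj_on (\<lambda>u. (0::'a, u::'b)) Basis"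
    by (auto intro!: inj_onI)
  moreover have "(\<lambda>u. (u::'a, 0::'b)) ` Basis \<inter> (\<lambda>u. (0::'a, u::'b)) ` Basis = {}"
    using nonzero_Basis by (auto simp: image_iff)
  ultimately show ?thesis
    unfolding Basis_prod_def by (subst sum.union_disjoint) (simp_all add: sum.reindex)
qed

text \<open>The generators are the iterated partials of the two factors, lifted to the product
  space; each lifted function has nonzero partials only along its own variable.\<close>

lemma Cinf_on_tensor:
  fixes f :: "'a::euclidean_space \<Rightarrow> real" and \<theta> :: "real \<Rightarrow> real"
  assumes f: "Cinf_on UNIV f" and \<theta>: "Cinf_on UNIV \<theta>"
  shows "Cinf_on UNIV (\<lambda>z. \<theta> (snd z) * f (fst z))"
proof -
  obtain F where F: "F [] = f" "\<And>ds x. (F ds has_derivative (\<lambda>h. \<Sum>b\<in>Basis. (h \<bullet> b) * F (b # ds) x)) (at x)"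
    using Cinf_on_UNIV_E[OF f] by blast
  obtain H where H: "H [] = \<theta>" "\<And>ds x. (H ds has_derivative (\<lambda>h. \<Sum>b\<in>Basis. (h \<bullet> b) * H (b # ds) x)) (at x)"
    using Cinf_on_UNIV_E[OF \<theta>] by blast
  let ?G = "(\<lambda>ds z. F ds (fst z)) ` UNIV \<union> (\<lambda>ds z. H ds (snd z)) ` UNIV :: ('a \<times> real \<Rightarrow> real) set"
  have 1: "(\<lambda>z. F ds (fst z)) \<in> function_algebra ?G" for ds by (rule function_algebra.generator) blast
  have 2: "(\<lambda>z. H ds (snd z)) \<in> function_algebra ?G" for ds by (rule function_algebra.generator) blast
  have "(\<lambda>z. \<theta> (snd z) * f (fst z)) \<in> function_algebra ?G"
    using 1[of "[]"] 2[of "[]"] by (intro function_algebra.mult) (simp_all add: F(1) H(1))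
  moreover have "partials_in (function_algebra ?G) u" if "u \<in> ?G" for u
    using that
  proof
    assume "u \<in> (\<lambda>ds z. F ds (fst z)) ` UNIV"
    then obtain ds where u: "u = (\<lambda>z. F ds (fst z))" by blast
    show ?thesis unfolding partials_in_def u
    \<comment> \<open>The basis of the product consists of vectors \<open>(i, 0)\<close> and
      \<open>(0, i)\<close>; the constant factor switches off the time direction.\<close>
    proof (rule exI[of _ "\<lambda>b z. (if snd b = 0 then 1 else 0) * F (fst b # ds) (fst z)"], intro conjI allI)
      show "(\<lambda>z. (if snd b = 0 then 1 else 0) * F (fst b # ds) (fst z)) \<in> function_algebra ?G" for b :: "'a \<times> real"
        by (intro function_algebra.mult[of "\<lambda>z. if snd b = 0 then 1 else 0"] function_algebra.const 1)
      fix z :: "'a \<times> real"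
      have eq: "(\<Sum>b\<in>Basis. (h \<bullet> b) * ((if snd b = 0 then 1 else 0) * F (fst b # ds) (fst z))) =
          (\<Sum>b\<in>Basis. (fst h \<bullet> b) * F (b # ds) (fst z))" for h :: "'a \<times> real"
        proof -
        have "b \<noteq> 0" if "b \<in> Basis" for b :: 'a using that nonzero_Basis by blast
        then show ?thesis by (cases h) (simp add: sum_Basis_prod)
      qed
      show "((\<lambda>z. F ds (fst z)) has_derivative (\<lambda>h. \<Sum>b\<in>Basis. (h \<bullet> b) * ((if snd b = 0 then 1 else 0) * F (fst b # ds) (fst z)))) (at z)"
        unfolding eq by (rule has_derivative_compose[OF has_derivative_fst[OF has_derivative_ident] F(2)])
    qed
  next
    assume "u \<in> (\<lambda>ds z. H ds (snd z)) ` UNIV"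
    then obtain ds where u: "u = (\<lambda>z. H ds (snd z))" by blast
    show ?thesis unfolding partials_in_def u
    proof (rule exI[of _ "\<lambda>b z. (if snd b = 0 then 0 else 1) * H (snd b # ds) (snd z)"], intro conjI allI)
      show "(\<lambda>z. (if snd b = 0 then 0 else 1) * H (snd b # ds) (snd z)) \<in> function_algebra ?G" for b :: "'a \<times> real"
        by (intro function_algebra.mult[of "\<lambda>z. if snd b = 0 then 0 else 1"] function_algebra.const 2)
      fix z :: "'a \<times> real"
      have eq: "(\<Sum>b\<in>Basis. (h \<bullet> b) * ((if snd b = 0 then 0 else 1) * H (snd b # ds) (snd z))) =
          (\<Sum>b\<in>Basis. (snd h \<bullet> b) * H (b # ds) (snd z))" for h :: "'a \<times> real"
        proof -
        have "b \<noteq> 0" if "b \<in> Basis" for b :: 'a using that nonzero_Basis by blast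
        then show ?thesis by (cases h) (simp add: sum_Basis_prod)
      qed
      show "((\<lambda>z. H ds (snd z)) has_derivative (\<lambda>h. \<Sum>b\<in>Basis. (h \<bullet> b) * ((if snd b = 0 then 0 else 1) * H (snd b # ds) (snd z)))) (at z)"
        unfolding eq by (rule has_derivative_compose[OF has_derivative_snd[OF has_derivative_ident] H(2)])
    qed
  qed
  ultimately show ?thesis by (rule Cinf_on_function_algebra)
qed

section \<open>Flat functions and smooth cut-offs of intervals\<close>

text \<open>The classical flat function exp(-1/t) times inverse powers of \<open>t\<close>. Such
  powers arise on differentiation, so the family over all \<open>k\<close> is closed under
  derivatives up to linear combinations.\<close>

definition flat :: "nat \<Rightarrow> real \<Rightarrow> real" where
  "flat k t = (if t > 0 then (1 / t) ^ k * exp (- (1 / t)) else 0)"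

lemma flat_tendsto_0: "((\<lambda>t. (1 / t) ^ k * exp (- (1 / t))) \<longlongrightarrow> 0) (at_right (0::real))"
proof -
  have "((\<lambda>s::real. s ^ k / exp s) \<longlongrightarrow> 0) at_top" by (rule tendsto_power_div_exp_0)
  from filterlim_compose[OF this filterlim_inverse_at_top_right]
  show ?thesis by (simp add: exp_minus divide_inverse)
qed

text \<open>Away from 0 this is a computation. At 0 the difference quotient of \<open>flat k\<close>
  is \<open>flat (Suc k)\<close>, which tends to 0 from the right and vanishes on the left.\<close>

lemma flat_derivative: "(flat k has_real_derivative - real k * flat (Suc k) t + flat (Suc (Suc k)) t) (at t)"
proof (cases t "0::real" rule: linorder_cases)
  case less
  have "((\<lambda>_. 0) has_real_derivative 0) (at t)" by simp
  then have "(flat k has_real_derivative 0) (at t)"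
    by (rule has_field_derivative_transform_within_open[where S = "{..<0}"]) (use less in \<open>auto simp: flat_def\<close>)
  then show ?thesis using less by (simp add: flat_def)
next
  case greater
  have "((\<lambda>t. (1 / t) ^ k * exp (- (1 / t))) has_real_derivative
      (1/t)^k * (exp (- (1/t)) * (1/t\<^sup>2)) + (real k * (1/t)^(k - 1) * (- (1/t\<^sup>2))) * exp (- (1/t))) (at t)"
    using greater by (auto intro!: derivative_eq_intros simp: power2_eq_square)
  moreover have "(1/t)^k * (exp (- (1/t)) * (1/t\<^sup>2)) + (real k * (1/t)^(k - 1) * (- (1/t\<^sup>2))) * exp (- (1/t))
    = - real k * flat (Suc k) t + flat (Suc (Suc k)) t"
    using greater by (cases k) (simp_all add: flat_def power2_eq_square field_simps)
  ultimately have "((\<lambda>t. (1 / t) ^ k * exp (- (1 / t))) has_real_derivative - real k * flat (Suc k) t + flat (Suc (Suc k)) t) (at t)"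
    by simp
  then show ?thesis
    by (rule has_field_derivative_transform_within_open[where S = "{0<..}"]) (use greater in \<open>auto simp: flat_def\<close>)
next
  case equal
  have "((\<lambda>y. (flat k y - flat k 0) / (y - 0)) \<longlongrightarrow> 0) (at 0)"
  proof (rule filterlim_split_at_real)
    have "((\<lambda>y. 0::real) \<longlongrightarrow> 0) (at_left 0)" by simp
    then show "((\<lambda>y. (flat k y - flat k 0) / (y - 0)) \<longlongrightarrow> 0) (at_left 0)"
      by (rule Lim_transform_eventually) (auto simp: eventually_at_filter flat_def)
    show "((\<lambda>y. (flat k y - flat k 0) / (y - 0)) \<longlongrightarrow> 0) (at_right 0)"
      by (rule Lim_transform_eventually[OF flat_tendsto_0[of "Suc k"]])
         (auto simp: eventually_at_filter flat_def)
  qed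
  then show ?thesis using equal by (simp add: has_field_derivative_iff flat_def)
qed

text \<open>A smooth approximation from below of the indicator of the open interval from
  \<open>a\<close> to \<open>b\<close>, sharper as \<open>n\<close> grows. The arguments have the
  form \<open>m * t + c\<close> so as to match the generators used for its smoothness.\<close>

definition bump :: "real \<Rightarrow> real \<Rightarrow> nat \<Rightarrow> real \<Rightarrow> real" where
  "bump a b n t = flat 0 (real n * t + - real n * a) * flat 0 (- real n * t + real n * b)"

lemma Cinf_on_bump: "Cinf_on UNIV (bump a b n)"
proof -
  let ?f = "\<lambda>m c k (t::real). flat k (m * t + c)"
  \<comment> \<open>All affine rescalings of all flat functions: the chain rule contributes only the
    constant \<open>m\<close> and larger values of \<open>k\<close>.\<close>
  let ?G = "{?f m c k | m c k. True}"
  have G: "?f m c k \<in> function_algebra ?G" for m c k by (rule function_algebra.generator) blast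
  have "bump a b n \<in> function_algebra ?G"
    using function_algebra.mult[OF G G] unfolding bump_def[abs_def] .
  then show ?thesis
  proof (rule Cinf_on_function_algebra)
    fix g assume "g \<in> ?G"
    then obtain m c k where g: "g = ?f m c k" by blast
    let ?D = "\<lambda>t. m * (- real k * flat (Suc k) (m * t + c) + flat (Suc (Suc k)) (m * t + c))"
    show "partials_in (function_algebra ?G) g"
      unfolding partials_in_def g
    proof (rule exI[of _ "\<lambda>b. ?D"], intro conjI allI)
      show "?D \<in> function_algebra ?G"
        by (intro function_algebra.mult[of "\<lambda>_. m"] function_algebra.mult[of "\<lambda>_. - real k"] function_algebra.add function_algebra.const G)
      fix t
      have "((\<lambda>t. m * t + c) has_real_derivative m) (at t)" by (auto intro!: derivative_eq_intros)
      from DERIV_chain2[OF flat_derivative this]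
      have "(?f m c k has_real_derivative ?D t) (at t)" by (simp add: mult.commute)
      then show "(?f m c k has_derivative (\<lambda>h. \<Sum>b\<in>Basis. (h \<bullet> b) * ?D t)) (at t)"
        by (simp add: has_field_derivative_def mult_commute_abs)
    qed
  qed
qed

lemma flat0_bounds: "0 \<le> flat 0 t" "flat 0 t \<le> 1"
  by (auto simp: flat_def)

lemma bump_bounds: "0 \<le> bump a b n t" "bump a b n t \<le> 1"
  unfolding bump_def by (intro mult_nonneg_nonneg mult_le_one flat0_bounds)+

lemma bump_eq_0: "t \<notin> {a<..<b} \<Longrightarrow> bump a b n t = 0"
proof -
  assume "t \<notin> {a<..<b}"
  then consider "t \<le> a" | "b \<le> t" by (auto simp: not_less)
  then show ?thesis
  proof cases
    case 1
    then have "real n * (t - a) \<le> 0" by (intro mult_nonneg_nonpos) auto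
    then have "real n * t + - real n * a \<le> 0" by (simp add: right_diff_distrib)
    then have "flat 0 (real n * t + - real n * a) = 0" unfolding flat_def by (simp only: not_less[symmetric] if_False)
    then show ?thesis unfolding bump_def by simp
  next
    case 2
    then have "real n * (b - t) \<le> 0" by (intro mult_nonneg_nonpos) auto
    then have "- real n * t + real n * b \<le> 0" by (simp add: right_diff_distrib)
    then have "flat 0 (- real n * t + real n * b) = 0" unfolding flat_def by (simp only: not_less[symmetric] if_False)
    then show ?thesis unfolding bump_def by simp
  qed
qed

text \<open>Inside the interval both arguments of \<open>flat 0\<close> grow linearly in
  \<open>n\<close>, so the exponentials tend to 1; outside, the bump vanishes for every
  \<open>n\<close>.\<close>

lemma bump_tendsto: "(\<lambda>n. bump a b n t) \<longlonglongrightarrow> indicator {a<..<b} t"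
proof (cases "t \<in> {a<..<b}")
  case True
  have *: "(\<lambda>n. flat 0 (real n * c)) \<longlonglongrightarrow> 1" if "c > 0" for c
  proof -
    have "(\<lambda>n. exp (- ((1 / c) * (1 / real n)))) \<longlonglongrightarrow> exp (- ((1/c) * 0))"
      by (intro tendsto_intros lim_1_over_n)
    then have "(\<lambda>n. exp (- ((1 / c) * (1 / real n)))) \<longlonglongrightarrow> 1" by simp
    then show ?thesis
      by (rule Lim_transform_eventually)
         (use eventually_gt_at_top[of 0] in \<open>eventually_elim, use that in \<open>auto simp: flat_def mult.commute\<close>\<close>)
  qed
  have "(\<lambda>n. flat 0 (real n * (t - a)) * flat 0 (real n * (b - t))) \<longlonglongrightarrow> 1 * 1"
    by (intro tendsto_mult *) (use True in auto)
  then show ?thesis using True by (simp add: bump_def algebra_simps)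
next
  case False
  then show ?thesis by (simp add: bump_eq_0)
qed

section \<open>Uniform separability\<close>

text \<open>The approximants must come from \<open>E\<close> itself, so that they are again of the
  prescribed kind. Functions are sorted into countably many classes by approximate values on a
  finite net and a modulus of continuity, and one member of each nonempty class is selected.\<close>

lemma countable_uniformly_dense:
  fixes E :: "('a::metric_space \<Rightarrow> 'b::{metric_space,second_countable_topology}) set"
  assumes K: "compact K" and E: "\<And>f. f \<in> E \<Longrightarrow> continuous_on K f"
  shows "\<exists>C. countable C \<and> C \<subseteq> E \<and> (\<forall>f\<in>E. \<forall>e>0. \<exists>g\<in>C. \<forall>x\<in>K. dist (f x) (g x) < e)"
proof -
  obtain S :: "'b set" where S: "countable S" "\<forall>X. open X \<longrightarrow> X \<noteq> {} \<longrightarrow> (\<exists>d\<in>S. d \<in> X)"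
    using countable_dense_exists[where 'a = 'b] by (elim exE conjE)
  define r where "r n = 1 / real (Suc n)" for n
  have r: "r n > 0" for n by (simp add: r_def)
  have "\<exists>ps. set ps \<subseteq> K \<and> K \<subseteq> (\<Union>p\<in>set ps. ball p (r n))" for n
  proof -
    have "\<forall>e>0. \<exists>k. finite k \<and> k \<subseteq> K \<and> K \<subseteq> (\<Union>x\<in>k. ball x e)"
      using K by (intro seq_compact_imp_totally_bounded compact_imp_seq_compact)
    from this[THEN spec, THEN mp, OF r[of n]]
    obtain k where k: "finite k" "k \<subseteq> K" "K \<subseteq> (\<Union>x\<in>k. ball x (r n))" by (elim exE conjE)
    obtain l where "set l = k" using finite_list[OF k(1)] by blast
    then show ?thesis using k(2,3) by (intro exI[of _ l]) simp
  qed
  then have "\<exists>ps. \<forall>n. set (ps n) \<subseteq> K \<and> K \<subseteq> (\<Union>p\<in>set (ps n). ball p (r n))" by (intro choice allI)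
  then obtain ps where "\<forall>n. set (ps n) \<subseteq> K \<and> K \<subseteq> (\<Union>p\<in>set (ps n). ball p (r n))" by (elim exE)
  then have ps: "\<And>n. set (ps n) \<subseteq> K" "\<And>n. K \<subseteq> (\<Union>p\<in>set (ps n). ball p (r n))" by simp_all
  \<comment> \<open>In a code \<open>(n, m, qs)\<close>, \<open>n\<close> fixes the net and the
    scale of the modulus, \<open>m\<close> the accuracy, and \<open>qs\<close> the approximate
    values on the net.\<close>
  define R where "R = (\<lambda>(n, m, qs). {f\<in>E. length qs = length (ps n) \<and> (\<forall>i<length qs. dist (f (ps n ! i)) (qs ! i) < r m) \<and>
     (\<forall>x\<in>K. \<forall>y\<in>K. dist x y < r n \<longrightarrow> dist (f x) (f y) < r m)})"
  define I where "I = {c \<in> UNIV \<times> UNIV \<times> lists S. R c \<noteq> {}}"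
  define C where "C = (\<lambda>c. SOME f. f \<in> R c) ` I"
  have some: "(SOME f. f \<in> R c) \<in> R c" if "c \<in> I" for c
  proof -
    have "\<exists>f. f \<in> R c" using that by (auto simp: I_def)
    then show ?thesis by (rule someI_ex)
  qed
  have "countable (UNIV \<times> UNIV \<times> lists S :: (nat \<times> nat \<times> 'b list) set)"
    using S(1) by (intro countable_SIGMA countable_lists) auto
  then have "countable I" by (rule countable_subset[rotated]) (auto simp: I_def)
  then have "countable C" by (simp add: C_def)
  moreover have "C \<subseteq> E"
  proof
    fix g assume "g \<in> C"
    then obtain c where "c \<in> I" "g = (SOME f. f \<in> R c)" by (auto simp: C_def)
    then have "g \<in> R c" using some by simp
    then show "g \<in> E" by (cases c) (simp add: R_def)
  qed
  moreover have "\<exists>g\<in>C. \<forall>x\<in>K. dist (f x) (g x) < e" if f: "f \<in> E" and e: "0 < e" for f e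
  proof -
    \<comment> \<open>Two members of one class differ by at most four errors: two from the modulus
      of continuity and two from the comparison with the common value \<open>q p\<close>.\<close>
    obtain m where m: "4 * r m < e"
    proof -
      obtain m where "inverse (real (Suc m)) < e / 4" using reals_Archimedean[of "e/4"] e by auto
      then show ?thesis using that[of m] by (simp add: r_def inverse_eq_divide)
    qed
    have "uniformly_continuous_on K f" using K E[OF f] compact_uniformly_continuous by blast
    then obtain d where d: "d > 0" "\<And>x y. x \<in> K \<Longrightarrow> y \<in> K \<Longrightarrow> dist x y < d \<Longrightarrow> dist (f x) (f y) < r m"
      unfolding uniformly_continuous_on_def using r[of m] by (metis dist_commute)
    obtain n where "inverse (real (Suc n)) < d" using reals_Archimedean[OF d(1)] by auto
    then have n: "r n < d" by (simp add: r_def inverse_eq_divide)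
    have "\<exists>q\<in>S. dist (f p) q < r m" for p
      using S(2)[THEN spec, of "ball (f p) (r m)"] r[of m] by (auto simp: mem_ball)
    then obtain q where q: "\<And>p. q p \<in> S" "\<And>p. dist (f p) (q p) < r m" by metis
    let ?c = "(n, m, map q (ps n))"
    have fR: "f \<in> R ?c" unfolding R_def using f q(2) d(2) n by auto
    have cI: "?c \<in> I" unfolding I_def using fR q(1) by auto
    define g where "g = (SOME f. f \<in> R ?c)"
    have gR: "g \<in> R ?c" unfolding g_def by (rule some[OF cI])
    have "dist (f x) (g x) < e" if x: "x \<in> K" for x
    proof -
      obtain p where "p \<in> set (ps n)" and px: "dist p x < r n" using ps(2)[of n] x by (auto simp: mem_ball)
      then obtain i where i: "i < length (ps n)" "p = ps n ! i" by (auto simp: in_set_conv_nth)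
      have pK: "p \<in> K" using ps(1)[of n] \<open>p \<in> set (ps n)\<close> by blast
      have "dist (g p) (q p) < r m" using gR i by (auto simp: R_def)
      moreover have "dist (g p) (g x) < r m" using gR pK x px by (auto simp: R_def)
      moreover have "dist (f p) (f x) < r m" using fR pK x px by (auto simp: R_def)
      ultimately have "dist (f x) (f p) + (dist (f p) (q p) + (dist (q p) (g p) + dist (g p) (g x))) < 4 * r m"
        using q(2)[of p] by (simp add: dist_commute)
      moreover have "dist (f x) (g x) \<le> dist (f x) (f p) + (dist (f p) (q p) + (dist (q p) (g p) + dist (g p) (g x)))"
        by (meson add_left_mono dist_triangle order_trans)
      ultimately show ?thesis using m by linarith
    qed
    then show ?thesis using cI by (auto simp: C_def g_def)
  qed
  ultimately show ?thesis by blast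
qed

section \<open>Gradients and supports of test functions\<close>

lemma grad_eq:
  assumes "(\<phi> has_derivative (\<lambda>h. \<Sum>b\<in>Basis. (h \<bullet> b) * D b)) (at x)"
  shows "grad \<phi> x = (\<Sum>b\<in>Basis. D b *\<^sub>R b)"
proof -
  have "frechet_derivative \<phi> (at x) = (\<lambda>h. \<Sum>b\<in>Basis. (h \<bullet> b) * D b)"
    using frechet_derivative_at[OF assms] by simp
  moreover have "(\<Sum>b\<in>Basis. (b' \<bullet> b) * D b) = D b'" if "b' \<in> Basis" for b'
    using that by (simp add: inner_Basis if_distrib[of "\<lambda>x. x * D _"] cong: if_cong)
  ultimately show ?thesis unfolding grad_def by (intro sum.cong) auto
qed

lemma Cinf_on_grad:
  fixes \<phi> :: "'a::euclidean_space \<Rightarrow> real"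
  assumes "Cinf_on UNIV \<phi>"
  shows "(\<phi> has_derivative (\<lambda>h. h \<bullet> grad \<phi> x)) (at x)" "continuous_on UNIV (grad \<phi>)" "continuous_on UNIV \<phi>"
proof -
  obtain F where F: "F [] = \<phi>" "\<And>ds x. (F ds has_derivative (\<lambda>h. \<Sum>b\<in>Basis. (h \<bullet> b) * F (b # ds) x)) (at x)"
    "\<And>ds. continuous_on UNIV (F ds)"
    using Cinf_on_UNIV_E[OF assms] by blast
  have d: "(\<phi> has_derivative (\<lambda>h. \<Sum>b\<in>Basis. (h \<bullet> b) * F [b] x)) (at x)" for x
    using F(2)[of "[]" x] by (simp add: F(1))
  have g: "grad \<phi> x = (\<Sum>b\<in>Basis. F [b] x *\<^sub>R b)" for x by (rule grad_eq[OF d])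
  have "(\<Sum>b\<in>Basis. (h \<bullet> b) * F [b] x) = h \<bullet> grad \<phi> x" for h
    unfolding g by (simp add: inner_sum_right mult.commute)
  then show "(\<phi> has_derivative (\<lambda>h. h \<bullet> grad \<phi> x)) (at x)" using d[of x] by simp
  show "continuous_on UNIV (grad \<phi>)"
    unfolding g[abs_def] by (intro continuous_intros F(3))
  show "continuous_on UNIV \<phi>" using F(3)[of "[]"] F(1) by simp
qed

lemma frechet_derivative_eq_grad:
  fixes \<phi> :: "'a::euclidean_space \<Rightarrow> real"
  assumes "Cinf_on UNIV \<phi>"
  shows "frechet_derivative \<phi> (at x) b = b \<bullet> grad \<phi> x"
  using frechet_derivative_at[OF Cinf_on_grad(1)[OF assms, of x]] by metis

lemma grad_unique:
  assumes "(\<phi> has_derivative (\<lambda>h. h \<bullet> v)) (at x)"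
  shows "grad \<phi> x = v"
proof -
  have "frechet_derivative \<phi> (at x) = (\<lambda>h. h \<bullet> v)" using frechet_derivative_at[OF assms] by simp
  then show ?thesis unfolding grad_def by (simp add: inner_commute[of _ v] euclidean_representation)
qed

lemma notin_fsupp: "x \<notin> fsupp \<phi> \<Longrightarrow> \<phi> x = 0"
  unfolding fsupp_def using closure_subset[of "{x. \<phi> x \<noteq> 0}"] by blast

lemma grad_notin_fsupp:
  fixes \<phi> :: "'a::euclidean_space \<Rightarrow> real"
  assumes "x \<notin> fsupp \<phi>"
  shows "grad \<phi> x = 0"
proof (rule grad_unique)
  have "((\<lambda>_. 0) has_derivative (\<lambda>h. h \<bullet> (0::'a))) (at x)" by simp
  moreover have "open (- fsupp \<phi>)" by (simp add: fsupp_def open_Compl)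
  moreover have "x \<in> - fsupp \<phi>" using assms by simp
  ultimately show "(\<phi> has_derivative (\<lambda>h. h \<bullet> 0)) (at x)"
    by (rule has_derivative_transform_within_open) (simp add: notin_fsupp)
qed

lemma compact_fsupp_subset:
  assumes "compact (fsupp \<phi>)" "\<And>x. \<phi> x = 0 \<Longrightarrow> \<psi> x = 0"
  shows "compact (fsupp \<psi>)" "fsupp \<psi> \<subseteq> fsupp \<phi>"
proof -
  show *: "fsupp \<psi> \<subseteq> fsupp \<phi>" unfolding fsupp_def by (rule closure_mono) (use assms(2) in auto)
  have "closed (fsupp \<psi>)" by (simp add: fsupp_def)
  from closed_Int_compact[OF this assms(1)] show "compact (fsupp \<psi>)"
    using * by (simp only: Int_absorb2)
qed

lemma test_fun_tanh: "test_fun U \<phi> \<Longrightarrow> test_fun U (\<lambda>x. tanh (n * \<phi> x))"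
  unfolding test_fun_def using compact_fsupp_subset[of \<phi> "\<lambda>x. tanh (n * \<phi> x)"] Cinf_on_tanh[of \<phi> n]
  by (metis (no_types, lifting) mult_zero_right order_trans tanh_0)

lemma test_fun_diff:
  fixes \<phi> \<psi> :: "'a::euclidean_space \<Rightarrow> real"
  assumes \<phi>: "test_fun U \<phi>" and \<psi>: "test_fun U \<psi>"
  shows "test_fun U (\<lambda>x. \<phi> x - \<psi> x)"
proof -
  have sub: "fsupp (\<lambda>x. \<phi> x - \<psi> x) \<subseteq> fsupp \<phi> \<union> fsupp \<psi>"
  proof -
    have "{x. \<phi> x - \<psi> x \<noteq> 0} \<subseteq> {x. \<phi> x \<noteq> 0} \<union> {x. \<psi> x \<noteq> 0}" by auto
    from closure_mono[OF this] show ?thesis by (simp only: fsupp_def closure_Un)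
  qed
  have c: "compact (fsupp \<phi> \<union> fsupp \<psi>)" using \<phi> \<psi> unfolding test_fun_def by (intro compact_Un) blast+
  have "closed (fsupp (\<lambda>x. \<phi> x - \<psi> x))" by (simp add: fsupp_def)
  from closed_Int_compact[OF this c] have "compact (fsupp (\<lambda>x. \<phi> x - \<psi> x))"
    using sub by (simp only: Int_absorb2)
  then show ?thesis using sub \<phi> \<psi> Cinf_on_diff unfolding test_fun_def by blast
qed

text \<open>The distributional equation for \<open>w\<close> is exploited through these products
  alone; the closed interval has to lie inside \<open>I\<close> because it contains the time
  support.\<close>

lemma test_fun_bump:
  fixes \<zeta> :: "'a::euclidean_space \<Rightarrow> real"
  assumes \<zeta>: "test_fun U \<zeta>" and "{a..b} \<subseteq> I"
  shows "test_fun (U \<times> I) (\<lambda>z. bump a b n (snd z) * \<zeta> (fst z))"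
proof -
  let ?\<psi> = "\<lambda>z. bump a b n (snd z) * \<zeta> (fst z)"
  have "closed (fsupp \<zeta> \<times> {a..b})" using \<zeta> by (intro closed_Times) (auto simp: fsupp_def)
  then have sub: "fsupp ?\<psi> \<subseteq> fsupp \<zeta> \<times> {a..b}"
    unfolding fsupp_def[of ?\<psi>]
  proof (intro closure_minimal subsetI)
    fix z assume "z \<in> {z. ?\<psi> z \<noteq> 0}"
    then have "bump a b n (snd z) \<noteq> 0" "\<zeta> (fst z) \<noteq> 0" by auto
    then have "snd z \<in> {a<..<b}" "fst z \<in> fsupp \<zeta>" using bump_eq_0[of "snd z" a b n] notin_fsupp[of "fst z" \<zeta>] by blast+
    then show "z \<in> fsupp \<zeta> \<times> {a..b}" by (auto simp: mem_Times_iff)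
  qed
  have c: "compact (fsupp \<zeta> \<times> {a..b})" using \<zeta> by (intro compact_Times) (auto simp: test_fun_def)
  have "closed (fsupp ?\<psi>)" by (simp add: fsupp_def)
  from closed_Int_compact[OF this c] have "compact (fsupp ?\<psi>)" using sub by (simp only: Int_absorb2)
  moreover have "fsupp ?\<psi> \<subseteq> U \<times> I" using sub \<zeta> assms(2) unfolding test_fun_def by blast
  moreover have "Cinf_on UNIV ?\<psi>" using Cinf_on_tensor[OF _ Cinf_on_bump] \<zeta> unfolding test_fun_def by blast
  ultimately show ?thesis unfolding test_fun_def by blast
qed

lemma bump_derivative: "(bump a b n has_real_derivative grad (bump a b n) t) (at t)"
  using Cinf_on_grad(1)[OF Cinf_on_bump, of a b n t]
  by (simp add: has_field_derivative_def mult_commute_abs)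

lemma tensor_derivatives:
  fixes \<zeta> :: "'a::euclidean_space \<Rightarrow> real"
  assumes \<zeta>: "Cinf_on UNIV \<zeta>"
  shows "grad_x (\<lambda>z. bump a b n (snd z) * \<zeta> (fst z)) z = bump a b n (snd z) *\<^sub>R grad \<zeta> (fst z)"
    "d_t (\<lambda>z. bump a b n (snd z) * \<zeta> (fst z)) z = grad (bump a b n) (snd z) * \<zeta> (fst z)"
proof -
  let ?\<psi> = "\<lambda>z::'a \<times> real. bump a b n (snd z) * \<zeta> (fst z)"
  have 1: "((\<lambda>z::'a \<times> real. bump a b n (snd z)) has_derivative (\<lambda>h. snd h \<bullet> grad (bump a b n) (snd z))) (at z)"
    by (rule has_derivative_compose[OF has_derivative_snd[OF has_derivative_ident] Cinf_on_grad(1)[OF Cinf_on_bump]])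
  have 2: "((\<lambda>z::'a \<times> real. \<zeta> (fst z)) has_derivative (\<lambda>h. fst h \<bullet> grad \<zeta> (fst z))) (at z)"
    by (rule has_derivative_compose[OF has_derivative_fst[OF has_derivative_ident] Cinf_on_grad(1)[OF \<zeta>]])
  have fd: "frechet_derivative ?\<psi> (at z) =
      (\<lambda>h. bump a b n (snd z) * (fst h \<bullet> grad \<zeta> (fst z)) + (snd h \<bullet> grad (bump a b n) (snd z)) * \<zeta> (fst z))"
    using frechet_derivative_at[OF has_derivative_mult[OF 1 2]] by simp
  show "grad_x ?\<psi> z = bump a b n (snd z) *\<^sub>R grad \<zeta> (fst z)"
    unfolding grad_x_def fd
    by (simp add: scaleR_scaleR[symmetric] scaleR_right.sum[symmetric] inner_commute[of _ "grad \<zeta> (fst z)"] euclidean_representation del: scaleR_scaleR)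
  show "d_t ?\<psi> z = grad (bump a b n) (snd z) * \<zeta> (fst z)"
    unfolding d_t_def fd by simp
qed

section \<open>Lebesgue spaces and Sobolev functions\<close>

text \<open>The norm of a difference is at most twice the larger norm. The constant is crude, but
  one argument covers all nonnegative exponents.\<close>

lemma norm_diff_powr_le:
  fixes a b :: "'b::real_normed_vector"
  assumes "p \<ge> 0"
  shows "norm (a - b) powr p \<le> 2 powr p * (norm a powr p + norm b powr p)"
proof -
  have "norm (a - b) \<le> 2 * max (norm a) (norm b)"
    using norm_triangle_ineq4[of a b] by (auto simp: max_def)
  then have "norm (a - b) powr p \<le> (2 * max (norm a) (norm b)) powr p"
    using assms by (intro powr_mono2) auto
  also have "\<dots> = 2 powr p * max (norm a) (norm b) powr p" by (rule powr_mult)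
  also have "max (norm a) (norm b) powr p \<le> norm a powr p + norm b powr p"
    by (auto simp: max_def)
  finally show ?thesis by simp
qed

lemma Lp_diff:
  assumes f: "Lp p M f" and g: "Lp p M g" and "p \<ge> 0"
  shows "Lp p M (\<lambda>x. f x - g x)"
  unfolding Lp_def
proof
  have m: "f \<in> borel_measurable M" "g \<in> borel_measurable M" using f g by (auto simp: Lp_def)
  then show m': "(\<lambda>x. f x - g x) \<in> borel_measurable M" by simp
  have i: "integrable M (\<lambda>x. 2 powr p * (norm (f x) powr p + norm (g x) powr p))"
    using f g by (auto simp: Lp_def)
  show "integrable M (\<lambda>x. norm (f x - g x) powr p)"
  proof (rule Bochner_Integration.integrable_bound[OF i])
    show "(\<lambda>x. norm (f x - g x) powr p) \<in> borel_measurable M" using m' by measurable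
    show "AE x in M. norm (norm (f x - g x) powr p) \<le> norm (2 powr p * (norm (f x) powr p + norm (g x) powr p))"
      using norm_diff_powr_le[OF \<open>p \<ge> 0\<close>] by (intro AE_I2) (simp add: order_trans[OF _ abs_ge_self])
  qed
qed

lemma Lp_dominated:
  assumes g: "Lp p M g" and f: "f \<in> borel_measurable M" and "p \<ge> 0" "C \<ge> 0"
    and le: "AE x in M. norm (f x) \<le> C * norm (g x)"
  shows "Lp p M f"
  unfolding Lp_def
proof
  have i: "integrable M (\<lambda>x. C powr p * norm (g x) powr p)" using g by (auto simp: Lp_def)
  show "integrable M (\<lambda>x. norm (f x) powr p)"
  proof (rule Bochner_Integration.integrable_bound[OF i])
    show "(\<lambda>x. norm (f x) powr p) \<in> borel_measurable M" using f by measurable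
    show "AE x in M. norm (norm (f x) powr p) \<le> norm (C powr p * norm (g x) powr p)"
      using le
    proof eventually_elim
      case (elim x)
      have "norm (f x) powr p \<le> (C * norm (g x)) powr p" using elim \<open>p \<ge> 0\<close> by (intro powr_mono2) auto
      also have "\<dots> = C powr p * norm (g x) powr p" by (rule powr_mult)
      finally show ?case by simp
    qed
  qed
qed fact

lemma (in finite_measure) Lp_bounded:
  assumes f: "f \<in> borel_measurable M" and "AE x in M. norm (f x) \<le> C" "p \<ge> 0"
  shows "Lp p M f"
  unfolding Lp_def
proof
  show "integrable M (\<lambda>x. norm (f x) powr p)"
  proof (rule integrable_const_bound)
    show "(\<lambda>x. norm (f x) powr p) \<in> borel_measurable M" using f by measurable
    show "AE x in M. norm (norm (f x) powr p) \<le> C powr p"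
      using assms(2)
    proof eventually_elim
      case (elim x)
      then show ?case using \<open>p \<ge> 0\<close> powr_mono2[of p "norm (f x)" C] by simp
    qed
  qed
qed fact

text \<open>The power with exponent \<open>q\<close> is at most 1 where the norm is at most 1, and
  at most the power with exponent \<open>p\<close> elsewhere; constants are integrable.\<close>

lemma (in finite_measure) Lp_mono:
  assumes f: "Lp p M f" and "0 \<le> q" "q \<le> p"
  shows "Lp q M f"
  unfolding Lp_def
proof
  show m: "f \<in> borel_measurable M" using f by (simp add: Lp_def)
  have i: "integrable M (\<lambda>x. 1 + norm (f x) powr p)" using f by (auto simp: Lp_def)
  show "integrable M (\<lambda>x. norm (f x) powr q)"
  proof (rule Bochner_Integration.integrable_bound[OF i])
    show "(\<lambda>x. norm (f x) powr q) \<in> borel_measurable M" using m by measurable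
    show "AE x in M. norm (norm (f x) powr q) \<le> norm (1 + norm (f x) powr p)"
    proof (rule AE_I2)
      fix x
      have "norm (f x) powr q \<le> 1 + norm (f x) powr p"
      proof (cases "norm (f x) \<le> 1")
        case True
        then have "norm (f x) powr q \<le> 1 powr q" using \<open>0 \<le> q\<close> by (intro powr_mono2) auto
        then have "norm (f x) powr q \<le> 1" by simp
        then show ?thesis using powr_ge_zero[of "norm (f x)" p] by linarith
      next
        case False
        then have "norm (f x) powr q \<le> norm (f x) powr p" using \<open>q \<le> p\<close> by (intro powr_mono) auto
        then show ?thesis by simp
      qed
      then show "norm (norm (f x) powr q) \<le> norm (1 + norm (f x) powr p)" by simp
    qed
  qed
qed

lemma Lp_product_integrable:
  assumes f: "Lp p M f" and g: "Lp q M g" and pq: "p > 1" "q > 1" "1/p + 1/q = 1"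
  shows "integrable M (\<lambda>x. norm (f x) * norm (g x))"
proof -
  have i: "integrable M (\<lambda>x. norm (f x) powr p / p + norm (g x) powr q / q)" using f g by (auto simp: Lp_def)
  show ?thesis
  proof (rule Bochner_Integration.integrable_bound[OF i])
    have "f \<in> borel_measurable M" "g \<in> borel_measurable M" using f g by (auto simp: Lp_def)
    then show "(\<lambda>x. norm (f x) * norm (g x)) \<in> borel_measurable M" by measurable
    show "AE x in M. norm (norm (f x) * norm (g x)) \<le> norm (norm (f x) powr p / p + norm (g x) powr q / q)"
      using Youngs_inequality[OF pq] by (intro AE_I2) (simp add: order_trans[OF _ abs_ge_self])
  qed
qed

lemma Lp_inner_integrable:
  fixes f g :: "'a \<Rightarrow> 'b::euclidean_space"
  assumes f: "Lp p M f" and g: "Lp q M g" and pq: "p > 1" "q > 1" "1/p + 1/q = 1"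
  shows "integrable M (\<lambda>x. f x \<bullet> g x)"
proof (rule Bochner_Integration.integrable_bound[OF Lp_product_integrable[OF assms]])
  have "f \<in> borel_measurable M" "g \<in> borel_measurable M" using f g by (auto simp: Lp_def)
  then show "(\<lambda>x. f x \<bullet> g x) \<in> borel_measurable M" by measurable
  show "AE x in M. norm (f x \<bullet> g x) \<le> norm (norm (f x) * norm (g x))"
    using Cauchy_Schwarz_ineq2 by (intro AE_I2) simp
qed

lemma Lp_mult_integrable:
  fixes f g :: "'a \<Rightarrow> real"
  assumes f: "Lp p M f" and g: "Lp q M g" and pq: "p > 1" "q > 1" "1/p + 1/q = 1"
  shows "integrable M (\<lambda>x. f x * g x)"
  using Lp_inner_integrable[OF assms] by simp

text \<open>Young's inequality with a free weight \<open>e\<close> takes the place of Hoelder's: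
  first a small \<open>e\<close> makes the term with \<open>g\<close> small, then a large
  \<open>k\<close> makes the term with \<open>f k\<close> small.\<close>

lemma Lp_product_tendsto_0:
  assumes f: "\<And>k. Lp p M (f k)" and f0: "(\<lambda>k. \<integral>x. norm (f k x) powr p \<partial>M) \<longlonglongrightarrow> 0"
    and g: "Lp q M g" and pq: "p > 1" "q > 1" "1/p + 1/q = 1"
  shows "(\<lambda>k. \<integral>x. norm (f k x) * norm (g x) \<partial>M) \<longlonglongrightarrow> 0"
proof (rule LIMSEQ_I)
  fix r :: real assume "0 < r"
  define G where "G = (\<integral>x. norm (g x) powr q \<partial>M)"
  have "G \<ge> 0" unfolding G_def by simp
  have "((\<lambda>e. e powr q * G / q) \<longlongrightarrow> 0 powr q * G / q) (at_right 0)"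
    using pq by (intro tendsto_intros) (auto simp: eventually_at_filter)
  then have "((\<lambda>e. e powr q * G / q) \<longlongrightarrow> 0) (at_right 0)" by simp
  then have "eventually (\<lambda>e. e powr q * G / q < r / 2) (at_right 0)"
    using \<open>0 < r\<close> by (intro order_tendstoD) auto
  moreover have "eventually (\<lambda>e::real. 0 < e) (at_right 0)" by (simp add: eventually_at_filter)
  ultimately have "eventually (\<lambda>e. e powr q * G / q < r / 2 \<and> 0 < e) (at_right 0)" by eventually_elim simp
  then obtain e where e: "e powr q * G / q < r / 2" "0 < e"
    using eventually_happens[of _ "at_right (0::real)"] by (auto simp: trivial_limit_at_right_real)
  define F where "F k = (\<integral>x. norm (f k x) powr p \<partial>M)" for k
  have "(\<lambda>k. (1/e) powr p * F k / p) \<longlonglongrightarrow> (1/e) powr p * 0 / p"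
    using f0 pq unfolding F_def by (intro tendsto_intros) auto
  then have "eventually (\<lambda>k. (1/e) powr p * F k / p < r / 2) sequentially"
    using \<open>0 < r\<close> by (intro order_tendstoD) auto
  then obtain N where N: "\<And>k. k \<ge> N \<Longrightarrow> (1/e) powr p * F k / p < r / 2" unfolding eventually_sequentially by blast
  show "\<exists>no. \<forall>n\<ge>no. norm ((\<integral>x. norm (f n x) * norm (g x) \<partial>M) - 0) < r"
  proof (intro exI allI impI)
    fix k assume k: "N \<le> k"
    have i1: "integrable M (\<lambda>x. (1/e) powr p * norm (f k x) powr p / p)" "integrable M (\<lambda>x. e powr q * norm (g x) powr q / q)"
      using f[of k] g by (auto simp: Lp_def)
    have "(\<integral>x. norm (f k x) * norm (g x) \<partial>M) \<le> (\<integral>x. (1/e) powr p * norm (f k x) powr p / p + e powr q * norm (g x) powr q / q \<partial>M)"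
    proof (rule integral_mono)
      show "integrable M (\<lambda>x. norm (f k x) * norm (g x))" by (rule Lp_product_integrable[OF f g pq])
      show "integrable M (\<lambda>x. (1/e) powr p * norm (f k x) powr p / p + e powr q * norm (g x) powr q / q)"
        by (rule Bochner_Integration.integrable_add[OF i1])
      fix x
      have "norm (f k x) * norm (g x) = (1/e * norm (f k x)) * (e * norm (g x))" using e by simp
      also have "\<dots> \<le> (1/e * norm (f k x)) powr p / p + (e * norm (g x)) powr q / q"
        by (rule Youngs_inequality[OF pq]) (use e in auto)
      also have "\<dots> = (1/e) powr p * norm (f k x) powr p / p + e powr q * norm (g x) powr q / q"
        by (simp only: powr_mult)
      finally show "norm (f k x) * norm (g x) \<le> (1/e) powr p * norm (f k x) powr p / p + e powr q * norm (g x) powr q / q" .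
    qed
    also have "\<dots> = (1/e) powr p * F k / p + e powr q * G / q"
      using i1 by (subst Bochner_Integration.integral_add) (simp_all add: F_def G_def)
    also have "\<dots> < r" using N[OF k] e by linarith
    finally show "norm ((\<integral>x. norm (f k x) * norm (g x) \<partial>M) - 0) < r"
      by (simp add: integral_nonneg_AE)
  qed
qed

lemma set_integral_lebesgue_on:
  fixes f :: "'a::euclidean_space \<Rightarrow> 'b::{banach,second_countable_topology}"
  assumes "S \<in> sets lebesgue"
  shows "(LINT x:S|lebesgue. f x) = integral\<^sup>L (lebesgue_on S) f"
  using assms by (simp add: set_lebesgue_integral_def integral_restrict_space)

lemma finite_measure_lebesgue_on_bounded:
  fixes S :: "'a::euclidean_space set"
  assumes "S \<in> sets lebesgue" "bounded S"
  shows "finite_measure (lebesgue_on S)"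
  using assms by (intro finite_measure_lebesgue_on bounded_set_imp_lmeasurable)

section \<open>Integration by parts for test functions\<close>

text \<open>Translation invariance of Lebesgue measure makes every difference quotient of
  \<open>f\<close> integrate to 0, and dominated convergence passes to the derivative.\<close>

lemma integral_partial_derivative_eq_0:
  fixes f :: "'a::euclidean_space \<Rightarrow> real"
  assumes f: "\<And>x. (f has_derivative (\<lambda>h. h \<bullet> G x)) (at x)" and G: "continuous_on UNIV G"
    and K: "compact K" "\<And>x. x \<notin> K \<Longrightarrow> f x = 0" "\<And>x. x \<notin> K \<Longrightarrow> G x = 0" and b: "norm b = 1"
  shows "(\<integral>x. b \<bullet> G x \<partial>lborel) = 0"
proof -
  have cf: "continuous_on UNIV f"
    by (rule has_derivative_continuous_on[of UNIV f "\<lambda>x h. h \<bullet> G x"]) (simp add: f)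
  have "compact (G ` K)" using K(1) G by (intro compact_continuous_image) (auto intro: continuous_on_subset)
  then obtain B where "\<forall>y\<in>G ` K. norm y \<le> B" using compact_imp_bounded bounded_iff by blast
  then have B': "norm (G x) \<le> max B 0" for x using K(3)[of x] by (cases "x \<in> K") (auto simp: le_max_iff_disj)
  define C where "C = max B 0"
  have B: "norm (G x) \<le> C" for x unfolding C_def by (rule B')
  have "C \<ge> 0" by (simp add: C_def)
  have "\<exists>R. \<forall>x\<in>K. norm x \<le> R" using compact_imp_bounded[OF K(1)] by (simp only: bounded_iff)
  then obtain R where "\<forall>x\<in>K. norm x \<le> R" by (elim exE)
  then have R: "norm x \<le> R" if "x \<in> K" for x using that by simp
  define h where "h m = 1 / real (Suc m)" for m
  have h: "0 < h m" "h m \<le> 1" for m by (auto simp: h_def)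
  define s where "s m x = (f (x + h m *\<^sub>R b) - f x) / h m" for m x
  have fi: "integrable lborel f"
  proof -
    have "integrable lborel (\<lambda>x. indicator K x *\<^sub>R f x)"
      using borel_integrable_compact[OF K(1) continuous_on_subset[OF cf]] by simp
    moreover have "(\<lambda>x. indicator K x *\<^sub>R f x) = f" using K(2) by (auto simp: fun_eq_iff indicator_def)
    ultimately show ?thesis by simp
  qed
  have tr: "integrable lborel (\<lambda>x. f (x + c))" "(\<integral>x. f (x + c) \<partial>lborel) = integral\<^sup>L lborel f" for c
  proof -
    have d: "distr lborel borel ((+) c) = lborel" by (rule lborel_distr_plus)
    have fb: "f \<in> borel_measurable borel" using cf by (rule borel_measurable_continuous_onI)
    have "integrable (distr lborel borel ((+) c)) f" using fi d by simp
    then show "integrable lborel (\<lambda>x. f (x + c))" by (subst (asm) integrable_distr_eq) (auto simp: fb add.commute)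
    have "integral\<^sup>L lborel f = integral\<^sup>L (distr lborel borel ((+) c)) f" by (simp add: d)
    also have "\<dots> = (\<integral>x. f (x + c) \<partial>lborel)" by (subst integral_distr) (auto simp: fb add.commute)
    finally show "(\<integral>x. f (x + c) \<partial>lborel) = integral\<^sup>L lborel f" ..
  qed
  have s0: "(\<integral>x. s m x \<partial>lborel) = 0" for m
    unfolding s_def using tr fi by simp
  have "(\<lambda>m. \<integral>x. s m x \<partial>lborel) \<longlonglongrightarrow> (\<integral>x. b \<bullet> G x \<partial>lborel)"
  \<comment> \<open>\<open>C\<close> bounds the quotients by the mean value inequality. The steps
    are at most 1, so all quotients vanish outside the ball of radius \<open>R + 1\<close>.\<close>
  proof (rule integral_dominated_convergence[where w = "\<lambda>x. C * indicator (cball 0 (R + 1)) x"])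
    show "(\<lambda>x. b \<bullet> G x) \<in> borel_measurable lborel"
      using G by (auto intro!: borel_measurable_continuous_onI continuous_intros)
    show "s m \<in> borel_measurable lborel" for m
      unfolding s_def[abs_def] using cf
      by (auto intro!: borel_measurable_continuous_onI continuous_intros continuous_on_compose2[OF cf] simp: less_imp_neq[OF h(1), symmetric])
    show "integrable lborel (\<lambda>x. C * indicator (cball 0 (R + 1)) x)"
      using emeasure_bounded_finite[of "cball 0 (R + 1)"] by (intro integrable_mult_right integrable_real_indicator) auto
    show "AE x in lborel. (\<lambda>m. s m x) \<longlonglongrightarrow> b \<bullet> G x"
    proof (rule AE_I2)
      fix x
      have 1: "((\<lambda>r. x + r *\<^sub>R b) has_derivative (\<lambda>r. r *\<^sub>R b)) (at 0)" by (auto intro!: derivative_eq_intros)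
      have "(f has_derivative (\<lambda>h. h \<bullet> G x)) (at (x + 0 *\<^sub>R b))" using f[of x] by simp
      from has_derivative_compose[OF 1 this]
      have "((\<lambda>r. f (x + r *\<^sub>R b)) has_real_derivative (b \<bullet> G x)) (at 0)"
        by (simp add: has_field_derivative_def mult_commute_abs)
      then have "((\<lambda>r. (f (x + r *\<^sub>R b) - f x) / r) \<longlongrightarrow> b \<bullet> G x) (at 0)"
        by (simp add: has_field_derivative_iff)
      moreover have "filterlim h (at 0) sequentially"
        unfolding filterlim_at using h(1) LIMSEQ_inverse_real_of_nat
        by (auto simp: h_def[abs_def] inverse_eq_divide)
      ultimately show "(\<lambda>m. s m x) \<longlonglongrightarrow> b \<bullet> G x"
        unfolding s_def by (rule filterlim_compose)
    qed
    show "AE x in lborel. norm (s m x) \<le> C * indicator (cball 0 (R + 1)) x" for m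
    proof (rule AE_I2)
      fix x
      show "norm (s m x) \<le> C * indicator (cball 0 (R + 1)) x"
      proof (cases "x \<in> cball 0 (R + 1)")
        case True
        have "norm (f (x + h m *\<^sub>R b) - f x) \<le> C * norm ((x + h m *\<^sub>R b) - x)"
        proof (rule differentiable_bound[of UNIV])
          show "(f has_derivative (\<lambda>h. h \<bullet> G y)) (at y within UNIV)" for y using f by simp
          show "onorm (\<lambda>h. h \<bullet> G y) \<le> C" for y
          proof (rule onorm_le)
            fix h
            show "norm (h \<bullet> G y) \<le> C * norm h"
              using Cauchy_Schwarz_ineq2[of h "G y"] mult_right_mono[OF B[of y], of "norm h"]
              by (simp add: mult.commute)
          qed
        qed auto
        then have "\<bar>f (x + h m *\<^sub>R b) - f x\<bar> \<le> C * h m" using b h(1)[of m] by simp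
        then show ?thesis using True h(1)[of m] by (simp add: s_def divide_le_eq)
      next
        case False
        then have n: "norm x > R + 1" by simp
        have "x \<notin> K" using R[of x] n by auto
        moreover have "x + h m *\<^sub>R b \<notin> K"
        proof
          assume "x + h m *\<^sub>R b \<in> K"
          then have "norm (x + h m *\<^sub>R b) \<le> R" by (rule R)
          moreover have "norm x \<le> norm (x + h m *\<^sub>R b) + norm (h m *\<^sub>R b)"
            using norm_triangle_ineq4[of "x + h m *\<^sub>R b" "h m *\<^sub>R b"] by simp
          ultimately show False using n b h[of m] by simp
        qed
        ultimately show ?thesis using K(2) \<open>C \<ge> 0\<close> by (simp add: s_def)
      qed
    qed
  qed
  then show ?thesis using s0 by (simp add: LIMSEQ_const_iff)
qed

lemma integral_lebesgue_on_support:
  fixes F :: "'a::euclidean_space \<Rightarrow> real"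
  assumes F: "continuous_on UNIV F" and U: "U \<in> sets lebesgue" "\<And>x. x \<notin> U \<Longrightarrow> F x = 0"
  shows "integral\<^sup>L (lebesgue_on U) F = integral\<^sup>L lborel F"
proof -
  have "(\<lambda>x. indicator U x *\<^sub>R F x) = F" using U(2) by (auto simp: fun_eq_iff indicator_def)
  then have "integral\<^sup>L (lebesgue_on U) F = integral\<^sup>L lebesgue F"
    using U(1) by (simp add: integral_restrict_space)
  also have "\<dots> = integral\<^sup>L lborel F"
    by (rule integral_completion) (use borel_measurable_continuous_onI[OF F] in simp)
  finally show ?thesis .
qed

text \<open>The product of the two test functions has compact support, so its partial derivative
  integrates to 0; the product rule splits that integral.\<close>

lemma test_fun_parts:
  fixes \<phi> \<psi> :: "'a::euclidean_space \<Rightarrow> real"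
  assumes U: "U \<in> sets lebesgue" and \<phi>: "test_fun U \<phi>" and \<psi>: "test_fun U \<psi>" and b: "b \<in> Basis"
  shows "(\<integral>x. \<psi> x * frechet_derivative \<phi> (at x) b \<partial>lebesgue_on U) = - (\<integral>x. (grad \<psi> x \<bullet> b) * \<phi> x \<partial>lebesgue_on U)"
proof -
  have C: "Cinf_on UNIV \<phi>" "Cinf_on UNIV \<psi>" and K: "compact (fsupp \<phi>)" and sub: "fsupp \<phi> \<subseteq> U"
    using \<phi> \<psi> by (auto simp: test_fun_def)
  note c = Cinf_on_grad(2,3)[OF C(1)] Cinf_on_grad(2,3)[OF C(2)]
  have z: "\<phi> x = 0" "grad \<phi> x = 0" if "x \<notin> fsupp \<phi>" for x
    using that notin_fsupp grad_notin_fsupp by blast+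
  let ?G = "\<lambda>x. \<psi> x *\<^sub>R grad \<phi> x + \<phi> x *\<^sub>R grad \<psi> x"
  have "(\<integral>x. b \<bullet> ?G x \<partial>lborel) = 0"
  proof (rule integral_partial_derivative_eq_0[OF _ _ K])
    fix x
    show "((\<lambda>x. \<psi> x * \<phi> x) has_derivative (\<lambda>h. h \<bullet> ?G x)) (at x)"
      using has_derivative_mult[OF Cinf_on_grad(1)[OF C(2), of x] Cinf_on_grad(1)[OF C(1), of x]]
      by (simp add: inner_add_right mult.commute)
  next
    show "continuous_on UNIV ?G" by (intro continuous_intros c)
  qed (use z b in auto)
  have s1: "continuous_on UNIV (\<lambda>x. \<psi> x * (b \<bullet> grad \<phi> x))" "continuous_on UNIV (\<lambda>x. (b \<bullet> grad \<psi> x) * \<phi> x)"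
    by (intro continuous_intros c)+
  have ig: "integrable lborel F" if "continuous_on UNIV F" "\<And>x. x \<notin> fsupp \<phi> \<Longrightarrow> F x = 0" for F :: "'a \<Rightarrow> real"
  proof -
    have "integrable lborel (\<lambda>x. indicator (fsupp \<phi>) x *\<^sub>R F x)"
      using borel_integrable_compact[OF K continuous_on_subset[OF that(1)]] by simp
    moreover have "(\<lambda>x. indicator (fsupp \<phi>) x *\<^sub>R F x) = F" using that(2) by (auto simp: fun_eq_iff indicator_def)
    ultimately show ?thesis by simp
  qed
  have "(\<integral>x. b \<bullet> ?G x \<partial>lborel) = (\<integral>x. \<psi> x * (b \<bullet> grad \<phi> x) + (b \<bullet> grad \<psi> x) * \<phi> x \<partial>lborel)"
    by (simp add: inner_add_right mult.commute)
  also have "\<dots> = (\<integral>x. \<psi> x * (b \<bullet> grad \<phi> x) \<partial>lborel) + (\<integral>x. (b \<bullet> grad \<psi> x) * \<phi> x \<partial>lborel)"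
    by (intro Bochner_Integration.integral_add ig s1) (simp_all add: z)
  also have "(\<integral>x. \<psi> x * (b \<bullet> grad \<phi> x) \<partial>lborel) = (\<integral>x. \<psi> x * (b \<bullet> grad \<phi> x) \<partial>lebesgue_on U)"
    by (rule integral_lebesgue_on_support[symmetric, OF s1(1) U]) (use sub z(2) in force)
  also have "(\<integral>x. (b \<bullet> grad \<psi> x) * \<phi> x \<partial>lborel) = (\<integral>x. (b \<bullet> grad \<psi> x) * \<phi> x \<partial>lebesgue_on U)"
    by (rule integral_lebesgue_on_support[symmetric, OF s1(2) U]) (use sub z(1) in force)
  finally show ?thesis using \<open>(\<integral>x. b \<bullet> ?G x \<partial>lborel) = 0\<close>
    by (simp add: frechet_derivative_eq_grad[OF C(1)] inner_commute[of b])
qed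

lemma test_fun_bounded:
  fixes \<phi> :: "'a::euclidean_space \<Rightarrow> real"
  assumes "test_fun U \<phi>"
  shows "\<exists>B. \<forall>x. \<bar>\<phi> x\<bar> \<le> B \<and> norm (grad \<phi> x) \<le> B"
proof -
  have C: "Cinf_on UNIV \<phi>" and K: "compact (fsupp \<phi>)" using assms by (auto simp: test_fun_def)
  have "compact (\<phi> ` fsupp \<phi>)" "compact (grad \<phi> ` fsupp \<phi>)"
    using K Cinf_on_grad(2,3)[OF C] by (auto intro!: compact_continuous_image intro: continuous_on_subset)
  then have "\<exists>B. \<forall>y\<in>\<phi> ` fsupp \<phi>. norm y \<le> B" "\<exists>B. \<forall>y\<in>grad \<phi> ` fsupp \<phi>. norm y \<le> B"
    by (auto dest!: compact_imp_bounded simp only: bounded_iff)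
  then obtain B1 B2 where B: "\<forall>y\<in>\<phi> ` fsupp \<phi>. norm y \<le> B1" "\<forall>y\<in>grad \<phi> ` fsupp \<phi>. norm y \<le> B2"
    by (elim exE)
  have "\<bar>\<phi> x\<bar> \<le> max 0 (max B1 B2) \<and> norm (grad \<phi> x) \<le> max 0 (max B1 B2)" for x
  proof (cases "x \<in> fsupp \<phi>")
    case True
    then have "\<bar>\<phi> x\<bar> \<le> B1" "norm (grad \<phi> x) \<le> B2" using B by auto
    then show ?thesis by (simp add: le_max_iff_disj)
  next
    case False
    then show ?thesis by (simp add: notin_fsupp grad_notin_fsupp)
  qed
  then show ?thesis by blast
qed

lemma test_fun_Lp:
  fixes \<phi> :: "'a::euclidean_space \<Rightarrow> real"
  assumes \<phi>: "test_fun U \<phi>" and U: "U \<in> sets lebesgue" "bounded U" and "p \<ge> 0"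
  shows "Lp p (lebesgue_on U) \<phi>" "Lp p (lebesgue_on U) (grad \<phi>)"
proof -
  interpret finite_measure "lebesgue_on U" using U by (rule finite_measure_lebesgue_on_bounded)
  have C: "Cinf_on UNIV \<phi>" using \<phi> by (simp add: test_fun_def)
  obtain B where B: "\<forall>x. \<bar>\<phi> x\<bar> \<le> B \<and> norm (grad \<phi> x) \<le> B" using test_fun_bounded[OF \<phi>] by blast
  have m: "f \<in> borel_measurable (lebesgue_on U)" if "continuous_on UNIV f" for f :: "'a \<Rightarrow> 'c::real_normed_vector"
    using continuous_imp_measurable_on_sets_lebesgue[OF continuous_on_subset[OF that] U(1)] by simp
  show "Lp p (lebesgue_on U) \<phi>" by (rule Lp_bounded[where C = B]) (use m Cinf_on_grad[OF C] B \<open>p \<ge> 0\<close> in auto)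
  show "Lp p (lebesgue_on U) (grad \<phi>)" by (rule Lp_bounded[where C = B]) (use m Cinf_on_grad[OF C] B \<open>p \<ge> 0\<close> in auto)
qed

section \<open>Strong convergence and duality\<close>

lemma Lp_tendsto_dominated:
  assumes b: "\<And>k. Lp p M (b k)" "(\<lambda>k. \<integral>x. norm (b k x) powr p \<partial>M) \<longlonglongrightarrow> 0" and "p \<ge> 0" "C \<ge> 0"
    and a: "\<And>k. a k \<in> borel_measurable M" "\<And>k x. norm (a k x) \<le> C * norm (b k x)"
  shows "Lp p M (a k)" "(\<lambda>k. \<integral>x. norm (a k x) powr p \<partial>M) \<longlonglongrightarrow> 0"
proof -
  show L: "Lp p M (a k)" for k
    by (rule Lp_dominated[OF b(1)[of k] a(1) \<open>p \<ge> 0\<close> \<open>C \<ge> 0\<close>]) (use a(2) in auto)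
  show "(\<lambda>k. \<integral>x. norm (a k x) powr p \<partial>M) \<longlonglongrightarrow> 0"
  proof (rule tendsto_sandwich)
    show "eventually (\<lambda>k. 0 \<le> (\<integral>x. norm (a k x) powr p \<partial>M)) sequentially" by simp
    show "(\<lambda>k. C powr p * (\<integral>x. norm (b k x) powr p \<partial>M)) \<longlonglongrightarrow> 0"
      using tendsto_mult_left[OF b(2), of "C powr p"] by simp
    show "eventually (\<lambda>k. (\<integral>x. norm (a k x) powr p \<partial>M) \<le> C powr p * (\<integral>x. norm (b k x) powr p \<partial>M)) sequentially"
    proof (rule always_eventually, rule allI)
      fix k
      have "(\<integral>x. norm (a k x) powr p \<partial>M) \<le> (\<integral>x. C powr p * norm (b k x) powr p \<partial>M)"
      proof (rule integral_mono)
        show "integrable M (\<lambda>x. norm (a k x) powr p)" using L by (simp add: Lp_def)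
        show "integrable M (\<lambda>x. C powr p * norm (b k x) powr p)" using b(1) by (simp add: Lp_def)
        show "norm (a k x) powr p \<le> C powr p * norm (b k x) powr p" for x
          using powr_mono2[of p "norm (a k x)" "C * norm (b k x)"] a(2)[of k x] \<open>p \<ge> 0\<close> by (simp add: powr_mult)
      qed
      then show "(\<integral>x. norm (a k x) powr p \<partial>M) \<le> C powr p * (\<integral>x. norm (b k x) powr p \<partial>M)" by simp
    qed
  qed simp
qed

lemma Lp_tendsto_diff:
  assumes a: "\<And>k. Lp p M (a k)" "(\<lambda>k. \<integral>x. norm (a k x) powr p \<partial>M) \<longlonglongrightarrow> 0" and "p \<ge> 0"
    and b: "\<And>k. Lp p M (b k)" "(\<lambda>k. \<integral>x. norm (b k x) powr p \<partial>M) \<longlonglongrightarrow> 0"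
  shows "(\<lambda>k. \<integral>x. norm (a k x - b k x) powr p \<partial>M) \<longlonglongrightarrow> 0"
proof (rule tendsto_sandwich)
  show "eventually (\<lambda>k. 0 \<le> (\<integral>x. norm (a k x - b k x) powr p \<partial>M)) sequentially" by simp
  show "(\<lambda>k. 2 powr p * ((\<integral>x. norm (a k x) powr p \<partial>M) + (\<integral>x. norm (b k x) powr p \<partial>M))) \<longlonglongrightarrow> 0"
    using tendsto_mult_left[OF tendsto_add[OF a(2) b(2)], of "2 powr p"] by simp
  show "eventually (\<lambda>k. (\<integral>x. norm (a k x - b k x) powr p \<partial>M) \<le> 2 powr p * ((\<integral>x. norm (a k x) powr p \<partial>M) + (\<integral>x. norm (b k x) powr p \<partial>M))) sequentially"
  proof (rule always_eventually, rule allI)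
    fix k
    have i: "integrable M (\<lambda>x. norm (a k x) powr p)" "integrable M (\<lambda>x. norm (b k x) powr p)" using a b by (simp_all add: Lp_def)
    have "(\<integral>x. norm (a k x - b k x) powr p \<partial>M) \<le> (\<integral>x. 2 powr p * (norm (a k x) powr p + norm (b k x) powr p) \<partial>M)"
    proof (rule integral_mono)
      show "integrable M (\<lambda>x. norm (a k x - b k x) powr p)" using Lp_diff[OF a(1) b(1) \<open>p \<ge> 0\<close>, of k k] by (simp add: Lp_def)
      show "integrable M (\<lambda>x. 2 powr p * (norm (a k x) powr p + norm (b k x) powr p))" using i by simp
    qed (rule norm_diff_powr_le[OF \<open>p \<ge> 0\<close>])
    then show "(\<integral>x. norm (a k x - b k x) powr p \<partial>M) \<le> 2 powr p * ((\<integral>x. norm (a k x) powr p \<partial>M) + (\<integral>x. norm (b k x) powr p \<partial>M))"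
      using i by simp
  qed
qed simp

lemma Lp_inner_tendsto:
  fixes f :: "nat \<Rightarrow> 'a \<Rightarrow> 'b::euclidean_space"
  assumes f: "\<And>k. Lp p M (f k)" "Lp p M F" and lim: "(\<lambda>k. \<integral>x. norm (f k x - F x) powr p \<partial>M) \<longlonglongrightarrow> 0"
    and g: "Lp q M g" and pq: "p > 1" "q > 1" "1/p + 1/q = 1"
  shows "(\<lambda>k. \<integral>x. f k x \<bullet> g x \<partial>M) \<longlonglongrightarrow> (\<integral>x. F x \<bullet> g x \<partial>M)"
proof -
  have L: "Lp p M (\<lambda>x. f k x - F x)" for k using f pq by (intro Lp_diff) auto
  have "(\<lambda>k. (\<integral>x. f k x \<bullet> g x \<partial>M) - (\<integral>x. F x \<bullet> g x \<partial>M)) \<longlonglongrightarrow> 0"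
  proof (rule Lim_null_comparison[OF always_eventually Lp_product_tendsto_0[OF L lim g pq]], rule allI)
    fix k
    have "(\<integral>x. f k x \<bullet> g x \<partial>M) - (\<integral>x. F x \<bullet> g x \<partial>M) = (\<integral>x. (f k x - F x) \<bullet> g x \<partial>M)"
      unfolding inner_diff_left
      by (rule Bochner_Integration.integral_diff[symmetric]) (intro Lp_inner_integrable[OF _ g pq] f)+
    moreover have "norm (\<integral>x. (f k x - F x) \<bullet> g x \<partial>M) \<le> (\<integral>x. norm (f k x - F x) * norm (g x) \<partial>M)"
    proof -
      have "norm (\<integral>x. (f k x - F x) \<bullet> g x \<partial>M) \<le> (\<integral>x. norm ((f k x - F x) \<bullet> g x) \<partial>M)" by (rule integral_norm_bound)
      also have "\<dots> \<le> (\<integral>x. norm (f k x - F x) * norm (g x) \<partial>M)"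
      proof (rule integral_mono)
        show "integrable M (\<lambda>x. norm ((f k x - F x) \<bullet> g x))" by (intro integrable_norm Lp_inner_integrable[OF L g pq])
        show "integrable M (\<lambda>x. norm (f k x - F x) * norm (g x))" by (rule Lp_product_integrable[OF L g pq])
      qed (simp add: Cauchy_Schwarz_ineq2)
      finally show ?thesis .
    qed
    ultimately show "norm ((\<integral>x. f k x \<bullet> g x \<partial>M) - (\<integral>x. F x \<bullet> g x \<partial>M)) \<le> (\<integral>x. norm (f k x - F x) * norm (g x) \<partial>M)"
      by simp
  qed
  then show ?thesis by (simp add: LIM_zero_iff)
qed

section \<open>The chain rule for tanh in the Sobolev space\<close>

lemma tanh_square_le_1: "(tanh (z::real))\<^sup>2 \<le> 1"
  using tanh_real_bounds[of z] by (simp add: abs_square_le_1 abs_le_iff less_imp_le)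

lemma tanh_lipschitz: "\<bar>tanh a - tanh (b::real)\<bar> \<le> \<bar>a - b\<bar>"
proof -
  have "norm (tanh a - tanh b) \<le> 1 * norm (a - b)"
  proof (rule field_differentiable_bound[of UNIV])
    show "(tanh has_field_derivative 1 - (tanh z)\<^sup>2) (at z within UNIV)" for z :: real
      by (auto intro!: derivative_eq_intros)
    show "norm (1 - (tanh z)\<^sup>2) \<le> 1" for z :: real
      using tanh_square_le_1[of z] by simp
  qed auto
  then show ?thesis by simp
qed

lemma grad_tanh:
  fixes \<phi> :: "'a::euclidean_space \<Rightarrow> real"
  assumes "Cinf_on UNIV \<phi>"
  shows "grad (\<lambda>x. tanh (n * \<phi> x)) x = (n * (1 - (tanh (n * \<phi> x))\<^sup>2)) *\<^sub>R grad \<phi> x"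
proof (rule grad_unique)
  have 1: "((\<lambda>x. n * \<phi> x) has_derivative (\<lambda>h. n * (h \<bullet> grad \<phi> x))) (at x)"
    by (rule has_derivative_mult_right[OF Cinf_on_grad(1)[OF assms]])
  have 2: "(tanh has_derivative (*) (1 - (tanh (n * \<phi> x))\<^sup>2)) (at (n * \<phi> x))"
    unfolding has_field_derivative_def[symmetric] by (auto intro!: derivative_eq_intros)
  show "((\<lambda>x. tanh (n * \<phi> x)) has_derivative (\<lambda>h. h \<bullet> ((n * (1 - (tanh (n * \<phi> x))\<^sup>2)) *\<^sub>R grad \<phi> x))) (at x)"
    using has_derivative_compose[OF 1 2] by (simp add: ac_simps)
qed

lemma grad_diff:
  fixes \<phi> \<psi> :: "'a::euclidean_space \<Rightarrow> real"
  assumes "Cinf_on UNIV \<phi>" "Cinf_on UNIV \<psi>"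
  shows "grad (\<lambda>x. \<phi> x - \<psi> x) x = grad \<phi> x - grad \<psi> x"
  by (rule grad_unique)
    (use has_derivative_diff[OF Cinf_on_grad(1)[OF assms(1), of x] Cinf_on_grad(1)[OF assms(2), of x]] in \<open>simp add: inner_diff_right\<close>)

lemma Lp_integrable:
  fixes f :: "'a \<Rightarrow> 'b::{banach,second_countable_topology}"
  assumes "finite_measure M" "Lp p M f" "1 \<le> p"
  shows "integrable M f"
proof -
  have "Lp 1 M f" using finite_measure.Lp_mono[OF assms(1,2), of 1] assms(3) by simp
  then show ?thesis unfolding Lp_def using integrable_norm_iff[of f M] by simp
qed

text \<open>Integration by parts holds for each smooth approximant and passes to the limit against a
  fixed test function, which lies in the dual Lebesgue space. Membership therefore reduces to
  convergence in norm.\<close>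

lemma weak_grad_limit:
  fixes \<psi> :: "nat \<Rightarrow> 'a::euclidean_space \<Rightarrow> real"
  assumes U: "U \<in> sets lebesgue" "bounded U" and p: "p > 1"
    and \<psi>: "\<And>k. test_fun U (\<psi> k)" and v: "Lp p (lebesgue_on U) v" and g: "Lp p (lebesgue_on U) g"
    and lim: "(\<lambda>k. \<integral>x. norm (\<psi> k x - v x) powr p \<partial>lebesgue_on U) \<longlonglongrightarrow> 0"
      "(\<lambda>k. \<integral>x. norm (grad (\<psi> k) x - g x) powr p \<partial>lebesgue_on U) \<longlonglongrightarrow> 0"
  shows "W1p0 p U v g"
proof -
  let ?N = "lebesgue_on U"
  have fin: "finite_measure ?N" using U by (rule finite_measure_lebesgue_on_bounded)
  define q where "q = p / (p - 1)"
  have q: "q > 1" "1/p + 1/q = 1" using p by (simp_all add: q_def field_simps)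
  have loc: "set_integrable lebesgue K f" if "Lp p ?N f" "compact K" "K \<subseteq> U" for K and f :: "'a \<Rightarrow> 'b::{banach,second_countable_topology}"
  proof -
    have "integrable ?N f" using Lp_integrable[OF fin that(1)] p by simp
    then have "integrable lebesgue (\<lambda>x. indicator U x *\<^sub>R f x)" using U(1) by (simp add: integrable_restrict_space)
    moreover have "K \<in> sets lebesgue" using lmeasurable_compact[OF \<open>compact K\<close>] by (rule fmeasurableD)
    ultimately have "integrable lebesgue (\<lambda>x. indicator K x *\<^sub>R (indicator U x *\<^sub>R f x))"
      by (rule integrable_mult_indicator[rotated])
    moreover have "(\<lambda>x. indicator K x *\<^sub>R (indicator U x *\<^sub>R f x)) = (\<lambda>x. indicator K x *\<^sub>R f x)"
      using \<open>K \<subseteq> U\<close> by (auto simp: fun_eq_iff indicator_def)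
    ultimately show ?thesis by (simp add: set_integrable_def)
  qed
  have wg: "(LINT x:U|lebesgue. v x * frechet_derivative \<phi> (at x) b) = - (LINT x:U|lebesgue. (g x \<bullet> b) * \<phi> x)"
    if \<phi>: "test_fun U \<phi>" and b: "b \<in> Basis" for \<phi> b
  proof -
    have C: "Cinf_on UNIV \<phi>" using \<phi> by (simp add: test_fun_def)
    obtain B where B: "\<forall>x. \<bar>\<phi> x\<bar> \<le> B \<and> norm (grad \<phi> x) \<le> B" using test_fun_bounded[OF \<phi>] by blast
    have Lq: "Lp q ?N \<phi>" "Lp q ?N (grad \<phi>)" using test_fun_Lp[OF \<phi> U, of q] q by auto
    have m: "\<phi> \<in> borel_measurable ?N" "grad \<phi> \<in> borel_measurable ?N" using Lq by (auto simp: Lp_def)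
    have 1: "Lp q ?N (\<lambda>x. grad \<phi> x \<bullet> b)"
      by (rule Lp_dominated[OF Lq(2), of _ 1]) (use m q b in \<open>auto intro!: Basis_le_norm\<close>)
    have 2: "Lp q ?N (\<lambda>x. \<phi> x *\<^sub>R b)"
      by (rule Lp_dominated[OF Lq(1), of _ 1]) (use m q b in auto)
    have "(\<lambda>k. \<integral>x. \<psi> k x \<bullet> (grad \<phi> x \<bullet> b) \<partial>?N) \<longlonglongrightarrow> (\<integral>x. v x \<bullet> (grad \<phi> x \<bullet> b) \<partial>?N)"
      by (rule Lp_inner_tendsto[OF _ v lim(1) 1 p q]) (use test_fun_Lp(1)[OF \<psi> U] p in auto)
    moreover have "(\<integral>x. \<psi> k x \<bullet> (grad \<phi> x \<bullet> b) \<partial>?N) = - (\<integral>x. grad (\<psi> k) x \<bullet> (\<phi> x *\<^sub>R b) \<partial>?N)" for k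
      using test_fun_parts[OF U(1) \<phi> \<psi>[of k] b]
      by (simp add: frechet_derivative_eq_grad[OF C] inner_commute[of b] mult.commute)
    moreover have "(\<lambda>k. - (\<integral>x. grad (\<psi> k) x \<bullet> (\<phi> x *\<^sub>R b) \<partial>?N)) \<longlonglongrightarrow> - (\<integral>x. g x \<bullet> (\<phi> x *\<^sub>R b) \<partial>?N)"
      by (intro tendsto_minus, rule Lp_inner_tendsto[OF _ g lim(2) 2 p q]) (use test_fun_Lp(2)[OF \<psi> U] p in auto)
    ultimately have "(\<integral>x. v x \<bullet> (grad \<phi> x \<bullet> b) \<partial>?N) = - (\<integral>x. g x \<bullet> (\<phi> x *\<^sub>R b) \<partial>?N)"
      using LIMSEQ_unique by simp
    then show ?thesis
      unfolding set_integral_lebesgue_on[OF U(1)]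
      by (simp add: frechet_derivative_eq_grad[OF C] inner_commute[of b] mult.commute)
  qed
  have "weak_grad U v g" unfolding weak_grad_def
    by (intro conjI allI impI ballI loc[OF v] loc[OF g] wg) auto
  moreover have "(\<lambda>k. LINT x:U|lebesgue. \<bar>\<psi> k x - v x\<bar> powr p) \<longlonglongrightarrow> 0"
    "(\<lambda>k. LINT x:U|lebesgue. norm (grad (\<psi> k) x - g x) powr p) \<longlonglongrightarrow> 0"
    unfolding set_integral_lebesgue_on[OF U(1)] using lim by simp_all
  ultimately show ?thesis unfolding W1p0_def by (intro conjI v g exI[of _ \<psi>] allI \<psi>)
qed

text \<open>The approximants are \<open>tanh\<close> of differences of smooth approximants and
  remain test functions. Their values converge because \<open>tanh\<close> is Lipschitz; their
  gradients are products of two varying factors and need a separate argument.\<close>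

lemma W1p0_tanh_diff:
  fixes v1 v2 :: "'a::euclidean_space \<Rightarrow> real"
  assumes U: "U \<in> sets lebesgue" "bounded U" and p: "p > 1"
    and W: "W1p0 p U v1 g1" "W1p0 p U v2 g2"
  shows "W1p0 p U (\<lambda>x. tanh (n * (v2 x - v1 x))) (\<lambda>x. (n * (1 - (tanh (n * (v2 x - v1 x)))\<^sup>2)) *\<^sub>R (g2 x - g1 x))"
proof -
  let ?N = "lebesgue_on U"
  interpret finite_measure ?N using U by (rule finite_measure_lebesgue_on_bounded)
  have p0: "p \<ge> 0" using p by simp
  obtain \<phi>1 where \<phi>1: "\<forall>k. test_fun U (\<phi>1 k)" "(\<lambda>k. LINT x:U|lebesgue. \<bar>\<phi>1 k x - v1 x\<bar> powr p) \<longlonglongrightarrow> 0"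
        "(\<lambda>k. LINT x:U|lebesgue. norm (grad (\<phi>1 k) x - g1 x) powr p) \<longlonglongrightarrow> 0"
    using W(1) unfolding W1p0_def by (elim exE conjE)
  obtain \<phi>2 where \<phi>2: "\<forall>k. test_fun U (\<phi>2 k)" "(\<lambda>k. LINT x:U|lebesgue. \<bar>\<phi>2 k x - v2 x\<bar> powr p) \<longlonglongrightarrow> 0"
        "(\<lambda>k. LINT x:U|lebesgue. norm (grad (\<phi>2 k) x - g2 x) powr p) \<longlonglongrightarrow> 0"
    using W(2) unfolding W1p0_def by (elim exE conjE)
  have L: "Lp p ?N v1" "Lp p ?N g1" "Lp p ?N v2" "Lp p ?N g2" using W by (simp_all add: W1p0_def)
  define V where "V x = v2 x - v1 x" for x
  define G where "G x = g2 x - g1 x" for x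
  define \<phi> where "\<phi> k x = \<phi>2 k x - \<phi>1 k x" for k x
  have \<phi>: "test_fun U (\<phi> k)" for k unfolding \<phi>_def[abs_def] using test_fun_diff \<phi>1(1) \<phi>2(1) by blast
  have C: "Cinf_on UNIV (\<phi> k)" "Cinf_on UNIV (\<phi>1 k)" "Cinf_on UNIV (\<phi>2 k)" for k
    using \<phi> \<phi>1(1) \<phi>2(1) by (simp_all add: test_fun_def)
  have g\<phi>: "grad (\<phi> k) x = grad (\<phi>2 k) x - grad (\<phi>1 k) x" for k x
    unfolding \<phi>_def[abs_def] by (rule grad_diff[OF C(3,2)])
  have LV: "Lp p ?N V" "Lp p ?N G" unfolding V_def[abs_def] G_def[abs_def] using L p0 by (auto intro!: Lp_diff)
  then have mV[measurable]: "V \<in> borel_measurable ?N" "G \<in> borel_measurable ?N" by (auto simp: Lp_def)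
  have T: "Lp p ?N (\<phi>1 k)" "Lp p ?N (grad (\<phi>1 k))" "Lp p ?N (\<phi>2 k)" "Lp p ?N (grad (\<phi>2 k))"
    "Lp p ?N (\<phi> k)" "Lp p ?N (grad (\<phi> k))" for k
    using test_fun_Lp[OF _ U p0] \<phi> \<phi>1(1) \<phi>2(1) by blast+
  have m\<phi>[measurable]: "\<phi> k \<in> borel_measurable ?N" "grad (\<phi> k) \<in> borel_measurable ?N" for k using T by (auto simp: Lp_def)
  have c1: "(\<lambda>k. \<integral>x. norm (\<phi> k x - V x) powr p \<partial>?N) \<longlonglongrightarrow> 0"
  proof -
    have "(\<lambda>k. \<integral>x. norm ((\<phi>2 k x - v2 x) - (\<phi>1 k x - v1 x)) powr p \<partial>?N) \<longlonglongrightarrow> 0"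
      by (rule Lp_tendsto_diff[OF _ _ p0])
        (use \<phi>1(2) \<phi>2(2) in \<open>auto simp: set_integral_lebesgue_on[OF U(1)] intro!: Lp_diff T L p0\<close>)
    moreover have "(\<phi>2 k x - v2 x) - (\<phi>1 k x - v1 x) = \<phi> k x - V x" for k x by (simp add: \<phi>_def V_def)
    ultimately show ?thesis by simp
  qed
  have c2: "(\<lambda>k. \<integral>x. norm (grad (\<phi> k) x - G x) powr p \<partial>?N) \<longlonglongrightarrow> 0"
  proof -
    have "(\<lambda>k. \<integral>x. norm ((grad (\<phi>2 k) x - g2 x) - (grad (\<phi>1 k) x - g1 x)) powr p \<partial>?N) \<longlonglongrightarrow> 0"
      by (rule Lp_tendsto_diff[OF _ _ p0])
        (use \<phi>1(3) \<phi>2(3) in \<open>auto simp: set_integral_lebesgue_on[OF U(1)] intro!: Lp_diff T L p0\<close>)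
    moreover have "(grad (\<phi>2 k) x - g2 x) - (grad (\<phi>1 k) x - g1 x) = grad (\<phi> k) x - G x" for k x by (simp add: g\<phi> G_def)
    ultimately show ?thesis by simp
  qed
  have d1: "Lp p ?N (\<lambda>x. \<phi> k x - V x)" "Lp p ?N (\<lambda>x. grad (\<phi> k) x - G x)" for k
    by (intro Lp_diff T LV p0)+
  \<comment> \<open>Convergence in norm yields convergence almost everywhere only along a
    subsequence, which replaces the original sequence from here on.\<close>
  have "\<exists>r::nat\<Rightarrow>nat. strict_mono r \<and> (AE x in ?N. (\<lambda>k. norm (\<phi> (r k) x - V x) powr p) \<longlonglongrightarrow> 0)"
    by (rule tendsto_L1_AE_subseq) (use d1 c1 in \<open>auto simp: Lp_def\<close>)
  then obtain r :: "nat \<Rightarrow> nat" where r: "strict_mono r" "AE x in ?N. (\<lambda>k. norm (\<phi> (r k) x - V x) powr p) \<longlonglongrightarrow> 0"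
    by (elim exE conjE)
  have conv: "AE x in ?N. (\<lambda>k. \<phi> (r k) x) \<longlonglongrightarrow> V x"
    using r(2)
  proof eventually_elim
    case (elim x)
    have "(\<lambda>k. (norm (\<phi> (r k) x - V x) powr p) powr (1/p)) \<longlonglongrightarrow> 0 powr (1/p)"
      by (rule tendsto_powr'[OF elim tendsto_const]) (use p in auto)
    then have "(\<lambda>k. norm (\<phi> (r k) x - V x)) \<longlonglongrightarrow> 0" using p by (simp add: powr_powr)
    then show ?case by (rule LIM_zero_cancel[OF tendsto_norm_zero_cancel])
  qed
  let ?S = "\<lambda>x. tanh (n * V x)"
  let ?D = "\<lambda>x. (n * (1 - (?S x)\<^sup>2)) *\<^sub>R G x"
  define \<psi> where "\<psi> k = (\<lambda>x. tanh (n * \<phi> (r k) x))" for k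
  have tm: "(\<lambda>x. tanh (n * f x)) \<in> borel_measurable ?N" if "f \<in> borel_measurable ?N" for f :: "'a \<Rightarrow> real"
    by (rule borel_measurable_continuous_on[of tanh]) (use that in \<open>auto intro!: continuous_intros\<close>)
  have [measurable]: "?S \<in> borel_measurable ?N" "\<psi> k \<in> borel_measurable ?N" for k
    unfolding \<psi>_def by (intro tm mV m\<phi>)+
  have \<psi>: "test_fun U (\<psi> k)" for k unfolding \<psi>_def by (rule test_fun_tanh[OF \<phi>])
  have g\<psi>: "grad (\<psi> k) x = (n * (1 - (\<psi> k x)\<^sup>2)) *\<^sub>R grad (\<phi> (r k)) x" for k x
    unfolding \<psi>_def by (rule grad_tanh[OF C(1)])
  have S1: "\<bar>1 - (tanh z)\<^sup>2\<bar> \<le> 1" for z :: real using tanh_square_le_1[of z] by simp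
  have cr1: "(\<lambda>k. \<integral>x. norm (\<phi> (r k) x - V x) powr p \<partial>?N) \<longlonglongrightarrow> 0"
    using LIMSEQ_subseq_LIMSEQ[OF c1 r(1)] by (simp add: o_def)
  have cr2: "(\<lambda>k. \<integral>x. norm (grad (\<phi> (r k)) x - G x) powr p \<partial>?N) \<longlonglongrightarrow> 0"
    using LIMSEQ_subseq_LIMSEQ[OF c2 r(1)] by (simp add: o_def)
  have l1: "(\<lambda>k. \<integral>x. norm (\<psi> k x - ?S x) powr p \<partial>?N) \<longlonglongrightarrow> 0"
  proof (rule Lp_tendsto_dominated(2)[OF d1(1) cr1 p0, of "\<bar>n\<bar>"])
    show "norm (\<psi> k x - ?S x) \<le> \<bar>n\<bar> * norm (\<phi> (r k) x - V x)" for k x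
      using tanh_lipschitz[of "n * \<phi> (r k) x" "n * V x"]
      by (simp add: \<psi>_def abs_mult[symmetric] right_diff_distrib)
  qed auto
  have l2: "(\<lambda>k. \<integral>x. norm (grad (\<psi> k) x - ?D x) powr p \<partial>?N) \<longlonglongrightarrow> 0"
  proof -
    \<comment> \<open>In \<open>?A\<close> the gradients converge in norm with bounded coefficients.
      In \<open>?B\<close> the coefficient converges almost everywhere, and the fixed
      \<open>G\<close> supplies the dominating function.\<close>
    let ?A = "\<lambda>k x. (n * (1 - (\<psi> k x)\<^sup>2)) *\<^sub>R (grad (\<phi> (r k)) x - G x)"
    let ?B = "\<lambda>k x. (n * ((\<psi> k x)\<^sup>2 - (?S x)\<^sup>2)) *\<^sub>R G x"
    have eq: "grad (\<psi> k) x - ?D x = ?A k x - ?B k x" for k x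
      unfolding g\<psi> by (simp add: algebra_simps)
    have Ale: "norm (?A k x) \<le> \<bar>n\<bar> * norm (grad (\<phi> (r k)) x - G x)" for k x
    proof -
      have "\<bar>n\<bar> * \<bar>1 - (\<psi> k x)\<^sup>2\<bar> \<le> \<bar>n\<bar> * 1" unfolding \<psi>_def by (intro mult_left_mono S1) auto
      then show ?thesis by (auto simp: abs_mult intro!: mult_right_mono)
    qed
    have Ble: "norm (?B k x) \<le> \<bar>n\<bar> * norm (G x)" for k x
    proof -
      have "\<bar>(\<psi> k x)\<^sup>2 - (?S x)\<^sup>2\<bar> \<le> 1"
        using tanh_square_le_1[of "n * \<phi> (r k) x"] tanh_square_le_1[of "n * V x"]
          zero_le_power2[of "tanh (n * \<phi> (r k) x)"] zero_le_power2[of "tanh (n * V x)"]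
        unfolding \<psi>_def abs_le_iff by linarith
      then have "\<bar>n\<bar> * \<bar>(\<psi> k x)\<^sup>2 - (?S x)\<^sup>2\<bar> \<le> \<bar>n\<bar> * 1" by (intro mult_left_mono) auto
      then show ?thesis by (auto simp: abs_mult intro!: mult_right_mono)
    qed
    have mA: "?A k \<in> borel_measurable ?N" "?B k \<in> borel_measurable ?N" for k by measurable
    have A: "Lp p ?N (?A k)" "(\<lambda>k. \<integral>x. norm (?A k x) powr p \<partial>?N) \<longlonglongrightarrow> 0" for k
      by (rule Lp_tendsto_dominated[OF d1(2) cr2 p0, of "\<bar>n\<bar>"]; use mA Ale in auto)+
    have B1: "Lp p ?N (?B k)" for k
      by (rule Lp_dominated[OF LV(2) mA(2) p0, of "\<bar>n\<bar>"]) (use Ble in auto)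
    have B2: "(\<lambda>k. \<integral>x. norm (?B k x) powr p \<partial>?N) \<longlonglongrightarrow> (\<integral>x. 0 \<partial>?N)"
    proof (rule integral_dominated_convergence[where w = "\<lambda>x. \<bar>n\<bar> powr p * norm (G x) powr p"])
      show "integrable ?N (\<lambda>x. \<bar>n\<bar> powr p * norm (G x) powr p)" using LV(2) by (simp add: Lp_def)
      show "(\<lambda>x. norm (?B k x) powr p) \<in> borel_measurable ?N" for k using mA(2)[of k] by measurable
      show "AE x in ?N. norm (norm (?B k x) powr p) \<le> \<bar>n\<bar> powr p * norm (G x) powr p" for k
      proof (rule AE_I2)
        fix x
        have "norm (?B k x) powr p \<le> (\<bar>n\<bar> * norm (G x)) powr p" using Ble[of k x] p0 by (intro powr_mono2) auto
        then show "norm (norm (?B k x) powr p) \<le> \<bar>n\<bar> powr p * norm (G x) powr p" by (simp add: powr_mult)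
      qed
      show "AE x in ?N. (\<lambda>k. norm (?B k x) powr p) \<longlonglongrightarrow> 0"
        using conv
      proof eventually_elim
        case (elim x)
        have "(\<lambda>k. norm (?B k x)) \<longlonglongrightarrow> norm ((n * ((?S x)\<^sup>2 - (?S x)\<^sup>2)) *\<^sub>R G x)"
          unfolding \<psi>_def by (intro tendsto_intros elim) auto
        then have "(\<lambda>k. norm (?B k x)) \<longlonglongrightarrow> 0" by simp
        then have "(\<lambda>k. norm (?B k x) powr p) \<longlonglongrightarrow> 0 powr p"
          by (rule tendsto_powr'[OF _ tendsto_const]) (use p in auto)
        then show ?case by simp
      qed
    qed simp
    then have B2': "(\<lambda>k. \<integral>x. norm (?B k x) powr p \<partial>?N) \<longlonglongrightarrow> 0" by simp
    show ?thesis unfolding eq by (rule Lp_tendsto_diff[OF A p0 B1 B2'])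
  qed
  have LS: "Lp p ?N ?S"
    by (rule Lp_bounded[where C = 1]) (use p0 tanh_real_bounds in \<open>auto simp: abs_le_iff intro: less_imp_le\<close>)
  have LD: "Lp p ?N ?D"
  proof (rule Lp_dominated[OF LV(2) _ p0, of _ "\<bar>n\<bar>"])
    show "AE x in ?N. norm (?D x) \<le> \<bar>n\<bar> * norm (G x)"
    proof (rule AE_I2)
      fix x
      have "\<bar>n\<bar> * \<bar>1 - (?S x)\<^sup>2\<bar> \<le> \<bar>n\<bar> * 1" by (intro mult_left_mono S1) auto
      then show "norm (?D x) \<le> \<bar>n\<bar> * norm (G x)" by (auto simp: abs_mult intro!: mult_right_mono)
    qed
  qed auto
  show ?thesis using weak_grad_limit[OF U p \<psi> LS LD l1 l2] by (simp add: V_def G_def)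
qed

section \<open>Convex integrands and measurable versions\<close>

text \<open>Convexity bounds the difference quotient along the segment by the full increment, and
  the limit is the tangent inequality. The case \<open>\<eta> = \<xi>\<close> is separate because
  strict convexity speaks of distinct points.\<close>

lemma strictly_convex_gradient_ineq:
  fixes f :: "'a::real_inner \<Rightarrow> real"
  assumes f: "strictly_convex f" and g: "(f has_derivative (\<lambda>h. g \<bullet> h)) (at \<xi>)"
  shows "f \<xi> + g \<bullet> (\<eta> - \<xi>) \<le> f \<eta>"
proof (cases "\<eta> = \<xi>")
  case False
  have 1: "((\<lambda>s. \<xi> + s *\<^sub>R (\<eta> - \<xi>)) has_derivative (\<lambda>s. s *\<^sub>R (\<eta> - \<xi>))) (at 0)"
    by (auto intro!: derivative_eq_intros)
  have "(f has_derivative (\<lambda>h. g \<bullet> h)) (at (\<xi> + 0 *\<^sub>R (\<eta> - \<xi>)))" using g by simp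
  from has_derivative_compose[OF 1 this]
  have "((\<lambda>s. f (\<xi> + s *\<^sub>R (\<eta> - \<xi>))) has_real_derivative g \<bullet> (\<eta> - \<xi>)) (at 0)"
    by (simp add: has_field_derivative_def mult_commute_abs)
  then have "((\<lambda>s. (f (\<xi> + s *\<^sub>R (\<eta> - \<xi>)) - f \<xi>) / s) \<longlongrightarrow> g \<bullet> (\<eta> - \<xi>)) (at 0)"
    by (simp add: has_field_derivative_iff)
  then have "((\<lambda>s. (f (\<xi> + s *\<^sub>R (\<eta> - \<xi>)) - f \<xi>) / s) \<longlongrightarrow> g \<bullet> (\<eta> - \<xi>)) (at_right 0)"
    by (rule filterlim_mono) (auto simp: at_within_le_nhds intro: at_le)
  moreover have "eventually (\<lambda>s. (f (\<xi> + s *\<^sub>R (\<eta> - \<xi>)) - f \<xi>) / s \<le> f \<eta> - f \<xi>) (at_right 0)"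
    unfolding eventually_at_right_field
  proof (intro exI[of _ 1] conjI allI impI)
    fix s :: real assume s: "0 < s" "s < 1"
    have "f ((1 - s) *\<^sub>R \<xi> + s *\<^sub>R \<eta>) < (1 - s) * f \<xi> + s * f \<eta>"
      using f False s unfolding strictly_convex_def by auto
    moreover have "(1 - s) *\<^sub>R \<xi> + s *\<^sub>R \<eta> = \<xi> + s *\<^sub>R (\<eta> - \<xi>)" by (simp add: algebra_simps)
    ultimately have "f (\<xi> + s *\<^sub>R (\<eta> - \<xi>)) - f \<xi> \<le> s * (f \<eta> - f \<xi>)" by (simp add: algebra_simps)
    then show "(f (\<xi> + s *\<^sub>R (\<eta> - \<xi>)) - f \<xi>) / s \<le> f \<eta> - f \<xi>"
      using s by (simp add: pos_divide_le_eq mult.commute)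
  qed simp
  ultimately have "g \<bullet> (\<eta> - \<xi>) \<le> f \<eta> - f \<xi>"
    by (rule tendsto_upperbound) simp
  then show ?thesis by simp
qed simp

text \<open>Sum of the tangent inequalities at the two points.\<close>

lemma gradient_monotone:
  fixes f :: "'a::real_inner \<Rightarrow> real"
  assumes "strictly_convex f" "\<And>\<xi>. (f has_derivative (\<lambda>h. g \<xi> \<bullet> h)) (at \<xi>)"
  shows "0 \<le> (g \<xi> - g \<eta>) \<bullet> (\<xi> - \<eta>)"
  using strictly_convex_gradient_ineq[OF assms(1) assms(2)[of \<xi>], of \<eta>]
    strictly_convex_gradient_ineq[OF assms(1) assms(2)[of \<eta>], of \<xi>]
  by (simp add: inner_diff_left inner_diff_right)

text \<open>Nonnegativity and the growth of \<open>f\<close> bound the gradient through the tangent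
  inequality, evaluated at a point reached from \<xi> in the direction of
  \<open>g \<xi>\<close>.\<close>

lemma gradient_growth:
  fixes f :: "'a::real_inner \<Rightarrow> real"
  assumes f: "strictly_convex f" "\<And>\<xi>. (f has_derivative (\<lambda>h. g \<xi> \<bullet> h)) (at \<xi>)"
    and bd: "\<And>\<xi>. 0 \<le> f \<xi>" "\<And>\<xi>. f \<xi> \<le> C * (1 + norm \<xi> powr p)" and p: "1 \<le> p" and C: "0 < C"
  shows "norm (g \<xi>) \<le> 2 * C * 2 powr p * (1 + norm \<xi>) powr (p - 1)"
proof (cases "g \<xi> = 0")
  case False
  \<comment> \<open>A step of length \<open>1 + norm \<xi>\<close>: comparable to the size of the
    point, so that dividing by the length lowers the exponent from \<open>p\<close> to
    \<open>p - 1\<close>.\<close>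
  let ?h = "((1 + norm \<xi>) / norm (g \<xi>)) *\<^sub>R g \<xi>"
  let ?r = "1 + norm \<xi>"
  have r: "?r > 0" by (simp add: add_pos_nonneg)
  have "norm (g \<xi>) * ?r = g \<xi> \<bullet> ?h" using False by (simp add: power2_norm_eq_inner[symmetric] power2_eq_square)
  also have "\<dots> \<le> f (\<xi> + ?h)"
    using strictly_convex_gradient_ineq[OF f(1) f(2), of \<xi> "\<xi> + ?h"] bd(1)[of \<xi>] by simp
  also have "\<dots> \<le> C * (1 + norm (\<xi> + ?h) powr p)" by (rule bd(2))
  also have "\<dots> \<le> C * ((2 * ?r) powr p + (2 * ?r) powr p)"
  proof (intro mult_left_mono add_mono)
    have "1 powr p \<le> (2 * ?r) powr p" using p by (intro powr_mono2) auto
    then show "1 \<le> (2 * ?r) powr p" by simp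
    have "norm (\<xi> + ?h) \<le> norm \<xi> + norm ?h" by (rule norm_triangle_ineq)
    also have "norm ?h = ?r" using False r by simp
    finally have "norm (\<xi> + ?h) \<le> 2 * ?r" by simp
    then show "norm (\<xi> + ?h) powr p \<le> (2 * ?r) powr p" using p by (intro powr_mono2) auto
  qed (use C in simp)
  also have "\<dots> = 2 * C * 2 powr p * ?r powr p" unfolding powr_mult by simp
  also have "?r powr p = ?r powr (p - 1) * ?r" using r powr_add[of ?r "p - 1" 1] by simp
  finally have "norm (g \<xi>) * ?r \<le> (2 * C * 2 powr p * ?r powr (p - 1)) * ?r" by (simp add: ac_simps)
  then show ?thesis using r by (simp add: mult_le_cancel_right)
qed (use C in simp)

text \<open>A simple function takes finitely many values, so measurability in \<open>z\<close> for
  fixed second argument suffices; continuity in that argument carries the claim over to limits of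
  simple functions.\<close>

lemma borel_measurable_Caratheodory:
  fixes F :: "'a \<Rightarrow> 'b::{metric_space,second_countable_topology} \<Rightarrow> real"
  assumes F: "\<And>\<xi>. (\<lambda>z. F z \<xi>) \<in> borel_measurable M" and c: "\<And>z. z \<in> space M \<Longrightarrow> continuous_on UNIV (F z)"
    and g: "g \<in> borel_measurable M"
  shows "(\<lambda>z. F z (g z)) \<in> borel_measurable M"
proof -
  have "\<exists>s. (\<forall>i. simple_function M (s i)) \<and> (\<forall>x\<in>space M. (\<lambda>i. s i x) \<longlonglongrightarrow> g x) \<and>
    (\<forall>i. \<forall>x\<in>space M. dist (s i x) undefined \<le> 2 * dist (g x) undefined)"
    by (rule borel_measurable_implies_sequence_metric[OF g])
  then obtain s where s: "\<forall>i. simple_function M (s i)" "\<forall>x\<in>space M. (\<lambda>i. s i x) \<longlonglongrightarrow> g x"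
    by (elim exE conjE)
  show ?thesis
  proof (rule borel_measurable_LIMSEQ_real)
    fix z assume z: "z \<in> space M"
    show "(\<lambda>i. F z (s i z)) \<longlonglongrightarrow> F z (g z)"
      by (rule continuous_on_tendsto_compose[OF c[OF z]]) (use s(2) z in auto)
  next
    fix i
    have sf: "simple_function M (s i)" using s(1) by blast
    show "(\<lambda>z. F z (s i z)) \<in> borel_measurable M"
    proof (rule measurable_compose_countable'[where I = "s i ` space M"])
      show "s i \<in> measurable M (count_space (s i ` space M))"
        using simple_functionD(1,2)[OF sf] by (intro measurable_count_space_eq2[THEN iffD2]) auto
      show "countable (s i ` space M)" using simple_functionD(1)[OF sf] by (rule countable_finite)
    qed (rule F)
  qed
qed

section \<open>Null sets, Borel representatives and Fubini on products\<close>

lemma null_sets_fst_vimage: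
  assumes "N \<in> null_sets (lborel :: 'a::euclidean_space measure)"
  shows "fst -` N \<in> null_sets (lborel :: ('a \<times> 'b::euclidean_space) measure)"
proof -
  have "(fst -` N :: ('a \<times> 'b) set) = N \<times> UNIV" by auto
  moreover have "N \<times> (UNIV :: 'b set) \<in> sets (lborel \<Otimes>\<^sub>M lborel)" using assms by auto
  moreover have "emeasure (lborel \<Otimes>\<^sub>M lborel) (N \<times> (UNIV :: 'b set)) = emeasure lborel N * emeasure (lborel :: 'b measure) UNIV"
    by (rule sigma_finite_measure.emeasure_pair_measure_Times[OF sigma_finite_lborel]) (use assms in auto)
  ultimately show ?thesis using assms unfolding lborel_prod[symmetric] by (simp add: null_sets_def)
qed

lemma AE_fst:
  assumes "AE x in (lborel :: 'a::euclidean_space measure). P x"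
  shows "AE z in (lborel :: ('a \<times> 'b::euclidean_space) measure). P (fst z)"
proof -
  obtain N where N: "N \<in> null_sets (lborel :: 'a measure)" "{x. \<not> P x} \<subseteq> N"
    using AE_E[OF assms] by (auto simp: null_sets_def)
  show ?thesis by (rule AE_I'[OF null_sets_fst_vimage[OF N(1)]]) (use N(2) in auto)
qed

text \<open>Measurability for the completed measures asks for more than Borel measurability of the
  projection: preimages of null sets must be null.\<close>

lemma fst_measurable_lebesgue: "fst \<in> measurable (lebesgue :: ('a::euclidean_space \<times> 'b::euclidean_space) measure) lebesgue"
proof (rule measurableI)
  fix A :: "'a set" assume "A \<in> sets lebesgue"
  then obtain S N N' where A: "A = S \<union> N" "N \<subseteq> N'" "N' \<in> null_sets lborel" "S \<in> sets lborel"
    by (rule sets_completionE)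
  have "fst -` A = (fst -` S \<union> fst -` N :: ('a \<times> 'b) set)" using A by auto
  moreover have "(fst -` S \<union> fst -` N :: ('a \<times> 'b) set) \<in> sets lebesgue"
  proof (rule sets_completionI)
    show "(fst -` N :: ('a \<times> 'b) set) \<subseteq> fst -` N'" using A(2) by auto
    show "fst -` N' \<in> null_sets (lborel :: ('a \<times> 'b) measure)" by (rule null_sets_fst_vimage[OF A(3)])
    have "S \<times> (UNIV :: 'b set) \<in> sets (lborel \<Otimes>\<^sub>M lborel)" using A(4) by auto
    moreover have "(fst -` S :: ('a \<times> 'b) set) = S \<times> UNIV" by auto
    ultimately show "(fst -` S :: ('a \<times> 'b) set) \<in> sets lborel" by (simp only: lborel_prod)
  qed simp
  ultimately show "fst -` A \<inter> space lebesgue \<in> sets (lebesgue :: ('a \<times> 'b) measure)" by simp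
qed simp

lemma borel_measurable_fst_lebesgue_on:
  assumes "f \<in> borel_measurable (lebesgue_on \<Omega>)"
  shows "(\<lambda>z. f (fst z)) \<in> borel_measurable (lebesgue_on (\<Omega> \<times> I))"
proof -
  have "fst \<in> measurable (lebesgue_on (\<Omega> \<times> I)) (lebesgue_on \<Omega>)"
    by (rule measurable_restrict_space2) (auto intro!: measurable_restrict_space1 fst_measurable_lebesgue simp: space_restrict_space)
  from measurable_compose[OF this assms] show ?thesis .
qed

lemma AE_lebesgue_on_iff:
  assumes "S \<in> sets lebesgue"
  shows "(AE x in lebesgue_on S. P x) \<longleftrightarrow> (AE x in lborel. x \<in> S \<longrightarrow> P x)"
  using assms by (simp add: AE_restrict_space_iff AE_completion_iff)

text \<open>Iterated integrals live on the product of Borel sigma-algebras, which is smaller than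
  the Lebesgue one. Vanishing off \<open>S\<close> lets the representative be integrated over the
  whole space.\<close>

lemma borel_version_real:
  fixes f :: "'a::euclidean_space \<Rightarrow> real"
  assumes S: "S \<in> sets borel" and f: "f \<in> borel_measurable (lebesgue_on S)"
  shows "\<exists>g. g \<in> borel_measurable borel \<and> (\<forall>x. x \<notin> S \<longrightarrow> g x = 0) \<and> (AE x in lborel. x \<in> S \<longrightarrow> f x = g x)"
proof -
  have "(\<lambda>x. indicator S x *\<^sub>R f x) \<in> borel_measurable lebesgue"
    using f S by (subst (asm) borel_measurable_restrict_space_iff) auto
  from completion_ex_borel_measurable_real[OF this]
  obtain g where g: "g \<in> borel_measurable lborel" "AE x in lborel. indicator S x *\<^sub>R f x = g x" by blast
  show ?thesis
  proof (intro exI[of _ "\<lambda>x. indicator S x * g x"] conjI)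
    show "(\<lambda>x. indicator S x * g x) \<in> borel_measurable borel" using g(1) S by simp
    show "AE x in lborel. x \<in> S \<longrightarrow> f x = indicator S x * g x" using g(2) by eventually_elim auto
  qed auto
qed

lemma borel_version:
  fixes f :: "'a::euclidean_space \<Rightarrow> 'b::euclidean_space"
  assumes S: "S \<in> sets borel" and f: "f \<in> borel_measurable (lebesgue_on S)"
  shows "\<exists>g. g \<in> borel_measurable borel \<and> (\<forall>x. x \<notin> S \<longrightarrow> g x = 0) \<and> (AE x in lborel. x \<in> S \<longrightarrow> f x = g x)"
proof -
  have "\<forall>b. \<exists>g. g \<in> borel_measurable borel \<and> (\<forall>x. x \<notin> S \<longrightarrow> g x = 0) \<and> (AE x in lborel. x \<in> S \<longrightarrow> f x \<bullet> b = g x)"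
    using f by (intro allI borel_version_real[OF S] borel_measurable_inner) auto
  from choice[OF this] obtain G where G: "\<forall>b. G b \<in> borel_measurable borel \<and> (\<forall>x. x \<notin> S \<longrightarrow> G b x = 0) \<and>
      (AE x in lborel. x \<in> S \<longrightarrow> f x \<bullet> b = G b x)" by (elim exE)
  show ?thesis
  proof (intro exI[of _ "\<lambda>x. \<Sum>b\<in>Basis. G b x *\<^sub>R b"] conjI)
    show "(\<lambda>x. \<Sum>b\<in>Basis. G b x *\<^sub>R b) \<in> borel_measurable borel" using G by (intro borel_measurable_sum borel_measurable_scaleR borel_measurable_const) blast
    show "\<forall>x. x \<notin> S \<longrightarrow> (\<Sum>b\<in>Basis. G b x *\<^sub>R b) = 0" using G by simp
    have "AE x in lborel. \<forall>b\<in>Basis. x \<in> S \<longrightarrow> f x \<bullet> b = G b x"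
      using G by (intro AE_finite_allI) auto
    then show "AE x in lborel. x \<in> S \<longrightarrow> f x = (\<Sum>b\<in>Basis. G b x *\<^sub>R b)"
    proof eventually_elim
      case (elim x)
      show ?case
      proof
        assume "x \<in> S"
        then have "(\<Sum>b\<in>Basis. G b x *\<^sub>R b) = (\<Sum>b\<in>Basis. (f x \<bullet> b) *\<^sub>R b)" using elim by (intro sum.cong) auto
        then show "f x = (\<Sum>b\<in>Basis. G b x *\<^sub>R b)" by (simp add: euclidean_representation)
      qed
    qed
  qed
qed

lemma integral_borel_version:
  fixes f g :: "'a::euclidean_space \<Rightarrow> 'b::{banach,second_countable_topology}"
  assumes S: "S \<in> sets borel" and g: "g \<in> borel_measurable borel" "\<And>x. x \<notin> S \<Longrightarrow> g x = 0"
    and f: "f \<in> borel_measurable (lebesgue_on S)" and ae: "AE x in lborel. x \<in> S \<longrightarrow> f x = g x"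
  shows "integrable (lebesgue_on S) f \<longleftrightarrow> integrable lborel g" "integral\<^sup>L (lebesgue_on S) f = integral\<^sup>L lborel g"
proof -
  have Sl: "S \<in> sets lebesgue" using S by simp
  have m: "(\<lambda>x. indicator S x *\<^sub>R f x) \<in> borel_measurable lebesgue"
    using f S by (subst (asm) borel_measurable_restrict_space_iff) auto
  have gl: "g \<in> borel_measurable lebesgue" using g(1) by (intro measurable_completion) simp
  have "AE x in lborel. indicator S x *\<^sub>R f x = g x"
    using ae by eventually_elim (auto simp: g(2) indicator_def)
  then have ae': "AE x in lebesgue. indicator S x *\<^sub>R f x = g x" by (simp only: AE_completion_iff)
  have "integrable (lebesgue_on S) f \<longleftrightarrow> integrable lebesgue (\<lambda>x. indicator S x *\<^sub>R f x)"
    using Sl by (simp add: integrable_restrict_space)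
  also have "\<dots> \<longleftrightarrow> integrable lebesgue g" by (rule integrable_cong_AE[OF m gl ae'])
  also have "\<dots> \<longleftrightarrow> integrable lborel g" by (rule integrable_completion) (use g in simp)
  finally show "integrable (lebesgue_on S) f \<longleftrightarrow> integrable lborel g" .
  have "integral\<^sup>L (lebesgue_on S) f = integral\<^sup>L lebesgue (\<lambda>x. indicator S x *\<^sub>R f x)"
    using Sl by (simp add: integral_restrict_space)
  also have "\<dots> = integral\<^sup>L lebesgue g" by (rule integral_cong_AE[OF m gl ae'])
  also have "\<dots> = integral\<^sup>L lborel g" by (rule integral_completion) (use g in simp)
  finally show "integral\<^sup>L (lebesgue_on S) f = integral\<^sup>L lborel g" .
qed

lemma Lp_borel_version:
  fixes f g :: "'a::euclidean_space \<Rightarrow> 'b::{banach,second_countable_topology}"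
  assumes S: "S \<in> sets borel" and g: "g \<in> borel_measurable borel" "\<And>x. x \<notin> S \<Longrightarrow> g x = 0"
    and f: "f \<in> borel_measurable (lebesgue_on S)" and ae: "AE x in lborel. x \<in> S \<longrightarrow> f x = g x"
  shows "Lp p (lebesgue_on S) f \<longleftrightarrow> Lp p lborel g"
proof -
  have "integrable (lebesgue_on S) (\<lambda>x. norm (f x) powr p) \<longleftrightarrow> integrable lborel (\<lambda>x. norm (g x) powr p)"
  proof (rule integral_borel_version(1)[OF S])
    show "(\<lambda>x. norm (g x) powr p) \<in> borel_measurable borel" using g(1) by measurable
    show "(\<lambda>x. norm (f x) powr p) \<in> borel_measurable (lebesgue_on S)" using f by measurable
    show "AE x in lborel. x \<in> S \<longrightarrow> norm (f x) powr p = norm (g x) powr p" using ae by eventually_elim auto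
  qed (simp add: g(2))
  then show ?thesis using f g(1) by (simp add: Lp_def)
qed

text \<open>The exceptional set is first enlarged to a measurable null set, to which Fubini
  applies.\<close>

lemma AE_lborel_pair:
  assumes "AE z in (lborel :: ('a::euclidean_space \<times> 'b::euclidean_space) measure). P z"
  shows "AE x in lborel. AE y in lborel. P (x, y)" "AE y in lborel. AE x in lborel. P (x, y)"
proof -
  have "AE z in (lborel :: 'a measure) \<Otimes>\<^sub>M (lborel :: 'b measure). P z" using assms by (simp only: lborel_prod)
  from AE_E[OF this] obtain N where N: "{z \<in> space (lborel \<Otimes>\<^sub>M lborel). \<not> P z} \<subseteq> N"
    "emeasure (lborel \<Otimes>\<^sub>M lborel) N = 0" "N \<in> sets (lborel \<Otimes>\<^sub>M lborel)" by blast
  have "AE z in (lborel :: 'a measure) \<Otimes>\<^sub>M (lborel :: 'b measure). z \<notin> N"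
    by (rule AE_not_in) (use N in \<open>auto simp: null_sets_def\<close>)
  from lborel_pair.AE_pair[OF this] have 1: "AE x in lborel. AE y in lborel. (x, y) \<notin> N" .
  have "{z \<in> space (lborel \<Otimes>\<^sub>M lborel). (fst z, snd z) \<notin> N} \<in> sets (lborel \<Otimes>\<^sub>M lborel)"
  proof -
    have "{z \<in> space (lborel \<Otimes>\<^sub>M lborel). (fst z, snd z) \<notin> N} = space (lborel \<Otimes>\<^sub>M lborel) - N" by auto
    then show ?thesis using N(3) by (simp only: sets.compl_sets)
  qed
  from lborel_pair.AE_commute[OF this] 1 have 2: "AE y in lborel. AE x in lborel. (x, y) \<notin> N" by simp
  have P: "P z" if "z \<notin> N" for z using N(1) that by (auto simp: space_pair_measure)
  show "AE x in lborel. AE y in lborel. P (x, y)" using 1 by eventually_elim (auto elim!: eventually_mono intro: P)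
  show "AE y in lborel. AE x in lborel. P (x, y)" using 2 by eventually_elim (auto elim!: eventually_mono intro: P)
qed

text \<open>In this direction measurability of the set is essential: null slices alone do not make a
  set null.\<close>

lemma AE_lborel_pairI:
  assumes "{z. P z} \<in> sets (borel :: ('a::euclidean_space \<times> 'b::euclidean_space) measure)"
    and "AE x in lborel. AE y in lborel. P (x, y)"
  shows "AE z in lborel. P z"
proof -
  have "{z \<in> space ((lborel :: 'a measure) \<Otimes>\<^sub>M (lborel :: 'b measure)). P z} \<in> sets (lborel \<Otimes>\<^sub>M lborel)"
    using assms(1) unfolding lborel_prod by simp
  from lborel_pair.AE_pair_measure[OF this assms(2)] show ?thesis unfolding lborel_prod .
qed

lemma lborel_Fubini:
  fixes F :: "'a::euclidean_space \<times> 'b::euclidean_space \<Rightarrow> 'c::{banach,second_countable_topology}"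
  assumes "integrable lborel F"
  shows "AE x in lborel. integrable lborel (\<lambda>y. F (x, y))" "integrable lborel (\<lambda>x. \<integral>y. F (x, y) \<partial>lborel)"
    "(\<integral>x. (\<integral>y. F (x, y) \<partial>lborel) \<partial>lborel) = integral\<^sup>L lborel F"
    "AE y in lborel. integrable lborel (\<lambda>x. F (x, y))" "integrable lborel (\<lambda>y. \<integral>x. F (x, y) \<partial>lborel)"
    "(\<integral>y. (\<integral>x. F (x, y) \<partial>lborel) \<partial>lborel) = integral\<^sup>L lborel F"
proof -
  have i: "integrable ((lborel :: 'a measure) \<Otimes>\<^sub>M (lborel :: 'b measure)) F" using assms by (simp only: lborel_prod)
  have i': "integrable ((lborel :: 'a measure) \<Otimes>\<^sub>M (lborel :: 'b measure)) (case_prod (\<lambda>x y. F (x, y)))" using i by simp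
  show "AE x in lborel. integrable lborel (\<lambda>y. F (x, y))" by (rule lborel_pair.AE_integrable_fst'[OF i])
  show "integrable lborel (\<lambda>x. \<integral>y. F (x, y) \<partial>lborel)" by (rule lborel_pair.integrable_fst'[OF i])
  show "(\<integral>x. (\<integral>y. F (x, y) \<partial>lborel) \<partial>lborel) = integral\<^sup>L lborel F" using lborel_pair.integral_fst'[OF i] by (simp only: lborel_prod)
  show "AE y in lborel. integrable lborel (\<lambda>x. F (x, y))" by (rule lborel_pair.AE_integrable_snd[OF i'])
  show "integrable lborel (\<lambda>y. \<integral>x. F (x, y) \<partial>lborel)" by (rule lborel_pair.integrable_snd[OF i'])
  show "(\<integral>y. (\<integral>x. F (x, y) \<partial>lborel) \<partial>lborel) = integral\<^sup>L lborel F"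
    using lborel_pair.integral_snd[OF i'] by (simp add: lborel_prod)
qed

section \<open>The time derivative of the hysteresis output\<close>

lemma borel_measurable_lebesgue_on:
  fixes F :: "'a::euclidean_space \<Rightarrow> 'b::topological_space"
  assumes "F \<in> borel_measurable borel"
  shows "F \<in> borel_measurable (lebesgue_on S)"
  by (intro measurable_restrict_space1 measurable_completion) (use assms in simp)

lemma Lp_bounded_support:
  fixes F :: "'a::euclidean_space \<Rightarrow> 'b::{banach,second_countable_topology}"
  assumes S: "S \<in> sets borel" "bounded S" and F: "F \<in> borel_measurable borel" "\<And>x. x \<notin> S \<Longrightarrow> F x = 0"
    and q: "Lp q lborel F" "1 \<le> q"
  shows "integrable lborel F" "Lp q (lebesgue_on S) F"
proof -
  have m: "F \<in> borel_measurable (lebesgue_on S)" by (rule borel_measurable_lebesgue_on[OF F(1)])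
  show "Lp q (lebesgue_on S) F" using Lp_borel_version[OF S(1) F m] q(1) by simp
  then have "integrable (lebesgue_on S) F"
    by (rule Lp_integrable[rotated]) (use S q in \<open>auto intro!: finite_measure_lebesgue_on_bounded\<close>)
  then show "integrable lborel F" using integral_borel_version(1)[OF S(1) F m] by simp
qed

lemma slice_measurable:
  fixes F :: "'a::euclidean_space \<times> real \<Rightarrow> 'b::topological_space"
  assumes "F \<in> borel_measurable borel"
  shows "(\<lambda>x. F (x, t)) \<in> borel_measurable borel" "(\<lambda>t. F (x, t)) \<in> borel_measurable borel"
proof -
  have "(\<lambda>x. (x, t)) \<in> borel_measurable (borel :: 'a measure)" "(\<lambda>t. (x, t)) \<in> borel_measurable (borel :: real measure)"
    by (intro borel_measurable_continuous_onI continuous_intros)+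
  then show "(\<lambda>x. F (x, t)) \<in> borel_measurable borel" "(\<lambda>t. F (x, t)) \<in> borel_measurable borel"
    using assms by (auto intro: measurable_compose)
qed

section \<open>From integrated identities to almost every time\<close>

text \<open>On compact subintervals the constant 0 is an indefinite integral of \<open>A\<close>, so
  Lebesgue differentiation gives \<open>A = 0\<close>. Only intervals strictly inside (0,T) are
  offered, because bumps must be compactly supported there.\<close>

lemma integral_intervals_zero_imp_AE_zero:
  fixes A :: "real \<Rightarrow> real"
  assumes A: "integrable lborel A" and T: "0 < T"
    and z: "\<And>a b. 0 < a \<Longrightarrow> a < b \<Longrightarrow> b < T \<Longrightarrow> (\<integral>t. indicator {a<..<b} t * A t \<partial>lborel) = 0"
  shows "AE t in lborel. t \<in> {0<..<T} \<longrightarrow> A t = 0"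
proof -
  have z': "(LINT x:{s..t}|lborel. A x) = 0" if "0 < s" "s \<le> t" "t < T" for s t
  proof -
    have "AE x in lborel. x \<noteq> s" "AE x in lborel. x \<noteq> t" by (rule AE_lborel_singleton)+
    then have "AE x in lborel. indicator {s..t} x *\<^sub>R A x = indicator {s<..<t} x * A x"
      by eventually_elim (auto simp: indicator_def)
    then have "(LINT x:{s..t}|lborel. A x) = (\<integral>t'. indicator {s<..<t} t' * A t' \<partial>lborel)"
      unfolding set_lebesgue_integral_def using A by (intro integral_cong_AE) auto
    also have "\<dots> = 0" using z[of s t] that by (cases "s = t") auto
    finally show ?thesis .
  qed
  \<comment> \<open>These inner intervals exhaust (0,T); the offset 3 makes each of them
    nonempty.\<close>
  have "AE x in lborel. x \<in> {T / (real k + 3)<..<T - T / (real k + 3)} \<longrightarrow> ((\<lambda>_. 0) has_real_derivative A x) (at x)" for k :: nat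
  proof (rule derivative_of_integral[OF A])
    fix s t assume st: "s \<in> {T / (real k + 3)..T - T / (real k + 3)}" "t \<in> {s..T - T / (real k + 3)}"
    have "0 < T / (real k + 3)" using T by simp
    then have "(LINT x:{s..t}|lborel. A x) = 0" using st by (intro z') auto
    then show "(0::real) - 0 = (LINT x:{s..t}|lborel. A x)" by simp
  qed
  then have "AE x in lborel. \<forall>k::nat. x \<in> {T / (real k + 3)<..<T - T / (real k + 3)} \<longrightarrow> ((\<lambda>_. 0) has_real_derivative A x) (at x)"
    unfolding AE_all_countable by (rule allI)
  then show ?thesis
  proof eventually_elim
    case (elim x)
    show ?case
    proof
      assume x: "x \<in> {0<..<T}"
      define m where "m = min x (T - x)"
      have m: "0 < m" using x by (simp add: m_def)
      obtain k :: nat where "T / m < real k" using reals_Archimedean2 by blast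
      then have "T < real k * m" using m by (simp add: pos_divide_less_eq)
      also have "\<dots> \<le> (real k + 3) * m" using m by (intro mult_right_mono) auto
      finally have "T / (real k + 3) < m" by (simp add: pos_divide_less_eq mult.commute)
      then have "x \<in> {T / (real k + 3)<..<T - T / (real k + 3)}" by (auto simp: m_def)
      then have "((\<lambda>_. 0) has_real_derivative A x) (at x)" using elim by blast
      then show "A x = 0" using DERIV_unique[OF _ DERIV_const] by blast
    qed
  qed
qed

lemma bump_bounded_grad: "\<exists>B. \<forall>t. \<bar>grad (bump a b n) t\<bar> \<le> B"
proof -
  have sub: "fsupp (bump a b n) \<subseteq> {a..b}"
    unfolding fsupp_def
  proof (rule closure_minimal)
    show "{x. bump a b n x \<noteq> 0} \<subseteq> {a..b}"
    proof
      fix x assume "x \<in> {x. bump a b n x \<noteq> 0}"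
      then have "x \<in> {a<..<b}" using bump_eq_0[of x a b n] by blast
      then show "x \<in> {a..b}" by auto
    qed
  qed simp
  have "closed (fsupp (bump a b n))" by (simp add: fsupp_def)
  from closed_Int_compact[OF this compact_Icc[of a b]] have "compact (fsupp (bump a b n))" using sub by (simp only: Int_absorb2)
  then have "test_fun UNIV (bump a b n)" unfolding test_fun_def using Cinf_on_bump by simp
  from test_fun_bounded[OF this] show ?thesis by auto
qed

text \<open>The exceptional null set of times must not depend on the test function: the equation is
  localised in time for a countable family whose members, with their gradients, are uniformly dense.\<close>

lemma slices_annihilate_W1p0:
  fixes H :: "'a::euclidean_space \<times> real \<Rightarrow> real" and G :: "'a \<times> real \<Rightarrow> 'a"
  assumes \<Omega>: "open \<Omega>" "bounded \<Omega>" and T: "0 < T" and pq: "p > 1" "q > 1" "1/p + 1/q = 1"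
    and H: "H \<in> borel_measurable borel" "\<And>z. z \<notin> \<Omega> \<times> {0<..<T} \<Longrightarrow> H z = 0" "Lp q lborel H"
    and G: "G \<in> borel_measurable borel" "\<And>z. z \<notin> \<Omega> \<times> {0<..<T} \<Longrightarrow> G z = 0" "Lp q lborel G"
    and eq: "\<And>\<zeta> a b n. test_fun \<Omega> \<zeta> \<Longrightarrow> 0 < a \<Longrightarrow> a < b \<Longrightarrow> b < T \<Longrightarrow>
      (\<integral>z. bump a b n (snd z) * (H z * \<zeta> (fst z) + G z \<bullet> grad \<zeta> (fst z)) \<partial>lborel) = 0"
  shows "AE t in lborel. \<forall>\<phi> D\<phi>. W1p0 p \<Omega> \<phi> D\<phi> \<longrightarrow> (\<integral>x. H (x, t) * \<phi> x + G (x, t) \<bullet> D\<phi> x \<partial>lebesgue_on \<Omega>) = 0"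
proof -
  let ?Q = "\<Omega> \<times> {0<..<T}"
  let ?N = "lebesgue_on \<Omega>"
  have Qo: "open ?Q" using \<Omega> by (intro open_Times) auto
  have Q: "?Q \<in> sets borel" "bounded ?Q" using Qo \<Omega> by (auto intro!: bounded_Times)
  have \<Omega>b: "\<Omega> \<in> sets borel" "\<Omega> \<in> sets lebesgue" using \<Omega> by auto
  have q1: "1 \<le> q" using pq by simp
  have HI: "integrable lborel H" and GI: "integrable lborel G"
    using Lp_bounded_support(1)[OF Q H q1] Lp_bounded_support(1)[OF Q G q1] by auto
  define F where "F \<zeta> z = H z * \<zeta> (fst z) + G z \<bullet> grad \<zeta> (fst z)" for \<zeta> :: "'a \<Rightarrow> real" and z
  have FI: "integrable lborel (F \<zeta>)" if \<zeta>: "test_fun \<Omega> \<zeta>" for \<zeta>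
  proof -
    have C: "Cinf_on UNIV \<zeta>" using \<zeta> by (simp add: test_fun_def)
    obtain B where B: "\<forall>x. \<bar>\<zeta> x\<bar> \<le> B \<and> norm (grad \<zeta> x) \<le> B" using test_fun_bounded[OF \<zeta>] by blast
    have m: "(\<lambda>z. \<zeta> (fst z)) \<in> borel_measurable (borel :: ('a \<times> real) measure)"
        "(\<lambda>z. grad \<zeta> (fst z)) \<in> borel_measurable (borel :: ('a \<times> real) measure)"
      by (intro borel_measurable_continuous_onI continuous_on_compose2[OF Cinf_on_grad(3)[OF C]]
          continuous_on_compose2[OF Cinf_on_grad(2)[OF C]] continuous_intros; simp)+
    have "integrable lborel (\<lambda>z. B * norm (H z) + B * norm (G z))" using HI GI by auto
    then show ?thesis
    proof (rule Bochner_Integration.integrable_bound)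
      show "F \<zeta> \<in> borel_measurable lborel" unfolding F_def[abs_def] using H(1) G(1) m by simp
      show "AE z in lborel. norm (F \<zeta> z) \<le> norm (B * norm (H z) + B * norm (G z))"
      proof (rule AE_I2)
        fix z
        have "norm (F \<zeta> z) \<le> \<bar>H z\<bar> * \<bar>\<zeta> (fst z)\<bar> + norm (G z) * norm (grad \<zeta> (fst z))"
          unfolding F_def real_norm_def
          by (intro order_trans[OF abs_triangle_ineq] add_mono Cauchy_Schwarz_ineq2) (simp add: abs_mult)
        also have "\<dots> \<le> \<bar>H z\<bar> * B + norm (G z) * B" using B by (intro add_mono mult_left_mono) auto
        finally show "norm (F \<zeta> z) \<le> norm (B * norm (H z) + B * norm (G z))" by (simp add: mult.commute)
      qed
    qed
  qed
  \<comment> \<open>The functional applied to \<zeta> on the slice at time \<open>t\<close>. Letting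
    bumps tend to indicators shows that its integral over every inner time interval
    vanishes.\<close>
  define A where "A \<zeta> t = (\<integral>x. F \<zeta> (x, t) \<partial>lborel)" for \<zeta> t
  have A0: "AE t in lborel. A \<zeta> t = 0" if \<zeta>: "test_fun \<Omega> \<zeta>" for \<zeta>
  proof -
    have AI: "integrable lborel (A \<zeta>)" unfolding A_def[abs_def] by (rule lborel_Fubini(5)[OF FI[OF \<zeta>]])
    have "AE t in lborel. t \<in> {0<..<T} \<longrightarrow> A \<zeta> t = 0"
    proof (rule integral_intervals_zero_imp_AE_zero[OF AI T])
      fix a b assume ab: "0 < a" "a < b" "b < T"
      have bm: "(\<lambda>z. bump a b n (snd z)) \<in> borel_measurable (borel :: ('a \<times> real) measure)" for n
        by (intro borel_measurable_continuous_onI continuous_on_compose2[OF Cinf_on_grad(3)[OF Cinf_on_bump]] continuous_intros) auto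
      have im: "(\<lambda>z. indicator {a<..<b} (snd z) :: real) \<in> borel_measurable (borel :: ('a \<times> real) measure)"
      proof -
        have "(\<lambda>z. indicator {a<..<b} (snd z) :: real) = indicator (UNIV \<times> {a<..<b} :: ('a \<times> real) set)"
          by (auto simp: fun_eq_iff indicator_def)
        moreover have "open (UNIV \<times> {a<..<b} :: ('a \<times> real) set)" by (intro open_Times) auto
        ultimately show ?thesis by simp
      qed
      have Fm: "F \<zeta> \<in> borel_measurable borel" using FI[OF \<zeta>] by auto
      have "(\<lambda>n. \<integral>z. bump a b n (snd z) * F \<zeta> z \<partial>lborel) \<longlonglongrightarrow> (\<integral>z. indicator {a<..<b} (snd z) * F \<zeta> z \<partial>lborel)"
      proof (rule integral_dominated_convergence[where w = "\<lambda>z. norm (F \<zeta> z)"])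
        show "AE z in lborel. (\<lambda>n. bump a b n (snd z) * F \<zeta> z) \<longlonglongrightarrow> indicator {a<..<b} (snd z) * F \<zeta> z"
          by (intro AE_I2 tendsto_intros bump_tendsto)
        show "AE z in lborel. norm (bump a b n (snd z) * F \<zeta> z) \<le> norm (F \<zeta> z)" for n
          using bump_bounds[of a b n] by (intro AE_I2) (simp add: abs_mult mult_left_le_one_le)
      qed (use FI[OF \<zeta>] bm im Fm in auto)
      moreover have "(\<integral>z. bump a b n (snd z) * F \<zeta> z \<partial>lborel) = 0" for n
        unfolding F_def by (rule eq[OF \<zeta> ab])
      ultimately have z: "(\<integral>z. indicator {a<..<b} (snd z) * F \<zeta> z \<partial>lborel) = 0"
        by (simp add: LIMSEQ_const_iff)
      have "integrable lborel (\<lambda>z. indicator {a<..<b} (snd z) * F \<zeta> z)"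
        by (rule Bochner_Integration.integrable_bound[OF FI[OF \<zeta>]]) (use im Fm in \<open>auto simp: indicator_def\<close>)
      from lborel_Fubini(6)[OF this] z
      show "(\<integral>t. indicator {a<..<b} t * A \<zeta> t \<partial>lborel) = 0" by (simp add: A_def)
    qed
    then show ?thesis
    proof eventually_elim
      case (elim t)
      show ?case
      proof (cases "t \<in> {0<..<T}")
        case False
        then have "F \<zeta> (x, t) = 0" for x using H(2)[of "(x, t)"] G(2)[of "(x, t)"] by (auto simp: F_def)
        then show ?thesis by (simp add: A_def)
      qed (use elim in simp)
    qed
  qed
  \<comment> \<open>Functions are paired with their gradients so that uniform density holds in the
    C^1 sense, as the term with \<open>G\<close> requires.\<close>
  define E where "E = {\<lambda>x. (\<zeta> x, grad \<zeta> x) | \<zeta>. test_fun \<Omega> \<zeta>}"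
  have "\<exists>C. countable C \<and> C \<subseteq> E \<and> (\<forall>f\<in>E. \<forall>e>0. \<exists>g\<in>C. \<forall>x\<in>closure \<Omega>. dist (f x) (g x) < e)"
  proof (rule countable_uniformly_dense)
    show "compact (closure \<Omega>)" using \<Omega> by (simp add: compact_closure)
    fix f assume "f \<in> E"
    then obtain \<zeta> where "test_fun \<Omega> \<zeta>" "f = (\<lambda>x. (\<zeta> x, grad \<zeta> x))" by (auto simp: E_def)
    moreover then have "Cinf_on UNIV \<zeta>" by (simp add: test_fun_def)
    ultimately show "continuous_on (closure \<Omega>) f"
      using Cinf_on_grad(2,3)[of \<zeta>] by (auto intro!: continuous_intros intro: continuous_on_subset)
  qed
  then obtain C where C: "countable C" "C \<subseteq> E" "\<forall>f\<in>E. \<forall>e>0. \<exists>g\<in>C. \<forall>x\<in>closure \<Omega>. dist (f x) (g x) < e"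
    by (elim exE conjE)
  have "AE t in lborel. \<forall>g\<in>C. A (\<lambda>x. fst (g x)) t = 0"
  proof (subst AE_ball_countable[OF C(1)], rule ballI)
    fix g assume "g \<in> C"
    then obtain \<zeta> where "test_fun \<Omega> \<zeta>" "g = (\<lambda>x. (\<zeta> x, grad \<zeta> x))" using C(2) by (auto simp: E_def)
    then show "AE t in lborel. A (\<lambda>x. fst (g x)) t = 0" using A0[of \<zeta>] by simp
  qed
  moreover have "AE t in lborel. integrable lborel (\<lambda>x. H (x, t))" by (rule lborel_Fubini(4)[OF HI])
  moreover have "AE t in lborel. integrable lborel (\<lambda>x. G (x, t))" by (rule lborel_Fubini(4)[OF GI])
  moreover have "AE t in lborel. integrable lborel (\<lambda>x. norm (H (x, t)) powr q)"
    by (rule lborel_Fubini(4)) (use H(3) in \<open>simp add: Lp_def\<close>)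
  moreover have "AE t in lborel. integrable lborel (\<lambda>x. norm (G (x, t)) powr q)"
    by (rule lborel_Fubini(4)) (use G(3) in \<open>simp add: Lp_def\<close>)
  ultimately show ?thesis
  proof eventually_elim
    case (elim t)
    have HL: "Lp q lborel (\<lambda>x. H (x, t))" "Lp q lborel (\<lambda>x. G (x, t))"
      using elim slice_measurable(1)[OF H(1), of t] slice_measurable(1)[OF G(1), of t] by (auto simp: Lp_def)
    have Hz: "H (x, t) = 0" "G (x, t) = 0" if "x \<notin> \<Omega>" for x using that H(2)[of "(x, t)"] G(2)[of "(x, t)"] by auto
    have HN: "Lp q ?N (\<lambda>x. H (x, t))" "Lp q ?N (\<lambda>x. G (x, t))"
      using Lp_bounded_support(2)[OF \<Omega>b(1) \<Omega>(2) slice_measurable(1)[OF H(1)] Hz(1) HL(1) q1]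
        Lp_bounded_support(2)[OF \<Omega>b(1) \<Omega>(2) slice_measurable(1)[OF G(1)] Hz(2) HL(2) q1] by auto
    have Atest: "A \<zeta> t = 0" if \<zeta>: "test_fun \<Omega> \<zeta>" for \<zeta>
    proof -
      define I where "I = (\<integral>x. \<bar>H (x, t)\<bar> + norm (G (x, t)) \<partial>lborel)"
      have FIs: "integrable lborel (\<lambda>x. F \<xi> (x, t))" if \<xi>: "test_fun \<Omega> \<xi>" for \<xi>
      proof -
        obtain B where B: "\<forall>x. \<bar>\<xi> x\<bar> \<le> B \<and> norm (grad \<xi> x) \<le> B" using test_fun_bounded[OF \<xi>] by blast
        have "integrable lborel (\<lambda>x. B * norm (H (x, t)) + B * norm (G (x, t)))" using elim(2,3) by auto
        then show ?thesis
        proof (rule Bochner_Integration.integrable_bound)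
          show "(\<lambda>x. F \<xi> (x, t)) \<in> borel_measurable lborel"
            using slice_measurable(1)[of "F \<xi>" t] FI[OF \<xi>] by auto
          show "AE x in lborel. norm (F \<xi> (x, t)) \<le> norm (B * norm (H (x, t)) + B * norm (G (x, t)))"
          proof (rule AE_I2)
            fix x
            have "norm (F \<xi> (x, t)) \<le> \<bar>H (x, t)\<bar> * \<bar>\<xi> x\<bar> + norm (G (x, t)) * norm (grad \<xi> x)"
              unfolding F_def real_norm_def fst_conv
              by (intro order_trans[OF abs_triangle_ineq] add_mono Cauchy_Schwarz_ineq2) (simp add: abs_mult)
            also have "\<dots> \<le> \<bar>H (x, t)\<bar> * B + norm (G (x, t)) * B" using B by (intro add_mono mult_left_mono) auto
            finally show "norm (F \<xi> (x, t)) \<le> norm (B * norm (H (x, t)) + B * norm (G (x, t)))" by (simp add: mult.commute)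
          qed
        qed
      qed
      have "I \<ge> 0" unfolding I_def by simp
      \<comment> \<open>The functional vanishes at a member \<xi> of the countable family that is
        C^1-close to \<zeta>, and \<open>I\<close> bounds the effect of the discrepancy.\<close>
      have le: "\<bar>A \<zeta> t\<bar> \<le> e * I" if "e > 0" for e
      proof -
        have \<zeta>E: "(\<lambda>x. (\<zeta> x, grad \<zeta> x)) \<in> E" using \<zeta> by (auto simp: E_def)
        from C(3)[THEN bspec, OF \<zeta>E, THEN spec, THEN mp, OF \<open>e > 0\<close>]
        obtain g where g: "g \<in> C" "\<forall>x\<in>closure \<Omega>. dist (\<zeta> x, grad \<zeta> x) (g x) < e" by (elim bexE)
        then obtain \<xi> where \<xi>: "test_fun \<Omega> \<xi>" "g = (\<lambda>x. (\<xi> x, grad \<xi> x))" using C(2) by (auto simp: E_def)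
        have "A \<xi> t = 0" using elim(1) g(1) \<xi>(2) by auto
        have "A \<zeta> t = A \<zeta> t - A \<xi> t" using \<open>A \<xi> t = 0\<close> by simp
        also have "\<dots> = (\<integral>x. F \<zeta> (x, t) - F \<xi> (x, t) \<partial>lborel)"
          unfolding A_def by (rule Bochner_Integration.integral_diff[symmetric, OF FIs[OF \<zeta>] FIs[OF \<xi>(1)]])
        finally have "\<bar>A \<zeta> t\<bar> \<le> (\<integral>x. norm (F \<zeta> (x, t) - F \<xi> (x, t)) \<partial>lborel)"
          using integral_norm_bound[of lborel "\<lambda>x. F \<zeta> (x, t) - F \<xi> (x, t)"] by simp
        also have "\<dots> \<le> (\<integral>x. e * (\<bar>H (x, t)\<bar> + norm (G (x, t))) \<partial>lborel)"
        proof (rule integral_mono)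
          show "integrable lborel (\<lambda>x. norm (F \<zeta> (x, t) - F \<xi> (x, t)))"
            by (intro integrable_norm Bochner_Integration.integrable_diff FIs \<zeta> \<xi>(1))
          show "integrable lborel (\<lambda>x. e * (\<bar>H (x, t)\<bar> + norm (G (x, t))))" using elim(2,3) by auto
          fix x
          show "norm (F \<zeta> (x, t) - F \<xi> (x, t)) \<le> e * (\<bar>H (x, t)\<bar> + norm (G (x, t)))"
          proof (cases "x \<in> \<Omega>")
            case True
            then have d: "dist (\<zeta> x, grad \<zeta> x) (\<xi> x, grad \<xi> x) < e" using g(2) \<xi>(2) closure_subset by auto
            have d1: "\<bar>\<zeta> x - \<xi> x\<bar> \<le> e" using d dist_fst_le[of "(\<zeta> x, grad \<zeta> x)" "(\<xi> x, grad \<xi> x)"] by (simp add: dist_real_def)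
            have d2: "norm (grad \<zeta> x - grad \<xi> x) \<le> e" using d dist_snd_le[of "(\<zeta> x, grad \<zeta> x)" "(\<xi> x, grad \<xi> x)"] by (simp add: dist_norm)
            have "F \<zeta> (x, t) - F \<xi> (x, t) = H (x, t) * (\<zeta> x - \<xi> x) + G (x, t) \<bullet> (grad \<zeta> x - grad \<xi> x)"
              by (simp add: F_def algebra_simps inner_diff_right)
            then have "norm (F \<zeta> (x, t) - F \<xi> (x, t)) \<le> \<bar>H (x, t)\<bar> * \<bar>\<zeta> x - \<xi> x\<bar> + norm (G (x, t)) * norm (grad \<zeta> x - grad \<xi> x)"
              unfolding real_norm_def
              by (simp only:) (intro order_trans[OF abs_triangle_ineq] add_mono Cauchy_Schwarz_ineq2, simp add: abs_mult)
            also have "\<dots> \<le> \<bar>H (x, t)\<bar> * e + norm (G (x, t)) * e" using d1 d2 by (intro add_mono mult_left_mono) auto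
            finally show ?thesis by (simp add: algebra_simps)
          next
            case False
            then show ?thesis using Hz[OF False] by (simp add: F_def)
          qed
        qed
        also have "\<dots> = e * I" by (simp add: I_def)
        finally show ?thesis .
      qed
      show ?thesis
      proof (rule ccontr)
        assume "A \<zeta> t \<noteq> 0"
        \<comment> \<open>Dividing by \<open>I + 1\<close> instead of \<open>I\<close> also covers
          \<open>I = 0\<close>.\<close>
        then have "0 < \<bar>A \<zeta> t\<bar> / (I + 1)" using \<open>I \<ge> 0\<close> by simp
        from le[OF this] have "\<bar>A \<zeta> t\<bar> * (I + 1) \<le> \<bar>A \<zeta> t\<bar> * I" using \<open>I \<ge> 0\<close> by (simp add: field_simps)
        then show False using \<open>A \<zeta> t \<noteq> 0\<close> by (simp add: distrib_left)
      qed
    qed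
    \<comment> \<open>From test functions the identity extends to the Sobolev space by continuity,
      since both slices lie in L^q.\<close>
    show ?case
    proof (intro allI impI)
      fix \<phi> D\<phi> assume W: "W1p0 p \<Omega> \<phi> D\<phi>"
      obtain \<phi>s where \<phi>s: "\<forall>k. test_fun \<Omega> (\<phi>s k)" "(\<lambda>k. LINT x:\<Omega>|lebesgue. \<bar>\<phi>s k x - \<phi> x\<bar> powr p) \<longlonglongrightarrow> 0"
        "(\<lambda>k. LINT x:\<Omega>|lebesgue. norm (grad (\<phi>s k) x - D\<phi> x) powr p) \<longlonglongrightarrow> 0"
        using W unfolding W1p0_def by (elim exE conjE)
      have L: "Lp p ?N \<phi>" "Lp p ?N D\<phi>" using W by (simp_all add: W1p0_def)
      have T: "Lp p ?N (\<phi>s k)" "Lp p ?N (grad (\<phi>s k))" for k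
        using test_fun_Lp[OF _ \<Omega>b(2) \<Omega>(2), of "\<phi>s k" p] \<phi>s(1) pq(1) by auto
      have 1: "(\<lambda>k. \<integral>x. \<phi>s k x \<bullet> H (x, t) \<partial>?N) \<longlonglongrightarrow> (\<integral>x. \<phi> x \<bullet> H (x, t) \<partial>?N)"
        by (rule Lp_inner_tendsto[OF T(1) L(1) _ HN(1) pq]) (use \<phi>s(2) in \<open>simp add: set_integral_lebesgue_on[OF \<Omega>b(2)]\<close>)
      have 2: "(\<lambda>k. \<integral>x. grad (\<phi>s k) x \<bullet> G (x, t) \<partial>?N) \<longlonglongrightarrow> (\<integral>x. D\<phi> x \<bullet> G (x, t) \<partial>?N)"
        by (rule Lp_inner_tendsto[OF T(2) L(2) _ HN(2) pq]) (use \<phi>s(3) in \<open>simp add: set_integral_lebesgue_on[OF \<Omega>b(2)]\<close>)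
      have split: "(\<integral>x. H (x, t) * f x + G (x, t) \<bullet> D x \<partial>?N) = (\<integral>x. f x \<bullet> H (x, t) \<partial>?N) + (\<integral>x. D x \<bullet> G (x, t) \<partial>?N)"
        if "Lp p ?N f" "Lp p ?N D" for f D
        using Bochner_Integration.integral_add[OF Lp_inner_integrable[OF that(1) HN(1) pq] Lp_inner_integrable[OF that(2) HN(2) pq]]
        by (simp add: inner_commute mult.commute)
      have 0: "(\<integral>x. \<phi>s k x \<bullet> H (x, t) \<partial>?N) + (\<integral>x. grad (\<phi>s k) x \<bullet> G (x, t) \<partial>?N) = 0" for k
      proof -
        have tk: "test_fun \<Omega> (\<phi>s k)" using \<phi>s(1) by blast
        have "(\<lambda>x. F (\<phi>s k) (x, t)) \<in> borel_measurable borel" using slice_measurable(1)[of "F (\<phi>s k)" t] FI[OF tk] by auto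
        then have "(\<integral>x. F (\<phi>s k) (x, t) \<partial>?N) = (\<integral>x. F (\<phi>s k) (x, t) \<partial>lborel)"
          by (intro integral_borel_version(2)[OF \<Omega>b(1)]) (auto simp: F_def Hz intro: borel_measurable_lebesgue_on)
        also have "\<dots> = 0" using Atest[OF tk] by (simp add: A_def)
        finally show ?thesis using split[OF T, of k k] by (simp add: F_def)
      qed
      have "(\<lambda>k. 0::real) \<longlonglongrightarrow> (\<integral>x. \<phi> x \<bullet> H (x, t) \<partial>?N) + (\<integral>x. D\<phi> x \<bullet> G (x, t) \<partial>?N)"
        using tendsto_add[OF 1 2] unfolding 0 .
      then show "(\<integral>x. H (x, t) * \<phi> x + G (x, t) \<bullet> D\<phi> x \<partial>?N) = 0"
        unfolding split[OF L] by (simp add: LIMSEQ_const_iff)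
    qed
  qed
qed

section \<open>A jointly measurable time derivative\<close>

text \<open>Lets an almost everywhere identity be used at the shifted times that a difference
  quotient samples.\<close>

lemma AE_lborel_translate:
  fixes c :: real
  assumes "AE t in lborel. P t"
  shows "AE t in lborel. P (c + t)"
proof -
  from AE_E[OF assms] obtain N where N': "{t \<in> space lborel. \<not> P t} \<subseteq> N" "emeasure lborel N = 0" "N \<in> sets lborel"
    by blast
  then have N: "N \<in> null_sets lborel" "{t. \<not> P t} \<subseteq> N" by (simp_all add: null_setsI)
  have "emeasure lborel ((+) c -` N) = emeasure (distr lborel borel ((+) c)) N"
    using N(1) by (subst emeasure_distr) auto
  also have "\<dots> = 0" using N(1) by (simp add: lborel_distr_plus null_setsD1)
  finally have "(+) c -` N \<in> null_sets lborel"
    using N(1) measurable_sets[of "(+) c" "borel :: real measure" borel N] by (auto simp: null_sets_def)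
  then show ?thesis by (rule AE_I') (use N(2) in auto)
qed

lemma abs_cont_on_cong:
  assumes f: "abs_cont_on S f" and eq: "\<And>x. x \<in> S \<Longrightarrow> g x = f x"
  shows "abs_cont_on S g"
  by (rule abs_cont_on_dominated[OF f f, where C = 1]) (simp add: eq)

text \<open>Line by line the derivative exists almost everywhere; joint measurability is gained by
  writing it as the limit of difference quotients of a Borel representative along one fixed sequence
  of steps.\<close>

lemma abs_cont_derivative_version:
  fixes w :: "'a::euclidean_space \<times> real \<Rightarrow> real"
  assumes \<Omega>: "open \<Omega>" and T: "0 < T"
    and w: "w \<in> borel_measurable (lebesgue_on (\<Omega> \<times> {0<..<T}))"
    and ac: "AE x in lborel. x \<in> \<Omega> \<longrightarrow> abs_cont_on {0..T} (\<lambda>t. w (x, t))"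
  shows "\<exists>wt. wt \<in> borel_measurable borel \<and> (\<forall>z. z \<notin> \<Omega> \<times> {0<..<T} \<longrightarrow> wt z = 0) \<and>
    (AE x in lborel. x \<in> \<Omega> \<longrightarrow> (AE t in lborel. t \<in> {0<..<T} \<longrightarrow> ((\<lambda>s. w (x, s)) has_real_derivative wt (x, t)) (at t)))"
proof -
  let ?Q = "\<Omega> \<times> {0<..<T}"
  have Q: "?Q \<in> sets borel" using \<Omega> by (intro borel_open open_Times) auto
  obtain v where v: "v \<in> borel_measurable borel" "AE z in lborel. z \<in> ?Q \<longrightarrow> w z = v z"
    using borel_version_real[OF Q w] by blast
  define h where "h k = 1 / real (Suc k)" for k
  have h: "h k > 0" for k by (simp add: h_def)
  have hl: "filterlim h (at 0) sequentially"
    unfolding filterlim_at using h LIMSEQ_inverse_real_of_nat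
    by (auto simp: h_def[abs_def] inverse_eq_divide)
  define D where "D k z = (v (fst z, h k + snd z) - v z) / h k" for k z
  have Dm: "D k \<in> borel_measurable borel" for k
  proof -
    have "(\<lambda>z. (fst z, h k + snd z)) \<in> borel_measurable (borel :: ('a \<times> real) measure)"
      by (intro borel_measurable_continuous_onI continuous_intros)
    from measurable_compose[OF this v(1)] show ?thesis unfolding D_def[abs_def] using v(1) by simp
  qed
  \<comment> \<open>Where the quotients diverge, \<open>lim\<close> has an unspecified value;
    measurability is unaffected, and only a null set is concerned.\<close>
  define wt where "wt z = indicator ?Q z * lim (\<lambda>k. D k z)" for z
  show ?thesis
  proof (intro exI[of _ wt] conjI)
    show "wt \<in> borel_measurable borel"
      unfolding wt_def[abs_def] using Q Dm by (intro borel_measurable_times borel_measurable_indicator borel_measurable_lim_metric) auto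
    show "\<forall>z. z \<notin> ?Q \<longrightarrow> wt z = 0" by (simp add: wt_def)
    show "AE x in lborel. x \<in> \<Omega> \<longrightarrow> (AE t in lborel. t \<in> {0<..<T} \<longrightarrow> ((\<lambda>s. w (x, s)) has_real_derivative wt (x, t)) (at t))"
      using ac AE_lborel_pair(1)[OF v(2)]
    proof eventually_elim
      case (elim x)
      show ?case
      proof
        assume x: "x \<in> \<Omega>"
        then have "abs_cont_on {0..T} (\<lambda>t. w (x, t))" using elim by blast
        from abs_cont_on_FTC[OF this T]
        obtain g where "AE t in lborel. t \<in> {0<..<T} \<longrightarrow> ((\<lambda>t. w (x, t)) has_real_derivative g t) (at t)"
          by (elim exE conjE)
        \<comment> \<open>There are countably many shifts, so for almost every \<open>t\<close> the
          representative agrees with \<open>w\<close> at all sampled times simultaneously.\<close>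
        moreover have "AE t in lborel. \<forall>k. (x, h k + t) \<in> ?Q \<longrightarrow> w (x, h k + t) = v (x, h k + t)"
          unfolding AE_all_countable by (intro allI AE_lborel_translate[OF elim(2)])
        ultimately show "AE t in lborel. t \<in> {0<..<T} \<longrightarrow> ((\<lambda>s. w (x, s)) has_real_derivative wt (x, t)) (at t)"
          using elim(2)
        proof eventually_elim
          case (elim t)
          show ?case
          proof
            assume t: "t \<in> {0<..<T}"
            then have d: "((\<lambda>s. w (x, s)) has_real_derivative g t) (at t)" using elim by blast
            then have "((\<lambda>r. (w (x, t + r) - w (x, t)) / r) \<longlongrightarrow> g t) (at 0)"
              by (simp add: DERIV_def)
            from filterlim_compose[OF this hl]
            have lim: "(\<lambda>k. (w (x, t + h k) - w (x, t)) / h k) \<longlonglongrightarrow> g t" .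
            have "h \<longlonglongrightarrow> 0" using hl by (simp add: filterlim_at)
            then have "eventually (\<lambda>k. h k < T - t) sequentially" using t by (intro order_tendstoD) auto
            then have "eventually (\<lambda>k. (w (x, t + h k) - w (x, t)) / h k = D k (x, t)) sequentially"
            proof eventually_elim
              case (elim k)
              then have "(x, h k + t) \<in> ?Q" using x t h[of k] by auto
              then have "w (x, h k + t) = v (x, h k + t)" using \<open>\<forall>k. (x, h k + t) \<in> ?Q \<longrightarrow> w (x, h k + t) = v (x, h k + t)\<close> by blast
              moreover have "w (x, t) = v (x, t)" using \<open>(x, t) \<in> ?Q \<longrightarrow> w (x, t) = v (x, t)\<close> x t by auto
              ultimately show ?case by (simp add: D_def add.commute)
            qed
            then have "(\<lambda>k. D k (x, t)) \<longlonglongrightarrow> g t" using lim by (rule Lim_transform_eventually[rotated])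
            then have "wt (x, t) = g t" using x t by (simp add: wt_def limI)
            then show "((\<lambda>s. w (x, s)) has_real_derivative wt (x, t)) (at t)" using d by simp
          qed
        qed
      qed
    qed
  qed
qed

lemma Lp_fst:
  fixes \<kappa> :: "'a::euclidean_space \<Rightarrow> real"
  assumes \<kappa>: "Lp r lborel \<kappa>" and T: "0 < T"
  shows "Lp r lborel (\<lambda>z. \<kappa> (fst z) * indicator {0<..<T} (snd z :: real))"
proof -
  have \<kappa>m: "\<kappa> \<in> borel_measurable borel" using \<kappa> by (simp add: Lp_def)
  have f: "fst \<in> borel_measurable (borel :: ('a \<times> real) measure)" by (intro borel_measurable_continuous_onI continuous_intros)
  have s: "snd \<in> borel_measurable (borel :: ('a \<times> real) measure)" by (intro borel_measurable_continuous_onI continuous_intros)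
  have m: "(\<lambda>z :: 'a \<times> real. \<kappa> (fst z) * indicator {0<..<T} (snd z)) \<in> borel_measurable borel"
    using measurable_compose[OF f \<kappa>m] measurable_compose[OF s, of "indicator {0<..<T} :: real \<Rightarrow> real" borel] by simp
  have eq: "norm (\<kappa> x * indicator {0<..<T} t) powr r = norm (\<kappa> x) powr r * indicator {0<..<T} t" for x t
    by (simp add: indicator_def)
  have i0: "integrable lborel (indicator {0<..<T} :: real \<Rightarrow> real)"
    by (rule integrable_real_indicator) (use T in \<open>simp_all add: less_imp_le\<close>)
  have "integrable (lborel \<Otimes>\<^sub>M lborel) (\<lambda>(x, t). norm (\<kappa> x * indicator {0<..<T} t) powr r :: real)"
  proof (rule lborel_pair.Fubini_integrable)
    show "(\<lambda>(x, t). norm (\<kappa> x * indicator {0<..<T} t) powr r) \<in> borel_measurable (lborel \<Otimes>\<^sub>M lborel)"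
      unfolding lborel_prod using m by (simp add: case_prod_unfold)
    have "(\<integral>t. norm (norm (\<kappa> x * indicator {0<..<T} t) powr r) \<partial>lborel) = norm (\<kappa> x) powr r * T" for x
      unfolding eq using T by simp
    then show "integrable lborel (\<lambda>x. \<integral>t. norm (case (x, t) of (x, t) \<Rightarrow> norm (\<kappa> x * indicator {0<..<T} t) powr r) \<partial>lborel)"
      using \<kappa> by (simp add: Lp_def)
    show "AE x in lborel. integrable lborel (\<lambda>t. case (x, t) of (x, t) \<Rightarrow> norm (\<kappa> x * indicator {0<..<T} t) powr r)"
      unfolding eq using i0 by simp
  qed
  then show ?thesis unfolding Lp_def using m by (simp add: lborel_prod case_prod_unfold)
qed

text \<open>Tonelli for a Borel representative; the bound per slice is multiplied by the length
  \<open>T\<close>.\<close>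

lemma Lp_of_slice_bound:
  fixes D :: "'a::euclidean_space \<times> real \<Rightarrow> 'b::euclidean_space"
  assumes \<Omega>: "open \<Omega>" and T: "0 < T" and D: "D \<in> borel_measurable (lebesgue_on (\<Omega> \<times> {0<..<T}))"
    and L: "AE t in lborel. t \<in> {0<..<T} \<longrightarrow> Lp r (lebesgue_on \<Omega>) (\<lambda>x. D (x, t)) \<and> (\<integral>x. norm (D (x, t)) powr r \<partial>lebesgue_on \<Omega>) \<le> M"
  shows "Lp r (lebesgue_on (\<Omega> \<times> {0<..<T})) D"
proof -
  let ?Q = "\<Omega> \<times> {0<..<T}"
  have Q: "?Q \<in> sets borel" using \<Omega> by (intro borel_open open_Times) auto
  have \<Omega>b: "\<Omega> \<in> sets borel" using \<Omega> by simp
  from borel_version[OF Q D] obtain E where E: "E \<in> borel_measurable borel" "\<forall>z. z \<notin> ?Q \<longrightarrow> E z = 0"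
    "AE z in lborel. z \<in> ?Q \<longrightarrow> D z = E z" by (elim exE conjE)
  have E0: "E z = 0" if "z \<notin> ?Q" for z using E(2) that by blast
  have m: "(\<lambda>z. norm (E z) powr r) \<in> borel_measurable borel" using E(1) by measurable
  have bd: "AE t in lborel. (\<integral>\<^sup>+x. ennreal (norm (E (x, t)) powr r) \<partial>lborel) \<le> ennreal M * indicator {0<..<T} t"
    using L AE_lborel_pair(2)[OF E(3)]
  proof eventually_elim
    case (elim t)
    show ?case
    proof (cases "t \<in> {0<..<T}")
      case True
      have ae: "AE x in lborel. x \<in> \<Omega> \<longrightarrow> D (x, t) = E (x, t)" using elim(2) by eventually_elim (use True in auto)
      have LD: "Lp r (lebesgue_on \<Omega>) (\<lambda>x. D (x, t))" "(\<integral>x. norm (D (x, t)) powr r \<partial>lebesgue_on \<Omega>) \<le> M" using elim(1) True by auto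
      have mD: "(\<lambda>x. D (x, t)) \<in> borel_measurable (lebesgue_on \<Omega>)" using LD(1) by (simp add: Lp_def)
      have ae': "AE x in lborel. x \<in> \<Omega> \<longrightarrow> norm (D (x, t)) powr r = norm (E (x, t)) powr r" using ae by eventually_elim auto
      have mD': "(\<lambda>x. norm (D (x, t)) powr r) \<in> borel_measurable (lebesgue_on \<Omega>)" using mD by measurable
      have z: "norm (E (x, t)) powr r = 0" if "x \<notin> \<Omega>" for x using E0[of "(x, t)"] that by auto
      note v = integral_borel_version[OF \<Omega>b slice_measurable(1)[OF m] z mD' ae']
      have "integrable lborel (\<lambda>x. norm (E (x, t)) powr r)" using v(1) LD(1) by (simp add: Lp_def)
      then have "(\<integral>\<^sup>+x. ennreal (norm (E (x, t)) powr r) \<partial>lborel) = ennreal (\<integral>x. norm (E (x, t)) powr r \<partial>lborel)"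
        by (rule nn_integral_eq_integral) simp
      also have "\<dots> \<le> ennreal M" using v(2) LD(2) by (intro ennreal_leI) simp
      finally show ?thesis using True by simp
    next
      case False
      then have "E (x, t) = 0" for x using E0[of "(x, t)"] by auto
      then show ?thesis by simp
    qed
  qed
  have "(\<integral>\<^sup>+z. ennreal (norm (E z) powr r) \<partial>lborel) = (\<integral>\<^sup>+t. (\<integral>\<^sup>+x. ennreal (norm (E (x, t)) powr r) \<partial>lborel) \<partial>lborel)"
    using lborel_pair.nn_integral_snd[of "\<lambda>z. ennreal (norm (E z) powr r)"] m by (simp add: lborel_prod)
  also have "\<dots> \<le> (\<integral>\<^sup>+t. ennreal M * indicator {0<..<T} t \<partial>lborel)" by (rule nn_integral_mono_AE[OF bd])
  also have "\<dots> = ennreal M * ennreal T" using T by (simp add: nn_integral_cmult_indicator)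
  also have "\<dots> < \<infinity>" by (simp add: ennreal_mult_less_top)
  finally have "integrable lborel (\<lambda>z. norm (E z) powr r)"
    using m by (intro integrableI_bounded) auto
  then have "Lp r lborel E" using E(1) by (simp add: Lp_def)
  then show ?thesis using Lp_borel_version[OF Q E(1) E0 D E(3)] by simp
qed

section \<open>The dual time derivative as a function\<close>

text \<open>For almost every \<open>x\<close> the product of \<open>w(x,.)\<close> with the bump is
  absolutely continuous and vanishes at 0 and \<open>T\<close>. The fundamental theorem on each
  line, followed by Fubini, gives the identity.\<close>

lemma time_integration_by_parts:
  fixes w wt :: "'a::euclidean_space \<times> real \<Rightarrow> real"
  assumes \<Omega>: "open \<Omega>" "bounded \<Omega>" and ab: "0 < a" "a < b" "b < T"
    and w: "Lp 2 (lebesgue_on (\<Omega> \<times> {0<..<T})) w"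
    and wt: "wt \<in> borel_measurable borel" "\<And>z. z \<notin> \<Omega> \<times> {0<..<T} \<Longrightarrow> wt z = 0" "integrable lborel wt"
    and ac: "AE x in lborel. x \<in> \<Omega> \<longrightarrow> abs_cont_on {0..T} (\<lambda>t. w (x, t)) \<and>
      (AE t in lborel. t \<in> {0<..<T} \<longrightarrow> ((\<lambda>s. w (x, s)) has_real_derivative wt (x, t)) (at t))"
    and \<zeta>: "test_fun \<Omega> \<zeta>"
  shows "- (LINT z:\<Omega> \<times> {0<..<T}|lebesgue. w z * d_t (\<lambda>z. bump a b n (snd z) * \<zeta> (fst z)) z) =
     (\<integral>z. bump a b n (snd z) * (wt z * \<zeta> (fst z)) \<partial>lborel)"
proof -
  let ?Q = "\<Omega> \<times> {0<..<T}"
  let ?\<theta> = "bump a b n"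
  let ?\<theta>' = "grad (bump a b n)"
  have T: "0 < T" using ab by simp
  have Qb: "?Q \<in> sets borel" "bounded ?Q" using \<Omega> by (auto intro!: borel_open open_Times bounded_Times)
  have wm: "w \<in> borel_measurable (lebesgue_on ?Q)" using w by (simp add: Lp_def)
  from borel_version_real[OF Qb(1) wm] obtain v where v: "v \<in> borel_measurable borel" "\<forall>z. z \<notin> ?Q \<longrightarrow> v z = 0"
    "AE z in lborel. z \<in> ?Q \<longrightarrow> w z = v z" by (elim exE conjE)
  have v0: "v z = 0" if "z \<notin> ?Q" for z using v(2) that by blast
  have "Lp 2 lborel v" using Lp_borel_version[OF Qb(1) v(1) v0 wm v(3)] w by simp
  then have vI: "integrable lborel v" using Lp_bounded_support(1)[OF Qb v(1) v0] by simp
  have C: "Cinf_on UNIV \<zeta>" using \<zeta> by (simp add: test_fun_def)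
  obtain B where B: "\<forall>x. \<bar>\<zeta> x\<bar> \<le> B \<and> norm (grad \<zeta> x) \<le> B" using test_fun_bounded[OF \<zeta>] by blast
  obtain B' where B': "\<forall>t. \<bar>?\<theta>' t\<bar> \<le> B'" using bump_bounded_grad by blast
  have m1: "(\<lambda>z. \<zeta> (fst z)) \<in> borel_measurable (borel :: ('a \<times> real) measure)"
      "(\<lambda>z. ?\<theta> (snd z)) \<in> borel_measurable (borel :: ('a \<times> real) measure)"
      "(\<lambda>z. ?\<theta>' (snd z)) \<in> borel_measurable (borel :: ('a \<times> real) measure)"
    by (intro borel_measurable_continuous_onI continuous_on_compose2[OF Cinf_on_grad(3)[OF C]]
        continuous_on_compose2[OF Cinf_on_grad(3)[OF Cinf_on_bump]]
        continuous_on_compose2[OF Cinf_on_grad(2)[OF Cinf_on_bump]] continuous_intros; simp)+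
  have m2: "?\<theta> \<in> borel_measurable borel" "?\<theta>' \<in> borel_measurable borel"
    by (intro borel_measurable_continuous_onI Cinf_on_grad[OF Cinf_on_bump])+
  have i1: "integrable lborel (\<lambda>z. v z * ?\<theta>' (snd z) * \<zeta> (fst z))"
  proof (rule Bochner_Integration.integrable_bound)
    show "integrable lborel (\<lambda>z. B' * B * v z)" using vI by simp
    show "AE z in lborel. norm (v z * ?\<theta>' (snd z) * \<zeta> (fst z)) \<le> norm (B' * B * v z)"
    proof (rule AE_I2)
      fix z
      have "\<bar>?\<theta>' (snd z)\<bar> * \<bar>\<zeta> (fst z)\<bar> \<le> \<bar>B'\<bar> * \<bar>B\<bar>"
        using B B' by (intro mult_mono) (auto intro: order_trans[OF _ abs_ge_self])
      from mult_left_mono[OF this, of "\<bar>v z\<bar>"]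
      show "norm (v z * ?\<theta>' (snd z) * \<zeta> (fst z)) \<le> norm (B' * B * v z)" by (simp add: abs_mult ac_simps)
    qed
  qed (use v(1) m1 in simp)
  have i2: "integrable lborel (\<lambda>z. wt z * ?\<theta> (snd z) * \<zeta> (fst z))"
  proof (rule Bochner_Integration.integrable_bound)
    show "integrable lborel (\<lambda>z. B * wt z)" using wt(3) by simp
    show "AE z in lborel. norm (wt z * ?\<theta> (snd z) * \<zeta> (fst z)) \<le> norm (B * wt z)"
    proof (rule AE_I2)
      fix z
      have "\<bar>?\<theta> (snd z)\<bar> * \<bar>\<zeta> (fst z)\<bar> \<le> 1 * \<bar>B\<bar>"
        using B bump_bounds[of a b n "snd z"] by (intro mult_mono) (auto intro: order_trans[OF _ abs_ge_self])
      from mult_left_mono[OF this, of "\<bar>wt z\<bar>"]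
      show "norm (wt z * ?\<theta> (snd z) * \<zeta> (fst z)) \<le> norm (B * wt z)" by (simp add: abs_mult ac_simps)
    qed
  qed (use wt(1) m1 in simp)
  have tz: "AE x in lborel. (\<integral>t. v (x, t) * ?\<theta>' t * \<zeta> x + wt (x, t) * ?\<theta> t * \<zeta> x \<partial>lborel) = 0"
    using ac AE_lborel_pair(1)[OF v(3)]
  proof eventually_elim
    case (elim x)
    show ?case
    proof (cases "x \<in> \<Omega>")
      case False
      then have "v (x, t) = 0" "wt (x, t) = 0" for t using v0[of "(x, t)"] wt(2)[of "(x, t)"] by auto
      then show ?thesis by simp
    next
      case True
      let ?h = "\<lambda>t. v (x, t) * ?\<theta>' t + wt (x, t) * ?\<theta> t"
      have A1: "abs_cont_on {0..T} (\<lambda>t. w (x, t))"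
        and A2: "AE t in lborel. t \<in> {0<..<T} \<longrightarrow> ((\<lambda>s. w (x, s)) has_real_derivative wt (x, t)) (at t)"
        using elim(1) True by auto
      have "abs_cont_on {0..T} ?\<theta>"
      proof (rule abs_cont_on_dominated[OF abs_cont_on_ident abs_cont_on_ident, where C = "\<bar>B'\<bar>"])
        fix s t :: real
        have "norm (?\<theta> s - ?\<theta> t) \<le> B' * norm (s - t)"
          by (rule field_differentiable_bound[of UNIV]) (use bump_derivative B' in auto)
        also have "\<dots> \<le> \<bar>B'\<bar> * (\<bar>s - t\<bar> + \<bar>s - t\<bar>)" by (intro mult_mono) auto
        finally show "\<bar>?\<theta> s - ?\<theta> t\<bar> \<le> \<bar>B'\<bar> * (\<bar>s - t\<bar> + \<bar>s - t\<bar>)" by simp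
      qed
      then have A3: "abs_cont_on {0..T} (\<lambda>t. w (x, t) * ?\<theta> t)" by (rule abs_cont_on_mult[OF A1])
      have hm: "?h \<in> borel_measurable lborel"
        using slice_measurable(2)[OF v(1), of x] slice_measurable(2)[OF wt(1), of x] m2 by simp
      have d: "AE t in lborel. t \<in> {0<..<T} \<longrightarrow> ((\<lambda>t. w (x, t) * ?\<theta> t) has_real_derivative ?h t) (at t)"
        using A2 elim(2)
      proof eventually_elim
        case (elim t)
        show ?case
        proof
          assume t: "t \<in> {0<..<T}"
          have "w (x, t) = v (x, t)" using elim(2) t True by auto
          moreover have "((\<lambda>t. w (x, t) * ?\<theta> t) has_real_derivative wt (x, t) * ?\<theta> t + ?\<theta>' t * w (x, t)) (at t)"
            by (rule DERIV_mult) (use elim(1) t bump_derivative in auto)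
          ultimately show "((\<lambda>t. w (x, t) * ?\<theta> t) has_real_derivative ?h t) (at t)" by (simp add: algebra_simps)
        qed
      qed
      have "(LINT t:{0..T}|lborel. ?h t) = w (x, T) * ?\<theta> T - w (x, 0) * ?\<theta> 0"
        by (rule abs_cont_on_FTC_derivative(2)[OF A3 T hm d, symmetric]) (use T in auto)
      also have "\<dots> = 0" using bump_eq_0[of T a b n] bump_eq_0[of 0 a b n] ab by simp
      also have "(LINT t:{0..T}|lborel. ?h t) = (\<integral>t. ?h t \<partial>lborel)"
        unfolding set_lebesgue_integral_def
      proof (rule Bochner_Integration.integral_cong[OF refl])
        fix t
        show "indicator {0..T} t *\<^sub>R ?h t = ?h t"
          using v0[of "(x, t)"] wt(2)[of "(x, t)"] by (cases "t \<in> {0<..<T}") auto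
      qed
      finally have "(\<integral>t. ?h t \<partial>lborel) = 0" .
      moreover have "v (x, t) * ?\<theta>' t * \<zeta> x + wt (x, t) * ?\<theta> t * \<zeta> x = ?h t * \<zeta> x" for t by (simp add: algebra_simps)
      ultimately show ?thesis by simp
    qed
  qed
  have "(\<integral>z. v z * ?\<theta>' (snd z) * \<zeta> (fst z) + wt z * ?\<theta> (snd z) * \<zeta> (fst z) \<partial>lborel) = (\<integral>x. 0 \<partial>(lborel :: 'a measure))"
    unfolding lborel_Fubini(3)[OF Bochner_Integration.integrable_add[OF i1 i2], symmetric]
    using tz borel_measurable_integrable[OF lborel_Fubini(2)[OF Bochner_Integration.integrable_add[OF i1 i2]]]
    by (intro integral_cong_AE) simp_all
  then have sum0: "(\<integral>z. v z * ?\<theta>' (snd z) * \<zeta> (fst z) \<partial>lborel) + (\<integral>z. wt z * ?\<theta> (snd z) * \<zeta> (fst z) \<partial>lborel) = 0"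
    by (simp add: Bochner_Integration.integral_add[OF i1 i2])
  have "(LINT z:?Q|lebesgue. w z * d_t (\<lambda>z. ?\<theta> (snd z) * \<zeta> (fst z)) z) = (\<integral>z. w z * ?\<theta>' (snd z) * \<zeta> (fst z) \<partial>lebesgue_on ?Q)"
    using Qb(1) by (simp add: set_integral_lebesgue_on tensor_derivatives(2)[OF C] mult.assoc)
  also have "\<dots> = (\<integral>z. v z * ?\<theta>' (snd z) * \<zeta> (fst z) \<partial>lborel)"
  proof (rule integral_borel_version(2)[OF Qb(1)])
    show "AE z in lborel. z \<in> ?Q \<longrightarrow> w z * ?\<theta>' (snd z) * \<zeta> (fst z) = v z * ?\<theta>' (snd z) * \<zeta> (fst z)"
      using v(3) by eventually_elim auto
    show "(\<lambda>z. w z * ?\<theta>' (snd z) * \<zeta> (fst z)) \<in> borel_measurable (lebesgue_on ?Q)"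
      using wm borel_measurable_lebesgue_on[OF m1(1)] borel_measurable_lebesgue_on[OF m1(3)] by simp
  qed (use v(1) m1 v0 in auto)
  finally show ?thesis using sum0 by (simp add: ac_simps)
qed

text \<open>The pair \<open>(g0, G)\<close> and \<open>wt\<close> represent the same distribution,
  so their difference annihilates all products of a bump and a spatial test function. Localisation
  in time carries this to almost every slice of \<phi>, and Fubini reassembles the slices.\<close>

lemma weak_solution_dual_pairing:
  fixes w wt g0 :: "'a::euclidean_space \<times> real \<Rightarrow> real" and G :: "'a \<times> real \<Rightarrow> 'a"
  assumes \<Omega>: "open \<Omega>" "bounded \<Omega>" and T: "0 < T" and p: "p \<ge> 2"
    and w: "Lp 2 (lebesgue_on (\<Omega> \<times> {0<..<T})) w"
    and wt: "wt \<in> borel_measurable borel" "\<And>z. z \<notin> \<Omega> \<times> {0<..<T} \<Longrightarrow> wt z = 0" "Lp 2 lborel wt"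
    and ac: "AE x in lborel. x \<in> \<Omega> \<longrightarrow> abs_cont_on {0..T} (\<lambda>t. w (x, t)) \<and>
      (AE t in lborel. t \<in> {0<..<T} \<longrightarrow> ((\<lambda>s. w (x, s)) has_real_derivative wt (x, t)) (at t))"
    and g0: "Lp (p / (p - 1)) (lebesgue_on (\<Omega> \<times> {0<..<T})) g0" and G: "Lp (p / (p - 1)) (lebesgue_on (\<Omega> \<times> {0<..<T})) G"
    and distr: "\<And>\<psi>. test_fun (\<Omega> \<times> {0<..<T}) \<psi> \<Longrightarrow>
      - (LINT z:\<Omega> \<times> {0<..<T}|lebesgue. w z * d_t \<psi> z) = (LINT z:\<Omega> \<times> {0<..<T}|lebesgue. g0 z * \<psi> z + G z \<bullet> grad_x \<psi> z)"
    and \<phi>: "Lp_W1p0 p \<Omega> T \<phi> D\<phi>"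
  shows "(LINT z:\<Omega> \<times> {0<..<T}|lebesgue. g0 z * \<phi> z + G z \<bullet> D\<phi> z) = (\<integral>z. wt z * \<phi> z \<partial>lebesgue_on (\<Omega> \<times> {0<..<T}))"
proof -
  let ?Q = "\<Omega> \<times> {0<..<T}"
  let ?N = "lebesgue_on ?Q"
  define q where "q = p / (p - 1)"
  have pq: "p > 1" "q > 1" "1/p + 1/q = 1" using p by (simp_all add: q_def field_simps)
  \<comment> \<open>As \<open>p\<close> is at least 2, the conjugate exponent is at most 2, and the
    square-integrable \<open>wt\<close> lies in L^q on the bounded cylinder.\<close>
  have q2: "q \<le> 2" "1 \<le> q" using p by (simp_all add: q_def field_simps)
  have Qb: "?Q \<in> sets borel" "bounded ?Q" using \<Omega> by (auto intro!: borel_open open_Times bounded_Times)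
  have Ql: "?Q \<in> sets lebesgue" using Qb by simp
  have \<Omega>b: "\<Omega> \<in> sets borel" using \<Omega> by simp
  interpret finite_measure ?N using Ql Qb by (intro finite_measure_lebesgue_on_bounded)
  have wtN: "Lp 2 ?N wt" "integrable lborel wt" using Lp_bounded_support[OF Qb wt(1,2,3)] by auto
  have wtq: "Lp q ?N wt" using Lp_mono[OF wtN(1)] q2 by simp
  have Lg: "Lp q ?N g0" "Lp q ?N G" using g0 G by (simp_all add: q_def)
  have m: "g0 \<in> borel_measurable ?N" "G \<in> borel_measurable ?N" "wt \<in> borel_measurable ?N"
    using Lg wtq by (auto simp: Lp_def)
  \<comment> \<open>The zero-order part of the discrepancy between the two representations; its
    first-order part is \<open>G\<close>.\<close>
  define H0 where "H0 z = g0 z - wt z" for z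
  have H0: "Lp q ?N H0" "H0 \<in> borel_measurable ?N"
    using Lp_diff[OF Lg(1) wtq] q2 m by (auto simp: H0_def[abs_def])
  from borel_version_real[OF Qb(1) H0(2)] obtain H where H: "H \<in> borel_measurable borel" "\<forall>z. z \<notin> ?Q \<longrightarrow> H z = 0"
    "AE z in lborel. z \<in> ?Q \<longrightarrow> H0 z = H z" by (elim exE conjE)
  from borel_version[OF Qb(1) m(2)] obtain K where K: "K \<in> borel_measurable borel" "\<forall>z. z \<notin> ?Q \<longrightarrow> K z = 0"
    "AE z in lborel. z \<in> ?Q \<longrightarrow> G z = K z" by (elim exE conjE)
  have Hz: "H z = 0" "K z = 0" if "z \<notin> ?Q" for z using H(2) K(2) that by blast+
  have HL: "Lp q lborel H" using Lp_borel_version[OF Qb(1) H(1) Hz(1) H0(2) H(3)] H0(1) by simp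
  have KL: "Lp q lborel K" using Lp_borel_version[OF Qb(1) K(1) Hz(2) m(2) K(3)] Lg(2) by simp
  have slices: "AE t in lborel. \<forall>\<phi> D\<phi>. W1p0 p \<Omega> \<phi> D\<phi> \<longrightarrow> (\<integral>x. H (x, t) * \<phi> x + K (x, t) \<bullet> D\<phi> x \<partial>lebesgue_on \<Omega>) = 0"
  proof (rule slices_annihilate_W1p0[OF \<Omega> T pq H(1) Hz(1) HL K(1) Hz(2) KL])
    fix \<zeta> a b n assume \<zeta>: "test_fun \<Omega> \<zeta>" and ab: "0 < a" "a < b" "b < T"
    let ?\<psi> = "\<lambda>z. bump a b n (snd z) * \<zeta> (fst z)"
    have C: "Cinf_on UNIV \<zeta>" using \<zeta> by (simp add: test_fun_def)
    have \<psi>: "test_fun ?Q ?\<psi>" by (rule test_fun_bump[OF \<zeta>]) (use ab in auto)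
    have C\<psi>: "continuous_on UNIV ?\<psi>" using \<psi> Cinf_on_grad(3) by (auto simp: test_fun_def)
    have C\<psi>': "continuous_on UNIV (\<lambda>z. bump a b n (snd z) *\<^sub>R grad \<zeta> (fst z))"
      by (intro continuous_intros continuous_on_compose2[OF Cinf_on_grad(2)[OF C]]
        continuous_on_compose2[OF Cinf_on_grad(3)[OF Cinf_on_bump]]) auto
    obtain B where B: "\<forall>x. \<bar>\<zeta> x\<bar> \<le> B \<and> norm (grad \<zeta> x) \<le> B" using test_fun_bounded[OF \<zeta>] by blast
    have \<psi>b: "\<bar>?\<psi> z\<bar> \<le> B" "norm (bump a b n (snd z) *\<^sub>R grad \<zeta> (fst z)) \<le> B" for z
      using bump_bounds[of a b n "snd z"] B
      by (auto simp: abs_mult intro: order_trans[OF mult_left_le_one_le])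
    have m\<psi>: "?\<psi> \<in> borel_measurable borel" "(\<lambda>z. bump a b n (snd z) *\<^sub>R grad \<zeta> (fst z)) \<in> borel_measurable borel"
      using C\<psi> C\<psi>' by (auto intro: borel_measurable_continuous_onI)
    have L\<psi>: "Lp p ?N ?\<psi>" "Lp p ?N (\<lambda>z. bump a b n (snd z) *\<^sub>R grad \<zeta> (fst z))"
      by (intro Lp_bounded[where C = B] borel_measurable_lebesgue_on m\<psi>; use \<psi>b pq in simp)+
    have i: "integrable ?N (\<lambda>z. H0 z * ?\<psi> z + G z \<bullet> (bump a b n (snd z) *\<^sub>R grad \<zeta> (fst z)))"
      "integrable ?N (\<lambda>z. wt z * ?\<psi> z)"
      by (intro Bochner_Integration.integrable_add Lp_mult_integrable[OF _ L\<psi>(1) pq(2,1)] Lp_inner_integrable[OF _ L\<psi>(2) pq(2,1)] H0(1) Lg(2) wtq;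
        use pq in simp)+
    have "(\<integral>z. bump a b n (snd z) * (wt z * \<zeta> (fst z)) \<partial>lborel) = (LINT z:?Q|lebesgue. g0 z * ?\<psi> z + G z \<bullet> grad_x ?\<psi> z)"
      using distr[OF \<psi>] time_integration_by_parts[OF \<Omega> ab w wt(1,2) wtN(2) ac \<zeta>, of n] by simp
    also have "\<dots> = (\<integral>z. (H0 z * ?\<psi> z + G z \<bullet> (bump a b n (snd z) *\<^sub>R grad \<zeta> (fst z))) + wt z * ?\<psi> z \<partial>?N)"
      unfolding set_integral_lebesgue_on[OF Ql] tensor_derivatives(1)[OF C]
      by (rule Bochner_Integration.integral_cong[OF refl]) (simp add: H0_def algebra_simps)
    also have "\<dots> = (\<integral>z. H0 z * ?\<psi> z + G z \<bullet> (bump a b n (snd z) *\<^sub>R grad \<zeta> (fst z)) \<partial>?N) + (\<integral>z. wt z * ?\<psi> z \<partial>?N)"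
      by (rule Bochner_Integration.integral_add[OF i])
    also have "(\<integral>z. wt z * ?\<psi> z \<partial>?N) = (\<integral>z. bump a b n (snd z) * (wt z * \<zeta> (fst z)) \<partial>lborel)"
      by (rule integral_borel_version(2)[OF Qb(1)])
        (use wt(1,2) m\<psi>(1) in \<open>auto simp: ac_simps intro!: borel_measurable_lebesgue_on intro: borel_measurable_times\<close>)
    finally have "(\<integral>z. H0 z * ?\<psi> z + G z \<bullet> (bump a b n (snd z) *\<^sub>R grad \<zeta> (fst z)) \<partial>?N) = 0" by simp
    moreover have "(\<integral>z. H0 z * ?\<psi> z + G z \<bullet> (bump a b n (snd z) *\<^sub>R grad \<zeta> (fst z)) \<partial>?N)
      = (\<integral>z. H z * ?\<psi> z + K z \<bullet> (bump a b n (snd z) *\<^sub>R grad \<zeta> (fst z)) \<partial>lborel)"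
    proof (rule integral_borel_version(2)[OF Qb(1)])
      show "(\<lambda>z. H z * ?\<psi> z + K z \<bullet> (bump a b n (snd z) *\<^sub>R grad \<zeta> (fst z))) \<in> borel_measurable borel"
        by (rule borel_measurable_add[OF borel_measurable_times[OF H(1) m\<psi>(1)] borel_measurable_inner[OF K(1) m\<psi>(2)]])
      show "AE z in lborel. z \<in> ?Q \<longrightarrow> H0 z * ?\<psi> z + G z \<bullet> (bump a b n (snd z) *\<^sub>R grad \<zeta> (fst z)) =
          H z * ?\<psi> z + K z \<bullet> (bump a b n (snd z) *\<^sub>R grad \<zeta> (fst z))"
        using H(3) K(3) by eventually_elim auto
    qed (use Hz i(1) in auto)
    ultimately show "(\<integral>z. bump a b n (snd z) * (H z * \<zeta> (fst z) + K z \<bullet> grad \<zeta> (fst z)) \<partial>lborel) = 0"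
      by (simp add: algebra_simps)
  qed
  have L\<phi>: "Lp p ?N \<phi>" "Lp p ?N D\<phi>" and W: "AE t in lborel. t \<in> {0<..<T} \<longrightarrow> W1p0 p \<Omega> (\<lambda>x. \<phi> (x, t)) (\<lambda>x. D\<phi> (x, t))"
    using \<phi> by (simp_all add: Lp_W1p0_def)
  have m\<phi>: "\<phi> \<in> borel_measurable ?N" "D\<phi> \<in> borel_measurable ?N" using L\<phi> by (auto simp: Lp_def)
  from borel_version_real[OF Qb(1) m\<phi>(1)] obtain f where f: "f \<in> borel_measurable borel" "\<forall>z. z \<notin> ?Q \<longrightarrow> f z = 0"
    "AE z in lborel. z \<in> ?Q \<longrightarrow> \<phi> z = f z" by (elim exE conjE)
  from borel_version[OF Qb(1) m\<phi>(2)] obtain g where g: "g \<in> borel_measurable borel" "\<forall>z. z \<notin> ?Q \<longrightarrow> g z = 0"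
    "AE z in lborel. z \<in> ?Q \<longrightarrow> D\<phi> z = g z" by (elim exE conjE)
  have i: "integrable ?N (\<lambda>z. H0 z * \<phi> z + G z \<bullet> D\<phi> z)" "integrable ?N (\<lambda>z. wt z * \<phi> z)"
    by (intro Bochner_Integration.integrable_add Lp_mult_integrable[OF _ L\<phi>(1) pq(2,1)] Lp_inner_integrable[OF _ L\<phi>(2) pq(2,1)] H0(1) Lg(2) wtq;
        use pq in simp)+
  have ver: "integrable ?N (\<lambda>z. H0 z * \<phi> z + G z \<bullet> D\<phi> z) = integrable lborel (\<lambda>z. H z * f z + K z \<bullet> g z)"
    "(\<integral>z. H0 z * \<phi> z + G z \<bullet> D\<phi> z \<partial>?N) = (\<integral>z. H z * f z + K z \<bullet> g z \<partial>lborel)"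
  proof -
    have a: "AE z in lborel. z \<in> ?Q \<longrightarrow> H0 z * \<phi> z + G z \<bullet> D\<phi> z = H z * f z + K z \<bullet> g z"
      using H(3) K(3) f(3) g(3) by eventually_elim auto
    have b: "(\<lambda>z. H z * f z + K z \<bullet> g z) \<in> borel_measurable borel"
      using H(1) K(1) f(1) g(1) by (intro borel_measurable_add borel_measurable_times borel_measurable_inner) auto
    have c: "(\<lambda>z. H0 z * \<phi> z + G z \<bullet> D\<phi> z) \<in> borel_measurable ?N" using i(1) by auto
    show "integrable ?N (\<lambda>z. H0 z * \<phi> z + G z \<bullet> D\<phi> z) = integrable lborel (\<lambda>z. H z * f z + K z \<bullet> g z)"
      by (rule integral_borel_version(1)[OF Qb(1) b _ c a]) (use Hz in auto)
    show "(\<integral>z. H0 z * \<phi> z + G z \<bullet> D\<phi> z \<partial>?N) = (\<integral>z. H z * f z + K z \<bullet> g z \<partial>lborel)"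
      by (rule integral_borel_version(2)[OF Qb(1) b _ c a]) (use Hz in auto)
  qed
  have I: "integrable lborel (\<lambda>z. H z * f z + K z \<bullet> g z)" using ver(1) i(1) by simp
  \<comment> \<open>The exceptional times in \<open>slices\<close> do not depend on the test
    function, so the slice of \<phi> at time \<open>t\<close> may itself serve as test function
    there.\<close>
  have t0: "AE t in lborel. (\<integral>x. H (x, t) * f (x, t) + K (x, t) \<bullet> g (x, t) \<partial>lborel) = 0"
    using slices W AE_lborel_pair(2)[OF f(3)] AE_lborel_pair(2)[OF g(3)]
  proof eventually_elim
    case (elim t)
    show ?case
    proof (cases "t \<in> {0<..<T}")
      case False
      then have "H (x, t) = 0" "K (x, t) = 0" for x using Hz[of "(x, t)"] by auto
      then show ?thesis by simp
    next
      case True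
      then have Wt: "W1p0 p \<Omega> (\<lambda>x. \<phi> (x, t)) (\<lambda>x. D\<phi> (x, t))" using elim(2) by blast
      then have mt: "(\<lambda>x. \<phi> (x, t)) \<in> borel_measurable (lebesgue_on \<Omega>)" "(\<lambda>x. D\<phi> (x, t)) \<in> borel_measurable (lebesgue_on \<Omega>)"
        by (auto simp: W1p0_def Lp_def)
      have ms: "(\<lambda>x. H (x, t)) \<in> borel_measurable borel" "(\<lambda>x. K (x, t)) \<in> borel_measurable borel"
        "(\<lambda>x. f (x, t)) \<in> borel_measurable borel" "(\<lambda>x. g (x, t)) \<in> borel_measurable borel"
        using H(1) K(1) f(1) g(1) by (auto intro: slice_measurable)
      have "0 = (\<integral>x. H (x, t) * \<phi> (x, t) + K (x, t) \<bullet> D\<phi> (x, t) \<partial>lebesgue_on \<Omega>)"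
        using elim(1)[THEN spec, THEN spec, THEN mp, OF Wt] by simp
      also have "\<dots> = (\<integral>x. H (x, t) * f (x, t) + K (x, t) \<bullet> g (x, t) \<partial>lborel)"
      proof (rule integral_borel_version(2)[OF \<Omega>b])
        show "(\<lambda>x. H (x, t) * f (x, t) + K (x, t) \<bullet> g (x, t)) \<in> borel_measurable borel"
          using ms by (intro borel_measurable_add borel_measurable_times borel_measurable_inner) auto
        show "(\<lambda>x. H (x, t) * \<phi> (x, t) + K (x, t) \<bullet> D\<phi> (x, t)) \<in> borel_measurable (lebesgue_on \<Omega>)"
          using ms(1,2) mt by (intro borel_measurable_add borel_measurable_times borel_measurable_inner) (auto intro: borel_measurable_lebesgue_on)
        show "AE x in lborel. x \<in> \<Omega> \<longrightarrow> H (x, t) * \<phi> (x, t) + K (x, t) \<bullet> D\<phi> (x, t) = H (x, t) * f (x, t) + K (x, t) \<bullet> g (x, t)"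
          using elim(3,4) by eventually_elim (use True in auto)
      qed (use Hz in auto)
      finally show ?thesis by simp
    qed
  qed
  have "(\<integral>z. H z * f z + K z \<bullet> g z \<partial>lborel) = (\<integral>t. (\<integral>x. H (x, t) * f (x, t) + K (x, t) \<bullet> g (x, t) \<partial>lborel) \<partial>lborel)"
    by (rule lborel_Fubini(6)[OF I, symmetric])
  also have "\<dots> = (\<integral>t. 0 \<partial>(lborel :: real measure))"
    by (rule integral_cong_AE) (use t0 borel_measurable_integrable[OF lborel_Fubini(5)[OF I]] in auto)
  finally have z: "(\<integral>z. H0 z * \<phi> z + G z \<bullet> D\<phi> z \<partial>?N) = 0" using ver(2) by simp
  have "(LINT z:?Q|lebesgue. g0 z * \<phi> z + G z \<bullet> D\<phi> z) = (\<integral>z. (H0 z * \<phi> z + G z \<bullet> D\<phi> z) + wt z * \<phi> z \<partial>?N)"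
    unfolding set_integral_lebesgue_on[OF Ql]
    by (rule Bochner_Integration.integral_cong[OF refl]) (simp add: H0_def algebra_simps)
  also have "\<dots> = (\<integral>z. wt z * \<phi> z \<partial>?N)"
    using Bochner_Integration.integral_add[OF i] z by simp
  finally show ?thesis .
qed

text \<open>Interface to the contraction argument: after this, a solution is described by functions
  only, with Borel time derivatives of both \<open>u\<close> and \<open>w\<close> and an equation
  free of dual pairings.\<close>

lemma weak_solution_strong_form:
  fixes u w f :: "'a::euclidean_space \<times> real \<Rightarrow> real"
  assumes \<Omega>: "open \<Omega>" "bounded \<Omega>" and T: "0 < T" and p: "p \<ge> 2"
    and c: "c \<in> borel_measurable (lebesgue_on \<Omega>)"
    and \<kappa>1: "Lp 2 (lebesgue_on \<Omega>) \<kappa>1" and \<gamma>1: "\<gamma>1 > 0"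
    and W: "\<forall>x v. x \<in> \<Omega> \<longrightarrow> abs_cont_on {0..T} v \<longrightarrow>
        abs_cont_on {0..T} (W x v) \<and>
        (AE t in lborel. t \<in> {0<..<T} \<longrightarrow> (\<forall>D E. (v has_real_derivative E) (at t) \<longrightarrow>
            (W x v has_real_derivative D) (at t) \<longrightarrow> \<bar>D\<bar> \<le> \<kappa>1 x + \<gamma>1 * \<bar>E\<bar>))"
    and sol: "weak_solution \<Omega> T p a c W f u0 u w"
  shows "\<exists>Du ut wt. u \<in> borel_measurable (lebesgue_on (\<Omega> \<times> {0<..<T})) \<and> Lp p (lebesgue_on (\<Omega> \<times> {0<..<T})) Du \<and>
    (AE t in lborel. t \<in> {0<..<T} \<longrightarrow> W1p0 p \<Omega> (\<lambda>x. u (x, t)) (\<lambda>x. Du (x, t))) \<and>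
    ut \<in> borel_measurable borel \<and> (\<forall>z. z \<notin> \<Omega> \<times> {0<..<T} \<longrightarrow> ut z = 0) \<and> Lp 2 lborel ut \<and>
    wt \<in> borel_measurable borel \<and> (\<forall>z. z \<notin> \<Omega> \<times> {0<..<T} \<longrightarrow> wt z = 0) \<and> Lp 2 lborel wt \<and>
    Lp 2 (lebesgue_on (\<Omega> \<times> {0<..<T})) w \<and>
    (AE x in lborel. x \<in> \<Omega> \<longrightarrow> abs_cont_on {0..T} (\<lambda>t. u (x, t)) \<and> u (x, 0) = u0 x \<and>
      (AE t in lborel. t \<in> {0<..<T} \<longrightarrow> ((\<lambda>s. u (x, s)) has_real_derivative ut (x, t)) (at t)) \<and>
      (\<forall>t\<in>{0..T}. w (x, t) = W x (\<lambda>s. u (x, s)) t) \<and> abs_cont_on {0..T} (\<lambda>t. w (x, t)) \<and>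
      (AE t in lborel. t \<in> {0<..<T} \<longrightarrow> ((\<lambda>s. w (x, s)) has_real_derivative wt (x, t)) (at t))) \<and>
    (\<forall>\<phi> D\<phi>. Lp_W1p0 p \<Omega> T \<phi> D\<phi> \<longrightarrow>
      (\<integral>z. c (fst z) * ut z * \<phi> z \<partial>lebesgue_on (\<Omega> \<times> {0<..<T})) + (\<integral>z. wt z * \<phi> z \<partial>lebesgue_on (\<Omega> \<times> {0<..<T}))
      + (\<integral>z. a (fst z) (Du z) \<bullet> D\<phi> z \<partial>lebesgue_on (\<Omega> \<times> {0<..<T}))
      = (\<integral>z. f z * \<phi> z \<partial>lebesgue_on (\<Omega> \<times> {0<..<T})))"
proof -
  have W_W11: "abs_cont_on {0..T} (W x v) \<and>
        (AE t in lborel. t \<in> {0<..<T} \<longrightarrow> (\<forall>D E. (v has_real_derivative E) (at t) \<longrightarrow>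
            (W x v has_real_derivative D) (at t) \<longrightarrow> \<bar>D\<bar> \<le> \<kappa>1 x + \<gamma>1 * \<bar>E\<bar>))"
    if "x \<in> \<Omega>" "abs_cont_on {0..T} v" for x v
    by (rule W[THEN spec, THEN spec, THEN mp, THEN mp, OF that])
  let ?Q = "\<Omega> \<times> {0<..<T}"
  let ?N = "lebesgue_on ?Q"
  have Qb: "?Q \<in> sets borel" "bounded ?Q" using \<Omega> by (auto intro!: borel_open open_Times bounded_Times)
  have Ql: "?Q \<in> sets lebesgue" using Qb by simp
  have \<Omega>b: "\<Omega> \<in> sets borel" "\<Omega> \<in> sets lebesgue" using \<Omega> by auto
  from sol obtain Du ut' g0 G where s1: "Linf_W1p0 p \<Omega> T u Du" and s2: "Lp 2 ?N ut'"
    and s3: "AE x in lebesgue_on \<Omega>. abs_cont_on {0..T} (\<lambda>t. u (x, t)) \<and>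
            (AE t in lborel. t \<in> {0<..<T} \<longrightarrow> ((\<lambda>s. u (x, s)) has_real_derivative ut' (x, t)) (at t)) \<and>
            u (x, 0) = u0 x"
    and s4: "AE x in lebesgue_on \<Omega>. \<forall>t\<in>{0..T}. w (x, t) = W x (\<lambda>s. u (x, s)) t"
    and s5: "Lp 2 ?N w" and s6: "Lp (p / (p - 1)) ?N g0" "Lp (p / (p - 1)) ?N G"
    and s7: "\<forall>\<psi>. test_fun ?Q \<psi> \<longrightarrow>
           - (LINT z:?Q|lebesgue. w z * d_t \<psi> z) = (LINT z:?Q|lebesgue. g0 z * \<psi> z + G z \<bullet> grad_x \<psi> z)"
    and s8: "\<forall>\<phi> D\<phi>. Lp_W1p0 p \<Omega> T \<phi> D\<phi> \<longrightarrow>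
           (LINT z:?Q|lebesgue. c (fst z) * ut' z * \<phi> z)
           + (LINT z:?Q|lebesgue. g0 z * \<phi> z + G z \<bullet> D\<phi> z)
           + (LINT z:?Q|lebesgue. a (fst z) (Du z) \<bullet> D\<phi> z)
           = (LINT z:?Q|lebesgue. f z * \<phi> z)"
    unfolding weak_solution_def Let_def by (elim exE conjE)
  have um: "u \<in> borel_measurable ?N" "Du \<in> borel_measurable ?N"
    and uW: "AE t in lborel. t \<in> {0<..<T} \<longrightarrow> W1p0 p \<Omega> (\<lambda>x. u (x, t)) (\<lambda>x. Du (x, t))"
    using s1 by (simp_all add: Linf_W1p0_def)
  have "\<exists>M. AE t in lborel. t \<in> {0<..<T} \<longrightarrow> (LINT x:\<Omega>|lebesgue. \<bar>u (x, t)\<bar> powr p + norm (Du (x, t)) powr p) \<le> M"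
    using s1 by (simp add: Linf_W1p0_def)
  then obtain M where M: "AE t in lborel. t \<in> {0<..<T} \<longrightarrow> (LINT x:\<Omega>|lebesgue. \<bar>u (x, t)\<bar> powr p + norm (Du (x, t)) powr p) \<le> M"
    by (elim exE)
  \<comment> \<open>The definition bounds the gradient slice by slice; uniformity of the bound in
    time gives integrability on the cylinder.\<close>
  have DuL: "Lp p ?N Du"
  proof (rule Lp_of_slice_bound[OF \<Omega>(1) T um(2)])
    show "AE t in lborel. t \<in> {0<..<T} \<longrightarrow> Lp p (lebesgue_on \<Omega>) (\<lambda>x. Du (x, t)) \<and>
      (\<integral>x. norm (Du (x, t)) powr p \<partial>lebesgue_on \<Omega>) \<le> M"
      using uW M
    proof eventually_elim
      case (elim t)
      show ?case
      proof
        assume t: "t \<in> {0<..<T}"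
        then have L: "Lp p (lebesgue_on \<Omega>) (\<lambda>x. u (x, t))" "Lp p (lebesgue_on \<Omega>) (\<lambda>x. Du (x, t))"
          using elim(1) by (simp_all add: W1p0_def)
        have "(\<integral>x. norm (Du (x, t)) powr p \<partial>lebesgue_on \<Omega>) \<le> (\<integral>x. \<bar>u (x, t)\<bar> powr p + norm (Du (x, t)) powr p \<partial>lebesgue_on \<Omega>)"
          by (rule integral_mono) (use L in \<open>auto simp: Lp_def\<close>)
        also have "\<dots> \<le> M" using elim(2) t by (simp add: set_integral_lebesgue_on[OF \<Omega>b(2)])
        finally show "Lp p (lebesgue_on \<Omega>) (\<lambda>x. Du (x, t)) \<and> (\<integral>x. norm (Du (x, t)) powr p \<partial>lebesgue_on \<Omega>) \<le> M"
          using L(2) by simp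
      qed
    qed
  qed
  have ut'm: "ut' \<in> borel_measurable ?N" using s2 by (simp add: Lp_def)
  from borel_version_real[OF Qb(1) ut'm] obtain ut where ut: "ut \<in> borel_measurable borel" "\<forall>z. z \<notin> ?Q \<longrightarrow> ut z = 0"
    "AE z in lborel. z \<in> ?Q \<longrightarrow> ut' z = ut z" by (elim exE conjE)
  have ut0: "ut z = 0" if "z \<notin> ?Q" for z using ut(2) that by blast
  have utL: "Lp 2 lborel ut" using Lp_borel_version[OF Qb(1) ut(1) ut0 ut'm ut(3)] s2 by simp
  have wm: "w \<in> borel_measurable ?N" using s5 by (simp add: Lp_def)
  have ux: "AE x in lborel. x \<in> \<Omega> \<longrightarrow> abs_cont_on {0..T} (\<lambda>t. u (x, t)) \<and> u (x, 0) = u0 x \<and>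
      (AE t in lborel. t \<in> {0<..<T} \<longrightarrow> ((\<lambda>s. u (x, s)) has_real_derivative ut (x, t)) (at t))"
    using s3[unfolded AE_lebesgue_on_iff[OF \<Omega>b(2)]] AE_lborel_pair(1)[OF ut(3)]
  proof eventually_elim
    case (elim x)
    show ?case
    proof (intro impI conjI)
      assume x: "x \<in> \<Omega>"
      then show "abs_cont_on {0..T} (\<lambda>t. u (x, t))" "u (x, 0) = u0 x" using elim(1) by blast+
      have "AE t in lborel. t \<in> {0<..<T} \<longrightarrow> ((\<lambda>s. u (x, s)) has_real_derivative ut' (x, t)) (at t)" using elim(1) x by blast
      then show "AE t in lborel. t \<in> {0<..<T} \<longrightarrow> ((\<lambda>s. u (x, s)) has_real_derivative ut (x, t)) (at t)"
        using elim(2) by eventually_elim (use x in auto)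
    qed
  qed
  have wW: "AE x in lborel. x \<in> \<Omega> \<longrightarrow> (\<forall>t\<in>{0..T}. w (x, t) = W x (\<lambda>s. u (x, s)) t)"
    using s4 unfolding AE_lebesgue_on_iff[OF \<Omega>b(2)] .
  have wac: "AE x in lborel. x \<in> \<Omega> \<longrightarrow> abs_cont_on {0..T} (\<lambda>t. w (x, t))"
    using ux wW
  proof eventually_elim
    case (elim x)
    show ?case
    proof
      assume x: "x \<in> \<Omega>"
      then have "abs_cont_on {0..T} (W x (\<lambda>s. u (x, s)))" using W_W11 elim(1) by blast
      then show "abs_cont_on {0..T} (\<lambda>t. w (x, t))" by (rule abs_cont_on_cong) (use elim(2) x in blast)
    qed
  qed
  from abs_cont_derivative_version[OF \<Omega>(1) T wm wac] obtain wt where wt: "wt \<in> borel_measurable borel"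
    "\<forall>z. z \<notin> ?Q \<longrightarrow> wt z = 0"
    "AE x in lborel. x \<in> \<Omega> \<longrightarrow> (AE t in lborel. t \<in> {0<..<T} \<longrightarrow> ((\<lambda>s. w (x, s)) has_real_derivative wt (x, t)) (at t))"
    by (elim exE conjE)
  have wt0: "wt z = 0" if "z \<notin> ?Q" for z using wt(2) that by blast
  have \<kappa>m: "\<kappa>1 \<in> borel_measurable (lebesgue_on \<Omega>)" using \<kappa>1 by (simp add: Lp_def)
  from borel_version_real[OF \<Omega>b(1) \<kappa>m] obtain k where k: "k \<in> borel_measurable borel" "\<forall>x. x \<notin> \<Omega> \<longrightarrow> k x = 0"
    "AE x in lborel. x \<in> \<Omega> \<longrightarrow> \<kappa>1 x = k x" by (elim exE conjE)
  have k0: "k x = 0" if "x \<notin> \<Omega>" for x using k(2) that by blast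
  have kL: "Lp 2 lborel k" using Lp_borel_version[OF \<Omega>b(1) k(1) k0 \<kappa>m k(3)] \<kappa>1 by simp
  let ?K = "\<lambda>z :: 'a \<times> real. k (fst z) * indicator {0<..<T} (snd z)"
  have KL: "Lp 2 lborel ?K" by (rule Lp_fst[OF kL T])
  have Km: "?K \<in> borel_measurable borel" using KL by (simp add: Lp_def)
  \<comment> \<open>The double minus presents a sum as a difference, so that \<open>Lp_diff\<close>
    applies.\<close>
  let ?R = "\<lambda>z. \<bar>?K z\<bar> - - (\<gamma>1 * \<bar>ut z\<bar>)"
  have RL: "Lp 2 lborel ?R"
  proof (rule Lp_diff)
    show "Lp 2 lborel (\<lambda>z. \<bar>?K z\<bar>)"
      by (rule Lp_dominated[OF KL, of _ 1]) (use Km in auto)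
    show "Lp 2 lborel (\<lambda>z. - (\<gamma>1 * \<bar>ut z\<bar>))"
      by (rule Lp_dominated[OF utL, of _ \<gamma>1]) (use ut(1) \<gamma>1 in \<open>auto simp: abs_mult\<close>)
  qed simp
  \<comment> \<open>(A5) gives the bound on almost every line. The set where it holds is Borel, so
    it has full measure in the product.\<close>
  have wtle: "AE z in lborel. norm (wt z) \<le> 1 * norm (?R z)"
  proof (rule AE_lborel_pairI)
    have "{z \<in> space borel. norm (wt z) \<le> 1 * norm (?R z)} \<in> sets borel"
      by (rule borel_measurable_le) (use wt(1) RL in \<open>auto simp: Lp_def\<close>)
    then show "{z. norm (wt z) \<le> 1 * norm (?R z)} \<in> sets borel" by simp
    show "AE x in lborel. AE t in lborel. norm (wt (x, t)) \<le> 1 * norm (?R (x, t))"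
      using ux wW wt(3) k(3)
    proof eventually_elim
      case (elim x)
      show ?case
      proof (cases "x \<in> \<Omega>")
        case False
        then show ?thesis using wt0[of "(x, _)"] by (intro AE_I2) auto
      next
        case x: True
        have ac: "abs_cont_on {0..T} (\<lambda>t. u (x, t))" using elim(1) x by blast
        have e1: "AE t in lborel. t \<in> {0<..<T} \<longrightarrow> ((\<lambda>s. u (x, s)) has_real_derivative ut (x, t)) (at t)" using elim(1) x by blast
        have e3: "AE t in lborel. t \<in> {0<..<T} \<longrightarrow> ((\<lambda>s. w (x, s)) has_real_derivative wt (x, t)) (at t)" using elim(3) x by blast
        have e4: "\<kappa>1 x = k x" using elim(4) x by blast
        have wx: "w (x, t) = W x (\<lambda>s. u (x, s)) t" if "t \<in> {0..T}" for t using elim(2) x that by blast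
        show ?thesis using e1 e3 conjunct2[OF W_W11[OF x ac]]
        proof eventually_elim
          case (elim t)
          show ?case
          proof (cases "t \<in> {0<..<T}")
            case False
            then show ?thesis using wt0[of "(x, t)"] by auto
          next
            case t: True
            have d1: "((\<lambda>s. u (x, s)) has_real_derivative ut (x, t)) (at t)" using elim(1) t by blast
            have "((\<lambda>s. w (x, s)) has_real_derivative wt (x, t)) (at t)" using elim(2) t by blast
            \<comment> \<open>\<open>w\<close> and the operator output agree on [0,T] only, but
              differentiability at an interior time is local.\<close>
            then have "(W x (\<lambda>s. u (x, s)) has_real_derivative wt (x, t)) (at t)"
              by (rule has_field_derivative_transform_within_open[of _ _ _ "{0<..<T}"]) (use t wx in auto)
            then have "\<bar>wt (x, t)\<bar> \<le> \<kappa>1 x + \<gamma>1 * \<bar>ut (x, t)\<bar>" using elim(3) t d1 by blast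
            also have "\<dots> \<le> \<bar>k x\<bar> + \<gamma>1 * \<bar>ut (x, t)\<bar>" using e4 by simp
            also have "\<dots> = ?R (x, t)" using t by simp
            also have "\<dots> \<le> 1 * norm (?R (x, t))" by (simp only: mult_1 real_norm_def abs_ge_self)
            finally show ?thesis by simp
          qed
        qed
      qed
    qed
  qed
  have wtL: "Lp 2 lborel wt"
    by (rule Lp_dominated[OF RL _ _ _ wtle]) (use wt(1) in auto)
  have wac': "AE x in lborel. x \<in> \<Omega> \<longrightarrow> abs_cont_on {0..T} (\<lambda>t. w (x, t)) \<and>
      (AE t in lborel. t \<in> {0<..<T} \<longrightarrow> ((\<lambda>s. w (x, s)) has_real_derivative wt (x, t)) (at t))"
    using wac wt(3) by eventually_elim blast
  have all: "AE x in lborel. x \<in> \<Omega> \<longrightarrow> abs_cont_on {0..T} (\<lambda>t. u (x, t)) \<and> u (x, 0) = u0 x \<and>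
      (AE t in lborel. t \<in> {0<..<T} \<longrightarrow> ((\<lambda>s. u (x, s)) has_real_derivative ut (x, t)) (at t)) \<and>
      (\<forall>t\<in>{0..T}. w (x, t) = W x (\<lambda>s. u (x, s)) t) \<and> abs_cont_on {0..T} (\<lambda>t. w (x, t)) \<and>
      (AE t in lborel. t \<in> {0<..<T} \<longrightarrow> ((\<lambda>s. w (x, s)) has_real_derivative wt (x, t)) (at t))"
    using ux wac' wW by eventually_elim blast
  have eqn: "(\<integral>z. c (fst z) * ut z * \<phi> z \<partial>?N) + (\<integral>z. wt z * \<phi> z \<partial>?N) + (\<integral>z. a (fst z) (Du z) \<bullet> D\<phi> z \<partial>?N)
      = (\<integral>z. f z * \<phi> z \<partial>?N)" if \<phi>: "Lp_W1p0 p \<Omega> T \<phi> D\<phi>" for \<phi> D\<phi>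
  proof -
    have \<phi>m: "\<phi> \<in> borel_measurable ?N" using \<phi> by (simp add: Lp_W1p0_def Lp_def)
    have cm: "(\<lambda>z. c (fst z)) \<in> borel_measurable ?N" by (rule borel_measurable_fst_lebesgue_on[OF c])
    have "(\<integral>z. c (fst z) * ut' z * \<phi> z \<partial>?N) = (\<integral>z. c (fst z) * ut z * \<phi> z \<partial>?N)"
    proof (rule integral_cong_AE)
      show "AE z in ?N. c (fst z) * ut' z * \<phi> z = c (fst z) * ut z * \<phi> z"
        unfolding AE_lebesgue_on_iff[OF Ql] using ut(3) by eventually_elim simp
    qed (use cm ut'm \<phi>m borel_measurable_lebesgue_on[OF ut(1)] in auto)
    moreover have "(LINT z:?Q|lebesgue. g0 z * \<phi> z + G z \<bullet> D\<phi> z) = (\<integral>z. wt z * \<phi> z \<partial>?N)"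
      by (rule weak_solution_dual_pairing[OF \<Omega> T p s5 wt(1) wt0 wtL wac' s6 s7[THEN spec, THEN mp] \<phi>])
    ultimately show ?thesis using s8[THEN spec, THEN spec, THEN mp, OF \<phi>]
      by (simp add: set_integral_lebesgue_on[OF Ql])
  qed
  show ?thesis
    by (intro exI[of _ Du] exI[of _ ut] exI[of _ wt] conjI um(1) DuL uW ut(1,2) utL wt(1,2) wtL s5 all allI impI eqn)
qed

text \<open>Completeness of Lebesgue measure: preimages under the two functions differ by a subset
  of a null set.\<close>

lemma AE_eq_borel_measurable_lebesgue_on:
  fixes f g :: "'a::euclidean_space \<Rightarrow> 'b::topological_space"
  assumes S: "S \<in> sets lebesgue" and g: "g \<in> borel_measurable (lebesgue_on S)" and ae: "AE x in lborel. x \<in> S \<longrightarrow> f x = g x"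
  shows "f \<in> borel_measurable (lebesgue_on S)"
proof (rule measurableI)
  fix A :: "'b set" assume A: "A \<in> sets borel"
  from AE_E[OF ae] obtain N where N': "{x \<in> space lborel. \<not> (x \<in> S \<longrightarrow> f x = g x)} \<subseteq> N" "emeasure lborel N = 0" "N \<in> sets lborel"
    by blast
  have nl: "f -` A \<inter> S \<inter> N \<in> sets lebesgue"
  proof (rule sets_completionI)
    show "f -` A \<inter> S \<inter> N = {} \<union> (f -` A \<inter> S \<inter> N)" by simp
    show "N \<in> null_sets lborel" using N'(2,3) by (simp add: null_setsI)
  qed auto
  have "g -` A \<inter> space (lebesgue_on S) \<in> sets (lebesgue_on S)" using g A by (rule measurable_sets)
  then have "g -` A \<inter> S \<in> sets lebesgue" using S by (simp add: sets_restrict_space_iff space_restrict_space)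
  moreover have "N \<in> sets lebesgue" using N'(3) by simp
  moreover have "f -` A \<inter> S = ((g -` A \<inter> S) - N) \<union> (f -` A \<inter> S \<inter> N)" using N'(1) by auto
  ultimately have "f -` A \<inter> S \<in> sets lebesgue" using nl by (metis sets.Diff sets.Un)
  then show "f -` A \<inter> space (lebesgue_on S) \<in> sets (lebesgue_on S)" using S by (simp add: sets_restrict_space_iff space_restrict_space)
qed simp

section \<open>The contraction estimate\<close>

text \<open>Away from zeros of \<open>v\<close> the absolute value is locally plus or minus
  \<open>v\<close>. At a zero it has a minimum, so its derivative is 0, in agreement with
  \<open>sgn 0 = 0\<close>.\<close>

lemma abs_derivative_sgn:
  assumes v: "(v has_real_derivative d) (at t)" and a: "((\<lambda>s. \<bar>v s\<bar>) has_real_derivative e) (at t)"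
  shows "e = d * sgn (v t)"
proof -
  have vc: "isCont v t" using v by (rule DERIV_isCont)
  consider "v t > 0" | "v t < 0" | "v t = 0" by linarith
  then show ?thesis
  proof cases
    case 1
    then have "eventually (\<lambda>s. 0 < v s) (at t)" using vc unfolding isCont_def by (intro order_tendstoD(1))
    then have ev: "eventually (\<lambda>s. \<bar>v s\<bar> = v s) (nhds t)" using 1 by (auto simp: eventually_nhds_conv_at elim: eventually_mono)
    have "(v has_real_derivative e) (at t)" by (rule iffD1[OF DERIV_cong_ev[OF refl ev refl] a])
    then show ?thesis using DERIV_unique[OF v] 1 by simp
  next
    case 2
    then have "eventually (\<lambda>s. v s < 0) (at t)" using vc unfolding isCont_def by (intro order_tendstoD(2))
    then have ev: "eventually (\<lambda>s. \<bar>v s\<bar> = - v s) (nhds t)" using 2 by (auto simp: eventually_nhds_conv_at elim: eventually_mono)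
    have "((\<lambda>s. - v s) has_real_derivative e) (at t)" by (rule iffD1[OF DERIV_cong_ev[OF refl ev refl] a])
    then show ?thesis using DERIV_unique[OF DERIV_minus[OF v]] 2 by simp
  next
    case 3
    have "e = 0" by (rule DERIV_local_min[OF a, of 1]) (use 3 in auto)
    then show ?thesis using 3 by simp
  qed
qed

text \<open>The absolute value of \<open>w\<close> is the sum of the positive parts of
  \<open>w\<close> and \<open>- w\<close>; the one-sided inequalities combine through
  \<open>heaviside v - heaviside (- v) = sgn v\<close>, and the derivative bound is integrated.
  \<open>vh\<close> is a measurable stand-in for \<open>v\<close> along the line.\<close>

lemma hilpert_abs_inequality:
  fixes v w vt wt vh :: "real \<Rightarrow> real"
  assumes T: "0 < T" and v: "abs_cont_on {0..T} v" and w: "abs_cont_on {0..T} w"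
    and m: "vt \<in> borel_measurable lborel" "wt \<in> borel_measurable lborel" "vh \<in> borel_measurable lborel"
    and dv: "AE t in lborel. t \<in> {0<..<T} \<longrightarrow> (v has_real_derivative vt t) (at t)"
    and dw: "AE t in lborel. t \<in> {0<..<T} \<longrightarrow> (w has_real_derivative wt t) (at t)"
    and vh: "AE t in lborel. t \<in> {0<..<T} \<longrightarrow> v t = vh t"
    and hp: "AE t in lborel. t \<in> {0<..<T} \<longrightarrow> (\<forall>D1 D2. ((\<lambda>s. max (w s) 0) has_real_derivative D1) (at t) \<longrightarrow>
        (w has_real_derivative D2) (at t) \<longrightarrow> D1 \<le> D2 * heaviside (v t))"
    and hm: "AE t in lborel. t \<in> {0<..<T} \<longrightarrow> (\<forall>D1 D2. ((\<lambda>s. max (- w s) 0) has_real_derivative D1) (at t) \<longrightarrow>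
        ((\<lambda>s. - w s) has_real_derivative D2) (at t) \<longrightarrow> D1 \<le> D2 * heaviside (- v t))"
    and c: "0 \<le> c" and t: "t \<in> {0..T}"
  shows "c * \<bar>v t\<bar> + \<bar>w t\<bar> \<le> c * \<bar>v 0\<bar> + \<bar>w 0\<bar> + (LINT s:{0..t}|lborel. (c * vt s + wt s) * sgn (vh s))"
proof -
  let ?h = "\<lambda>s. (c * vt s + wt s) * sgn (vh s)"
  let ?F = "\<lambda>s. c * \<bar>v s\<bar> + \<bar>w s\<bar>"
  have F: "abs_cont_on {0..T} ?F"
  proof (rule abs_cont_on_dominated[OF v w, where C = "c + 1"])
    fix x y
    have "?F x - ?F y = c * (\<bar>v x\<bar> - \<bar>v y\<bar>) + (\<bar>w x\<bar> - \<bar>w y\<bar>)" by (simp add: algebra_simps)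
    then have "\<bar>?F x - ?F y\<bar> \<le> \<bar>c * (\<bar>v x\<bar> - \<bar>v y\<bar>)\<bar> + \<bar>\<bar>w x\<bar> - \<bar>w y\<bar>\<bar>"
      by (simp only: abs_triangle_ineq)
    also have "\<dots> \<le> c * \<bar>v x - v y\<bar> + \<bar>w x - w y\<bar>"
      using c by (auto simp: abs_mult intro!: add_mono mult_left_mono abs_triangle_ineq3)
    also have "\<dots> \<le> (c + 1) * \<bar>v x - v y\<bar> + (c + 1) * \<bar>w x - w y\<bar>"
      using c by (intro add_mono mult_right_mono) (auto simp: distrib_right)
    finally show "\<bar>?F x - ?F y\<bar> \<le> (c + 1) * (\<bar>v x - v y\<bar> + \<bar>w x - w y\<bar>)" by (simp add: distrib_left)
  qed
  have mw: "abs_cont_on {0..T} (\<lambda>s. - w s)"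
    by (rule abs_cont_on_dominated[OF w w, where C = 1]) (simp add: abs_minus_commute)
  \<comment> \<open>\<open>hp\<close> and \<open>hm\<close> speak only of derivatives that exist;
    absolute continuity of each composite supplies them for almost every time.\<close>
  obtain g where g: "integrable lborel g" "AE s in lborel. s \<in> {0<..<T} \<longrightarrow> (?F has_real_derivative g s) (at s)"
    "\<forall>s\<in>{0..T}. \<forall>t\<in>{s..T}. ?F t - ?F s = (LINT x:{s..t}|lborel. g x)"
    using abs_cont_on_FTC[OF F T] by (elim exE conjE)
  obtain e1 where e1: "AE s in lborel. s \<in> {0<..<T} \<longrightarrow> ((\<lambda>s. \<bar>v s\<bar>) has_real_derivative e1 s) (at s)"
    using abs_cont_on_FTC[OF abs_cont_on_abs[OF v] T] by (elim exE conjE)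
  obtain e2 where e2: "AE s in lborel. s \<in> {0<..<T} \<longrightarrow> ((\<lambda>s. max (w s) 0) has_real_derivative e2 s) (at s)"
    using abs_cont_on_FTC[OF abs_cont_on_max0[OF w] T] by (elim exE conjE)
  obtain e3 where e3: "AE s in lborel. s \<in> {0<..<T} \<longrightarrow> ((\<lambda>s. max (- w s) 0) has_real_derivative e3 s) (at s)"
    using abs_cont_on_FTC[OF abs_cont_on_max0[OF mw] T] by (elim exE conjE)
  have gh: "AE s in lborel. s \<in> {0<..<T} \<longrightarrow> g s \<le> ?h s"
    using g(2) e1 e2 e3 dv dw vh hp hm
  proof eventually_elim
    case (elim s)
    show ?case
    proof
      assume s: "s \<in> {0<..<T}"
      have d: "(?F has_real_derivative g s) (at s)" "((\<lambda>s. \<bar>v s\<bar>) has_real_derivative e1 s) (at s)"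
        "((\<lambda>s. max (w s) 0) has_real_derivative e2 s) (at s)" "((\<lambda>s. max (- w s) 0) has_real_derivative e3 s) (at s)"
        "(v has_real_derivative vt s) (at s)" "(w has_real_derivative wt s) (at s)" and vs: "v s = vh s"
        using elim(1-7) s by blast+
      have "((\<lambda>s. c * \<bar>v s\<bar> + (max (w s) 0 + max (- w s) 0)) has_real_derivative c * e1 s + (e2 s + e3 s)) (at s)"
        by (intro DERIV_add DERIV_cmult d)
      moreover have "(\<lambda>s. c * \<bar>v s\<bar> + (max (w s) 0 + max (- w s) 0)) = ?F" by (auto simp: fun_eq_iff max_def)
      ultimately have "g s = c * e1 s + (e2 s + e3 s)" using DERIV_unique[OF d(1)] by simp
      moreover have "c * e1 s = c * (vt s * sgn (v s))" using abs_derivative_sgn[OF d(5,2)] by simp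
      moreover have "e2 s \<le> wt s * heaviside (v s)" using elim(8) s d(3,6) by blast
      moreover have "e3 s \<le> - wt s * heaviside (- v s)" using elim(9) s d(4) DERIV_minus[OF d(6)] by blast
      moreover have "wt s * heaviside (v s) + - wt s * heaviside (- v s) = wt s * sgn (v s)"
        by (auto simp: heaviside_def sgn_if)
      ultimately have "g s \<le> c * (vt s * sgn (v s)) + wt s * sgn (v s)" by linarith
      then show "g s \<le> ?h s" by (simp add: vs algebra_simps)
    qed
  qed
  have t0: "0 \<in> {0..T}" "t \<in> {0..T}" using t by auto
  have vi: "set_integrable lborel {0..t} vt" by (rule abs_cont_on_FTC_derivative(1)[OF v T m(1) dv]) (use t in auto)
  have wi: "set_integrable lborel {0..t} wt" by (rule abs_cont_on_FTC_derivative(1)[OF w T m(2) dw]) (use t in auto)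
  have "set_integrable lborel {0..t} ?h"
    unfolding set_integrable_def
  proof (rule Bochner_Integration.integrable_bound)
    show "integrable lborel (\<lambda>x. c * norm (indicator {0..t} x *\<^sub>R vt x) + norm (indicator {0..t} x *\<^sub>R wt x))"
      using vi wi by (intro Bochner_Integration.integrable_add integrable_mult_right integrable_norm) (auto simp: set_integrable_def)
    show "(\<lambda>x. indicator {0..t} x *\<^sub>R ?h x) \<in> borel_measurable lborel" using m by measurable
    show "AE x in lborel. norm (indicator {0..t} x *\<^sub>R ?h x) \<le> norm (c * norm (indicator {0..t} x *\<^sub>R vt x) + norm (indicator {0..t} x *\<^sub>R wt x))"
    proof (rule AE_I2)
      fix x
      have "\<bar>?h x\<bar> \<le> \<bar>c * vt x + wt x\<bar>" by (auto simp: abs_mult sgn_if)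
      also have "\<dots> \<le> \<bar>c * vt x\<bar> + \<bar>wt x\<bar>" by (rule abs_triangle_ineq)
      finally have "\<bar>?h x\<bar> \<le> c * \<bar>vt x\<bar> + \<bar>wt x\<bar>" using c by (simp add: abs_mult)
      then show "norm (indicator {0..t} x *\<^sub>R ?h x) \<le> norm (c * norm (indicator {0..t} x *\<^sub>R vt x) + norm (indicator {0..t} x *\<^sub>R wt x))"
        using c by (auto simp: indicator_def)
    qed
  qed
  moreover have "set_integrable lborel {0..t} g"
    unfolding set_integrable_def by (rule integrable_mult_indicator[OF _ g(1)]) auto
  moreover have "AE x\<in>{0..t} in lborel. g x \<le> ?h x"
    using gh AE_lborel_singleton[of 0] AE_lborel_singleton[of T]
    by eventually_elim (use t in auto)
  ultimately have "(LINT s:{0..t}|lborel. g s) \<le> (LINT s:{0..t}|lborel. ?h s)"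
    by (intro set_integral_mono_AE)
  moreover have "?F t - ?F 0 = (LINT s:{0..t}|lborel. g s)" using g(3) t by (auto simp: T less_imp_le)
  ultimately show ?thesis by linarith
qed

section \<open>The tested difference of the equations\<close>

lemma tanh_tendsto_sgn: "(\<lambda>n. tanh (real n * r)) \<longlonglongrightarrow> sgn r"
proof -
  have *: "(\<lambda>n. tanh (real n * s)) \<longlonglongrightarrow> 1" if "s > 0" for s :: real
  proof -
    have "filterlim (\<lambda>n. real n * s) at_top sequentially"
      by (rule filterlim_at_top_mult_tendsto_pos[OF tendsto_const that filterlim_real_sequentially])
    from filterlim_compose[OF tanh_real_at_top this] show ?thesis .
  qed
  consider "r > 0" | "r < 0" | "r = 0" by linarith
  then show ?thesis
  proof cases
    case 2
    then have "(\<lambda>n. - tanh (real n * (- r))) \<longlonglongrightarrow> - 1" by (intro tendsto_minus *) simp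
    then show ?thesis using 2 by simp
  qed (use *[of r] in auto)
qed

text \<open>Each component of \<open>a\<close> along \<open>Du\<close> is a limit of difference
  quotients of \<open>J\<close>, measurable by the Caratheodory property. For integrability, the
  growth exponent \<open>p - 1\<close> times \<open>p / (p - 1)\<close> is \<open>p\<close>.\<close>

lemma gradient_Lp:
  fixes Du :: "'a::euclidean_space \<times> real \<Rightarrow> 'a"
  assumes fin: "finite_measure (lebesgue_on (\<Omega> \<times> I))" and \<Omega>: "\<Omega> \<times> I \<in> sets lebesgue" and p: "p > 1"
    and J_meas: "\<And>\<xi>. (\<lambda>x. J x \<xi>) \<in> borel_measurable (lebesgue_on \<Omega>)"
    and J_nonneg: "\<And>x \<xi>. x \<in> \<Omega> \<Longrightarrow> J x \<xi> \<ge> 0"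
    and J_deriv: "\<And>x \<xi>. x \<in> \<Omega> \<Longrightarrow> (J x has_derivative (\<lambda>h. a x \<xi> \<bullet> h)) (at \<xi>)"
    and J_conv: "\<And>x. x \<in> \<Omega> \<Longrightarrow> strictly_convex (J x)"
    and C: "C > 0" and J_le: "\<And>x \<xi>. x \<in> \<Omega> \<Longrightarrow> J x \<xi> \<le> C * (1 + norm \<xi> powr p)"
    and Du: "Lp p (lebesgue_on (\<Omega> \<times> I)) Du"
  shows "Lp (p / (p - 1)) (lebesgue_on (\<Omega> \<times> I)) (\<lambda>z. a (fst z) (Du z))"
proof -
  let ?N = "lebesgue_on (\<Omega> \<times> I)"
  interpret finite_measure ?N by (rule fin)
  have sp: "fst z \<in> \<Omega>" if "z \<in> space ?N" for z using that by (auto simp: space_restrict_space)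
  have Dm: "Du \<in> borel_measurable ?N" using Du by (simp add: Lp_def)
  have Jc: "continuous_on UNIV (J x)" if "x \<in> \<Omega>" for x
    by (rule has_derivative_continuous_on[of UNIV "J x" "\<lambda>\<xi> h. a x \<xi> \<bullet> h"]) (simp add: J_deriv[OF that])
  have Jm: "(\<lambda>z. J (fst z) (g z)) \<in> borel_measurable ?N" if "g \<in> borel_measurable ?N" for g
    by (rule borel_measurable_Caratheodory[where F = "\<lambda>z. J (fst z)"])
      (use that Jc sp borel_measurable_fst_lebesgue_on[OF J_meas] in auto)
  have comp: "(\<lambda>z. a (fst z) (Du z) \<bullet> b) \<in> borel_measurable ?N" for b
  proof (rule borel_measurable_LIMSEQ_real)
    define h where "h k = 1 / real (Suc k)" for k
    have hl: "filterlim h (at 0) sequentially"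
      unfolding filterlim_at using LIMSEQ_inverse_real_of_nat
      by (auto simp: h_def[abs_def] inverse_eq_divide)
    let ?d = "\<lambda>k z. (J (fst z) (Du z + h k *\<^sub>R b) - J (fst z) (Du z)) / h k"
    show "?d k \<in> borel_measurable ?N" for k
      using Jm[OF Dm] Jm[of "\<lambda>z. Du z + h k *\<^sub>R b"] Dm by simp
    fix z assume z: "z \<in> space ?N"
    have 1: "((\<lambda>r. Du z + r *\<^sub>R b) has_derivative (\<lambda>r. r *\<^sub>R b)) (at 0)" by (auto intro!: derivative_eq_intros)
    have "(J (fst z) has_derivative (\<lambda>h. a (fst z) (Du z) \<bullet> h)) (at (Du z + 0 *\<^sub>R b))"
      using J_deriv[OF sp[OF z]] by simp
    from has_derivative_compose[OF 1 this]
    have "((\<lambda>r. J (fst z) (Du z + r *\<^sub>R b)) has_real_derivative (a (fst z) (Du z) \<bullet> b)) (at 0)"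
      by (simp add: has_field_derivative_def mult_commute_abs)
    then have "((\<lambda>r. (J (fst z) (Du z + r *\<^sub>R b) - J (fst z) (Du z)) / r) \<longlongrightarrow> a (fst z) (Du z) \<bullet> b) (at 0)"
      by (simp add: has_field_derivative_iff)
    from filterlim_compose[OF this hl] show "(\<lambda>k. ?d k z) \<longlonglongrightarrow> a (fst z) (Du z) \<bullet> b" .
  qed
  have am: "(\<lambda>z. a (fst z) (Du z)) \<in> borel_measurable ?N"
  proof -
    have "(\<lambda>z. \<Sum>b\<in>Basis. (a (fst z) (Du z) \<bullet> b) *\<^sub>R b) \<in> borel_measurable ?N"
      by (intro borel_measurable_sum borel_measurable_scaleR comp borel_measurable_const)
    then show ?thesis by (simp add: euclidean_representation)
  qed
  let ?C = "2 * C * 2 powr p" and ?q = "p / (p - 1)"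
  have "integrable ?N (\<lambda>z. norm (a (fst z) (Du z)) powr ?q)"
  proof (rule Bochner_Integration.integrable_bound)
    show "integrable ?N (\<lambda>z. ?C powr ?q * (2 powr p * (1 + norm (Du z) powr p)))"
      using Du by (intro integrable_mult_right Bochner_Integration.integrable_add) (auto simp: Lp_def)
    show "(\<lambda>z. norm (a (fst z) (Du z)) powr ?q) \<in> borel_measurable ?N" using am by measurable
    show "AE z in ?N. norm (norm (a (fst z) (Du z)) powr ?q) \<le> norm (?C powr ?q * (2 powr p * (1 + norm (Du z) powr p)))"
    proof (rule AE_I2)
      fix z assume "z \<in> space ?N"
      then have x: "fst z \<in> \<Omega>" by (rule sp)
      have "norm (a (fst z) (Du z)) \<le> ?C * (1 + norm (Du z)) powr (p - 1)"
        by (rule gradient_growth[OF J_conv[OF x] J_deriv[OF x] J_nonneg[OF x] J_le[OF x]]) (use p C in auto)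
      then have "norm (a (fst z) (Du z)) powr ?q \<le> (?C * (1 + norm (Du z)) powr (p - 1)) powr ?q"
        using p by (intro powr_mono2) auto
      also have "\<dots> = ?C powr ?q * (1 + norm (Du z)) powr p"
        unfolding powr_mult powr_powr using p by simp
      also have "(1 + norm (Du z)) powr p \<le> 2 powr p * (1 + norm (Du z) powr p)"
        using norm_diff_powr_le[of p "1::real" "- norm (Du z)"] p by simp
      finally have "norm (a (fst z) (Du z)) powr ?q \<le> ?C powr ?q * (2 powr p * (1 + norm (Du z) powr p))"
        by (simp add: mult_left_mono)
      then show "norm (norm (a (fst z) (Du z)) powr ?q) \<le> norm (?C powr ?q * (2 powr p * (1 + norm (Du z) powr p)))"
        by (simp only: real_norm_def abs_of_nonneg[OF powr_ge_zero] order_trans[OF _ abs_ge_self])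
    qed
  qed
  then show ?thesis unfolding Lp_def using am by simp
qed

text \<open>The factor with \<open>snd z < t0\<close> stems from cutting the test function off in
  time. The equations put no time derivative on the test function, so a sharp cut-off is
  admissible.\<close>

lemma tested_difference_inequality:
  fixes u1 u2 f1 f2 ut1 ut2 wt1 wt2 :: "'a::euclidean_space \<times> real \<Rightarrow> real" and Du1 Du2 :: "'a \<times> real \<Rightarrow> 'a"
  assumes \<Omega>: "open \<Omega>" "bounded \<Omega>" and T: "0 < T" and p: "p \<ge> 2"
    and c: "c \<in> borel_measurable (lebesgue_on \<Omega>)" "AE x in lebesgue_on \<Omega>. \<bar>c x\<bar> \<le> M"
    and mono: "\<And>x \<xi> \<eta>. x \<in> \<Omega> \<Longrightarrow> 0 \<le> (a x \<xi> - a x \<eta>) \<bullet> (\<xi> - \<eta>)"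
    and aL: "Lp (p / (p - 1)) (lebesgue_on (\<Omega> \<times> {0<..<T})) (\<lambda>z. a (fst z) (Du1 z))"
      "Lp (p / (p - 1)) (lebesgue_on (\<Omega> \<times> {0<..<T})) (\<lambda>z. a (fst z) (Du2 z))"
    and u: "u1 \<in> borel_measurable (lebesgue_on (\<Omega> \<times> {0<..<T}))" "u2 \<in> borel_measurable (lebesgue_on (\<Omega> \<times> {0<..<T}))"
    and Du: "Lp p (lebesgue_on (\<Omega> \<times> {0<..<T})) Du1" "Lp p (lebesgue_on (\<Omega> \<times> {0<..<T})) Du2"
    and W: "AE t in lborel. t \<in> {0<..<T} \<longrightarrow> W1p0 p \<Omega> (\<lambda>x. u1 (x, t)) (\<lambda>x. Du1 (x, t))"
      "AE t in lborel. t \<in> {0<..<T} \<longrightarrow> W1p0 p \<Omega> (\<lambda>x. u2 (x, t)) (\<lambda>x. Du2 (x, t))"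
    and L2: "Lp 2 (lebesgue_on (\<Omega> \<times> {0<..<T})) ut1" "Lp 2 (lebesgue_on (\<Omega> \<times> {0<..<T})) ut2"
      "Lp 2 (lebesgue_on (\<Omega> \<times> {0<..<T})) wt1" "Lp 2 (lebesgue_on (\<Omega> \<times> {0<..<T})) wt2"
      "Lp 2 (lebesgue_on (\<Omega> \<times> {0<..<T})) f1" "Lp 2 (lebesgue_on (\<Omega> \<times> {0<..<T})) f2"
    and eq1: "\<And>\<phi> D\<phi>. Lp_W1p0 p \<Omega> T \<phi> D\<phi> \<Longrightarrow>
      (\<integral>z. c (fst z) * ut1 z * \<phi> z \<partial>lebesgue_on (\<Omega> \<times> {0<..<T})) + (\<integral>z. wt1 z * \<phi> z \<partial>lebesgue_on (\<Omega> \<times> {0<..<T}))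
      + (\<integral>z. a (fst z) (Du1 z) \<bullet> D\<phi> z \<partial>lebesgue_on (\<Omega> \<times> {0<..<T}))
      = (\<integral>z. f1 z * \<phi> z \<partial>lebesgue_on (\<Omega> \<times> {0<..<T}))"
    and eq2: "\<And>\<phi> D\<phi>. Lp_W1p0 p \<Omega> T \<phi> D\<phi> \<Longrightarrow>
      (\<integral>z. c (fst z) * ut2 z * \<phi> z \<partial>lebesgue_on (\<Omega> \<times> {0<..<T})) + (\<integral>z. wt2 z * \<phi> z \<partial>lebesgue_on (\<Omega> \<times> {0<..<T}))
      + (\<integral>z. a (fst z) (Du2 z) \<bullet> D\<phi> z \<partial>lebesgue_on (\<Omega> \<times> {0<..<T}))
      = (\<integral>z. f2 z * \<phi> z \<partial>lebesgue_on (\<Omega> \<times> {0<..<T}))"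
  shows "integrable (lebesgue_on (\<Omega> \<times> {0<..<T})) (\<lambda>z. (c (fst z) * (ut2 z - ut1 z) + (wt2 z - wt1 z)) * (if snd z < t0 then sgn (u2 z - u1 z) else 0))"
    "(\<integral>z. (c (fst z) * (ut2 z - ut1 z) + (wt2 z - wt1 z)) * (if snd z < t0 then sgn (u2 z - u1 z) else 0) \<partial>lebesgue_on (\<Omega> \<times> {0<..<T}))
      \<le> (\<integral>z. \<bar>f2 z - f1 z\<bar> * (if snd z < t0 then 1 else 0) \<partial>lebesgue_on (\<Omega> \<times> {0<..<T}))"
proof -
  let ?Q = "\<Omega> \<times> {0<..<T}"
  let ?N = "lebesgue_on ?Q"
  define q where "q = p / (p - 1)"
  have pq: "p > 1" "q > 1" "1/q + 1/p = 1" using p by (simp_all add: q_def field_simps)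
  have Qb: "?Q \<in> sets borel" "bounded ?Q" using \<Omega> by (auto intro!: borel_open open_Times bounded_Times)
  have Ql: "?Q \<in> sets lebesgue" using Qb by simp
  have \<Omega>l: "\<Omega> \<in> sets lebesgue" using \<Omega> by simp
  have fin: "finite_measure ?N" using Ql Qb by (intro finite_measure_lebesgue_on_bounded)
  interpret finite_measure ?N by (rule fin)
  have L1: "integrable ?N ut1" "integrable ?N ut2" "integrable ?N wt1" "integrable ?N wt2" "integrable ?N f1" "integrable ?N f2"
    using Lp_integrable[OF fin L2(1)] Lp_integrable[OF fin L2(2)] Lp_integrable[OF fin L2(3)]
      Lp_integrable[OF fin L2(4)] Lp_integrable[OF fin L2(5)] Lp_integrable[OF fin L2(6)] by auto
  have cm: "(\<lambda>z. c (fst z)) \<in> borel_measurable ?N" by (rule borel_measurable_fst_lebesgue_on[OF c(1)])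
  have cb: "AE z in ?N. \<bar>c (fst z)\<bar> \<le> M"
  proof -
    have "AE x in lborel. x \<in> \<Omega> \<longrightarrow> \<bar>c x\<bar> \<le> M" using c(2) unfolding AE_lebesgue_on_iff[OF \<Omega>l] .
    from AE_fst[OF this] show ?thesis unfolding AE_lebesgue_on_iff[OF Ql] by eventually_elim auto
  qed
  have ci: "integrable ?N (\<lambda>z. c (fst z) * g z)" if "integrable ?N g" for g :: "'a \<times> real \<Rightarrow> real"
  proof (rule Bochner_Integration.integrable_bound)
    show "integrable ?N (\<lambda>z. M * g z)" using that by simp
    show "(\<lambda>z. c (fst z) * g z) \<in> borel_measurable ?N" using cm that by auto
    show "AE z in ?N. norm (c (fst z) * g z) \<le> norm (M * g z)"
      using cb by eventually_elim (auto simp: abs_mult intro!: mult_right_mono)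
  qed
  have \<phi>i: "integrable ?N (\<lambda>z. g z * \<phi> z)"
    if "integrable ?N g" "\<phi> \<in> borel_measurable ?N" "\<And>z. \<bar>\<phi> z\<bar> \<le> 1" for g \<phi> :: "'a \<times> real \<Rightarrow> real"
  proof (rule Bochner_Integration.integrable_bound[OF that(1)])
    show "(\<lambda>z. g z * \<phi> z) \<in> borel_measurable ?N" using that by auto
    show "AE z in ?N. norm (g z * \<phi> z) \<le> norm (g z)" using that(3) by (intro AE_I2) (simp add: abs_mult mult_left_le)
  qed
  define V where "V z = u2 z - u1 z" for z
  define D where "D z = Du2 z - Du1 z" for z
  \<comment> \<open>The cut-off is placed inside \<open>tanh\<close>: each slice is then covered by
    the chain rule, with parameter \<open>n\<close> before \<open>t0\<close> and afterwards with
    parameter 0, which gives the zero function.\<close>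
  define m where "m n t = (if t < t0 then real n else 0)" for n t
  define \<phi> where "\<phi> n z = tanh (m n (snd z) * V z)" for n z
  define D\<phi> where "D\<phi> n z = (m n (snd z) * (1 - (\<phi> n z)\<^sup>2)) *\<^sub>R D z" for n z
  define S where "S z = (if snd z < t0 then sgn (V z) else 0)" for z
  have Vm: "V \<in> borel_measurable ?N" unfolding V_def[abs_def] using u by simp
  have DL: "Lp p ?N D" unfolding D_def[abs_def] using Du p by (intro Lp_diff) auto
  have Dm: "D \<in> borel_measurable ?N" using DL by (simp add: Lp_def)
  have sm: "snd \<in> borel_measurable (borel :: ('a \<times> real) measure)" by (intro borel_measurable_continuous_onI continuous_intros)
  have mm: "(\<lambda>z. m n (snd z)) \<in> borel_measurable ?N" for n
    by (rule borel_measurable_lebesgue_on, rule measurable_compose[OF sm]) (simp add: m_def[abs_def])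
  have im: "(\<lambda>z. if snd z < t0 then 1 else 0 :: real) \<in> borel_measurable ?N"
    by (rule borel_measurable_lebesgue_on, rule measurable_compose[OF sm]) simp
  have \<phi>m: "\<phi> n \<in> borel_measurable ?N" for n
    unfolding \<phi>_def[abs_def]
    by (rule borel_measurable_continuous_on[of tanh]) (use mm[of n] Vm in \<open>auto intro!: continuous_intros\<close>)
  have D\<phi>m: "D\<phi> n \<in> borel_measurable ?N" for n
    unfolding D\<phi>_def[abs_def] using mm[of n] \<phi>m[of n] Dm by measurable
  have \<phi>1: "\<bar>\<phi> n z\<bar> \<le> 1" for n z
    using tanh_real_bounds[of "m n (snd z) * V z"] by (simp add: \<phi>_def abs_le_iff less_imp_le)
  have \<phi>sq: "0 \<le> 1 - (\<phi> n z)\<^sup>2" "1 - (\<phi> n z)\<^sup>2 \<le> 1" for n z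
    using tanh_square_le_1[of "m n (snd z) * V z"] by (auto simp: \<phi>_def)
  have mn: "0 \<le> m n t" "m n t \<le> real n" for n t by (auto simp: m_def)
  have D\<phi>L: "Lp p ?N (D\<phi> n)" for n
  proof (rule Lp_dominated[OF DL D\<phi>m])
    show "AE z in ?N. norm (D\<phi> n z) \<le> real n * norm (D z)"
    proof (rule AE_I2)
      fix z
      have "m n (snd z) * (1 - (\<phi> n z)\<^sup>2) \<le> real n * 1" using mn \<phi>sq by (intro mult_mono) auto
      then have "\<bar>m n (snd z) * (1 - (\<phi> n z)\<^sup>2)\<bar> \<le> real n" using mn(1)[of n "snd z"] \<phi>sq(1)[of n z] by simp
      then show "norm (D\<phi> n z) \<le> real n * norm (D z)" unfolding D\<phi>_def norm_scaleR by (rule mult_right_mono) simp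
    qed
  qed (use p in auto)
  have test: "Lp_W1p0 p \<Omega> T (\<phi> n) (D\<phi> n)" for n
    unfolding Lp_W1p0_def
  proof (intro conjI)
    show "Lp p ?N (\<phi> n)" by (rule Lp_bounded[OF \<phi>m, where C = 1]) (use \<phi>1 p in auto)
    show "Lp p ?N (D\<phi> n)" by (rule D\<phi>L)
    show "AE t in lborel. t \<in> {0<..<T} \<longrightarrow> W1p0 p \<Omega> (\<lambda>x. \<phi> n (x, t)) (\<lambda>x. D\<phi> n (x, t))"
      using W
    proof eventually_elim
      case (elim t)
      show ?case
      proof
        assume t: "t \<in> {0<..<T}"
        have "W1p0 p \<Omega> (\<lambda>x. u1 (x, t)) (\<lambda>x. Du1 (x, t))" "W1p0 p \<Omega> (\<lambda>x. u2 (x, t)) (\<lambda>x. Du2 (x, t))" using elim t by blast+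
        from W1p0_tanh_diff[OF \<Omega>l \<Omega>(2) pq(1) this, of "m n t"]
        show "W1p0 p \<Omega> (\<lambda>x. \<phi> n (x, t)) (\<lambda>x. D\<phi> n (x, t))" by (simp add: \<phi>_def D\<phi>_def V_def D_def)
      qed
    qed
  qed
  let ?X = "\<lambda>z. c (fst z) * (ut2 z - ut1 z) + (wt2 z - wt1 z)"
  have XI: "integrable ?N ?X" using L1 by (intro Bochner_Integration.integrable_add ci Bochner_Integration.integrable_diff)
  have ineq: "(\<integral>z. ?X z * \<phi> n z \<partial>?N) \<le> (\<integral>z. \<bar>f2 z - f1 z\<bar> * (if snd z < t0 then 1 else 0) \<partial>?N)" for n
  proof -
    have i: "integrable ?N (\<lambda>z. c (fst z) * ut1 z * \<phi> n z)" "integrable ?N (\<lambda>z. c (fst z) * ut2 z * \<phi> n z)"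
      "integrable ?N (\<lambda>z. wt1 z * \<phi> n z)" "integrable ?N (\<lambda>z. wt2 z * \<phi> n z)" "integrable ?N (\<lambda>z. f1 z * \<phi> n z)" "integrable ?N (\<lambda>z. f2 z * \<phi> n z)"
      by (rule \<phi>i[OF ci[OF L1(1)] \<phi>m \<phi>1] \<phi>i[OF ci[OF L1(2)] \<phi>m \<phi>1] \<phi>i[OF L1(3) \<phi>m \<phi>1]
          \<phi>i[OF L1(4) \<phi>m \<phi>1] \<phi>i[OF L1(5) \<phi>m \<phi>1] \<phi>i[OF L1(6) \<phi>m \<phi>1])+
    have j: "integrable ?N (\<lambda>z. a (fst z) (Du1 z) \<bullet> D\<phi> n z)" "integrable ?N (\<lambda>z. a (fst z) (Du2 z) \<bullet> D\<phi> n z)"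
    proof -
      have aL': "Lp q ?N (\<lambda>z. a (fst z) (Du1 z))" "Lp q ?N (\<lambda>z. a (fst z) (Du2 z))" using aL by (simp_all add: q_def)
      show "integrable ?N (\<lambda>z. a (fst z) (Du1 z) \<bullet> D\<phi> n z)" by (rule Lp_inner_integrable[OF aL'(1) D\<phi>L pq(2,1,3)])
      show "integrable ?N (\<lambda>z. a (fst z) (Du2 z) \<bullet> D\<phi> n z)" by (rule Lp_inner_integrable[OF aL'(2) D\<phi>L pq(2,1,3)])
    qed
    have "(\<integral>z. ?X z * \<phi> n z \<partial>?N) = (\<integral>z. (c (fst z) * ut2 z * \<phi> n z - c (fst z) * ut1 z * \<phi> n z) + (wt2 z * \<phi> n z - wt1 z * \<phi> n z) \<partial>?N)"
      by (rule Bochner_Integration.integral_cong[OF refl]) (simp add: algebra_simps)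
    also have "\<dots> = (\<integral>z. c (fst z) * ut2 z * \<phi> n z \<partial>?N) - (\<integral>z. c (fst z) * ut1 z * \<phi> n z \<partial>?N)
        + ((\<integral>z. wt2 z * \<phi> n z \<partial>?N) - (\<integral>z. wt1 z * \<phi> n z \<partial>?N))"
      using i by simp
    also have "\<dots> = (\<integral>z. f2 z * \<phi> n z \<partial>?N) - (\<integral>z. f1 z * \<phi> n z \<partial>?N)
        - ((\<integral>z. a (fst z) (Du2 z) \<bullet> D\<phi> n z \<partial>?N) - (\<integral>z. a (fst z) (Du1 z) \<bullet> D\<phi> n z \<partial>?N))"
      using eq1[OF test, of n] eq2[OF test, of n] by linarith
    also have "(\<integral>z. a (fst z) (Du2 z) \<bullet> D\<phi> n z \<partial>?N) - (\<integral>z. a (fst z) (Du1 z) \<bullet> D\<phi> n z \<partial>?N)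
        = (\<integral>z. a (fst z) (Du2 z) \<bullet> D\<phi> n z - a (fst z) (Du1 z) \<bullet> D\<phi> n z \<partial>?N)"
      using j by simp
    also have "(\<integral>z. f2 z * \<phi> n z \<partial>?N) - (\<integral>z. f1 z * \<phi> n z \<partial>?N) = (\<integral>z. f2 z * \<phi> n z - f1 z * \<phi> n z \<partial>?N)"
      using i by simp
    finally have e: "(\<integral>z. ?X z * \<phi> n z \<partial>?N) = (\<integral>z. f2 z * \<phi> n z - f1 z * \<phi> n z \<partial>?N)
        - (\<integral>z. a (fst z) (Du2 z) \<bullet> D\<phi> n z - a (fst z) (Du1 z) \<bullet> D\<phi> n z \<partial>?N)" .
    \<comment> \<open>The gradient of the test function is a nonnegative multiple of
      \<open>Du2 - Du1\<close>, so monotonicity of \<open>a\<close> fixes the sign.\<close>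
    have "0 \<le> (\<integral>z. a (fst z) (Du2 z) \<bullet> D\<phi> n z - a (fst z) (Du1 z) \<bullet> D\<phi> n z \<partial>?N)"
    proof (rule integral_nonneg_AE, rule AE_I2)
      fix z assume "z \<in> space ?N"
      then have x: "fst z \<in> \<Omega>" by (auto simp: space_restrict_space)
      have "a (fst z) (Du2 z) \<bullet> D\<phi> n z - a (fst z) (Du1 z) \<bullet> D\<phi> n z
        = (m n (snd z) * (1 - (\<phi> n z)\<^sup>2)) * ((a (fst z) (Du2 z) - a (fst z) (Du1 z)) \<bullet> (Du2 z - Du1 z))"
        by (simp add: D\<phi>_def D_def inner_diff_left right_diff_distrib)
      also have "\<dots> \<ge> 0" using mn(1) \<phi>sq(1) mono[OF x] by (intro mult_nonneg_nonneg) auto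
      finally show "0 \<le> a (fst z) (Du2 z) \<bullet> D\<phi> n z - a (fst z) (Du1 z) \<bullet> D\<phi> n z" .
    qed
    moreover have "(\<integral>z. f2 z * \<phi> n z - f1 z * \<phi> n z \<partial>?N) \<le> (\<integral>z. \<bar>f2 z - f1 z\<bar> * (if snd z < t0 then 1 else 0) \<partial>?N)"
    proof (rule integral_mono)
      show "integrable ?N (\<lambda>z. f2 z * \<phi> n z - f1 z * \<phi> n z)" using i by (intro Bochner_Integration.integrable_diff)
      show "integrable ?N (\<lambda>z. \<bar>f2 z - f1 z\<bar> * (if snd z < t0 then 1 else 0))"
        using L1 by (intro \<phi>i im integrable_abs Bochner_Integration.integrable_diff) auto
      fix z
      have "f2 z * \<phi> n z - f1 z * \<phi> n z \<le> \<bar>f2 z - f1 z\<bar> * \<bar>\<phi> n z\<bar>"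
        using abs_ge_self[of "(f2 z - f1 z) * \<phi> n z"] unfolding abs_mult by (simp add: left_diff_distrib)
      also have "\<dots> \<le> \<bar>f2 z - f1 z\<bar> * (if snd z < t0 then 1 else 0)"
        using \<phi>1[of n z] by (intro mult_left_mono) (auto simp: \<phi>_def m_def)
      finally show "f2 z * \<phi> n z - f1 z * \<phi> n z \<le> \<bar>f2 z - f1 z\<bar> * (if snd z < t0 then 1 else 0)" .
    qed
    ultimately show ?thesis using e by linarith
  qed
  have Sm: "S \<in> borel_measurable ?N"
  proof -
    have "(\<lambda>z. (if snd z < t0 then 1 else 0) * sgn (V z)) \<in> borel_measurable ?N" using im Vm by measurable
    moreover have "(\<lambda>z. (if snd z < t0 then 1 else 0) * sgn (V z)) = S" by (auto simp: S_def fun_eq_iff)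
    ultimately show ?thesis by simp
  qed
  have S1: "\<bar>S z\<bar> \<le> 1" for z by (auto simp: S_def sgn_if)
  show "integrable ?N (\<lambda>z. ?X z * (if snd z < t0 then sgn (u2 z - u1 z) else 0))"
    using \<phi>i[OF XI Sm S1] unfolding S_def V_def .
  have "(\<lambda>n. \<integral>z. ?X z * \<phi> n z \<partial>?N) \<longlonglongrightarrow> (\<integral>z. ?X z * S z \<partial>?N)"
  proof (rule integral_dominated_convergence[where w = "\<lambda>z. norm (?X z)"])
    show "(\<lambda>z. ?X z * S z) \<in> borel_measurable ?N" using \<phi>i[OF XI Sm S1] by auto
    show "(\<lambda>z. ?X z * \<phi> n z) \<in> borel_measurable ?N" for n using \<phi>i[OF XI \<phi>m \<phi>1] by auto
    show "integrable ?N (\<lambda>z. norm (?X z))" by (rule integrable_norm[OF XI])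
    show "AE z in ?N. (\<lambda>n. ?X z * \<phi> n z) \<longlonglongrightarrow> ?X z * S z"
    proof (rule AE_I2, rule tendsto_mult_left)
      fix z
      show "(\<lambda>n. \<phi> n z) \<longlonglongrightarrow> S z"
        using tanh_tendsto_sgn[of "V z"] by (simp add: \<phi>_def m_def S_def)
    qed
    show "AE z in ?N. norm (?X z * \<phi> n z) \<le> norm (?X z)" for n
      using \<phi>1 by (intro AE_I2) (simp add: abs_mult mult_left_le)
  qed
  from LIMSEQ_le_const2[OF this] ineq
  have "(\<integral>z. ?X z * S z \<partial>?N) \<le> (\<integral>z. \<bar>f2 z - f1 z\<bar> * (if snd z < t0 then 1 else 0) \<partial>?N)" by blast
  then show "(\<integral>z. ?X z * (if snd z < t0 then sgn (u2 z - u1 z) else 0) \<partial>?N)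
      \<le> (\<integral>z. \<bar>f2 z - f1 z\<bar> * (if snd z < t0 then 1 else 0) \<partial>?N)" unfolding S_def V_def .
qed

section \<open>Assembly of the contraction estimate\<close>

text \<open>Almost every slice agrees almost everywhere with a Borel slice, hence is measurable by
  completeness.\<close>

lemma slice_integrable_lebesgue_on:
  fixes F :: "'a::euclidean_space \<times> real \<Rightarrow> real"
  assumes \<Omega>: "open \<Omega>" and F: "integrable (lebesgue_on (\<Omega> \<times> {0<..<T})) F"
  shows "AE t in lborel. t \<in> {0<..<T} \<longrightarrow> integrable (lebesgue_on \<Omega>) (\<lambda>x. F (x, t))"
proof -
  let ?Q = "\<Omega> \<times> {0<..<T}"
  have Qb: "?Q \<in> sets borel" using \<Omega> by (intro borel_open open_Times) auto
  have \<Omega>b: "\<Omega> \<in> sets borel" "\<Omega> \<in> sets lebesgue" using \<Omega> by auto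
  have Fm: "F \<in> borel_measurable (lebesgue_on ?Q)" using F by auto
  from borel_version_real[OF Qb Fm] obtain g where g: "g \<in> borel_measurable borel" "\<forall>z. z \<notin> ?Q \<longrightarrow> g z = 0"
    "AE z in lborel. z \<in> ?Q \<longrightarrow> F z = g z" by (elim exE conjE)
  have g0: "g z = 0" if "z \<notin> ?Q" for z using g(2) that by blast
  have "integrable lborel g" using integral_borel_version(1)[OF Qb g(1) g0 Fm g(3)] F by simp
  from lborel_Fubini(4)[OF this] AE_lborel_pair(2)[OF g(3)] show ?thesis
  proof eventually_elim
    case (elim t)
    show ?case
    proof
      assume t: "t \<in> {0<..<T}"
      have ae: "AE x in lborel. x \<in> \<Omega> \<longrightarrow> F (x, t) = g (x, t)" using elim(2) by eventually_elim (use t in auto)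
      have gm: "(\<lambda>x. g (x, t)) \<in> borel_measurable borel" by (rule slice_measurable(1)[OF g(1)])
      have m: "(\<lambda>x. F (x, t)) \<in> borel_measurable (lebesgue_on \<Omega>)"
        by (rule AE_eq_borel_measurable_lebesgue_on[OF \<Omega>b(2) borel_measurable_lebesgue_on[OF gm] ae])
      show "integrable (lebesgue_on \<Omega>) (\<lambda>x. F (x, t))"
        using integral_borel_version(1)[OF \<Omega>b(1) gm _ m ae] elim(1) g0 by auto
    qed
  qed
qed

theorem theorem5p3:
  fixes \<Omega> :: "'a::euclidean_space set" and T p :: real
    and J :: "'a \<Rightarrow> 'a \<Rightarrow> real" and a :: "'a \<Rightarrow> 'a \<Rightarrow> 'a" and c :: "'a \<Rightarrow> real"
    and W :: "'a \<Rightarrow> (real \<Rightarrow> real) \<Rightarrow> real \<Rightarrow> real"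
    and \<alpha> \<alpha>1 \<alpha>2 L \<gamma>0 \<gamma>1 :: real and \<upsilon> \<kappa>0 \<kappa>1 :: "'a \<Rightarrow> real"
    and f1 f2 u1 u2 w1 w2 :: "'a \<times> real \<Rightarrow> real" and u01 u02 :: "'a \<Rightarrow> real"
  assumes dom: "smooth_domain \<Omega>" and T: "T > 0" and p: "p \<ge> 2"
    \<comment> \<open>J and a = grad_lambda J\<close>
    and J_meas: "\<And>\<xi>. (\<lambda>x. J x \<xi>) \<in> borel_measurable (lebesgue_on \<Omega>)"
    and J_nonneg: "\<And>x \<xi>. x \<in> \<Omega> \<Longrightarrow> J x \<xi> \<ge> 0"
    and J_deriv: "\<And>x \<xi>. x \<in> \<Omega> \<Longrightarrow> (J x has_derivative (\<lambda>h. a x \<xi> \<bullet> h)) (at \<xi>)"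
    and J_conv: "\<And>x. x \<in> \<Omega> \<Longrightarrow> strictly_convex (J x)"
    and \<alpha>12: "\<alpha>1 > 0" "\<alpha>2 > 0"
    and J_bounds: "\<And>x \<xi>. x \<in> \<Omega> \<Longrightarrow>
        \<alpha>1 * norm \<xi> powr p \<le> J x \<xi> \<and> J x \<xi> \<le> \<alpha>2 * (1 + norm \<xi> powr p)"
    \<comment> \<open>c in L^infinity, c >= alpha > 0\<close>
    and c_meas: "c \<in> borel_measurable (lebesgue_on \<Omega>)"
    and c_bdd: "\<exists>M. AE x in lebesgue_on \<Omega>. \<bar>c x\<bar> \<le> M"
    and \<alpha>: "\<alpha> > 0" and c_ge: "AE x in lebesgue_on \<Omega>. c x \<ge> \<alpha>"
    \<comment> \<open>(A4)\<close>
    and W_hyst: "\<And>x. x \<in> \<Omega> \<Longrightarrow> hysteresis_operator T (W x)"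
    and W_cont: "\<And>x. x \<in> \<Omega> \<Longrightarrow> continuous_on_C T (W x)"
    and W_pinc: "\<And>x. x \<in> \<Omega> \<Longrightarrow> piecewise_increasing T (W x)"
    and L: "L > 0" and \<upsilon>: "Lp 2 (lebesgue_on \<Omega>) \<upsilon>"
    and W_affine: "\<And>x v. x \<in> \<Omega> \<Longrightarrow> continuous_on {0..T} v \<Longrightarrow>
        (SUP t\<in>{0..T}. \<bar>W x v t\<bar>) \<le> L * (SUP t\<in>{0..T}. \<bar>v t\<bar>) + \<upsilon> x"
    and Wf_meas: "\<And>k::nat. (\<lambda>(x, s). gen_functional T (W x) (map s [0..<Suc k]))
        \<in> borel_measurable (lebesgue_on \<Omega> \<Otimes>\<^sub>M PiM {..k} (\<lambda>_. lborel))"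
    and \<kappa>0: "Lp 2 (lebesgue_on \<Omega>) \<kappa>0" and \<gamma>0: "\<gamma>0 > 0"
    and Wf_bound: "\<And>x s. x \<in> \<Omega> \<Longrightarrow> s \<noteq> [] \<Longrightarrow>
        \<bar>gen_functional T (W x) s\<bar> \<le> \<kappa>0 x + \<gamma>0 * Max (abs ` set s)"
    \<comment> \<open>(A5)\<close>
    and \<kappa>1: "Lp 2 (lebesgue_on \<Omega>) \<kappa>1" and \<gamma>1: "\<gamma>1 > 0"
    and W_W11: "\<And>x v. x \<in> \<Omega> \<Longrightarrow> abs_cont_on {0..T} v \<Longrightarrow>
        abs_cont_on {0..T} (W x v) \<and>
        (AE t in lborel. t \<in> {0<..<T} \<longrightarrow> (\<forall>D E. (v has_real_derivative E) (at t) \<longrightarrow>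
            (W x v has_real_derivative D) (at t) \<longrightarrow> \<bar>D\<bar> \<le> \<kappa>1 x + \<gamma>1 * \<bar>E\<bar>))"
    \<comment> \<open>Hilpert-type inequality\<close>
    and W_hilpert: "\<And>x v1 v2. x \<in> \<Omega> \<Longrightarrow> abs_cont_on {0..T} v1 \<Longrightarrow> abs_cont_on {0..T} v2 \<Longrightarrow>
        AE t in lborel. t \<in> {0<..<T} \<longrightarrow>
          (\<forall>D1 D2. ((\<lambda>s. max (W x v2 s - W x v1 s) 0) has_real_derivative D1) (at t) \<longrightarrow>
                   ((\<lambda>s. W x v2 s - W x v1 s) has_real_derivative D2) (at t) \<longrightarrow>
                   D1 \<le> D2 * heaviside (v2 t - v1 t))"
    \<comment> \<open>data and solutions\<close>
    and u0: "\<exists>g. W1p0 p \<Omega> u01 g" "\<exists>g. W1p0 p \<Omega> u02 g"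
    and f: "Lp 2 (lebesgue_on (\<Omega> \<times> {0<..<T})) f1" "Lp 2 (lebesgue_on (\<Omega> \<times> {0<..<T})) f2"
    and sol1: "weak_solution \<Omega> T p a c W f1 u01 u1 w1"
    and sol2: "weak_solution \<Omega> T p a c W f2 u02 u2 w2"
  shows "AE t in lborel. t \<in> {0<..<T} \<longrightarrow>
     (LINT x:\<Omega>|lebesgue. c x * \<bar>u2 (x, t) - u1 (x, t)\<bar>)
     + (LINT x:\<Omega>|lebesgue. \<bar>w2 (x, t) - w1 (x, t)\<bar>)
     \<le> (LINT x:\<Omega>|lebesgue. c x * \<bar>u02 x - u01 x\<bar>)
       + (LINT x:\<Omega>|lebesgue. \<bar>w2 (x, 0) - w1 (x, 0)\<bar>)
       + (LINT z:\<Omega> \<times> {0<..<t}|lebesgue. \<bar>f2 z - f1 z\<bar>)"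
proof -
  let ?Q = "\<Omega> \<times> {0<..<T}"
  let ?N = "lebesgue_on ?Q"
  let ?M = "lebesgue_on \<Omega>"
  have \<Omega>: "open \<Omega>" "bounded \<Omega>" using dom by (simp_all add: smooth_domain_def)
  have Qb: "?Q \<in> sets borel" "bounded ?Q" using \<Omega> by (auto intro!: borel_open open_Times bounded_Times)
  have Ql: "?Q \<in> sets lebesgue" using Qb by simp
  have \<Omega>b: "\<Omega> \<in> sets borel" "\<Omega> \<in> sets lebesgue" using \<Omega> by auto
  have finN: "finite_measure ?N" using Ql Qb by (intro finite_measure_lebesgue_on_bounded)
  have finM: "finite_measure ?M" using \<Omega>b \<Omega> by (intro finite_measure_lebesgue_on_bounded)
  have p1: "p > 1" "1 \<le> p" using p by simp_all
  obtain M where M: "AE x in ?M. \<bar>c x\<bar> \<le> M" using c_bdd by (elim exE)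
  have W: "\<forall>x v. x \<in> \<Omega> \<longrightarrow> abs_cont_on {0..T} v \<longrightarrow>
        abs_cont_on {0..T} (W x v) \<and>
        (AE t in lborel. t \<in> {0<..<T} \<longrightarrow> (\<forall>D E. (v has_real_derivative E) (at t) \<longrightarrow>
            (W x v has_real_derivative D) (at t) \<longrightarrow> \<bar>D\<bar> \<le> \<kappa>1 x + \<gamma>1 * \<bar>E\<bar>))"
    by (intro allI impI W_W11)
  from weak_solution_strong_form[OF \<Omega> T p c_meas \<kappa>1 \<gamma>1 W sol1]
  obtain Du1 ut1 wt1 where r1: "u1 \<in> borel_measurable ?N" "Lp p ?N Du1"
    "AE t in lborel. t \<in> {0<..<T} \<longrightarrow> W1p0 p \<Omega> (\<lambda>x. u1 (x, t)) (\<lambda>x. Du1 (x, t))"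
    "ut1 \<in> borel_measurable borel" "\<forall>z. z \<notin> ?Q \<longrightarrow> ut1 z = 0" "Lp 2 lborel ut1"
    "wt1 \<in> borel_measurable borel" "\<forall>z. z \<notin> ?Q \<longrightarrow> wt1 z = 0" "Lp 2 lborel wt1" "Lp 2 ?N w1"
    and x1: "AE x in lborel. x \<in> \<Omega> \<longrightarrow> abs_cont_on {0..T} (\<lambda>t. u1 (x, t)) \<and> u1 (x, 0) = u01 x \<and>
      (AE t in lborel. t \<in> {0<..<T} \<longrightarrow> ((\<lambda>s. u1 (x, s)) has_real_derivative ut1 (x, t)) (at t)) \<and>
      (\<forall>t\<in>{0..T}. w1 (x, t) = W x (\<lambda>s. u1 (x, s)) t) \<and> abs_cont_on {0..T} (\<lambda>t. w1 (x, t)) \<and>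
      (AE t in lborel. t \<in> {0<..<T} \<longrightarrow> ((\<lambda>s. w1 (x, s)) has_real_derivative wt1 (x, t)) (at t))"
    and e1: "\<forall>\<phi> D\<phi>. Lp_W1p0 p \<Omega> T \<phi> D\<phi> \<longrightarrow>
      (\<integral>z. c (fst z) * ut1 z * \<phi> z \<partial>?N) + (\<integral>z. wt1 z * \<phi> z \<partial>?N) + (\<integral>z. a (fst z) (Du1 z) \<bullet> D\<phi> z \<partial>?N)
      = (\<integral>z. f1 z * \<phi> z \<partial>?N)"
    by (elim exE conjE)
  from weak_solution_strong_form[OF \<Omega> T p c_meas \<kappa>1 \<gamma>1 W sol2]
  obtain Du2 ut2 wt2 where r2: "u2 \<in> borel_measurable ?N" "Lp p ?N Du2"
    "AE t in lborel. t \<in> {0<..<T} \<longrightarrow> W1p0 p \<Omega> (\<lambda>x. u2 (x, t)) (\<lambda>x. Du2 (x, t))"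
    "ut2 \<in> borel_measurable borel" "\<forall>z. z \<notin> ?Q \<longrightarrow> ut2 z = 0" "Lp 2 lborel ut2"
    "wt2 \<in> borel_measurable borel" "\<forall>z. z \<notin> ?Q \<longrightarrow> wt2 z = 0" "Lp 2 lborel wt2" "Lp 2 ?N w2"
    and x2: "AE x in lborel. x \<in> \<Omega> \<longrightarrow> abs_cont_on {0..T} (\<lambda>t. u2 (x, t)) \<and> u2 (x, 0) = u02 x \<and>
      (AE t in lborel. t \<in> {0<..<T} \<longrightarrow> ((\<lambda>s. u2 (x, s)) has_real_derivative ut2 (x, t)) (at t)) \<and>
      (\<forall>t\<in>{0..T}. w2 (x, t) = W x (\<lambda>s. u2 (x, s)) t) \<and> abs_cont_on {0..T} (\<lambda>t. w2 (x, t)) \<and>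
      (AE t in lborel. t \<in> {0<..<T} \<longrightarrow> ((\<lambda>s. w2 (x, s)) has_real_derivative wt2 (x, t)) (at t))"
    and e2: "\<forall>\<phi> D\<phi>. Lp_W1p0 p \<Omega> T \<phi> D\<phi> \<longrightarrow>
      (\<integral>z. c (fst z) * ut2 z * \<phi> z \<partial>?N) + (\<integral>z. wt2 z * \<phi> z \<partial>?N) + (\<integral>z. a (fst z) (Du2 z) \<bullet> D\<phi> z \<partial>?N)
      = (\<integral>z. f2 z * \<phi> z \<partial>?N)"
    by (elim exE conjE)
  have z1: "ut1 z = 0" "wt1 z = 0" "ut2 z = 0" "wt2 z = 0" if "z \<notin> ?Q" for z
    using r1(5,8) r2(5,8) that by blast+
  have L2: "Lp 2 ?N ut1" "Lp 2 ?N ut2" "Lp 2 ?N wt1" "Lp 2 ?N wt2"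
    using Lp_bounded_support(2)[OF Qb r1(4) z1(1) r1(6)] Lp_bounded_support(2)[OF Qb r2(4) z1(3) r2(6)]
      Lp_bounded_support(2)[OF Qb r1(7) z1(2) r1(9)] Lp_bounded_support(2)[OF Qb r2(7) z1(4) r2(9)] by auto
  have LI: "integrable lborel wt1" "integrable lborel wt2"
    using Lp_bounded_support(1)[OF Qb r1(7) z1(2) r1(9)] Lp_bounded_support(1)[OF Qb r2(7) z1(4) r2(9)] by auto
  have J_le: "J x \<xi> \<le> \<alpha>2 * (1 + norm \<xi> powr p)" if "x \<in> \<Omega>" for x \<xi> using J_bounds[OF that] by blast
  have aL: "Lp (p / (p - 1)) ?N (\<lambda>z. a (fst z) (Du1 z))" "Lp (p / (p - 1)) ?N (\<lambda>z. a (fst z) (Du2 z))"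
    by (rule gradient_Lp[OF finN Ql p1(1) J_meas J_nonneg J_deriv J_conv \<alpha>12(2) J_le r1(2)]; assumption)
       (rule gradient_Lp[OF finN Ql p1(1) J_meas J_nonneg J_deriv J_conv \<alpha>12(2) J_le r2(2)]; assumption)
  have mono: "0 \<le> (a x \<xi> - a x \<eta>) \<bullet> (\<xi> - \<eta>)" if "x \<in> \<Omega>" for x \<xi> \<eta>
    using gradient_monotone[OF J_conv[OF that] J_deriv[OF that]] .
  define V where "V z = u2 z - u1 z" for z
  define \<omega> where "\<omega> z = w2 z - w1 z" for z
  define vt where "vt z = ut2 z - ut1 z" for z
  define wt where "wt z = wt2 z - wt1 z" for z
  have vtm: "vt \<in> borel_measurable borel" "wt \<in> borel_measurable borel"
    using r1(4,7) r2(4,7) by (simp_all add: vt_def[abs_def] wt_def[abs_def])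
  have vt0: "vt z = 0" "wt z = 0" if "z \<notin> ?Q" for z using z1[OF that] by (simp_all add: vt_def wt_def)
  have wtI: "integrable lborel wt" unfolding wt_def[abs_def] using LI by simp
  have Vm: "V \<in> borel_measurable ?N" unfolding V_def[abs_def] using r1(1) r2(1) by simp
  \<comment> \<open>The integrand containing the sign of \<open>V\<close> and the coefficient
    \<open>c\<close> has to be Borel on the product for Fubini, hence representatives of
    both.\<close>
  from borel_version_real[OF Qb(1) Vm] obtain vh where vh: "vh \<in> borel_measurable borel" "\<forall>z. z \<notin> ?Q \<longrightarrow> vh z = 0"
    "AE z in lborel. z \<in> ?Q \<longrightarrow> V z = vh z" by (elim exE conjE)
  from borel_version_real[OF \<Omega>b(1) c_meas] obtain ch where ch: "ch \<in> borel_measurable borel" "\<forall>x. x \<notin> \<Omega> \<longrightarrow> ch x = 0"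
    "AE x in lborel. x \<in> \<Omega> \<longrightarrow> c x = ch x" by (elim exE conjE)
  have c0: "AE x in lborel. x \<in> \<Omega> \<longrightarrow> 0 \<le> c x"
    using c_ge[unfolded AE_lebesgue_on_iff[OF \<Omega>b(2)]] by eventually_elim (use \<alpha> in auto)
  have X: "AE x in lborel. x \<in> \<Omega> \<longrightarrow> abs_cont_on {0..T} (\<lambda>t. V (x, t)) \<and> abs_cont_on {0..T} (\<lambda>t. \<omega> (x, t)) \<and>
      V (x, 0) = u02 x - u01 x \<and>
      (AE t in lborel. t \<in> {0<..<T} \<longrightarrow> ((\<lambda>s. V (x, s)) has_real_derivative vt (x, t)) (at t)) \<and>
      (AE t in lborel. t \<in> {0<..<T} \<longrightarrow> ((\<lambda>s. \<omega> (x, s)) has_real_derivative wt (x, t)) (at t)) \<and>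
      (AE t in lborel. t \<in> {0<..<T} \<longrightarrow> (\<forall>D1 D2. ((\<lambda>s. max (\<omega> (x, s)) 0) has_real_derivative D1) (at t) \<longrightarrow>
        ((\<lambda>s. \<omega> (x, s)) has_real_derivative D2) (at t) \<longrightarrow> D1 \<le> D2 * heaviside (V (x, t)))) \<and>
      (AE t in lborel. t \<in> {0<..<T} \<longrightarrow> (\<forall>D1 D2. ((\<lambda>s. max (- \<omega> (x, s)) 0) has_real_derivative D1) (at t) \<longrightarrow>
        ((\<lambda>s. - \<omega> (x, s)) has_real_derivative D2) (at t) \<longrightarrow> D1 \<le> D2 * heaviside (- V (x, t))))"
    using x1 x2
  proof eventually_elim
    case (elim x)
    show ?case
    proof (intro impI)
      assume x: "x \<in> \<Omega>"
      have a: "abs_cont_on {0..T} (\<lambda>t. u1 (x, t))" "abs_cont_on {0..T} (\<lambda>t. u2 (x, t))"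
        "abs_cont_on {0..T} (\<lambda>t. w1 (x, t))" "abs_cont_on {0..T} (\<lambda>t. w2 (x, t))" "u1 (x, 0) = u01 x" "u2 (x, 0) = u02 x"
        and d: "AE t in lborel. t \<in> {0<..<T} \<longrightarrow> ((\<lambda>s. u1 (x, s)) has_real_derivative ut1 (x, t)) (at t)"
          "AE t in lborel. t \<in> {0<..<T} \<longrightarrow> ((\<lambda>s. u2 (x, s)) has_real_derivative ut2 (x, t)) (at t)"
          "AE t in lborel. t \<in> {0<..<T} \<longrightarrow> ((\<lambda>s. w1 (x, s)) has_real_derivative wt1 (x, t)) (at t)"
          "AE t in lborel. t \<in> {0<..<T} \<longrightarrow> ((\<lambda>s. w2 (x, s)) has_real_derivative wt2 (x, t)) (at t)"
        using elim x by blast+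
      have ww: "w1 (x, t) = W x (\<lambda>s. u1 (x, s)) t" "w2 (x, t) = W x (\<lambda>s. u2 (x, s)) t" if "t \<in> {0..T}" for t
        using elim x that by blast+
      \<comment> \<open>The Hilpert hypothesis concerns the operator outputs, which are known to
        coincide with \<open>w1\<close> and \<open>w2\<close> on [0,T]; derivatives at interior
        times transfer.\<close>
      have tr: "(g has_real_derivative D) (at t)"
        if "(f has_real_derivative D) (at t)" "t \<in> {0<..<T}" "\<And>s. s \<in> {0<..<T} \<Longrightarrow> f s = g s" for f g :: "real \<Rightarrow> real" and D t
        by (rule has_field_derivative_transform_within_open[OF that(1), of "{0<..<T}"]) (use that in auto)
      have h1: "AE t in lborel. t \<in> {0<..<T} \<longrightarrow> (\<forall>D1 D2. ((\<lambda>s. max (\<omega> (x, s)) 0) has_real_derivative D1) (at t) \<longrightarrow>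
        ((\<lambda>s. \<omega> (x, s)) has_real_derivative D2) (at t) \<longrightarrow> D1 \<le> D2 * heaviside (V (x, t)))"
        using W_hilpert[OF x a(1,2)]
      proof eventually_elim
        case (elim t)
        show ?case
        proof (intro impI allI)
          fix D1 D2 assume t: "t \<in> {0<..<T}" and D: "((\<lambda>s. max (\<omega> (x, s)) 0) has_real_derivative D1) (at t)"
            "((\<lambda>s. \<omega> (x, s)) has_real_derivative D2) (at t)"
          have "((\<lambda>s. max (W x (\<lambda>s. u2 (x, s)) s - W x (\<lambda>s. u1 (x, s)) s) 0) has_real_derivative D1) (at t)"
            by (rule tr[OF D(1) t]) (use ww in \<open>auto simp: \<omega>_def\<close>)
          moreover have "((\<lambda>s. W x (\<lambda>s. u2 (x, s)) s - W x (\<lambda>s. u1 (x, s)) s) has_real_derivative D2) (at t)"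
            by (rule tr[OF D(2) t]) (use ww in \<open>auto simp: \<omega>_def\<close>)
          ultimately show "D1 \<le> D2 * heaviside (V (x, t))" unfolding V_def using elim t by blast
        qed
      qed
      \<comment> \<open>The same hypothesis with the two inputs exchanged controls the positive part
        of \<open>- \<omega>\<close>.\<close>
      have h2: "AE t in lborel. t \<in> {0<..<T} \<longrightarrow> (\<forall>D1 D2. ((\<lambda>s. max (- \<omega> (x, s)) 0) has_real_derivative D1) (at t) \<longrightarrow>
        ((\<lambda>s. - \<omega> (x, s)) has_real_derivative D2) (at t) \<longrightarrow> D1 \<le> D2 * heaviside (- V (x, t)))"
        using W_hilpert[OF x a(2,1)]
      proof eventually_elim
        case (elim t)
        show ?case
        proof (intro impI allI)
          fix D1 D2 assume t: "t \<in> {0<..<T}" and D: "((\<lambda>s. max (- \<omega> (x, s)) 0) has_real_derivative D1) (at t)"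
            "((\<lambda>s. - \<omega> (x, s)) has_real_derivative D2) (at t)"
          have "((\<lambda>s. max (W x (\<lambda>s. u1 (x, s)) s - W x (\<lambda>s. u2 (x, s)) s) 0) has_real_derivative D1) (at t)"
            by (rule tr[OF D(1) t]) (use ww in \<open>auto simp: \<omega>_def\<close>)
          moreover have "((\<lambda>s. W x (\<lambda>s. u1 (x, s)) s - W x (\<lambda>s. u2 (x, s)) s) has_real_derivative D2) (at t)"
            by (rule tr[OF D(2) t]) (use ww in \<open>auto simp: \<omega>_def\<close>)
          ultimately have "D1 \<le> D2 * heaviside (u1 (x, t) - u2 (x, t))" using elim t by blast
          then show "D1 \<le> D2 * heaviside (- V (x, t))" by (simp add: V_def)
        qed
      qed
      have d1: "AE t in lborel. t \<in> {0<..<T} \<longrightarrow> ((\<lambda>s. V (x, s)) has_real_derivative vt (x, t)) (at t)"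
        using d(1,2) by eventually_elim (auto simp: V_def vt_def intro!: DERIV_diff)
      have d2: "AE t in lborel. t \<in> {0<..<T} \<longrightarrow> ((\<lambda>s. \<omega> (x, s)) has_real_derivative wt (x, t)) (at t)"
        using d(3,4) by eventually_elim (auto simp: \<omega>_def wt_def intro!: DERIV_diff)
      have ac: "abs_cont_on {0..T} (\<lambda>t. V (x, t))" "abs_cont_on {0..T} (\<lambda>t. \<omega> (x, t))"
        unfolding V_def \<omega>_def by (intro abs_cont_on_diff a)+
      have v0: "V (x, 0) = u02 x - u01 x" using a by (simp add: V_def)
      show "abs_cont_on {0..T} (\<lambda>t. V (x, t)) \<and> abs_cont_on {0..T} (\<lambda>t. \<omega> (x, t)) \<and>
      V (x, 0) = u02 x - u01 x \<and>
      (AE t in lborel. t \<in> {0<..<T} \<longrightarrow> ((\<lambda>s. V (x, s)) has_real_derivative vt (x, t)) (at t)) \<and>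
      (AE t in lborel. t \<in> {0<..<T} \<longrightarrow> ((\<lambda>s. \<omega> (x, s)) has_real_derivative wt (x, t)) (at t)) \<and>
      (AE t in lborel. t \<in> {0<..<T} \<longrightarrow> (\<forall>D1 D2. ((\<lambda>s. max (\<omega> (x, s)) 0) has_real_derivative D1) (at t) \<longrightarrow>
        ((\<lambda>s. \<omega> (x, s)) has_real_derivative D2) (at t) \<longrightarrow> D1 \<le> D2 * heaviside (V (x, t)))) \<and>
      (AE t in lborel. t \<in> {0<..<T} \<longrightarrow> (\<forall>D1 D2. ((\<lambda>s. max (- \<omega> (x, s)) 0) has_real_derivative D1) (at t) \<longrightarrow>
        ((\<lambda>s. - \<omega> (x, s)) has_real_derivative D2) (at t) \<longrightarrow> D1 \<le> D2 * heaviside (- V (x, t))))"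
        by (intro conjI ac v0 d1 d2 h1 h2)
    qed
  qed
  have uM: "integrable ?M (\<lambda>x. u02 x - u01 x)"
    using u0 Lp_integrable[OF finM _ p1(2)] by (auto simp: W1p0_def)
  have cM: "integrable ?M (\<lambda>x. c x * \<bar>g x\<bar>)" if "integrable ?M g" for g
  proof (rule Bochner_Integration.integrable_bound)
    show "integrable ?M (\<lambda>x. M * g x)" using that by simp
    show "(\<lambda>x. c x * \<bar>g x\<bar>) \<in> borel_measurable ?M" using c_meas that by auto
    show "AE x in ?M. norm (c x * \<bar>g x\<bar>) \<le> norm (M * g x)"
      using M by eventually_elim (auto simp: abs_mult intro!: mult_right_mono)
  qed
  have \<omega>N: "integrable ?N \<omega>"
    unfolding \<omega>_def[abs_def] using Lp_integrable[OF finN r1(10)] Lp_integrable[OF finN r2(10)] by simp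
  \<comment> \<open>Admissible times are those at which the slice of \<omega> is integrable and the
    slices of \<open>u1\<close> and \<open>u2\<close> lie in the Sobolev space. At each of them the
    tested inequality is used with cut-off time \<open>t\<close>.\<close>
  show ?thesis
    using slice_integrable_lebesgue_on[OF \<Omega>(1) \<omega>N] r1(3) r2(3)
  proof eventually_elim
    case (elim t)
    show ?case
    proof
      assume t: "t \<in> {0<..<T}"
      have Vt: "integrable ?M (\<lambda>x. V (x, t))"
      proof -
        have "Lp p ?M (\<lambda>x. u1 (x, t))" "Lp p ?M (\<lambda>x. u2 (x, t))"
          using elim(2,3) t unfolding W1p0_def by blast+
        then show ?thesis unfolding V_def
          by (intro Bochner_Integration.integrable_diff Lp_integrable[OF finM _ p1(2)])
      qed
      have \<omega>t: "integrable ?M (\<lambda>x. \<omega> (x, t))" using elim(1) t by blast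
      \<comment> \<open>Borel version of the tested integrand.\<close>
      define Y where "Y z = (ch (fst z) * vt z + wt z) * (if snd z < t then sgn (vh z) else 0)" for z
      have Ym: "Y \<in> borel_measurable borel"
      proof -
        have f: "fst \<in> borel_measurable (borel :: ('a \<times> real) measure)" and s: "snd \<in> borel_measurable (borel :: ('a \<times> real) measure)"
          by (intro borel_measurable_continuous_onI continuous_intros)+
        have "(\<lambda>z :: 'a \<times> real. ch (fst z)) \<in> borel_measurable borel" by (rule measurable_compose[OF f ch(1)])
        moreover have "(\<lambda>z :: 'a \<times> real. if snd z < t then 1 else 0 :: real) \<in> borel_measurable borel"
          by (rule measurable_compose[OF s]) simp
        ultimately have "(\<lambda>z. (ch (fst z) * vt z + wt z) * ((if snd z < t then 1 else 0) * sgn (vh z))) \<in> borel_measurable borel"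
          using vtm vh(1) by measurable
        moreover have "(\<lambda>z. (ch (fst z) * vt z + wt z) * ((if snd z < t then 1 else 0) * sgn (vh z))) = Y"
          by (auto simp: Y_def fun_eq_iff)
        ultimately show ?thesis by simp
      qed
      have Y0: "Y z = 0" if "z \<notin> ?Q" for z using vt0[OF that] by (simp add: Y_def)
      let ?Y = "\<lambda>z. (c (fst z) * (ut2 z - ut1 z) + (wt2 z - wt1 z)) * (if snd z < t then sgn (u2 z - u1 z) else 0)"
      have YI: "integrable ?N ?Y"
        by (rule tested_difference_inequality(1)[OF \<Omega> T p c_meas M mono aL r1(1) r2(1) r1(2) r2(2) r1(3) r2(3) L2 f
          e1[THEN spec, THEN spec, THEN mp] e2[THEN spec, THEN spec, THEN mp]])
      have Yle: "(\<integral>z. ?Y z \<partial>?N) \<le> (\<integral>z. \<bar>f2 z - f1 z\<bar> * (if snd z < t then 1 else 0) \<partial>?N)"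
        by (rule tested_difference_inequality(2)[OF \<Omega> T p c_meas M mono aL r1(1) r2(1) r1(2) r2(2) r1(3) r2(3) L2 f
          e1[THEN spec, THEN spec, THEN mp] e2[THEN spec, THEN spec, THEN mp]])
      have Yae: "AE z in lborel. z \<in> ?Q \<longrightarrow> ?Y z = Y z"
        using vh(3) AE_fst[OF ch(3)] by eventually_elim (auto simp: Y_def V_def vt_def wt_def)
      have Ym': "?Y \<in> borel_measurable ?N" using YI by auto
      have YL: "integrable lborel Y" "(\<integral>z. ?Y z \<partial>?N) = integral\<^sup>L lborel Y"
        using integral_borel_version[OF Qb(1) Ym Y0 Ym' Yae] YI by auto
      \<comment> \<open>On almost every line this is the integral in the Hilpert estimate, while its
        integral over \<Omega> is the tested quantity; this links the two halves of the
        argument.\<close>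
      define Z where "Z x = (\<integral>s. Y (x, s) \<partial>lborel)" for x
      have ZI: "integrable lborel Z" "integral\<^sup>L lborel Z = integral\<^sup>L lborel Y"
        unfolding Z_def[abs_def] using lborel_Fubini(2,3)[OF YL(1)] by auto
      have Z0: "Z x = 0" if "x \<notin> \<Omega>" for x using Y0[of "(x, _)"] that by (simp add: Z_def)
      have Zm: "Z \<in> borel_measurable borel" using ZI(1) by auto
      have ZM: "integrable ?M Z" "integral\<^sup>L ?M Z = integral\<^sup>L lborel Y"
        using integral_borel_version[OF \<Omega>b(1) Zm Z0 borel_measurable_lebesgue_on[OF Zm]] ZI by auto
      have wI: "integrable lborel (\<lambda>z. wt z * (if snd z < t then 1 else 0))"
      proof (rule Bochner_Integration.integrable_bound[OF wtI])
        have s: "snd \<in> borel_measurable (borel :: ('a \<times> real) measure)" by (intro borel_measurable_continuous_onI continuous_intros)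
        have "(\<lambda>z :: 'a \<times> real. if snd z < t then 1 else 0 :: real) \<in> borel_measurable borel"
          by (rule measurable_compose[OF s]) simp
        then show "(\<lambda>z. wt z * (if snd z < t then 1 else 0)) \<in> borel_measurable lborel" using vtm(2) by simp
      qed auto
      \<comment> \<open>Increment of \<omega> between the times 0 and \<open>t\<close>. It carries
        integrability from the admissible time \<open>t\<close> to time 0, about which statements
        for almost every time say nothing.\<close>
      define I where "I x = (\<integral>s. wt (x, s) * (if s < t then 1 else 0) \<partial>lborel)" for x
      have II: "integrable lborel I" unfolding I_def[abs_def] using lborel_Fubini(2)[OF wI] by simp
      have I0: "I x = 0" if "x \<notin> \<Omega>" for x using vt0(2)[of "(x, _)"] that by (simp add: I_def)
      have Im: "I \<in> borel_measurable borel" using II by auto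
      have IM: "integrable ?M I"
        using integral_borel_version(1)[OF \<Omega>b(1) Im I0 borel_measurable_lebesgue_on[OF Im]] II by auto
      \<comment> \<open>The closed interval and the weight \<open>s < t\<close> differ at
        \<open>s = t\<close>, a null set, and for negative \<open>s\<close>, where \<open>h\<close>
        vanishes.\<close>
      have cut: "(LINT s:{0..t}|lborel. h s) = (\<integral>s. h s * (if s < t then 1 else 0) \<partial>lborel)"
        if "h \<in> borel_measurable lborel" "\<And>s. s \<notin> {0<..<T} \<Longrightarrow> h s = 0" for h :: "real \<Rightarrow> real"
        unfolding set_lebesgue_integral_def
      proof (rule integral_cong_AE)
        show "AE s in lborel. indicator {0..t} s *\<^sub>R h s = h s * (if s < t then 1 else 0)"
          using AE_lborel_singleton[of t]
        proof eventually_elim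
          case (elim s)
          then show ?case using that(2)[of s] t by (cases "s \<in> {0<..<T}") (auto simp: indicator_def)
        qed
      qed (use that in measurable)
      have main: "AE x in lborel. x \<in> \<Omega> \<longrightarrow>
          c x * \<bar>V (x, t)\<bar> + \<bar>\<omega> (x, t)\<bar> \<le> c x * \<bar>u02 x - u01 x\<bar> + \<bar>\<omega> (x, 0)\<bar> + Z x \<and> \<omega> (x, 0) = \<omega> (x, t) - I x"
        using X c0 ch(3) AE_lborel_pair(1)[OF vh(3)]
      proof eventually_elim
        case (elim x)
        show ?case
        proof (intro impI conjI)
          assume x: "x \<in> \<Omega>"
          have ac: "abs_cont_on {0..T} (\<lambda>t. V (x, t))" "abs_cont_on {0..T} (\<lambda>t. \<omega> (x, t))" "V (x, 0) = u02 x - u01 x"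
            and dV: "AE t in lborel. t \<in> {0<..<T} \<longrightarrow> ((\<lambda>s. V (x, s)) has_real_derivative vt (x, t)) (at t)"
            and dw: "AE t in lborel. t \<in> {0<..<T} \<longrightarrow> ((\<lambda>s. \<omega> (x, s)) has_real_derivative wt (x, t)) (at t)"
            and h1: "AE t in lborel. t \<in> {0<..<T} \<longrightarrow> (\<forall>D1 D2. ((\<lambda>s. max (\<omega> (x, s)) 0) has_real_derivative D1) (at t) \<longrightarrow>
              ((\<lambda>s. \<omega> (x, s)) has_real_derivative D2) (at t) \<longrightarrow> D1 \<le> D2 * heaviside (V (x, t)))"
            and h2: "AE t in lborel. t \<in> {0<..<T} \<longrightarrow> (\<forall>D1 D2. ((\<lambda>s. max (- \<omega> (x, s)) 0) has_real_derivative D1) (at t) \<longrightarrow>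
              ((\<lambda>s. - \<omega> (x, s)) has_real_derivative D2) (at t) \<longrightarrow> D1 \<le> D2 * heaviside (- V (x, t)))"
            using elim(1) x by blast+
          have cx: "0 \<le> c x" "c x = ch x" using elim(2,3) x by blast+
          have vv: "AE s in lborel. s \<in> {0<..<T} \<longrightarrow> V (x, s) = vh (x, s)"
            using elim(4) by eventually_elim (use x in auto)
          have sl: "(\<lambda>s. vt (x, s)) \<in> borel_measurable lborel" "(\<lambda>s. wt (x, s)) \<in> borel_measurable lborel" "(\<lambda>s. vh (x, s)) \<in> borel_measurable lborel"
            using slice_measurable(2)[OF vtm(1)] slice_measurable(2)[OF vtm(2)] slice_measurable(2)[OF vh(1)] by auto
          have tT: "t \<in> {0..T}" "0 \<in> {0..T}" using t by auto
          have vt00: "vt (x, s) = 0" "wt (x, s) = 0" if "s \<notin> {0<..<T}" for s using vt0[of "(x, s)"] that by auto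
          have "(LINT s:{0..t}|lborel. (c x * vt (x, s) + wt (x, s)) * sgn (vh (x, s))) = Z x"
          proof (subst cut)
            show "(\<lambda>s. (c x * vt (x, s) + wt (x, s)) * sgn (vh (x, s))) \<in> borel_measurable lborel" using sl by measurable
            show "(\<integral>s. (c x * vt (x, s) + wt (x, s)) * sgn (vh (x, s)) * (if s < t then 1 else 0) \<partial>lborel) = Z x"
              unfolding Z_def Y_def by (rule Bochner_Integration.integral_cong[OF refl]) (simp add: cx(2))
          qed (simp add: vt00)
          then show "c x * \<bar>V (x, t)\<bar> + \<bar>\<omega> (x, t)\<bar> \<le> c x * \<bar>u02 x - u01 x\<bar> + \<bar>\<omega> (x, 0)\<bar> + Z x"
            using hilpert_abs_inequality[OF T ac(1,2) sl dV dw vv h1 h2 cx(1) tT(1)] ac(3) by simp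
          have "\<omega> (x, t) - \<omega> (x, 0) = (LINT s:{0..t}|lborel. wt (x, s))"
            by (rule abs_cont_on_FTC_derivative(2)[OF ac(2) T sl(2) dw tT(2)]) (use tT in auto)
          also have "\<dots> = I x" unfolding I_def by (rule cut[OF sl(2)]) (simp add: vt00)
          finally show "\<omega> (x, 0) = \<omega> (x, t) - I x" by simp
        qed
      qed
      have \<omega>0: "integrable ?M (\<lambda>x. \<omega> (x, 0))"
      proof -
        have i: "integrable ?M (\<lambda>x. \<omega> (x, t) - I x)" using \<omega>t IM by simp
        have ae: "AE x in lborel. x \<in> \<Omega> \<longrightarrow> \<omega> (x, 0) = \<omega> (x, t) - I x" using main by eventually_elim blast
        have m: "(\<lambda>x. \<omega> (x, 0)) \<in> borel_measurable ?M"
          by (rule AE_eq_borel_measurable_lebesgue_on[OF \<Omega>b(2) borel_measurable_integrable[OF i] ae])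
        show ?thesis
          by (rule integrable_cong_AE_imp[OF i m]) (use ae in \<open>simp add: AE_lebesgue_on_iff[OF \<Omega>b(2)] eq_commute\<close>)
      qed
      have P: "integrable ?M (\<lambda>x. c x * \<bar>V (x, t)\<bar>)" "integrable ?M (\<lambda>x. \<bar>\<omega> (x, t)\<bar>)"
        "integrable ?M (\<lambda>x. c x * \<bar>u02 x - u01 x\<bar>)" "integrable ?M (\<lambda>x. \<bar>\<omega> (x, 0)\<bar>)"
        using cM[OF Vt] cM[OF uM] \<omega>t \<omega>0 by auto
      have "(\<integral>x. c x * \<bar>V (x, t)\<bar> \<partial>?M) + (\<integral>x. \<bar>\<omega> (x, t)\<bar> \<partial>?M) = (\<integral>x. c x * \<bar>V (x, t)\<bar> + \<bar>\<omega> (x, t)\<bar> \<partial>?M)"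
        using P by simp
      also have "\<dots> \<le> (\<integral>x. c x * \<bar>u02 x - u01 x\<bar> + \<bar>\<omega> (x, 0)\<bar> + Z x \<partial>?M)"
      proof (rule integral_mono_AE)
        show "AE x in ?M. c x * \<bar>V (x, t)\<bar> + \<bar>\<omega> (x, t)\<bar> \<le> c x * \<bar>u02 x - u01 x\<bar> + \<bar>\<omega> (x, 0)\<bar> + Z x"
          unfolding AE_lebesgue_on_iff[OF \<Omega>b(2)] using main by eventually_elim blast
      qed (use P ZM(1) in auto)
      also have "\<dots> = (\<integral>x. c x * \<bar>u02 x - u01 x\<bar> \<partial>?M) + (\<integral>x. \<bar>\<omega> (x, 0)\<bar> \<partial>?M) + (\<integral>z. ?Y z \<partial>?N)"
        using P ZM YL(2) by simp
      also have "\<dots> \<le> (\<integral>x. c x * \<bar>u02 x - u01 x\<bar> \<partial>?M) + (\<integral>x. \<bar>\<omega> (x, 0)\<bar> \<partial>?M)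
          + (\<integral>z. \<bar>f2 z - f1 z\<bar> * (if snd z < t then 1 else 0) \<partial>?N)"
        using Yle by simp
      \<comment> \<open>The weight turns the cylinder up to \<open>T\<close> into the one up to
        \<open>t\<close>.\<close>
      also have "(\<integral>z. \<bar>f2 z - f1 z\<bar> * (if snd z < t then 1 else 0) \<partial>?N) = (LINT z:\<Omega> \<times> {0<..<t}|lebesgue. \<bar>f2 z - f1 z\<bar>)"
      proof -
        have "(\<integral>z. \<bar>f2 z - f1 z\<bar> * (if snd z < t then 1 else 0) \<partial>?N)
            = (\<integral>z. indicator ?Q z *\<^sub>R (\<bar>f2 z - f1 z\<bar> * (if snd z < t then 1 else 0)) \<partial>lebesgue)"
          using Ql by (simp add: integral_restrict_space)
        also have "\<dots> = (\<integral>z. indicator (\<Omega> \<times> {0<..<t}) z *\<^sub>R \<bar>f2 z - f1 z\<bar> \<partial>lebesgue)"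
          by (rule Bochner_Integration.integral_cong[OF refl]) (use t in \<open>auto simp: indicator_def\<close>)
        finally show ?thesis by (simp add: set_lebesgue_integral_def)
      qed
      finally show "(LINT x:\<Omega>|lebesgue. c x * \<bar>u2 (x, t) - u1 (x, t)\<bar>)
     + (LINT x:\<Omega>|lebesgue. \<bar>w2 (x, t) - w1 (x, t)\<bar>)
     \<le> (LINT x:\<Omega>|lebesgue. c x * \<bar>u02 x - u01 x\<bar>)
       + (LINT x:\<Omega>|lebesgue. \<bar>w2 (x, 0) - w1 (x, 0)\<bar>)
       + (LINT z:\<Omega> \<times> {0<..<t}|lebesgue. \<bar>f2 z - f1 z\<bar>)"
        unfolding set_integral_lebesgue_on[OF \<Omega>b(2)] V_def \<omega>_def .
    qed
  qed
qed

end
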